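(* There exists $\tau_0>0$ such that the following holds for every $\gamma\in[0,1]$ and every $\tau\ge\tau_0$. Let $I\subset\mathbb{R}$ be an open interval and $\Omega\subset\mathbb{R}^n$ an open set. Let $w:\Omega\to(0,\infty)$ be a (time-independent) Borel function uniformly bounded from above and from below on compact subsets of $\Omega$ (i.e. for every compact $K\subset\Omega$ there are constants $0<c_K\le C_K<\infty$ with $c_K\le w\le C_K$ on $K$). Let $b\in L^1_{\rm loc}(I;W^{1,1}_{\rm loc}(\Omega;\mathbb{R}^m))$. Assume that one of the following two cases holds: (a) $\varphi=\exp^*_{\gamma,\tau}$; or (b) $\varphi=\widetilde{\exp}_{\gamma,\tau}$ and either $w|Db|\in L^1(I\times\Omega)$ or $w\in L^1(I\times\Omega)$ (with $w$ regarded as the function $(t,x)\mapsto w(x)$). Suppose that $$N_{\varphi,w}(|Db|):=\int_I\int_\Omega w(x)\,\varphi(|Db(t,x)|)\,\mathrm{d}x\,\mathrm{d}t<\infty.$$ Then there exists a sequence $(b_h)_h\subset C^\infty(I\times\Omega;\mathbb{R}^m)$ such that, as $h\to\infty$, $$b_h\to b \text{ in } L^1_{\rm loc}(I\times\Omega;\mathbb{R}^m),\qquad Db_h\to Db\text{ in }L^1_{\rm loc}(I\times\Omega;\mathbb{R}^{nm}),$$ $$w\,\varphi(|Db_h|)\to w\,\varphi(|Db|)\ \text{ in } L^1(I\times\Omega),\qquad \lim_{h\to\infty}N_{\varphi,w}(|Db_h|)=N_{\varphi,w}(|Db|).$$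
   Context: For $0\le\gamma\le1$, $\tau>1$ and $t\ge0$ set $$\exp_{\gamma,\tau}(t):=\exp\left(\frac{t}{(\log(t+\tau))^\gamma}\right),\qquad \exp^*_{\gamma,\tau}(t):=\exp_{\gamma,\tau}(t)-1,$$ $$\widetilde{\exp}_{\gamma,\tau}(t):=\exp_{\gamma,\tau}(t)-1-\frac{t}{(\log\tau)^\gamma}.$$ For a function $b=b(t,x)$ of time $t\in I$ and space $x\in\Omega$, $Db$ denotes the (weak) derivative with respect to the spatial variable $x$ only, an $m\times n$ matrix identified with an element of $\mathbb{R}^{nm}$, and $|\cdot|$ is the Euclidean norm. No continuity of $b$ is assumed. *)

theory Defs
  imports "HOL-Analysis.Analysis"
begin

text \<open>
  The dimensions n and m are natural numbers and not types, because the threshold for \<tau> in the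
  main statement must not depend on them. The space of dimension n is the set of extensional
  functions on {..<n}; this is at the same time the carrier of the product topology and the space
  of the product measure below. Only the components with index j < m (and i < n) of vectors
  and matrices are ever used.
\<close>

type_synonym point = "nat \<Rightarrow> real"

definition exp_gt :: "real \<Rightarrow> real \<Rightarrow> real \<Rightarrow> real" where
  "exp_gt \<gamma> \<tau> t = exp (t / ln (t + \<tau>) powr \<gamma>)"

definition exp_star :: "real \<Rightarrow> real \<Rightarrow> real \<Rightarrow> real" where
  "exp_star \<gamma> \<tau> t = exp_gt \<gamma> \<tau> t - 1"

definition exp_tilde :: "real \<Rightarrow> real \<Rightarrow> real \<Rightarrow> real" where
  "exp_tilde \<gamma> \<tau> t = exp_gt \<gamma> \<tau> t - 1 - t / ln \<tau> powr \<gamma>"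

definition sp_top :: "nat \<Rightarrow> point topology" where
  "sp_top n = product_topology (\<lambda>_. euclideanreal) {..<n}"

definition st_top :: "nat \<Rightarrow> (real \<times> point) topology" where
  "st_top n = prod_topology euclideanreal (sp_top n)"

text \<open>
  The measurable sets of \<^term>\<open>sp_borel n\<close> are the Borel sets of \<^term>\<open>sp_top n\<close>; the completions
  \<open>sp_leb\<close> and \<open>st_leb\<close> are the usual Lebesgue measures.
\<close>

definition sp_borel :: "nat \<Rightarrow> point measure" where
  "sp_borel n = (\<Pi>\<^sub>M i\<in>{..<n}. lborel)"

definition sp_leb :: "nat \<Rightarrow> point measure" where
  "sp_leb n = completion (sp_borel n)"

definition st_leb :: "nat \<Rightarrow> (real \<times> point) measure" where
  "st_leb n = completion (lborel \<Otimes>\<^sub>M sp_borel n)"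

text \<open>
  The parameter \<open>move d p s\<close> stands for the point p + s e, with e the unit vector of the
  coordinate direction d. A function is smooth on an open set U if all its iterated partial
  derivatives exist and are continuous on U.
\<close>

definition partial :: "('d \<Rightarrow> 'p \<Rightarrow> real \<Rightarrow> 'p) \<Rightarrow> 'd \<Rightarrow> ('p \<Rightarrow> real) \<Rightarrow> 'p \<Rightarrow> real" where
  "partial move d f p = deriv (\<lambda>s. f (move d p s)) 0"

definition smooth_wrt ::
    "'p topology \<Rightarrow> ('d \<Rightarrow> 'p \<Rightarrow> real \<Rightarrow> 'p) \<Rightarrow> 'd set \<Rightarrow> 'p set \<Rightarrow> ('p \<Rightarrow> real) \<Rightarrow> bool" where
  "smooth_wrt T move D U f \<longleftrightarrow>
     (\<forall>ds\<in>lists D. let g = foldr (partial move) ds f in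
        continuous_map (subtopology T U) euclideanreal g \<and>
        (\<forall>d\<in>D. \<forall>p\<in>U. (\<lambda>s. g (move d p s)) field_differentiable at 0))"

definition sp_move :: "nat \<Rightarrow> point \<Rightarrow> real \<Rightarrow> point" where
  "sp_move i x s = x(i := x i + s)"

text \<open>In space-time the direction \<^term>\<open>None\<close> is time and \<^term>\<open>Some i\<close> is the i-th space direction.\<close>

fun st_move :: "nat option \<Rightarrow> real \<times> point \<Rightarrow> real \<Rightarrow> real \<times> point" where
  "st_move None (t, x) s = (t + s, x)"
| "st_move (Some i) (t, x) s = (t, sp_move i x s)"

definition sp_smooth :: "nat \<Rightarrow> point set \<Rightarrow> (point \<Rightarrow> real) \<Rightarrow> bool" where
  "sp_smooth n = smooth_wrt (sp_top n) sp_move {..<n}"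

definition st_smooth :: "nat \<Rightarrow> (real \<times> point) set \<Rightarrow> (real \<times> point \<Rightarrow> real) \<Rightarrow> bool" where
  "st_smooth n = smooth_wrt (st_top n) st_move (insert None (Some ` {..<n}))"

text \<open>
  The classical spatial derivative; entry (j, i) is the i-th spatial derivative of component j.
\<close>

definition sp_deriv :: "(real \<times> point \<Rightarrow> nat \<Rightarrow> real) \<Rightarrow> real \<times> point \<Rightarrow> nat \<times> nat \<Rightarrow> real" where
  "sp_deriv b z = (\<lambda>(j, i). partial st_move (Some i) (\<lambda>z'. b z' j) z)"

definition vec_norm :: "nat \<Rightarrow> (nat \<Rightarrow> real) \<Rightarrow> real" where
  "vec_norm m v = L2_set v {..<m}"

definition mat_norm :: "nat \<Rightarrow> nat \<Rightarrow> (nat \<times> nat \<Rightarrow> real) \<Rightarrow> real" where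
  "mat_norm m n A = L2_set A ({..<m} \<times> {..<n})"

definition test_function :: "nat \<Rightarrow> point set \<Rightarrow> (point \<Rightarrow> real) \<Rightarrow> bool" where
  "test_function n \<Omega> \<psi> \<longleftrightarrow>
     sp_smooth n (topspace (sp_top n)) \<psi> \<and>
     (\<exists>K. compactin (sp_top n) K \<and> K \<subseteq> \<Omega> \<and> (\<forall>x\<in>topspace (sp_top n) - K. \<psi> x = 0))"

definition weak_derivative ::
    "nat \<Rightarrow> point set \<Rightarrow> (point \<Rightarrow> real) \<Rightarrow> (nat \<Rightarrow> point \<Rightarrow> real) \<Rightarrow> bool" where
  "weak_derivative n \<Omega> u g \<longleftrightarrow>
     (\<forall>\<psi> i. test_function n \<Omega> \<psi> \<and> i < n \<longrightarrow>
        (LINT x:\<Omega>|sp_leb n. u x * partial sp_move i \<psi> x) = - (LINT x:\<Omega>|sp_leb n. g i x * \<psi> x))"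

definition sp_L1loc :: "nat \<Rightarrow> point set \<Rightarrow> (point \<Rightarrow> real) \<Rightarrow> bool" where
  "sp_L1loc n \<Omega> u \<longleftrightarrow> (\<forall>K. compactin (sp_top n) K \<and> K \<subseteq> \<Omega> \<longrightarrow> set_integrable (sp_leb n) K u)"

text \<open>\<open>W11loc n m \<Omega> u g\<close>: u belongs to the local Sobolev space, with weak derivative g.\<close>

definition W11loc ::
    "nat \<Rightarrow> nat \<Rightarrow> point set \<Rightarrow> (point \<Rightarrow> nat \<Rightarrow> real) \<Rightarrow> (point \<Rightarrow> nat \<times> nat \<Rightarrow> real) \<Rightarrow> bool" where
  "W11loc n m \<Omega> u g \<longleftrightarrow>
     (\<forall>j<m. sp_L1loc n \<Omega> (\<lambda>x. u x j) \<and> (\<forall>i<n. sp_L1loc n \<Omega> (\<lambda>x. g x (j, i))) \<and>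
            weak_derivative n \<Omega> (\<lambda>x. u x j) (\<lambda>i x. g x (j, i)))"

text \<open>
  \<open>L1loc_W11loc n m I \<Omega> b Db\<close>: the function b is locally integrable in time with values in the
  local Sobolev space, and Db is its weak spatial derivative. Since the Sobolev spaces
  are separable, strong measurability in time amounts to joint measurability of b and Db.
\<close>

definition L1loc_W11loc ::
    "nat \<Rightarrow> nat \<Rightarrow> real set \<Rightarrow> point set \<Rightarrow> (real \<times> point \<Rightarrow> nat \<Rightarrow> real) \<Rightarrow>
     (real \<times> point \<Rightarrow> nat \<times> nat \<Rightarrow> real) \<Rightarrow> bool" where
  "L1loc_W11loc n m I \<Omega> b Db \<longleftrightarrow>
     (\<forall>j<m. set_borel_measurable (st_leb n) (I \<times> \<Omega>) (\<lambda>z. b z j)) \<and>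
     (\<forall>j<m. \<forall>i<n. set_borel_measurable (st_leb n) (I \<times> \<Omega>) (\<lambda>z. Db z (j, i))) \<and>
     (AE t in lebesgue. t \<in> I \<longrightarrow> W11loc n m \<Omega> (\<lambda>x. b (t, x)) (\<lambda>x. Db (t, x))) \<and>
     (\<forall>J K. compact J \<and> J \<subseteq> I \<and> compactin (sp_top n) K \<and> K \<subseteq> \<Omega> \<longrightarrow>
        (\<integral>\<^sup>+t\<in>J. (\<integral>\<^sup>+x\<in>K. ennreal (vec_norm m (b (t, x)) + mat_norm m n (Db (t, x))) \<partial>sp_leb n)
           \<partial>lebesgue) < \<infinity>)"

definition L1_tendsto :: "'a measure \<Rightarrow> 'a set \<Rightarrow> (nat \<Rightarrow> 'a \<Rightarrow> real) \<Rightarrow> ('a \<Rightarrow> real) \<Rightarrow> bool" where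
  "L1_tendsto M A f g \<longleftrightarrow>
     (\<forall>h. set_integrable M A (f h)) \<and> set_integrable M A g \<and>
     (\<lambda>h. LINT z:A|M. \<bar>f h z - g z\<bar>) \<longlonglongrightarrow> 0"

text \<open>Here J is the finite set of component indices of the vector- or matrix-valued functions.\<close>

definition L1loc_tendsto ::
    "nat \<Rightarrow> 'j set \<Rightarrow> (real \<times> point) set \<Rightarrow> (nat \<Rightarrow> real \<times> point \<Rightarrow> 'j \<Rightarrow> real) \<Rightarrow>
     (real \<times> point \<Rightarrow> 'j \<Rightarrow> real) \<Rightarrow> bool" where
  "L1loc_tendsto n J U f g \<longleftrightarrow>
     (\<forall>K. compactin (st_top n) K \<and> K \<subseteq> U \<longrightarrow>
        (\<forall>j\<in>J. (\<forall>h. set_integrable (st_leb n) K (\<lambda>z. f h z j)) \<and>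
                set_integrable (st_leb n) K (\<lambda>z. g z j)) \<and>
        (\<lambda>h. LINT z:K|st_leb n. L2_set (\<lambda>j. f h z j - g z j) J) \<longlonglongrightarrow> 0)"

definition modular ::
    "nat \<Rightarrow> real set \<Rightarrow> point set \<Rightarrow> (real \<Rightarrow> real) \<Rightarrow> (point \<Rightarrow> real) \<Rightarrow> (real \<times> point \<Rightarrow> real) \<Rightarrow> ennreal"
  where
  "modular n I \<Omega> \<phi> w f = (\<integral>\<^sup>+t\<in>I. (\<integral>\<^sup>+x\<in>\<Omega>. ennreal (w x * \<phi> (f (t, x))) \<partial>sp_leb n) \<partial>lebesgue)"

end

theory Submission
  imports Defs
begin

text \<open>
  The functions \<open>\<phi>\<close> are convex for \<open>\<tau> \<ge> 16\<close>, but satisfy no doubling condition. Cut b off in time and put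
  \<open>B = \<Sum>\<^sub>k \<beta>\<^sub>k (b * \<rho>\<^sub>k)\<close> with a partition of unity \<open>\<beta>\<^sub>k = \<theta>\<^sub>k - \<theta>\<^sub>k\<^sub>-\<^sub>1\<close> subordinate to an exhaustion of
  \<open>\<Omega>\<close> and mollifiers \<open>\<rho>\<^sub>k\<close> of width \<open>\<epsilon>\<^sub>k\<close> in space and of one common width in time. Its gradient is
  \<open>\<Sum>\<^sub>k \<beta>\<^sub>k (Db * \<rho>\<^sub>k)\<close> plus, after a summation by parts, the terms \<open>D\<theta>\<^sub>k (b * (\<rho>\<^sub>k - \<rho>\<^sub>k\<^sub>+\<^sub>1))\<close>. A difference of
  two mollifiers is a divergence of kernels with mass of order \<open>\<epsilon>\<^sub>k\<close>, so these terms, too, are integrals of Db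
  against kernels of small mass. Hence, for small \<open>\<epsilon>\<^sub>k\<close>, \<open>(1 - \<eta>) DB\<close> is dominated by an average of \<open>|Db|\<close> with total
  mass at most 1, and Jensen's inequality bounds \<open>w \<phi>((1 - \<eta>) |DB|)\<close> by \<open>w \<phi>(|Db|)\<close> up to a
  small error in mean; the common time mollification is harmless because w does not depend on time. This
  one-sided bound together with convergence almost everywhere gives convergence in mean by dominated
  convergence.
\<close>

subsection \<open>Young functions\<close>

text \<open>Without doubling, \<phi>(x + y) cannot be bounded through \<phi>(x) and \<phi>(y)
  separately, so a commutator term cannot be split off and sent to zero afterwards. It has to enter
  the same average as the main term, and the factor 1 - \<eta> makes room for its mass. It must also
  be expressed through Db itself, since nothing is known about \<phi>(|b|). The weight has no
  regularity and no global bounds. In space this costs the constant sup w on a compact set, which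
  the choice of the width for that set absorbs; the lower bound of w there makes \<phi>(|Db|)
  locally integrable. In time, w \<phi>(|Db|) is integrable over everything and averaging commutes
  with w, so a single width serves all of \<Omega>. Setting b and Db to zero off a compact set of
  times keeps the weak identity, which concerns almost every time separately, and can only decrease
  w \<phi>(|Db|), because \<phi>(0) = 0.\<close>

definition young_fun :: "(real \<Rightarrow> real) \<Rightarrow> bool" where
  "young_fun \<phi> \<longleftrightarrow> \<phi> 0 = 0 \<and> continuous_on {0..} \<phi> \<and>
     (\<forall>a\<ge>0. \<exists>s\<ge>0. \<forall>v\<ge>0. \<phi> a + s * (v - a) \<le> \<phi> v)"

text \<open>The tangent at a is the supporting line that \<open>young_fun\<close> asks for: by the
  mean value theorem f v - f a is v - a times a slope taken between a and v, and f' is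
  nondecreasing. The slope is nonnegative because f' 0 is.\<close>

lemma young_funI_deriv:
  fixes f f' f'' :: "real \<Rightarrow> real"
  assumes "f 0 = 0" and f: "\<And>t. 0 \<le> t \<Longrightarrow> (f has_real_derivative f' t) (at t)"
    and f': "\<And>t. 0 \<le> t \<Longrightarrow> (f' has_real_derivative f'' t) (at t)"
    and "\<And>t. 0 \<le> t \<Longrightarrow> 0 \<le> f'' t" and "0 \<le> f' 0"
  shows "young_fun f"
proof -
  have mono: "f' a \<le> f' b" if "0 \<le> a" "a \<le> b" for a b
  proof (rule DERIV_nonneg_imp_nondecreasing[OF that(2)])
    fix x assume "a \<le> x" "x \<le> b"
    then show "\<exists>y. DERIV f' x :> y \<and> 0 \<le> y"
      using that(1) f'[of x] assms(4)[of x] by (intro exI[of _ "f'' x"]) auto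
  qed
  have "f a + f' a * (v - a) \<le> f v" if a: "0 \<le> a" and v: "0 \<le> v" for a v
  proof (cases a v rule: linorder_cases)
    case less
    then obtain z where "a < z" "z < v" "f v - f a = (v - a) * f' z"
      using MVT2[of a v f f'] f a by force
    moreover have "(v - a) * f' a \<le> (v - a) * f' z"
      using mono[of a z] a less \<open>a < z\<close> by (intro mult_left_mono) auto
    ultimately show ?thesis by (simp add: algebra_simps)
  next
    case greater
    then obtain z where "v < z" "z < a" "f a - f v = (a - v) * f' z"
      using MVT2[of v a f f'] f v by force
    moreover have "(a - v) * f' z \<le> (a - v) * f' a"
      using mono[of z a] v greater \<open>v < z\<close> \<open>z < a\<close> by (intro mult_left_mono) auto
    ultimately show ?thesis by (simp add: algebra_simps)
  qed auto
  moreover have "0 \<le> f' a" if "0 \<le> a" for a using mono[of 0 a] that assms(5) by auto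
  moreover have "continuous_on {0..} f"
    by (intro continuous_at_imp_continuous_on ballI DERIV_isCont[OF f]) auto
  ultimately show ?thesis unfolding young_fun_def using assms(1) by blast
qed

lemma young_fun_mono:
  assumes "young_fun \<phi>" "0 \<le> a" "a \<le> v"
  shows "\<phi> a \<le> \<phi> v"
proof -
  obtain s where "0 \<le> s" "\<And>v. 0 \<le> v \<Longrightarrow> \<phi> a + s * (v - a) \<le> \<phi> v"
    using assms unfolding young_fun_def by blast
  from this(2)[of v] mult_nonneg_nonneg[OF this(1), of "v - a"] assms show ?thesis by simp
qed

lemma young_fun_nonneg: "young_fun \<phi> \<Longrightarrow> 0 \<le> v \<Longrightarrow> 0 \<le> \<phi> v"
  using young_fun_mono[of \<phi> 0 v] by (simp add: young_fun_def)

lemma young_fun_measurable: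
  assumes "young_fun \<phi>" "f \<in> borel_measurable M" "\<And>x. 0 \<le> f x"
  shows "(\<lambda>x. \<phi> (f x)) \<in> borel_measurable M"
proof -
  \<comment> \<open>\<open>young_fun\<close> controls \<phi> on the half-line only; composition with
    \<open>max 0\<close> gives a function that is continuous on the whole line.\<close>
  have "continuous_on UNIV (\<lambda>t. \<phi> (max 0 t))"
    using assms(1) unfolding young_fun_def
    by (intro continuous_on_compose2[where f="\<lambda>t. max 0 t" and g=\<phi>]) (auto intro!: continuous_intros)
  then have "(\<lambda>x. \<phi> (max 0 (f x))) \<in> borel_measurable M"
    using assms(2) by (rule borel_measurable_continuous_on)
  then show ?thesis using assms(3) by (simp add: max_absorb2)
qed

text \<open>Integrate the supporting line at the mean \<open>a\<close> against the density k. Mass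
  below 1 does no harm: at the origin the line has the value \<phi> a - s * a \<le> \<phi> 0 = 0,
  and multiplying this value by the mass m can only raise it. This form is wanted because the
  averaging kernel of the gradient has a mass that is merely bounded by 1.\<close>

lemma jensen_sub_probability:
  assumes \<phi>: "young_fun \<phi>" and k: "integrable M k" "\<And>x. x \<in> space M \<Longrightarrow> 0 \<le> k x" "(LINT x|M. k x) \<le> 1"
    and v: "integrable M (\<lambda>x. k x * v x)" "\<And>x. 0 \<le> v x"
    and \<phi>v: "integrable M (\<lambda>x. k x * \<phi> (v x))"
  shows "\<phi> (LINT x|M. k x * v x) \<le> (LINT x|M. k x * \<phi> (v x))"
proof -
  define a where "a = (LINT x|M. k x * v x)"
  define m where "m = (LINT x|M. k x)"
  have "0 \<le> a" unfolding a_def by (intro integral_nonneg_AE AE_I2 mult_nonneg_nonneg k v)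
  then obtain s where s: "0 \<le> s" "\<And>v. 0 \<le> v \<Longrightarrow> \<phi> a + s * (v - a) \<le> \<phi> v"
    using \<phi> unfolding young_fun_def by blast
  have "\<phi> a - s * a \<le> 0" using s(2)[of 0] \<phi> unfolding young_fun_def by simp
  moreover have "m \<le> 1" using k(3) by (simp add: m_def)
  ultimately have "\<phi> a - s * a \<le> m * (\<phi> a - s * a)"
    using mult_right_mono_neg[of m 1 "\<phi> a - s * a"] by simp
  also have "m * (\<phi> a - s * a) + s * a = (LINT x|M. k x * (\<phi> a - s * a) + s * (k x * v x))"
    using k v by (simp add: m_def a_def)
  then have "m * (\<phi> a - s * a) = (LINT x|M. k x * (\<phi> a - s * a) + s * (k x * v x)) - s * a" by simp
  also have "(LINT x|M. k x * (\<phi> a - s * a) + s * (k x * v x)) \<le> (LINT x|M. k x * \<phi> (v x))"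
  proof (intro integral_mono \<phi>v)
    show "integrable M (\<lambda>x. k x * (\<phi> a - s * a) + s * (k x * v x))" using k v by auto
    fix x assume "x \<in> space M"
    then have "k x * (\<phi> a + s * (v x - a)) \<le> k x * \<phi> (v x)" using k v s by (intro mult_left_mono) auto
    then show "k x * (\<phi> a - s * a) + s * (k x * v x) \<le> k x * \<phi> (v x)" by (simp add: algebra_simps)
  qed
  finally show ?thesis unfolding a_def by simp
qed

text \<open>With L = ln (t + \<tau>), q = L powr (-\<gamma>) and a = (t q)', the function is exp (t
  q) and its second derivative is (a' + a^2) exp (t q). Convexity is a competition between a' \<ge>
  -2 c, where c = q / (L s) and s = t + \<tau>, and a \<ge> q / 2. From \<gamma> \<le> 1 follows q
  \<ge> 1 / L, hence 2 c \<le> q / (4 L) \<le> q^2 / 4 once s \<ge> 8, while L \<ge> 2 gives a \<ge>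
  q / 2. The value 16 secures both, since exp 2 \<le> 9. The slope at 0 is recorded because
  \<open>exp_tilde\<close> subtracts exactly the tangent there.\<close>

lemma exp_gt_convexity:
  assumes \<gamma>: "0 \<le> \<gamma>" "\<gamma> \<le> 1" and \<tau>: "16 \<le> \<tau>"
  obtains f' f'' where
    "\<And>t. 0 \<le> t \<Longrightarrow> (exp_gt \<gamma> \<tau> has_real_derivative f' t) (at t)"
    "\<And>t. 0 \<le> t \<Longrightarrow> (f' has_real_derivative f'' t) (at t)"
    "\<And>t. 0 \<le> t \<Longrightarrow> 0 \<le> f'' t" "f' 0 = 1 / ln \<tau> powr \<gamma>"
proof -
  define L where "L t = ln (t + \<tau>)" for t
  define q where "q t = L t powr (-\<gamma>)" for t
  define r where "r t = t / (L t * (t + \<tau>))" for t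
  define a where "a t = q t * (1 - \<gamma> * r t)" for t
  define a' where "a' t = - \<gamma> * q t / (L t * (t + \<tau>)) * (1 - \<gamma> * r t)
     - q t * \<gamma> * (1 / (L t * (t + \<tau>)) - t * (1 + L t) / (L t * (t + \<tau>))^2)" for t
  have L2: "2 \<le> L t" if "0 \<le> t" for t
  proof -
    have "exp (2::real) = exp 1 * exp 1" by (simp flip: exp_add)
    also have "\<dots> \<le> 3 * 3" by (intro mult_mono exp_le) auto
    finally show ?thesis unfolding L_def using that \<tau> by (subst ln_ge_iff) auto
  qed
  have dL: "(L has_real_derivative 1 / (t + \<tau>)) (at t)" if "0 \<le> t" for t
    unfolding L_def using that \<tau> by (auto intro!: derivative_eq_intros simp: field_simps)
  have dq: "(q has_real_derivative - \<gamma> * q t / (L t * (t + \<tau>))) (at t)" if t: "0 \<le> t" for t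
  proof -
    have "((\<lambda>t. L t powr (-\<gamma>)) has_real_derivative (-\<gamma>) * L t powr (-\<gamma> - 1) * (1 / (t + \<tau>))) (at t)"
      using has_real_derivative_powr[of "L t" "-\<gamma>"] L2[OF t] dL[OF t]
      by (intro DERIV_chain2[where f="\<lambda>x. x powr (-\<gamma>)" and g=L]) auto
    then show ?thesis using L2[OF t] t \<tau> unfolding q_def
      by (simp add: powr_diff field_simps)
  qed
  have dr: "(r has_real_derivative (1 / (L t * (t + \<tau>)) - t * (1 + L t) / (L t * (t + \<tau>))^2)) (at t)"
    if t: "0 \<le> t" for t
    unfolding r_def using dL[OF t] L2[OF t] t \<tau>
    by (auto intro!: derivative_eq_intros simp: power2_eq_square divide_simps)
  have da: "(a has_real_derivative a' t) (at t)" if t: "0 \<le> t" for t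
    unfolding a_def a'_def using dq[OF t] dr[OF t]
    by (auto intro!: derivative_eq_intros simp: algebra_simps add_divide_distrib diff_divide_distrib)
  have gt: "exp_gt \<gamma> \<tau> = (\<lambda>t. exp (t * q t))"
    by (auto simp: exp_gt_def q_def L_def powr_minus_divide)
  have d1: "(exp_gt \<gamma> \<tau> has_real_derivative a t * exp (t * q t)) (at t)" if t: "0 \<le> t" for t
    unfolding gt using dq[OF t] L2[OF t] t \<tau>
    by (auto intro!: derivative_eq_intros simp: a_def r_def field_simps)
  have d2: "((\<lambda>t. a t * exp (t * q t)) has_real_derivative (a' t + a t ^ 2) * exp (t * q t)) (at t)"
    if t: "0 \<le> t" for t
    using DERIV_mult[OF da[OF t] d1[OF t, unfolded gt]]
    by (simp add: power2_eq_square algebra_simps)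
  have pos: "0 \<le> a' t + a t ^ 2" if t: "0 \<le> t" for t
  proof -
    define s where "s = t + \<tau>"
    have s: "16 \<le> s" "t \<le> s" using t \<tau> by (auto simp: s_def)
    have l: "2 \<le> L t" by (rule L2[OF t])
    have q0: "0 < q t" using l by (simp add: q_def)
    have qL: "1 / L t \<le> q t" unfolding q_def using l \<gamma> powr_mono[of "-1" "-\<gamma>" "L t"]
      by (simp add: powr_minus_divide)
    have r0: "0 \<le> r t" unfolding r_def using t l \<tau> by auto
    have r1: "r t \<le> 1 / 2"
    proof -
      have "r t \<le> s / (L t * s)" unfolding r_def s_def[symmetric] using s l by (intro divide_right_mono) auto
      also have "\<dots> \<le> 1 / 2" using l s by (simp add: field_simps)
      finally show ?thesis .
    qed
    have gr: "0 \<le> \<gamma> * r t" "\<gamma> * r t \<le> 1 / 2"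
      using r0 r1 \<gamma> mult_mono[of \<gamma> 1 "r t" "1/2"] by auto
    define c where "c = q t / (L t * s)"
    have c0: "0 \<le> c" using q0 l s by (simp add: c_def)
    have "a' t = - \<gamma> * c * (1 - \<gamma> * r t) - \<gamma> * (c - q t * (t * (1 + L t) / (L t * s)^2))"
      unfolding a'_def c_def s_def by (simp add: algebra_simps)
    \<comment> \<open>This part of r' enters a' with a favourable sign and is discarded.\<close>
    moreover have "0 \<le> \<gamma> * (q t * (t * (1 + L t) / (L t * s)^2))" using \<gamma> q0 t l by auto
    moreover have "\<gamma> * c * (1 - \<gamma> * r t) \<le> 1 * c * 1" using \<gamma> gr c0 by (intro mult_mono) auto
    moreover have "\<gamma> * c \<le> 1 * c" using \<gamma> c0 by (intro mult_mono) auto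
    ultimately have A: "- 2 * c \<le> a' t" by (simp add: algebra_simps)
    have "q t * (1 / 2) \<le> a t" unfolding a_def using gr q0 by (intro mult_left_mono) auto
    then have "(q t * (1 / 2))^2 \<le> a t ^ 2" using q0 by (intro power_mono) auto
    moreover have "2 * c \<le> (q t * (1 / 2))^2"
    proof -
      have "2 * c = q t * (2 / (L t * s))" by (simp add: c_def)
      also have "\<dots> \<le> q t * (1 / 4 * (1 / L t))"
        using l s q0 by (intro mult_left_mono) (auto simp: field_simps)
      also have "\<dots> \<le> q t * (1 / 4 * q t)" using qL q0 by (intro mult_left_mono) auto
      finally show ?thesis by (simp add: power2_eq_square)
    qed
    ultimately show ?thesis using A by linarith
  qed
  show thesis
  proof (rule that[OF d1 d2])
    show "0 \<le> (a' t + a t ^ 2) * exp (t * q t)" if "0 \<le> t" for t using pos[OF that] by simp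
    show "a 0 * exp (0 * q 0) = 1 / ln \<tau> powr \<gamma>"
      by (simp add: a_def r_def q_def L_def powr_minus_divide)
  qed
qed

text \<open>Subtracting an affine function leaves the second derivative alone, so both functions
  inherit convexity from \<open>exp_gt\<close>. For \<open>exp_tilde\<close> the slope at 0 becomes
  exactly 0, the least value for which the function is still nondecreasing.\<close>

lemma
  assumes \<gamma>: "0 \<le> \<gamma>" "\<gamma> \<le> 1" and \<tau>: "16 \<le> \<tau>"
  shows young_fun_exp_star: "young_fun (exp_star \<gamma> \<tau>)"
    and young_fun_exp_tilde: "young_fun (exp_tilde \<gamma> \<tau>)"
proof -
  obtain f' f'' where
    d: "\<And>t. 0 \<le> t \<Longrightarrow> (exp_gt \<gamma> \<tau> has_real_derivative f' t) (at t)"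
    "\<And>t. 0 \<le> t \<Longrightarrow> (f' has_real_derivative f'' t) (at t)"
    "\<And>t. 0 \<le> t \<Longrightarrow> 0 \<le> f'' t" "f' 0 = 1 / ln \<tau> powr \<gamma>"
    using exp_gt_convexity[OF assms] by metis
  have 0: "exp_gt \<gamma> \<tau> 0 = 1" by (simp add: exp_gt_def)
  have "young_fun (\<lambda>t. exp_gt \<gamma> \<tau> t - 1)"
  proof (rule young_funI_deriv[OF _ _ d(2) d(3)])
    show "((\<lambda>t. exp_gt \<gamma> \<tau> t - 1) has_real_derivative f' t) (at t)" if "0 \<le> t" for t
      using DERIV_diff[OF d(1)[OF that] DERIV_const[of 1]] by simp
  qed (auto simp: 0 d(4))
  then show "young_fun (exp_star \<gamma> \<tau>)" by (simp add: exp_star_def[abs_def])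
  have "young_fun (\<lambda>t. exp_gt \<gamma> \<tau> t - 1 - t / ln \<tau> powr \<gamma>)"
  proof (rule young_funI_deriv[where f'="\<lambda>t. f' t - 1 / ln \<tau> powr \<gamma>", OF _ _ _ d(3)])
    show "((\<lambda>t. exp_gt \<gamma> \<tau> t - 1 - t / ln \<tau> powr \<gamma>) has_real_derivative
        f' t - 1 / ln \<tau> powr \<gamma>) (at t)" if "0 \<le> t" for t
      using DERIV_diff[OF DERIV_diff[OF d(1)[OF that] DERIV_const[of 1]]
          DERIV_cdivide[OF DERIV_ident, of "ln \<tau> powr \<gamma>"]] by simp
    show "((\<lambda>t. f' t - 1 / ln \<tau> powr \<gamma>) has_real_derivative f'' t) (at t)" if "0 \<le> t" for t
      using DERIV_diff[OF d(2)[OF that] DERIV_const[of "1 / ln \<tau> powr \<gamma>"]] by simp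
  qed (auto simp: 0 d(4))
  then show "young_fun (exp_tilde \<gamma> \<tau>)" by (simp add: exp_tilde_def[abs_def])
qed

subsection \<open>A bump function\<close>

text \<open>Smooth functions on the line with every derivative bounded. The bounds permit
  differentiation under the integral sign against any integrable function and, unlike compact
  support, they admit constants and the smooth step.\<close>

definition Cb :: "(real \<Rightarrow> real) set" where
  "Cb = {f. \<forall>k. (\<forall>x. (deriv ^^ k) f field_differentiable at x) \<and> (\<exists>C. \<forall>x. \<bar>(deriv ^^ k) f x\<bar> \<le> C)}"

text \<open>\<open>Cb\<close> is the largest class of bounded differentiable functions that is
  closed under \<open>deriv\<close>; to place f in it, exhibit any such class F around f. This takes
  the place of an induction on the order of the derivative.\<close>

lemma Cb_coinduct:
  assumes "f \<in> F"
    and "\<And>f. f \<in> F \<Longrightarrow> (\<forall>x. f field_differentiable at x) \<and> (\<exists>C. \<forall>x. \<bar>f x\<bar> \<le> C) \<and> deriv f \<in> F"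
  shows "f \<in> Cb"
proof -
  have "(deriv ^^ k) f \<in> F" for k
    by (induction k) (use assms in auto)
  then show ?thesis unfolding Cb_def using assms(2) by blast
qed

lemma Cb_field_differentiable: "f \<in> Cb \<Longrightarrow> f field_differentiable at x"
  unfolding Cb_def by (metis (mono_tags, lifting) funpow_0 mem_Collect_eq)

lemma Cb_bounded:
  assumes "f \<in> Cb" shows "\<exists>C. \<forall>x. \<bar>f x\<bar> \<le> C"
proof -
  have "\<exists>C. \<forall>x. \<bar>(deriv ^^ 0) f x\<bar> \<le> C" using assms unfolding Cb_def by blast
  then show ?thesis by simp
qed

lemma Cb_deriv: "f \<in> Cb \<Longrightarrow> deriv f \<in> Cb"
  unfolding Cb_def by (simp add: funpow_swap1) (metis funpow.simps(2) funpow_swap1 comp_apply)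

lemma Cb_DERIV: "f \<in> Cb \<Longrightarrow> (f has_real_derivative deriv f x) (at x)"
  using Cb_field_differentiable field_differentiable_derivI by blast

lemma Cb_continuous_on: "f \<in> Cb \<Longrightarrow> continuous_on A f"
  by (meson Cb_DERIV DERIV_isCont continuous_at_imp_continuous_on)

lemma Cb_measurable [measurable_dest]: "f \<in> Cb \<Longrightarrow> f \<in> borel_measurable borel"
  by (intro borel_measurable_continuous_onI Cb_continuous_on)

lemma Cb_bound:
  assumes "f \<in> Cb"
  obtains C where "1 \<le> C" "\<And>x. \<bar>f x\<bar> \<le> C"
proof -
  obtain C where "\<And>x. \<bar>f x\<bar> \<le> C" using Cb_bounded[OF assms] by blast
  then show thesis using that[of "max 1 C"] by (simp add: le_max_iff_disj)
qed

lemma Cb_lipschitz: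
  assumes "f \<in> Cb"
  obtains C where "0 \<le> C" "\<And>x y. \<bar>f x - f y\<bar> \<le> C * \<bar>x - y\<bar>"
proof -
  obtain C where C: "1 \<le> C" "\<And>x. \<bar>deriv f x\<bar> \<le> C" using Cb_bound[OF Cb_deriv[OF assms]] by blast
  have "norm (f x - f y) \<le> C * norm (x - y)" for x y
    by (rule field_differentiable_bound[of UNIV f "deriv f"])
      (use C Cb_DERIV[OF assms] in auto)
  then show thesis using that[of C] C by auto
qed

lemma Cb_const: "(\<lambda>_. c) \<in> Cb"
  by (rule Cb_coinduct[where F="range (\<lambda>c _. c)"]) auto

lemma Cb_add:
  assumes "f \<in> Cb" "g \<in> Cb"
  shows "(\<lambda>x. f x + g x) \<in> Cb"
proof (rule Cb_coinduct[where F="{(\<lambda>x. f x + g x) | f g. f \<in> Cb \<and> g \<in> Cb}"], use assms in blast)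
  fix h assume "h \<in> {(\<lambda>x. f x + g x) | f g. f \<in> Cb \<and> g \<in> Cb}"
  then obtain f g where h: "h = (\<lambda>x. f x + g x)" "f \<in> Cb" "g \<in> Cb" by auto
  have "deriv h = (\<lambda>x. deriv f x + deriv g x)"
    unfolding h(1) by (intro ext DERIV_imp_deriv DERIV_add Cb_DERIV h)
  moreover obtain C where "\<And>x. \<bar>f x\<bar> \<le> C" using Cb_bound[OF h(2)] by blast
  moreover obtain D where "\<And>x. \<bar>g x\<bar> \<le> D" using Cb_bound[OF h(3)] by blast
  ultimately show "(\<forall>x. h field_differentiable at x) \<and> (\<exists>C. \<forall>x. \<bar>h x\<bar> \<le> C) \<and>
      deriv h \<in> {(\<lambda>x. f x + g x) | f g. f \<in> Cb \<and> g \<in> Cb}"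
    using h Cb_deriv[OF h(2)] Cb_deriv[OF h(3)] unfolding h(1)
    by (intro conjI allI field_differentiable_add Cb_field_differentiable exI[of _ "C + D"]
        order_trans[OF abs_triangle_ineq] add_mono) auto
qed

lemma Cb_affine:
  assumes "f \<in> Cb"
  shows "(\<lambda>x. c * f (a * x + b)) \<in> Cb"
\<comment> \<open>The factor c must vary inside the class, because every derivative contributes a
  factor a.\<close>
proof (rule Cb_coinduct[where F="{(\<lambda>x. c * f (a * x + b)) | c f. f \<in> Cb}"], use assms in blast)
  fix h assume "h \<in> {(\<lambda>x. c * f (a * x + b)) | c f. f \<in> Cb}"
  then obtain f c where h: "h = (\<lambda>x. c * f (a * x + b))" "f \<in> Cb" by auto
  have d: "(h has_real_derivative (c * a) * deriv f (a * x + b)) (at x)" for x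
    unfolding h(1) by (auto intro!: derivative_eq_intros DERIV_chain2[OF Cb_DERIV[OF h(2)]])
  then have "deriv h = (\<lambda>x. (c * a) * deriv f (a * x + b))"
    by (intro ext DERIV_imp_deriv)
  moreover obtain C where "\<And>x. \<bar>f x\<bar> \<le> C" using Cb_bound[OF h(2)] by blast
  then have "\<bar>h x\<bar> \<le> \<bar>c\<bar> * C" for x by (simp add: h(1) abs_mult mult_left_mono)
  ultimately show "(\<forall>x. h field_differentiable at x) \<and> (\<exists>C. \<forall>x. \<bar>h x\<bar> \<le> C) \<and>
      deriv h \<in> {(\<lambda>x. c * f (a * x + b)) | c f. f \<in> Cb}"
    using d h(2) Cb_deriv field_differentiable_def by blast
qed

lemma Cb_diff: "f \<in> Cb \<Longrightarrow> g \<in> Cb \<Longrightarrow> (\<lambda>x. f x - g x) \<in> Cb"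
  using Cb_add[of f "\<lambda>x. -1 * g (1 * x + 0)"] Cb_affine[of g "-1" 1 0] by simp

lemma CbI_deriv:
  assumes f: "\<And>x. (f has_real_derivative f' x) (at x)" and "f' \<in> Cb" "\<And>x. \<bar>f x\<bar> \<le> C"
  shows "f \<in> Cb"
proof (rule Cb_coinduct[where F="insert f Cb"])
  have "deriv f = f'" using f by (intro ext DERIV_imp_deriv)
  then show "(\<forall>x. g field_differentiable at x) \<and> (\<exists>C. \<forall>x. \<bar>g x\<bar> \<le> C) \<and> deriv g \<in> insert f Cb"
    if "g \<in> insert f Cb" for g
    using that assms Cb_deriv Cb_bounded Cb_field_differentiable field_differentiable_def by blast
qed auto

text \<open>The classical exp (-1 / (1 - x^2)) together with the factors that its derivatives
  acquire. With p and k free the family is closed under \<open>deriv\<close>, as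
  \<open>Cb_coinduct\<close> demands.\<close>

definition bump :: "real poly \<Rightarrow> nat \<Rightarrow> real \<Rightarrow> real" where
  "bump p k x = (if \<bar>x\<bar> < 1 then poly p x / (1 - x\<^sup>2) ^ k * exp (- (1 / (1 - x\<^sup>2))) else 0)"

text \<open>Comes from the single term of degree k + 2 of the exponential series. The two spare
  powers turn into the factor (1 - x^2)^2 in the bound on \<open>bump\<close>.\<close>

lemma power_mult_exp_minus_le:
  assumes "1 \<le> (y::real)"
  shows "y ^ k * exp (- y) \<le> fact (k + 2) / y\<^sup>2"
proof -
  have "y ^ (k + 2) / fact (k + 2) \<le> exp y"
  proof -
    have "(\<Sum>n\<in>{k + 2}. inverse (fact n) * y ^ n) \<le> (\<Sum>n. inverse (fact n) * y ^ n)"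
      using assms by (intro sum_le_suminf summable_exp) auto
    also have "\<dots> = exp y" by (simp add: exp_def)
    finally show ?thesis by (simp add: divide_inverse mult.commute del: fact_Suc)
  qed
  then have "y ^ k * y\<^sup>2 \<le> fact (k + 2) * exp y"
    by (simp add: divide_le_eq power_add power2_eq_square mult_ac del: fact_Suc)
  then show ?thesis using assms
    by (simp add: exp_minus divide_simps del: fact_Suc)
qed

text \<open>The square is what matters: 1 - x^2 vanishes to first order at 1 and -1, so
  \<open>bump\<close> vanishes to second order there and is differentiable across these
  points.\<close>

lemma bump_bound: "\<exists>C. 0 \<le> C \<and> (\<forall>x. \<bar>x\<bar> < 1 \<longrightarrow> \<bar>bump p k x\<bar> \<le> C * (1 - x\<^sup>2)\<^sup>2)"
proof -
  have "bounded (poly p ` {-1..1})"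
    by (intro compact_imp_bounded compact_continuous_image continuous_intros) auto
  then obtain C where C: "\<And>x. x \<in> {-1..1} \<Longrightarrow> \<bar>poly p x\<bar> \<le> C"
    unfolding bounded_iff by force
  have "\<bar>bump p k x\<bar> \<le> (C * fact (k + 2)) * (1 - x\<^sup>2)\<^sup>2" if x: "\<bar>x\<bar> < 1" for x
  proof -
    define y where "y = 1 / (1 - x\<^sup>2)"
    have "x\<^sup>2 < 1" using x by (simp add: abs_square_less_1)
    then have y: "1 \<le> y" "(1 - x\<^sup>2) = 1 / y" by (auto simp: y_def)
    have "\<bar>bump p k x\<bar> = \<bar>poly p x\<bar> * (y ^ k * exp (- y))"
      using x y by (simp add: bump_def abs_mult power_one_over)
    also have "\<dots> \<le> C * (fact (k + 2) / y\<^sup>2)"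
      using C[of x] C[of 0] x y by (intro mult_mono power_mult_exp_minus_le) (auto simp: abs_less_iff)
    finally show ?thesis using y by (simp add: power_one_over)
  qed
  moreover have "0 \<le> C" using C[of 0] by auto
  ultimately show ?thesis by (intro exI[of _ "C * fact (k + 2)"]) auto
qed

lemma bump_DERIV:
  "(bump p k has_real_derivative
     bump (pderiv p * [:1, 0, -1:]\<^sup>2 + smult (2 * real k) ([:0, 1:] * p * [:1, 0, -1:]) - smult 2 ([:0, 1:] * p)) (k + 2) x) (at x)"
  (is "(_ has_real_derivative bump ?q _ x) _")
proof (cases "\<bar>x\<bar>" "1::real" rule: linorder_cases)
  case less
  then have x: "x\<^sup>2 < 1" by (simp add: abs_square_less_1)
  define D where "D = 1 - x\<^sup>2"
  have D: "0 < D" using x by (simp add: D_def)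
  define f where "f x = poly p x / (1 - x\<^sup>2) ^ k * exp (- (1 / (1 - x\<^sup>2)))" for x
  have 1: "((\<lambda>x. (1 - x\<^sup>2) ^ k) has_real_derivative real k * (- 2 * x) * D ^ (k - 1)) (at x)"
    by (auto intro!: derivative_eq_intros simp: D_def)
  have 2: "((\<lambda>x. exp (- (1 / (1 - x\<^sup>2)))) has_real_derivative exp (- (1 / D)) * (- (2 * x) / D\<^sup>2)) (at x)"
    using D by (auto intro!: derivative_eq_intros simp: D_def power2_eq_square field_simps)
  have 3: "((\<lambda>x. poly p x / (1 - x\<^sup>2) ^ k) has_real_derivative
      (poly (pderiv p) x * D ^ k - poly p x * (real k * (- 2 * x) * D ^ (k - 1))) / (D ^ k * D ^ k)) (at x)"
    using DERIV_divide[OF poly_DERIV[of p x] 1] D by (simp add: D_def)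
  have "(f has_real_derivative
      (poly (pderiv p) x * D ^ k - poly p x * (real k * (- 2 * x) * D ^ (k - 1))) / (D ^ k * D ^ k) * exp (- (1 / D)) +
      exp (- (1 / D)) * (- (2 * x) / D\<^sup>2) * (poly p x / D ^ k)) (at x)"
    unfolding f_def using DERIV_mult[OF 3 2] by (simp add: D_def)
  also have "real k * (- 2 * x) * D ^ (k - 1) = real k * (- 2 * x) * D ^ k / D"
    using D by (cases k) auto
  also have "(poly (pderiv p) x * D ^ k - poly p x * (real k * (- 2 * x) * D ^ k / D)) / (D ^ k * D ^ k) * exp (- (1 / D)) +
      exp (- (1 / D)) * (- (2 * x) / D\<^sup>2) * (poly p x / D ^ k) =
      (poly (pderiv p) x * D\<^sup>2 + 2 * real k * x * poly p x * D - 2 * x * poly p x) / D ^ (k + 2) * exp (- (1 / D))"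
    using D by (simp add: divide_simps power_add power2_eq_square) (simp add: algebra_simps)
  also have "\<dots> = bump ?q (k + 2) x"
    using less by (simp add: bump_def D_def power2_eq_square algebra_simps)
  finally have "(f has_real_derivative bump ?q (k + 2) x) (at x)" .
  then show ?thesis
    by (rule has_field_derivative_transform_within_open[where S="{-1<..<1}"])
      (use less in \<open>auto simp: f_def bump_def abs_less_iff\<close>)
next
  case greater
  have "((\<lambda>_. 0) has_real_derivative bump ?q (k + 2) x) (at x)"
    using greater by (simp add: bump_def)
  then show ?thesis
    by (rule has_field_derivative_transform_within_open[where S="- {-1..1}"])
      (use greater in \<open>auto simp: bump_def abs_if split: if_splits\<close>)
next
  \<comment> \<open>At the two boundary points the difference quotient is estimated directly. Since
    x^2 = 1, the factorisation 1 - y^2 = (x - y) (x + y) with |x + y| \<le> 2 turns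
    \<open>bump_bound\<close> into a bound by 4 C (y - x)^2, so the derivative is 0.\<close>
  case equal
  obtain C where C: "0 \<le> C" "\<And>x. \<bar>x\<bar> < 1 \<Longrightarrow> \<bar>bump p k x\<bar> \<le> C * (1 - x\<^sup>2)\<^sup>2"
    using bump_bound by blast
  have *: "\<bar>bump p k y\<bar> \<le> 4 * C * (y - x)\<^sup>2" for y
  proof (cases "\<bar>y\<bar> < 1")
    case True
    have "1 - y\<^sup>2 = (x - y) * (x + y)" using equal
      by (metis abs_square_eq_1 power2_eq_square square_diff_square_factored mult.commute)
    then have "(1 - y\<^sup>2)\<^sup>2 = (x + y)\<^sup>2 * (y - x)\<^sup>2"
      by (simp add: power_mult_distrib power2_commute)
    moreover have "(x + y)\<^sup>2 \<le> 2\<^sup>2" using True equal by (intro power2_le_iff_abs_le[THEN iffD2]) auto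
    ultimately have "(1 - y\<^sup>2)\<^sup>2 \<le> 4 * (y - x)\<^sup>2" by (simp add: mult_right_mono)
    then have "C * (1 - y\<^sup>2)\<^sup>2 \<le> C * (4 * (y - x)\<^sup>2)" using C(1) by (rule mult_left_mono)
    then show ?thesis using C(2)[OF True] by simp
  next
    case False then show ?thesis using C by (simp add: bump_def)
  qed
  have b0: "bump p k x = 0" "bump ?q (k + 2) x = 0" using equal by (auto simp: bump_def)
  have "((\<lambda>y. (bump p k y - bump p k x) / (y - x)) \<longlongrightarrow> 0) (at x)"
  proof (rule Lim_null_comparison)
    show "\<forall>\<^sub>F y in at x. norm ((bump p k y - bump p k x) / (y - x)) \<le> 4 * C * \<bar>y - x\<bar>"
    proof (rule eventually_at_filter[THEN iffD2], intro always_eventually allI impI)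
      fix y assume "y \<noteq> x"
      then have "\<bar>bump p k y\<bar> / \<bar>y - x\<bar> \<le> 4 * C * (y - x)\<^sup>2 / \<bar>y - x\<bar>"
        using *[of y] by (intro divide_right_mono) auto
      also have "(y - x)\<^sup>2 = \<bar>y - x\<bar> * \<bar>y - x\<bar>" by (simp add: power2_eq_square flip: abs_mult)
      also have "4 * C * (\<bar>y - x\<bar> * \<bar>y - x\<bar>) / \<bar>y - x\<bar> = 4 * C * \<bar>y - x\<bar>"
        using \<open>y \<noteq> x\<close> by (simp del: abs_mult_self_eq)
      finally show "norm ((bump p k y - bump p k x) / (y - x)) \<le> 4 * C * \<bar>y - x\<bar>"
        unfolding b0 by simp
    qed
    show "((\<lambda>y. 4 * C * \<bar>y - x\<bar>) \<longlongrightarrow> 0) (at x)"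
      by (auto intro!: tendsto_eq_intros)
  qed
  then show ?thesis unfolding has_field_derivative_iff b0(2) .
qed

lemma bump_Cb: "bump p k \<in> Cb"
proof (rule Cb_coinduct[where F="{bump p k | p k. True}"], blast)
  fix f assume "f \<in> {bump p k | p k. True}"
  then obtain p k where f: "f = bump p k" by auto
  obtain C where C: "0 \<le> C" "\<And>x. \<bar>x\<bar> < 1 \<Longrightarrow> \<bar>bump p k x\<bar> \<le> C * (1 - x\<^sup>2)\<^sup>2"
    using bump_bound by blast
  have "\<bar>bump p k x\<bar> \<le> C" for x
  proof (cases "\<bar>x\<bar> < 1")
    case True
    then have "x\<^sup>2 \<le> 1" by (simp add: abs_square_le_1)
    then have "(1 - x\<^sup>2)\<^sup>2 \<le> 1" by (simp add: power_le_one)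
    then have "C * (1 - x\<^sup>2)\<^sup>2 \<le> C * 1" using C(1) by (intro mult_left_mono)
    then show ?thesis using C(2)[OF True] by simp
  qed (use C in \<open>auto simp: bump_def\<close>)
  moreover have "deriv f \<in> {bump p k | p k. True}"
  proof -
    have "deriv f = bump (pderiv p * [:1, 0, -1:]\<^sup>2 + smult (2 * real k) ([:0, 1:] * p * [:1, 0, -1:]) - smult 2 ([:0, 1:] * p)) (k + 2)"
      unfolding f by (intro ext DERIV_imp_deriv bump_DERIV)
    then show ?thesis by blast
  qed
  ultimately show "(\<forall>x. f field_differentiable at x) \<and> (\<exists>C. \<forall>x. \<bar>f x\<bar> \<le> C) \<and>
      deriv f \<in> {bump p k | p k. True}"
    unfolding f using bump_DERIV field_differentiable_def by blast
qed

text \<open>A normalised antiderivative of \<open>bump [:1:] 0\<close>. The step is the primary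
  object and the mollifiers are its scaled derivatives: a difference of two mollifiers then has an
  explicit antiderivative of compact support, namely a difference of two scaled steps.\<close>

lemma smooth_step_exists:
  "\<exists>P. P \<in> Cb \<and> (\<forall>x\<le>-1. P x = 0) \<and> (\<forall>x\<ge>1. P x = 1) \<and> (\<forall>x. 0 \<le> deriv P x)"
proof -
  define b where "b = bump [:1:] 0"
  have b: "b \<in> Cb" "\<And>x. 0 \<le> b x" "\<And>x. 1 \<le> \<bar>x\<bar> \<Longrightarrow> b x = 0" "\<And>x. \<bar>x\<bar> < 1 \<Longrightarrow> 0 < b x"
    by (auto simp: b_def bump_Cb) (auto simp: bump_def)
  obtain F where F': "\<And>x. (F has_vector_derivative b x) (at x)"
    using einterval_antiderivative[of "-\<infinity>" "\<infinity>" b] Cb_DERIV[OF b(1)] DERIV_isCont by force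
  then have F: "(F has_real_derivative b x) (at x)" for x
    by (simp add: has_real_derivative_iff_has_vector_derivative)
  have mono: "F x \<le> F y" if "x \<le> y" for x y
    using DERIV_nonneg_imp_nondecreasing[OF that, of F] F b(2) by blast
  have const: "F y = F x" if "x < y" "\<And>z. x < z \<Longrightarrow> z < y \<Longrightarrow> b z = 0" for x y
    using MVT2[of x y F b] F that by force
  have lo: "F x = F (-1)" if "x \<le> -1" for x
    using const[of x "-1"] b(3) that by (cases "x = -1") auto
  have hi: "F x = F 1" if "1 \<le> x" for x
    using const[of 1 x] b(3) that by (cases "x = 1") auto
  have pos: "F (-1) < F 1"
  proof -
    obtain z where "-1 < z" "z < 1" "F 1 - F (-1) = (1 - (-1)) * b z"
      using MVT2[of "-1" 1 F b] F by auto
    then show ?thesis using b(4)[of z] by (auto simp: abs_less_iff)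
  qed
  define P where "P x = 1 / (F 1 - F (-1)) * (F x - F (-1))" for x
  have dP: "(P has_real_derivative 1 / (F 1 - F (-1)) * b x) (at x)" for x
    unfolding P_def using DERIV_cmult[OF DERIV_diff[OF F DERIV_const[of "F (-1)"]], of "1 / (F 1 - F (-1))"]
    by (simp only: diff_zero)
  have P01: "0 \<le> P x \<and> P x \<le> 1" for x
  proof -
    have "F (-1) \<le> F x"
    proof (cases "x \<le> -1")
      case True show ?thesis unfolding lo[OF True] ..
    next
      case False then show ?thesis by (intro mono) simp
    qed
    moreover have "F x \<le> F 1"
    proof (cases "1 \<le> x")
      case True show ?thesis unfolding hi[OF True] ..
    next
      case False then show ?thesis by (intro mono) simp
    qed
    ultimately show ?thesis using pos by (simp add: P_def)
  qed
  have "P \<in> Cb"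
  proof (rule CbI_deriv[OF dP])
    show "(\<lambda>x. 1 / (F 1 - F (-1)) * b x) \<in> Cb" using Cb_affine[OF b(1), of "1 / (F 1 - F (-1))" 1 0] by simp
    show "\<bar>P x\<bar> \<le> 1" for x using P01[of x] by auto
  qed
  moreover have "deriv P x \<ge> 0" for x using DERIV_imp_deriv[OF dP] pos b(2) by simp
  moreover have "P x = 0" if "x \<le> -1" for x using lo[OF that] by (simp add: P_def)
  moreover have "P x = 1" if "1 \<le> x" for x using hi[OF that] pos by (simp add: P_def)
  ultimately show ?thesis by blast
qed

definition step :: "real \<Rightarrow> real" where
  "step = (SOME P. P \<in> Cb \<and> (\<forall>x\<le>-1. P x = 0) \<and> (\<forall>x\<ge>1. P x = 1) \<and> (\<forall>x. 0 \<le> deriv P x))"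

lemma step_Cb: "step \<in> Cb" and step_left: "x \<le> -1 \<Longrightarrow> step x = 0"
  and step_right: "1 \<le> x \<Longrightarrow> step x = 1" and step_deriv_nonneg: "0 \<le> deriv step x"
  using someI_ex[OF smooth_step_exists] unfolding step_def[symmetric] by auto

lemma step_mono: "x \<le> y \<Longrightarrow> step x \<le> step y"
  using DERIV_nonneg_imp_nondecreasing[of x y step] Cb_DERIV[OF step_Cb] step_deriv_nonneg by blast

lemma step_bounds: "0 \<le> step x" "step x \<le> 1"
proof -
  show "0 \<le> step x" using step_mono[of "min x (-1)" x] step_left[of "min x (-1)"] by simp
  show "step x \<le> 1" using step_mono[of x "max x 1"] step_right[of "max x 1"] by simp
qed

text \<open>Beyond 1 and -1 the step is locally constant. At these two points themselves, continuity
  of the derivative carries over the value 0 along the outer points x * (1 + 1 / (n + 1)).\<close>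

lemma deriv_step_eq_0:
  assumes "1 \<le> \<bar>x\<bar>" shows "deriv step x = 0"
proof -
  have 0: "deriv step y = 0" if "1 < \<bar>y\<bar>" for y
  proof (rule DERIV_imp_deriv)
    show "(step has_real_derivative 0) (at y)"
      by (rule has_field_derivative_transform_within_open[where f="\<lambda>_. if 0 < y then 1 else 0"
            and S="if 0 < y then {1<..} else {..< -1}"])
        (use that step_left step_right in \<open>auto split: if_splits\<close>)
  qed
  have c: "isCont (deriv step) x" using Cb_DERIV[OF Cb_deriv[OF step_Cb]] DERIV_isCont by blast
  have "(\<lambda>n. deriv step (x * (1 + 1 / real (Suc n)))) \<longlonglongrightarrow> deriv step x"
    using isCont_tendsto_compose[OF c, of "\<lambda>n. x * (1 + 1 / real (Suc n))" sequentially]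
      tendsto_mult[OF tendsto_const[of x] tendsto_add[OF tendsto_const[of 1] LIMSEQ_inverse_real_of_nat]]
    by (simp add: inverse_eq_divide)
  moreover have "deriv step (x * (1 + 1 / real (Suc n))) = 0" for n
  proof (rule 0)
    have "1 * 1 < \<bar>x\<bar> * (1 + 1 / real (Suc n))"
      using assms by (intro mult_le_less_imp_less) auto
    then show "1 < \<bar>x * (1 + 1 / real (Suc n))\<bar>" by (simp add: abs_mult)
  qed
  ultimately have "(\<lambda>n. 0) \<longlonglongrightarrow> deriv step x" by (simp only:)
  then show ?thesis by (simp add: LIMSEQ_const_iff)
qed

section \<open>One-dimensional mollifiers and the antiderivatives of their differences\<close>

definition mol :: "real \<Rightarrow> real \<Rightarrow> real" where
  "mol \<epsilon> x = deriv step (x / \<epsilon>) / \<epsilon>"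

text \<open>Antiderivative of the difference of the mollifiers of widths \<epsilon> and \<delta>. It
  vanishes beyond the larger width, because both steps are constant with the same value there. All
  commutator kernels are built from it.\<close>

definition mol_gap :: "real \<Rightarrow> real \<Rightarrow> real \<Rightarrow> real" where
  "mol_gap \<epsilon> \<delta> x = step (x / \<epsilon>) - step (x / \<delta>)"

lemma mol_Cb: "mol \<epsilon> \<in> Cb"
  using Cb_affine[OF Cb_deriv[OF step_Cb], of "1/\<epsilon>" "1/\<epsilon>" 0] by (simp add: mol_def[abs_def])

lemma mol_nonneg: "0 < \<epsilon> \<Longrightarrow> 0 \<le> mol \<epsilon> x"
  by (simp add: mol_def step_deriv_nonneg)

lemma mol_eq_0: "0 < \<epsilon> \<Longrightarrow> \<epsilon> \<le> \<bar>x\<bar> \<Longrightarrow> mol \<epsilon> x = 0"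
  by (simp add: mol_def deriv_step_eq_0)

lemma mol_gap_Cb: "mol_gap \<epsilon> \<delta> \<in> Cb"
  using Cb_diff[OF Cb_affine[OF step_Cb, of 1 "1/\<epsilon>" 0] Cb_affine[OF step_Cb, of 1 "1/\<delta>" 0]]
  by (simp add: mol_gap_def[abs_def])

lemma step_scaled_DERIV:
  "((\<lambda>x. step (x / a)) has_real_derivative deriv step (x / a) * (1 / a)) (at x)"
  using DERIV_chain2[where f=step and g="\<lambda>x. x / a", OF Cb_DERIV[OF step_Cb] DERIV_cdivide[OF DERIV_ident]] .

lemma deriv_mol_gap: "deriv (mol_gap \<epsilon> \<delta>) x = mol \<epsilon> x - mol \<delta> x"
  using DERIV_diff[OF step_scaled_DERIV[of \<epsilon> x] step_scaled_DERIV[of \<delta> x]]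
  by (intro DERIV_imp_deriv) (simp add: mol_gap_def[abs_def] mol_def)

lemma mol_gap_eq_0: "0 < \<epsilon> \<Longrightarrow> 0 < \<delta> \<Longrightarrow> \<epsilon> \<le> \<bar>x\<bar> \<Longrightarrow> \<delta> \<le> \<bar>x\<bar> \<Longrightarrow> mol_gap \<epsilon> \<delta> x = 0"
  by (cases "0 \<le> x") (auto simp: mol_gap_def step_left step_right field_simps)

lemma abs_mol_gap_le: "\<bar>mol_gap \<epsilon> \<delta> x\<bar> \<le> 1"
  using step_bounds[of "x / \<epsilon>"] step_bounds[of "x / \<delta>"] by (auto simp: mol_gap_def)

lemma nn_integral_mol:
  assumes "0 < \<epsilon>" shows "(\<integral>\<^sup>+x. mol \<epsilon> x \<partial>lborel) = 1"
proof -
  have "(\<integral>\<^sup>+x. ennreal (mol \<epsilon> x) * indicator {-\<epsilon>..\<epsilon>} x \<partial>lborel) = step (\<epsilon> / \<epsilon>) - step (- \<epsilon> / \<epsilon>)"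
  proof (rule nn_integral_FTC_Icc[where F="\<lambda>x. step (x / \<epsilon>)"])
    show "((\<lambda>x. step (x / \<epsilon>)) has_real_derivative mol \<epsilon> x) (at x)" for x
      using step_scaled_DERIV[of \<epsilon> x] by (simp add: mol_def)
  qed (use assms mol_nonneg Cb_measurable[OF mol_Cb] in auto)
  also have "\<dots> = 1" using assms by (simp add: step_left step_right)
  also have "(\<integral>\<^sup>+x. ennreal (mol \<epsilon> x) * indicator {-\<epsilon>..\<epsilon>} x \<partial>lborel) = (\<integral>\<^sup>+x. mol \<epsilon> x \<partial>lborel)"
    using assms by (intro nn_integral_cong) (auto simp: indicator_def mol_eq_0)
  finally show ?thesis .
qed

text \<open>The smallness behind the commutator estimate: height at most 1 on an interval of length
  2 (\<epsilon> + \<delta>), whereas a mollifier has mass 1 at every scale.\<close>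

lemma nn_integral_mol_gap:
  assumes "0 < \<epsilon>" "0 < \<delta>" shows "(\<integral>\<^sup>+x. \<bar>mol_gap \<epsilon> \<delta> x\<bar> \<partial>lborel) \<le> 2 * (\<epsilon> + \<delta>)"
proof -
  have "(\<integral>\<^sup>+x. \<bar>mol_gap \<epsilon> \<delta> x\<bar> \<partial>lborel) \<le> (\<integral>\<^sup>+x. indicator {-(\<epsilon>+\<delta>)..\<epsilon>+\<delta>} x \<partial>lborel)"
    using assms abs_mol_gap_le[of \<epsilon> \<delta>]
    by (intro nn_integral_mono) (auto simp: indicator_def not_le intro!: mol_gap_eq_0)
  also have "\<dots> = 2 * (\<epsilon> + \<delta>)" using assms by (simp add: ennreal_plus[symmetric] del: ennreal_plus) 
  finally show ?thesis .
qed

lemma nn_integral_reflect: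
  fixes f :: "real \<Rightarrow> ennreal"
  assumes [measurable]: "f \<in> borel_measurable borel"
  shows "(\<integral>\<^sup>+x. f (x - y) \<partial>lborel) = (\<integral>\<^sup>+x. f x \<partial>lborel)" "(\<integral>\<^sup>+x. f (y - x) \<partial>lborel) = (\<integral>\<^sup>+x. f x \<partial>lborel)"
  using nn_integral_real_affine[of f 1 "-y"] nn_integral_real_affine[of f "-1" y] by auto

subsection \<open>Smoothness in coordinates\<close>

text \<open>Meant for functions that agree near each point with a regular function which changes
  from point to point.\<close>

lemma continuous_map_real_local:
  fixes f :: "'a \<Rightarrow> real"
  assumes "\<And>p. p \<in> topspace T \<Longrightarrow> \<exists>V h. openin T V \<and> p \<in> V \<and> continuous_map T euclideanreal h \<and> (\<forall>q\<in>V. f q = h q)"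
  shows "continuous_map T euclideanreal f"
  unfolding continuous_map
proof (intro conjI allI impI)
  fix W :: "real set" assume W: "openin euclideanreal W"
  show "openin T {x \<in> topspace T. f x \<in> W}"
  proof (subst openin_subopen, intro ballI)
    fix p assume p: "p \<in> {x \<in> topspace T. f x \<in> W}"
    then obtain V h where V: "openin T V" "p \<in> V" "continuous_map T euclideanreal h" "\<forall>q\<in>V. f q = h q"
      using assms[of p] by blast
    have "openin T (V \<inter> {x \<in> topspace T. h x \<in> W})"
      using V(3) W by (intro openin_Int V(1)) (simp add: continuous_map)
    then show "\<exists>S. openin T S \<and> p \<in> S \<and> S \<subseteq> {x \<in> topspace T. f x \<in> W}"
      using V p by (intro exI[of _ "V \<inter> {x \<in> topspace T. h x \<in> W}"]) auto
  qed
qed auto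

text \<open>The bound on h' makes h Lipschitz in s with constant C, so the difference quotients are
  dominated by |u| C. Limits are taken along arbitrary sequences because dominated convergence is
  sequential.\<close>

lemma DERIV_under_integral:
  fixes u :: "'a \<Rightarrow> real"
  assumes u: "integrable N u" and m: "\<And>s. (\<lambda>q. h q s) \<in> borel_measurable N"
    and m': "(\<lambda>q. h' q 0) \<in> borel_measurable N"
    and d: "\<And>q s. (h q has_real_derivative h' q s) (at s)"
    and C: "\<And>q s. \<bar>h q s\<bar> \<le> C" "\<And>q s. \<bar>h' q s\<bar> \<le> C"
  shows "((\<lambda>s. LINT q|N. u q * h q s) has_real_derivative (LINT q|N. u q * h' q 0)) (at 0)"
proof -
  have um: "u \<in> borel_measurable N" using u by auto
  have C0: "0 \<le> C" using C(1)[of undefined undefined] by linarith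
  have int: "integrable N (\<lambda>q. u q * h q s)" for s
    by (rule Bochner_Integration.integrable_bound[where f="\<lambda>q. u q * C"])
      (use u um m C C0 in \<open>auto simp: abs_mult intro!: mult_left_mono\<close>)
  have lip: "\<bar>h q s - h q 0\<bar> \<le> C * \<bar>s\<bar>" for q s
    using field_differentiable_bound[of UNIV "h q" "h' q" C s 0] d C by auto
  have "(\<lambda>n. ((LINT q|N. u q * h q (S n)) - (LINT q|N. u q * h q 0)) / (S n - 0)) \<longlonglongrightarrow> (LINT q|N. u q * h' q 0)"
    if S: "\<And>n. S n \<noteq> 0" "S \<longlonglongrightarrow> 0" for S
  proof -
    have "(\<lambda>n. LINT q|N. u q * ((h q (S n) - h q 0) / S n)) \<longlonglongrightarrow> (LINT q|N. u q * h' q 0)"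
    proof (rule integral_dominated_convergence)
      show "integrable N (\<lambda>q. \<bar>u q\<bar> * C)" using u by auto
      show "AE q in N. (\<lambda>n. u q * ((h q (S n) - h q 0) / S n)) \<longlonglongrightarrow> u q * h' q 0"
      proof (intro AE_I2 tendsto_mult tendsto_const)
        fix q
        have "((\<lambda>s. (h q s - h q 0) / (s - 0)) \<longlongrightarrow> h' q 0) (at 0)"
          using d[of q 0] by (simp add: has_field_derivative_iff)
        moreover have "filterlim S (at 0) sequentially"
          using S by (auto simp: filterlim_at)
        ultimately show "(\<lambda>n. (h q (S n) - h q 0) / S n) \<longlonglongrightarrow> h' q 0"
          using filterlim_compose by fastforce
      qed
      show "AE q in N. norm (u q * ((h q (S n) - h q 0) / S n)) \<le> \<bar>u q\<bar> * C" for n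
      proof (intro AE_I2)
        fix q
        have "\<bar>h q (S n) - h q 0\<bar> / \<bar>S n\<bar> \<le> C" using lip[of q "S n"] S(1)[of n] by (simp add: divide_le_eq)
        then show "norm (u q * ((h q (S n) - h q 0) / S n)) \<le> \<bar>u q\<bar> * C"
          unfolding real_norm_def abs_mult abs_divide by (rule mult_left_mono) simp
      qed
    qed (use um m m' in auto)
    moreover have "(LINT q|N. u q * ((h q s - h q 0) / s)) =
        ((LINT q|N. u q * h q s) - (LINT q|N. u q * h q 0)) / (s - 0)" for s
      using int by (simp add: right_diff_distrib flip: Bochner_Integration.integral_diff)
    ultimately show ?thesis by (simp only:)
  qed
  then show ?thesis unfolding has_field_derivative_iff tendsto_at_iff_sequentially comp_def by auto
qed

text \<open>Treats space and space-time together. Smoothness sees of a point only its coordinates in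
  D and the shifts along them, so default values outside D, as in extensional functions, do not
  enter.\<close>

locale coordinate_space =
  fixes T :: "'p topology" and D :: "'d set" and coord :: "'p \<Rightarrow> 'd \<Rightarrow> real"
    and move :: "'d \<Rightarrow> 'p \<Rightarrow> real \<Rightarrow> 'p"
  assumes finite_D: "finite D"
    and coord_continuous: "\<And>d. d \<in> D \<Longrightarrow> continuous_map T euclideanreal (\<lambda>p. coord p d)"
    and coord_move: "\<And>d e p s. d \<in> D \<Longrightarrow> e \<in> D \<Longrightarrow> coord (move d p s) e = (if e = d then coord p e + s else coord p e)"
    and move_continuous: "\<And>d p. d \<in> D \<Longrightarrow> p \<in> topspace T \<Longrightarrow> continuous_map euclideanreal T (move d p)"
    and move_0: "\<And>d p. d \<in> D \<Longrightarrow> move d p 0 = p"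
begin

text \<open>In product form a partial derivative changes a single factor, and integrals over the
  centre split into one-dimensional ones.\<close>

definition ker :: "('d \<Rightarrow> real \<Rightarrow> real) \<Rightarrow> 'p \<Rightarrow> ('d \<Rightarrow> real) \<Rightarrow> real" where
  "ker k p c = (\<Prod>d\<in>D. k d (coord p d - c d))"

text \<open>The generators are convolutions with product kernels. A partial derivative of a
  generator is a generator with one factor differentiated, so the algebra is closed under partial
  derivatives and all orders of smoothness come at once. Products are included because a cutoff
  times a convolution has to belong to it.\<close>

inductive_set smooth_alg :: "'q measure \<Rightarrow> ('q \<Rightarrow> 'd \<Rightarrow> real) \<Rightarrow> ('p \<Rightarrow> real) set"
  for N :: "'q measure" and c :: "'q \<Rightarrow> 'd \<Rightarrow> real" where
  base: "integrable N u \<Longrightarrow> \<forall>d\<in>D. k d \<in> Cb \<Longrightarrow> (\<lambda>p. LINT q|N. u q * ker k p (c q)) \<in> smooth_alg N c"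
| scale: "f \<in> smooth_alg N c \<Longrightarrow> (\<lambda>p. a * f p) \<in> smooth_alg N c"
| add: "f \<in> smooth_alg N c \<Longrightarrow> g \<in> smooth_alg N c \<Longrightarrow> (\<lambda>p. f p + g p) \<in> smooth_alg N c"
| mult: "f \<in> smooth_alg N c \<Longrightarrow> g \<in> smooth_alg N c \<Longrightarrow> (\<lambda>p. f p * g p) \<in> smooth_alg N c"

lemma ker_bounded:
  assumes "\<forall>d\<in>D. k d \<in> Cb"
  obtains C where "0 \<le> C" "\<And>p c. \<bar>ker k p c\<bar> \<le> C"
proof -
  obtain C where C: "\<And>d. d \<in> D \<Longrightarrow> \<forall>x. \<bar>k d x\<bar> \<le> C d"
    using bchoice[of D "\<lambda>d C. \<forall>x. \<bar>k d x\<bar> \<le> C"] Cb_bounded assms by blast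
  have "\<bar>ker k p c\<bar> \<le> (\<Prod>d\<in>D. C d)" for p c
    unfolding ker_def abs_prod using C by (intro prod_mono) auto
  then show thesis using that[of "\<Prod>d\<in>D. C d"] by (meson abs_ge_zero order_trans)
qed

lemma ker_measurable:
  assumes "\<forall>d\<in>D. k d \<in> Cb" "\<forall>d\<in>D. (\<lambda>q. c q d) \<in> borel_measurable N"
  shows "(\<lambda>q. ker k p (c q)) \<in> borel_measurable N"
  unfolding ker_def
proof (rule borel_measurable_prod)
  fix d assume "d \<in> D"
  then have "k d \<in> borel_measurable borel" "(\<lambda>q. coord p d - c q d) \<in> borel_measurable N"
    using assms Cb_measurable by auto
  then show "(\<lambda>q. k d (coord p d - c q d)) \<in> borel_measurable N"
    by (rule measurable_compose[rotated])
qed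

lemma ker_move:
  assumes "d \<in> D"
  shows "ker k (move d p s) c = k d (coord p d - c d + s) * (\<Prod>e\<in>D - {d}. k e (coord p e - c e))"
  unfolding ker_def using assms
  by (subst prod.remove[OF finite_D assms]) (auto simp: coord_move algebra_simps intro!: prod.cong)

text \<open>Change one factor of the product at a time, the other factors being bounded. The
  constant does not depend on the centre, so continuity survives integration over centres.\<close>

lemma ker_lipschitz:
  assumes "\<forall>d\<in>D. k d \<in> Cb"
  obtains L where "0 \<le> L" "\<And>p p' c. \<bar>ker k p c - ker k p' c\<bar> \<le> L * (\<Sum>d\<in>D. \<bar>coord p d - coord p' d\<bar>)"
proof -
  have "\<exists>L\<ge>0. \<forall>a b. \<bar>(\<Prod>d\<in>D. k d (a d)) - (\<Prod>d\<in>D. k d (b d))\<bar> \<le> L * (\<Sum>d\<in>D. \<bar>a d - b d\<bar>)"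
    using finite_D assms
  proof (induction D rule: finite_induct)
    case (insert d D)
    then obtain L where L: "0 \<le> L" "\<And>a b. \<bar>(\<Prod>d\<in>D. k d (a d)) - (\<Prod>d\<in>D. k d (b d))\<bar> \<le> L * (\<Sum>d\<in>D. \<bar>a d - b d\<bar>)"
      by blast
    obtain C where C: "\<And>e. e \<in> D \<Longrightarrow> \<forall>x. \<bar>k e x\<bar> \<le> C e"
      using bchoice[of D "\<lambda>d C. \<forall>x. \<bar>k d x\<bar> \<le> C"] Cb_bounded insert.prems by blast
    define P where "P = (\<Prod>e\<in>D. C e)"
    have P: "\<bar>\<Prod>e\<in>D. k e (a e)\<bar> \<le> P" for a
      unfolding P_def abs_prod using C by (intro prod_mono) auto
    then have P0: "0 \<le> P" by (meson abs_ge_zero order_trans)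
    obtain M where M: "1 \<le> M" "\<And>x. \<bar>k d x\<bar> \<le> M" using Cb_bound insert.prems by (metis insertCI)
    obtain K where K: "0 \<le> K" "\<And>x y. \<bar>k d x - k d y\<bar> \<le> K * \<bar>x - y\<bar>" using Cb_lipschitz insert.prems by (metis insertCI)
    have "\<bar>(\<Prod>d\<in>insert d D. k d (a d)) - (\<Prod>d\<in>insert d D. k d (b d))\<bar> \<le> (K * P + M * L) * (\<Sum>d\<in>insert d D. \<bar>a d - b d\<bar>)" for a b
    proof -
      define A where "A = (\<Prod>e\<in>D. k e (a e))"
      define B where "B = (\<Prod>e\<in>D. k e (b e))"
      define S where "S = (\<Sum>e\<in>D. \<bar>a e - b e\<bar>)"
      have S0: "0 \<le> S" unfolding S_def by (intro sum_nonneg) auto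
      have "k d (a d) * A - k d (b d) * B = (k d (a d) - k d (b d)) * A + k d (b d) * (A - B)"
        by (simp add: algebra_simps)
      then have "\<bar>k d (a d) * A - k d (b d) * B\<bar> \<le> \<bar>k d (a d) - k d (b d)\<bar> * \<bar>A\<bar> + \<bar>k d (b d)\<bar> * \<bar>A - B\<bar>"
        by (metis abs_mult abs_triangle_ineq)
      also have "\<dots> \<le> (K * \<bar>a d - b d\<bar>) * P + M * (L * S)"
        using K M P[of a] L(2)[of a b] P0 unfolding A_def B_def S_def by (intro add_mono mult_mono) auto
      also have "\<dots> \<le> (K * P + M * L) * (\<bar>a d - b d\<bar> + S)"
        using K(1) M(1) L(1) P0 S0 by (simp add: algebra_simps)
      finally show ?thesis using insert.hyps by (simp add: A_def B_def S_def)
    qed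
    then show ?case using K(1) M(1) L(1) P0 by (intro exI[of _ "K * P + M * L"]) auto
  qed (auto intro!: exI[of _ 0])
  then obtain L where L: "0 \<le> L" "\<And>a b. \<bar>(\<Prod>d\<in>D. k d (a d)) - (\<Prod>d\<in>D. k d (b d))\<bar> \<le> L * (\<Sum>d\<in>D. \<bar>a d - b d\<bar>)"
    by blast
  show thesis
  proof (rule that[OF L(1)])
    show "\<bar>ker k p c - ker k p' c\<bar> \<le> L * (\<Sum>d\<in>D. \<bar>coord p d - coord p' d\<bar>)" for p p' c
      using L(2)[of "\<lambda>d. coord p d - c d" "\<lambda>d. coord p' d - c d"] by (simp add: ker_def)
  qed
qed

lemma lipschitz_continuous:
  fixes f :: "'p \<Rightarrow> real"
  assumes f: "\<And>p q. \<bar>f p - f q\<bar> \<le> L * (\<Sum>d\<in>D. \<bar>coord p d - coord q d\<bar>)"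
  shows "continuous_map T euclideanreal f"
  unfolding continuous_map
proof (intro conjI allI impI)
  fix W :: "real set" assume W: "openin euclideanreal W"
  show "openin T {x \<in> topspace T. f x \<in> W}"
  proof (subst openin_subopen, intro ballI)
    fix p assume p: "p \<in> {x \<in> topspace T. f x \<in> W}"
    then obtain e where e: "0 < e" "\<And>y. \<bar>y - f p\<bar> < e \<Longrightarrow> y \<in> W"
      using W by (auto simp: open_dist dist_real_def)
    have "continuous_map T euclideanreal (\<lambda>q. L * (\<Sum>d\<in>D. \<bar>coord q d - coord p d\<bar>))"
      by (intro continuous_map_real_mult continuous_map_sum continuous_map_real_abs
          continuous_map_diff coord_continuous finite_D continuous_map_const[THEN iffD2]) auto
    then have "openin T {q \<in> topspace T. L * (\<Sum>d\<in>D. \<bar>coord q d - coord p d\<bar>) \<in> {..<e}}"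
      unfolding continuous_map by (auto simp del: lessThan_iff)
    then show "\<exists>S. openin T S \<and> p \<in> S \<and> S \<subseteq> {x \<in> topspace T. f x \<in> W}"
      using p e f by (intro exI[of _ "{q \<in> topspace T. L * (\<Sum>d\<in>D. \<bar>coord q d - coord p d\<bar>) \<in> {..<e}}"])
        (auto intro: order_le_less_trans)
  qed
qed auto

lemma base_DERIV:
  assumes u: "integrable N u" and k: "\<forall>d\<in>D. k d \<in> Cb" and d: "d \<in> D"
    and c: "\<forall>d\<in>D. (\<lambda>q. c q d) \<in> borel_measurable N"
  shows "((\<lambda>s. LINT q|N. u q * ker k (move d p s) (c q)) has_real_derivative
    (LINT q|N. u q * ker (k(d := deriv (k d))) p (c q))) (at 0)"
proof -
  let ?k = "k(d := deriv (k d))"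
  have k': "\<forall>d\<in>D. ?k d \<in> Cb" using k d by (auto intro: Cb_deriv)
  obtain C where C: "0 \<le> C" "\<And>p c. \<bar>ker k p c\<bar> \<le> C" using ker_bounded[OF k] by blast
  obtain C' where C': "0 \<le> C'" "\<And>p c. \<bar>ker ?k p c\<bar> \<le> C'" using ker_bounded[OF k'] by blast
  have "((\<lambda>s. LINT q|N. u q * ker k (move d p s) (c q)) has_real_derivative
    (LINT q|N. u q * ker ?k (move d p 0) (c q))) (at 0)"
  proof (rule DERIV_under_integral[OF u, where C="max C C'"])
    show "((\<lambda>s. ker k (move d p s) (c q)) has_real_derivative ker ?k (move d p s) (c q)) (at s)" for q s
    proof -
      have "((\<lambda>s. k d (coord p d - c q d + s)) has_real_derivative deriv (k d) (coord p d - c q d + s)) (at s)"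
        using DERIV_chain2[OF Cb_DERIV DERIV_add[OF DERIV_const DERIV_ident], of "k d"] k d by auto
      from DERIV_cmult_right[OF this] show ?thesis
        using d unfolding ker_move[OF d] by (simp cong: prod.cong_simp)
    qed
  qed (use k k' c C C' in \<open>auto intro!: ker_measurable max.coboundedI1[OF C(2)] max.coboundedI2[OF C'(2)] simp del: fun_upd_apply\<close>)
  then show ?thesis by (simp add: move_0 d)
qed

text \<open>Induction on the construction. The derivative is produced as a member of the algebra
  again, which allows the statement to be iterated.\<close>

lemma smooth_alg_regular:
  assumes c: "\<forall>d\<in>D. (\<lambda>q. c q d) \<in> borel_measurable N" and "f \<in> smooth_alg N c"
  shows "continuous_map T euclideanreal f \<and>
    (\<forall>d\<in>D. \<exists>f'\<in>smooth_alg N c. \<forall>p. ((\<lambda>s. f (move d p s)) has_real_derivative f' p) (at 0))"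
  using assms(2)
proof induction
  case (base u k)
  obtain L where L: "0 \<le> L" "\<And>p p' c. \<bar>ker k p c - ker k p' c\<bar> \<le> L * (\<Sum>d\<in>D. \<bar>coord p d - coord p' d\<bar>)"
    using ker_lipschitz base(2) by blast
  obtain C where C: "0 \<le> C" "\<And>p c. \<bar>ker k p c\<bar> \<le> C" using ker_bounded base(2) by blast
  have km: "(\<lambda>q. ker k p (c q)) \<in> borel_measurable N" for p
    by (rule ker_measurable[OF base(2) c])
  have um: "u \<in> borel_measurable N" using base(1) by auto
  have int: "integrable N (\<lambda>q. u q * ker k p (c q))" for p
    by (rule Bochner_Integration.integrable_bound[where f="\<lambda>q. u q * C"])
      (use base um km C in \<open>auto simp: abs_mult intro!: mult_left_mono\<close>)
  have "continuous_map T euclideanreal (\<lambda>p. LINT q|N. u q * ker k p (c q))"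
  proof (rule lipschitz_continuous)
    fix p p'
    let ?S = "\<Sum>d\<in>D. \<bar>coord p d - coord p' d\<bar>"
    have "\<bar>(LINT q|N. u q * ker k p (c q)) - (LINT q|N. u q * ker k p' (c q))\<bar>
        = \<bar>LINT q|N. u q * (ker k p (c q) - ker k p' (c q))\<bar>"
      using int by (simp add: right_diff_distrib)
    also have "\<dots> \<le> (LINT q|N. \<bar>u q * (ker k p (c q) - ker k p' (c q))\<bar>)"
      by (rule integral_abs_bound)
    also have "\<dots> \<le> (LINT q|N. \<bar>u q\<bar> * (L * ?S))"
    proof (intro integral_mono)
      show "integrable N (\<lambda>q. \<bar>u q * (ker k p (c q) - ker k p' (c q))\<bar>)"
        using int[of p] int[of p'] by (simp add: right_diff_distrib)
    qed (use base(1) L(2)[of p _ p'] in \<open>auto simp: abs_mult intro!: mult_left_mono\<close>)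
    finally show "\<bar>(LINT q|N. u q * ker k p (c q)) - (LINT q|N. u q * ker k p' (c q))\<bar> \<le> ((LINT q|N. \<bar>u q\<bar>) * L) * ?S"
      by (simp add: mult_ac)
  qed
  moreover have "\<exists>f'\<in>smooth_alg N c. \<forall>p. ((\<lambda>s. LINT q|N. u q * ker k (move d p s) (c q)) has_real_derivative f' p) (at 0)"
    if d: "d \<in> D" for d
  proof (rule bexI)
    show "(\<lambda>p. LINT q|N. u q * ker (k(d := deriv (k d))) p (c q)) \<in> smooth_alg N c"
      using base(2) d by (intro smooth_alg.base base(1)) (auto intro: Cb_deriv)
  qed (intro allI base_DERIV[OF base(1,2) d c])
  ultimately show ?case by blast
next
  case (scale f a)
  have "\<exists>h\<in>smooth_alg N c. \<forall>p. ((\<lambda>s. a * f (move d p s)) has_real_derivative h p) (at 0)"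
    if d: "d \<in> D" for d
  proof -
    obtain f' where f': "f' \<in> smooth_alg N c" "\<And>p. ((\<lambda>s. f (move d p s)) has_real_derivative f' p) (at 0)"
      using scale.IH d by blast
    show ?thesis
      by (rule bexI[OF _ smooth_alg.scale[OF f'(1), of a]]) (intro allI DERIV_cmult f')
  qed
  then show ?case using scale.IH by (auto intro!: continuous_map_real_mult)
next
  case (add f g)
  have "\<exists>h\<in>smooth_alg N c. \<forall>p. ((\<lambda>s. f (move d p s) + g (move d p s)) has_real_derivative h p) (at 0)"
    if d: "d \<in> D" for d
  proof -
    obtain f' where f': "f' \<in> smooth_alg N c" "\<And>p. ((\<lambda>s. f (move d p s)) has_real_derivative f' p) (at 0)"
      using add.IH d by blast
    obtain g' where g': "g' \<in> smooth_alg N c" "\<And>p. ((\<lambda>s. g (move d p s)) has_real_derivative g' p) (at 0)"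
      using add.IH d by blast
    show ?thesis
      by (rule bexI[OF _ smooth_alg.add[OF f'(1) g'(1)]]) (intro allI DERIV_add f' g')
  qed
  then show ?case using add.IH by (auto intro!: continuous_map_add)
next
  case (mult f g)
  have "\<exists>h\<in>smooth_alg N c. \<forall>p. ((\<lambda>s. f (move d p s) * g (move d p s)) has_real_derivative h p) (at 0)"
    if d: "d \<in> D" for d
  proof -
    obtain f' where f': "f' \<in> smooth_alg N c" "\<And>p. ((\<lambda>s. f (move d p s)) has_real_derivative f' p) (at 0)"
      using mult.IH d by blast
    obtain g' where g': "g' \<in> smooth_alg N c" "\<And>p. ((\<lambda>s. g (move d p s)) has_real_derivative g' p) (at 0)"
      using mult.IH d by blast
    show ?thesis
      by (rule bexI[OF _ smooth_alg.add[OF smooth_alg.mult[OF f'(1) mult.hyps(2)] smooth_alg.mult[OF g'(1) mult.hyps(1)]]])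
        (use DERIV_mult[OF f'(2) g'(2)] in \<open>simp add: move_0 d\<close>)
  qed
  then show ?case using mult.IH by (auto intro!: continuous_map_real_mult)
qed

lemma eventually_move:
  assumes "d \<in> D" "openin T V" "p \<in> V"
  shows "\<forall>\<^sub>F s in nhds 0. move d p s \<in> V"
proof -
  have "p \<in> topspace T" using assms openin_subset by blast
  then have "openin euclideanreal {s \<in> topspace euclideanreal. move d p s \<in> V}"
    using move_continuous[OF assms(1)] assms(2) unfolding continuous_map by blast
  then have "open {s. move d p s \<in> V}" by simp
  then show ?thesis using assms move_0 unfolding eventually_nhds by force
qed

text \<open>A partial derivative at p depends only on values near p, so being locally equal to a
  member of the algebra is inherited by partial derivatives. Iteration over the list of directions
  gives existence and continuity of all of them.\<close>

theorem smooth_wrt_local: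
  assumes c: "\<forall>d\<in>D. (\<lambda>q. c q d) \<in> borel_measurable N" and U: "openin T U"
    and f: "\<And>p. p \<in> U \<Longrightarrow> \<exists>V g. openin T V \<and> p \<in> V \<and> g \<in> smooth_alg N c \<and> (\<forall>q\<in>V. f q = g q)"
  shows "smooth_wrt T move D U f"
proof -
  define P where "P f \<longleftrightarrow> (\<forall>p\<in>U. \<exists>V g. openin T V \<and> p \<in> V \<and> g \<in> smooth_alg N c \<and> (\<forall>q\<in>V. f q = g q))" for f
  have deriv: "\<exists>V h'. openin T V \<and> p \<in> V \<and> h' \<in> smooth_alg N c \<and> (\<forall>q\<in>V. ((\<lambda>s. g (move d q s)) has_real_derivative h' q) (at 0))"
    if g: "P g" and d: "d \<in> D" and p: "p \<in> U" for g d p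
  proof -
    obtain V h where V: "openin T V" "p \<in> V" "h \<in> smooth_alg N c" "\<forall>q\<in>V. g q = h q"
      using g p unfolding P_def by blast
    obtain h' where h': "h' \<in> smooth_alg N c" "\<And>p. ((\<lambda>s. h (move d p s)) has_real_derivative h' p) (at 0)"
      using smooth_alg_regular[OF c V(3)] d by blast
    have "((\<lambda>s. g (move d q s)) has_real_derivative h' q) (at 0)" if q: "q \<in> V" for q
    proof -
      have "\<forall>\<^sub>F s in nhds 0. g (move d q s) = h (move d q s)"
        using eventually_move[OF d V(1) q] by eventually_elim (use V(4) in auto)
      then show ?thesis using h'(2)[of q] by (simp add: DERIV_cong_ev)
    qed
    then show ?thesis using V h' by blast
  qed
  have "P (foldr (partial move) ds f)" if "ds \<in> lists D" for ds
    using that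
  proof (induction ds)
    case Nil then show ?case using f by (simp add: P_def)
  next
    case (Cons d ds)
    show ?case unfolding P_def
    proof
      fix p assume p: "p \<in> U"
      obtain V h' where V: "openin T V" "p \<in> V" "h' \<in> smooth_alg N c"
        "\<forall>q\<in>V. ((\<lambda>s. foldr (partial move) ds f (move d q s)) has_real_derivative h' q) (at 0)"
        using deriv[OF Cons.IH Cons.hyps(1) p] by blast
      have "\<forall>q\<in>V. foldr (partial move) (d # ds) f q = h' q"
        using V(4) by (simp add: partial_def DERIV_imp_deriv)
      then show "\<exists>V g. openin T V \<and> p \<in> V \<and> g \<in> smooth_alg N c \<and> (\<forall>q\<in>V. foldr (partial move) (d # ds) f q = g q)"
        using V by blast
    qed
  qed
  moreover have "continuous_map (subtopology T U) euclideanreal g" if "P g" for g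
  proof (rule continuous_map_real_local)
    fix p assume "p \<in> topspace (subtopology T U)"
    then have "p \<in> U" by simp
    moreover then obtain V h where V: "openin T V" "p \<in> V" "h \<in> smooth_alg N c" "\<forall>q\<in>V. g q = h q"
      using \<open>P g\<close> unfolding P_def by blast
    ultimately show "\<exists>V h. openin (subtopology T U) V \<and> p \<in> V \<and> continuous_map (subtopology T U) euclideanreal h \<and> (\<forall>q\<in>V. g q = h q)"
      using smooth_alg_regular[OF c V(3)] U
      by (intro exI[of _ "V \<inter> U"] exI[of _ h])
        (auto simp: openin_open_subtopology intro: continuous_map_from_subtopology)
  qed
  moreover have "(\<lambda>s. g (move d p s)) field_differentiable at 0" if "P g" "d \<in> D" "p \<in> U" for g d p
    using deriv[OF that] unfolding field_differentiable_def by blast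
  ultimately show ?thesis unfolding smooth_wrt_def Let_def by blast
qed

end

section \<open>Space and space-time as coordinate spaces\<close>

definition st_dirs :: "nat \<Rightarrow> nat option set" where
  "st_dirs n = insert None (Some ` {..<n})"

fun st_coord :: "real \<times> point \<Rightarrow> nat option \<Rightarrow> real" where
  "st_coord (t, x) None = t"
| "st_coord (t, x) (Some i) = x i"

lemma topspace_sp_top [simp]: "topspace (sp_top n) = (\<Pi>\<^sub>E i\<in>{..<n}. UNIV)"
  by (simp add: sp_top_def)

lemma topspace_st_top [simp]: "topspace (st_top n) = UNIV \<times> (\<Pi>\<^sub>E i\<in>{..<n}. UNIV)"
  by (simp add: st_top_def)

lemma sp_coord_continuous: "i < n \<Longrightarrow> continuous_map (sp_top n) euclideanreal (\<lambda>x. x i)"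
  unfolding sp_top_def by (rule continuous_map_product_projection) simp

lemma sp_move_continuous:
  assumes "i < n" "x \<in> topspace (sp_top n)"
  shows "continuous_map euclideanreal (sp_top n) (sp_move i x)"
  unfolding sp_top_def continuous_map_componentwise
proof (intro conjI ballI)
  show "sp_move i x ` topspace euclideanreal \<subseteq> extensional {..<n}"
    using assms by (auto simp: sp_move_def PiE_def extensional_def)
  fix k show "continuous_map euclideanreal euclideanreal (\<lambda>s. sp_move i x s k)"
    by (cases "k = i") (auto simp: sp_move_def intro!: continuous_intros)
qed

interpretation sp: coordinate_space "sp_top n" "{..<n}" "\<lambda>x. x" sp_move for n
proof
  show "continuous_map (sp_top n) euclideanreal (\<lambda>x. x d)" if "d \<in> {..<n}" for d
    using that by (intro sp_coord_continuous) simp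
  show "continuous_map euclideanreal (sp_top n) (sp_move d p)"
    if "d \<in> {..<n}" "p \<in> topspace (sp_top n)" for d p
    using that by (intro sp_move_continuous) simp_all
qed (simp_all add: sp_move_def)

interpretation st: coordinate_space "st_top n" "st_dirs n" st_coord st_move for n
proof
  show "finite (st_dirs n)" by (simp add: st_dirs_def)
  fix d assume d: "d \<in> st_dirs n"
  show "continuous_map (st_top n) euclideanreal (\<lambda>p. st_coord p d)"
  proof (cases d)
    case None
    then have "(\<lambda>p. st_coord p d) = fst" by auto
    then show ?thesis by (simp add: st_top_def continuous_map_fst)
  next
    case (Some i)
    then have "(\<lambda>p. st_coord p d) = (\<lambda>x. x i) \<circ> snd" by auto
    then show ?thesis using d Some
      by (auto simp: st_top_def st_dirs_def intro!: continuous_map_compose[OF continuous_map_snd] sp_coord_continuous)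
  qed
  show "st_coord (st_move d p s) e = (if e = d then st_coord p e + s else st_coord p e)" for p s e
    by (cases p; cases d; cases e) (auto simp: sp_move_def)
  show "st_move d p 0 = p" for p
    by (cases p; cases d) (auto simp: sp_move_def)
  show "continuous_map euclideanreal (st_top n) (st_move d p)" if p: "p \<in> topspace (st_top n)" for p
  proof (cases p)
    case (Pair t x)
    show ?thesis
    proof (cases d)
      case None
      then have "st_move d p = (\<lambda>s. (t + s, x))" using Pair by auto
      then show ?thesis using p Pair
        by (auto simp: st_top_def continuous_map_pairwise comp_def intro!: continuous_intros)
    next
      case (Some i)
      then have "st_move d p = (\<lambda>s. (t, sp_move i x s))" using Pair by auto
      then show ?thesis using p Pair d Some sp_move_continuous[of i n x]
        by (auto simp: st_top_def st_dirs_def continuous_map_pairwise comp_def)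
    qed
  qed
qed

lemma sp_smooth_prod:
  assumes "\<And>i. i < n \<Longrightarrow> h i \<in> Cb"
  shows "sp_smooth n (topspace (sp_top n)) (\<lambda>y. \<Prod>i<n. h i (y i))"
  unfolding sp_smooth_def
\<comment> \<open>The product is an integral over a one-point space with density 1 and centre 0,
  hence already a generator of the algebra.\<close>
proof (rule sp.smooth_wrt_local[where N="count_space {()}" and c="\<lambda>_ _. 0"])
  have "(\<lambda>y. LINT q|count_space {()}. 1 * sp.ker n h y (\<lambda>_. 0)) \<in> sp.smooth_alg n (count_space {()}) (\<lambda>_ _. 0)"
    using assms by (intro sp.smooth_alg.base integrable_count_space) auto
  then show "\<exists>V g. openin (sp_top n) V \<and> p \<in> V \<and> g \<in> sp.smooth_alg n (count_space {()}) (\<lambda>_ _. 0) \<and>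
      (\<forall>q\<in>V. (\<Prod>i<n. h i (q i)) = g q)" if "p \<in> topspace (sp_top n)" for p
    using that by (intro exI[of _ "topspace (sp_top n)"] exI)
      (auto simp: sp.ker_def lebesgue_integral_count_space_finite simp del: topspace_sp_top intro: openin_topspace)
qed (simp_all del: topspace_sp_top)

subsection \<open>Borel structure and exhaustions\<close>

lemma (in coordinate_space) ker_measurable_comp:
  assumes "\<And>d. d \<in> D \<Longrightarrow> k d \<in> Cb" "\<And>d. d \<in> D \<Longrightarrow> (\<lambda>q. coord (a q) d) \<in> borel_measurable N"
    "\<And>d. d \<in> D \<Longrightarrow> (\<lambda>q. c q d) \<in> borel_measurable N"
  shows "(\<lambda>q. ker k (a q) (c q)) \<in> borel_measurable N"
  unfolding ker_def
proof (rule borel_measurable_prod)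
  fix d assume d: "d \<in> D"
  have "(\<lambda>q. coord (a q) d - c q d) \<in> borel_measurable N"
    using assms(2,3)[OF d] by (rule borel_measurable_diff)
  then show "(\<lambda>q. k d (coord (a q) d - c q d)) \<in> borel_measurable N"
    using Cb_measurable[OF assms(1)[OF d]] by (rule measurable_compose)
qed

definition st_borel :: "nat \<Rightarrow> (real \<times> point) measure" where
  "st_borel n = lborel \<Otimes>\<^sub>M sp_borel n"

lemma space_sp_borel [simp]: "space (sp_borel n) = (\<Pi>\<^sub>E i\<in>{..<n}. UNIV)"
  by (simp add: sp_borel_def space_PiM)

lemma space_st_borel [simp]: "space (st_borel n) = UNIV \<times> (\<Pi>\<^sub>E i\<in>{..<n}. UNIV)"
  by (simp add: st_borel_def space_pair_measure)

interpretation sp_prod: product_sigma_finite "\<lambda>_::nat. lborel :: real measure"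
  by unfold_locales

interpretation sp_sigma: sigma_finite_measure "sp_borel n"
  unfolding sp_borel_def by (rule sp_prod.sigma_finite) simp

interpretation st_pair: pair_sigma_finite "lborel :: real measure" "sp_borel n"
  by unfold_locales

interpretation st_sigma: sigma_finite_measure "st_borel n"
  unfolding st_borel_def by unfold_locales

lemma sp_coord_measurable [measurable]: "i < n \<Longrightarrow> (\<lambda>x. x i) \<in> borel_measurable (sp_borel n)"
  unfolding sp_borel_def by measurable

lemma st_coord_measurable: "d \<in> st_dirs n \<Longrightarrow> (\<lambda>z. st_coord z d) \<in> borel_measurable (st_borel n)"
proof (cases d)
  case None
  then have "(\<lambda>z. st_coord z d) = fst" by auto
  then show ?thesis by (simp add: st_borel_def)
next
  case (Some i)
  assume "d \<in> st_dirs n"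
  then have "i < n" using Some by (auto simp: st_dirs_def)
  then have "(\<lambda>z. snd z i) \<in> borel_measurable (st_borel n)"
    unfolding st_borel_def by (intro measurable_compose[OF measurable_snd sp_coord_measurable])
  also have "(\<lambda>z. snd z i) = (\<lambda>z. st_coord z d)" using Some by auto
  finally show ?thesis .
qed

text \<open>Moves Borel questions to the type \<open>nat \<Rightarrow> real\<close>, whose Borel
  sets are those of the countable product. Restriction to the first n coordinates is continuous from
  there into \<open>sp_top n\<close>.\<close>

lemma openin_sp_top_restrict:
  assumes "openin (sp_top n) U"
  shows "open {f. restrict f {..<n} \<in> U}"
proof -
  have "continuous_map euclidean (sp_top n) (\<lambda>f::nat \<Rightarrow> real. restrict f {..<n})"
    unfolding sp_top_def continuous_map_componentwise
  proof (intro conjI ballI)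
    fix k assume "k \<in> {..<n}"
    then show "continuous_map euclidean euclideanreal (\<lambda>f::nat \<Rightarrow> real. restrict f {..<n} k)"
      by (simp add: continuous_on_product_coordinates)
  qed auto
  then have "openin euclidean {f \<in> topspace euclidean. (restrict f {..<n} :: nat \<Rightarrow> real) \<in> U}"
    using assms unfolding continuous_map by blast
  then show ?thesis by simp
qed

lemma sp_inclusion_measurable: "(\<lambda>x. x) \<in> measurable (sp_borel n) (borel :: (nat \<Rightarrow> real) measure)"
proof -
  have "(\<lambda>x. x) \<in> measurable (sp_borel n) (\<Pi>\<^sub>M i\<in>UNIV. (borel :: real measure))"
  proof (rule measurable_PiM_single')
    fix i :: nat
    show "(\<lambda>x. x i) \<in> borel_measurable (sp_borel n)"
    proof (cases "i < n")
      \<comment> \<open>Coordinates beyond n are the constant \<open>undefined\<close> on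
        extensional functions.\<close>
      case False
      then have "(\<lambda>x. x i) \<in> borel_measurable (sp_borel n) \<longleftrightarrow> (\<lambda>x. undefined :: real) \<in> borel_measurable (sp_borel n)"
        by (intro measurable_cong) (auto simp: PiE_def extensional_def)
      then show ?thesis by simp
    qed measurable
  qed auto
  then show ?thesis using sets_PiM_equal_borel measurable_cong_sets by blast
qed

lemma openin_sp_top_sets:
  assumes "openin (sp_top n) U" shows "U \<in> sets (sp_borel n)"
proof -
  have "(\<lambda>x. x) -` {f. restrict f {..<n} \<in> U} \<inter> space (sp_borel n) \<in> sets (sp_borel n)"
    using openin_sp_top_restrict[OF assms] by (intro measurable_sets[OF sp_inclusion_measurable]) auto
  also have "(\<lambda>x. x) -` {f. restrict f {..<n} \<in> U} \<inter> space (sp_borel n) = U"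
    using openin_subset[OF assms] by (auto simp: PiE_restrict)
  finally show ?thesis .
qed

lemma openin_st_top_sets:
  assumes "openin (st_top n) U" shows "U \<in> sets (st_borel n)"
proof -
  define r where "r z = (fst z, restrict (snd z) {..<n})" for z :: "real \<times> (nat \<Rightarrow> real)"
  have "open {z. r z \<in> U}"
  proof (subst open_subopen, intro ballI)
    fix z assume z: "z \<in> {z. r z \<in> U}"
    then obtain V W where VW: "openin euclideanreal V" "openin (sp_top n) W" "r z \<in> V \<times> W" "V \<times> W \<subseteq> U"
      using assms unfolding st_top_def openin_prod_topology_alt
      by (metis mem_Collect_eq mem_Sigma_iff prod.collapse)
    have "open (V \<times> {f. restrict f {..<n} \<in> W})"
      using VW openin_sp_top_restrict[OF VW(2)] by (intro open_Times) auto
    moreover have "z \<in> V \<times> {f. restrict f {..<n} \<in> W}"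
      using VW(3) by (cases z) (auto simp: r_def)
    moreover have "V \<times> {f. restrict f {..<n} \<in> W} \<subseteq> {z. r z \<in> U}"
      using VW(4) by (auto simp: r_def)
    ultimately show "\<exists>T. open T \<and> z \<in> T \<and> T \<subseteq> {z. r z \<in> U}" by blast
  qed
  moreover have "(\<lambda>z. (fst z, snd z)) \<in> measurable (st_borel n) (borel \<Otimes>\<^sub>M borel)"
    unfolding st_borel_def
    by (intro measurable_Pair measurable_fst'' measurable_compose[OF measurable_snd sp_inclusion_measurable]) auto
  then have "(\<lambda>z. z) \<in> measurable (st_borel n) borel" by (simp add: borel_prod)
  ultimately have "(\<lambda>z. z) -` {z. r z \<in> U} \<inter> space (st_borel n) \<in> sets (st_borel n)"
    by (intro measurable_sets[of _ _ borel]) auto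
  also have "(\<lambda>z. z) -` {z. r z \<in> U} \<inter> space (st_borel n) = U"
    using openin_subset[OF assms] by (auto simp: r_def PiE_restrict)
  finally show ?thesis .
qed

lemma Hausdorff_sp_top: "Hausdorff_space (sp_top n)"
  unfolding sp_top_def by (simp add: Hausdorff_space_product_topology)

lemma Hausdorff_st_top: "Hausdorff_space (st_top n)"
  unfolding st_top_def by (simp add: Hausdorff_space_prod_topology Hausdorff_sp_top)

lemma compactin_sp_top_sets:
  assumes "compactin (sp_top n) K" shows "K \<in> sets (sp_borel n)"
proof -
  have "closedin (sp_top n) K" using assms Hausdorff_sp_top by (rule compactin_imp_closedin[rotated])
  then have "K = space (sp_borel n) - (topspace (sp_top n) - K)" "openin (sp_top n) (topspace (sp_top n) - K)"
    by (auto simp: closedin_def)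
  then show ?thesis using openin_sp_top_sets sets.compl_sets by metis
qed

lemma compactin_st_top_sets:
  assumes "compactin (st_top n) K" shows "K \<in> sets (st_borel n)"
proof -
  have "closedin (st_top n) K" using assms Hausdorff_st_top by (rule compactin_imp_closedin[rotated])
  then have "K = space (st_borel n) - (topspace (st_top n) - K)" "openin (st_top n) (topspace (st_top n) - K)"
    by (auto simp: closedin_def)
  then show ?thesis using openin_st_top_sets sets.compl_sets by metis
qed

lemma continuous_map_st_measurable:
  assumes U: "openin (st_top n) U" and f: "continuous_map (subtopology (st_top n) U) euclideanreal f"
  shows "(\<lambda>z. indicator U z * f z) \<in> borel_measurable (st_borel n)"
proof -
  have [measurable]: "U \<in> sets (st_borel n)" by (rule openin_st_top_sets[OF U])
  have "f \<in> borel_measurable (restrict_space (st_borel n) U)"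
  proof (rule borel_measurableI)
    fix S :: "real set" assume "open S"
    then have "openin (subtopology (st_top n) U) {x \<in> topspace (subtopology (st_top n) U). f x \<in> S}"
      using f unfolding continuous_map by simp
    moreover have "{x \<in> topspace (subtopology (st_top n) U). f x \<in> S} = f -` S \<inter> space (restrict_space (st_borel n) U)"
      using openin_subset[OF U] by (auto simp: space_restrict_space)
    ultimately have "openin (st_top n) (f -` S \<inter> space (restrict_space (st_borel n) U))"
      using U by (simp add: openin_open_subtopology)
    then show "f -` S \<inter> space (restrict_space (st_borel n) U) \<in> sets (restrict_space (st_borel n) U)"
      using openin_st_top_sets sets.Int[OF \<open>U \<in> sets (st_borel n)\<close> sets.top]
      by (subst sets_restrict_space_iff) (simp_all add: space_restrict_space le_infI2)
  qed
  then show ?thesis using sets.Int[OF \<open>U \<in> sets (st_borel n)\<close> sets.top]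
    by (subst (asm) borel_measurable_restrict_space_iff) (auto simp: mult.commute)
qed

section \<open>Masses of product kernels\<close>

lemma st_ker_split:
  "st.ker n k z c = k None (st_coord z None - c None) * (\<Prod>i<n. k (Some i) (st_coord z (Some i) - c (Some i)))"
proof -
  have "st.ker n k z c = k None (st_coord z None - c None) *
      (\<Prod>d\<in>Some ` {..<n}. k d (st_coord z d - c d))"
    by (subst st.ker_def) (simp add: st_dirs_def image_iff)
  also have "(\<Prod>d\<in>Some ` {..<n}. k d (st_coord z d - c d)) = (\<Prod>i<n. k (Some i) (st_coord z (Some i) - c (Some i)))"
    by (subst prod.reindex) auto
  finally show ?thesis .
qed

lemma st_ker_pair:
  "st.ker n k (t, x) (st_coord (s, y)) = k None (t - s) * sp.ker n (\<lambda>i. k (Some i)) x y"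
  by (simp add: st_ker_split sp.ker_def)

text \<open>Tonelli for products, then invariance of Lebesgue measure under shift and reflection in
  each coordinate. Integration over the second argument gives the mass of the average taken at a
  fixed point, integration over the first controls the L1 norm of the averaging operator.\<close>

lemma nn_integral_sp_ker:
  assumes "\<And>i. i < n \<Longrightarrow> k i \<in> Cb"
  shows "(\<integral>\<^sup>+y. \<bar>sp.ker n k x y\<bar> \<partial>sp_borel n) = (\<Prod>i<n. \<integral>\<^sup>+s. \<bar>k i s\<bar> \<partial>lborel)"
    and "(\<integral>\<^sup>+y. \<bar>sp.ker n k y x\<bar> \<partial>sp_borel n) = (\<Prod>i<n. \<integral>\<^sup>+s. \<bar>k i s\<bar> \<partial>lborel)"
proof -
  have [measurable]: "k i \<in> borel_measurable borel" if "i < n" for i using assms[OF that] by (rule Cb_measurable)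
  have "(\<integral>\<^sup>+y. \<bar>sp.ker n k x y\<bar> \<partial>sp_borel n) = (\<integral>\<^sup>+y. (\<Prod>i<n. ennreal \<bar>k i (x i - y i)\<bar>) \<partial>sp_borel n)"
    by (intro nn_integral_cong) (simp add: sp.ker_def abs_prod prod_ennreal)
  also have "\<dots> = (\<Prod>i<n. \<integral>\<^sup>+s. \<bar>k i (x i - s)\<bar> \<partial>lborel)"
    unfolding sp_borel_def by (intro sp_prod.product_nn_integral_prod[where f="\<lambda>i s. ennreal \<bar>k i (x i - s)\<bar>"]) auto
  also have "\<dots> = (\<Prod>i<n. \<integral>\<^sup>+s. \<bar>k i s\<bar> \<partial>lborel)"
    by (intro prod.cong refl nn_integral_reflect(2)[where f="\<lambda>s. ennreal \<bar>k _ s\<bar>"]) auto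
  finally show "(\<integral>\<^sup>+y. \<bar>sp.ker n k x y\<bar> \<partial>sp_borel n) = (\<Prod>i<n. \<integral>\<^sup>+s. \<bar>k i s\<bar> \<partial>lborel)" .
  have "(\<integral>\<^sup>+y. \<bar>sp.ker n k y x\<bar> \<partial>sp_borel n) = (\<integral>\<^sup>+y. (\<Prod>i<n. ennreal \<bar>k i (y i - x i)\<bar>) \<partial>sp_borel n)"
    by (intro nn_integral_cong) (simp add: sp.ker_def abs_prod prod_ennreal)
  also have "\<dots> = (\<Prod>i<n. \<integral>\<^sup>+s. \<bar>k i (s - x i)\<bar> \<partial>lborel)"
    unfolding sp_borel_def by (intro sp_prod.product_nn_integral_prod[where f="\<lambda>i s. ennreal \<bar>k i (s - x i)\<bar>"]) auto
  also have "\<dots> = (\<Prod>i<n. \<integral>\<^sup>+s. \<bar>k i s\<bar> \<partial>lborel)"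
    by (intro prod.cong refl nn_integral_reflect(1)[where f="\<lambda>s. ennreal \<bar>k _ s\<bar>"]) auto
  finally show "(\<integral>\<^sup>+y. \<bar>sp.ker n k y x\<bar> \<partial>sp_borel n) = (\<Prod>i<n. \<integral>\<^sup>+s. \<bar>k i s\<bar> \<partial>lborel)" .
qed

lemma sp_ker_measurable_pair:
  assumes "\<And>i. i < n \<Longrightarrow> k i \<in> Cb"
  shows "(\<lambda>p. sp.ker n k (fst p) (snd p)) \<in> borel_measurable (sp_borel n \<Otimes>\<^sub>M sp_borel n)"
  by (rule sp.ker_measurable_comp)
    (use assms in \<open>auto intro: measurable_compose[OF measurable_fst sp_coord_measurable]
      measurable_compose[OF measurable_snd sp_coord_measurable]\<close>)

lemma st_ker_measurable_pair:
  assumes "\<And>d. d \<in> st_dirs n \<Longrightarrow> k d \<in> Cb"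
  shows "(\<lambda>p. st.ker n k (fst p) (st_coord (snd p))) \<in> borel_measurable (st_borel n \<Otimes>\<^sub>M st_borel n)"
  by (rule st.ker_measurable_comp)
    (use assms in \<open>auto intro: measurable_compose[OF measurable_fst st_coord_measurable]
      measurable_compose[OF measurable_snd st_coord_measurable]\<close>)

lemma nn_integral_st_ker:
  assumes "\<And>d. d \<in> st_dirs n \<Longrightarrow> k d \<in> Cb"
  shows "(\<integral>\<^sup>+q. \<bar>st.ker n k z (st_coord q)\<bar> \<partial>st_borel n) =
      (\<integral>\<^sup>+s. \<bar>k None s\<bar> \<partial>lborel) * (\<Prod>i<n. \<integral>\<^sup>+s. \<bar>k (Some i) s\<bar> \<partial>lborel)" (is ?A)
    and "(\<integral>\<^sup>+q. \<bar>st.ker n k q (st_coord z)\<bar> \<partial>st_borel n) =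
      (\<integral>\<^sup>+s. \<bar>k None s\<bar> \<partial>lborel) * (\<Prod>i<n. \<integral>\<^sup>+s. \<bar>k (Some i) s\<bar> \<partial>lborel)" (is ?B)
proof -
  have k: "k None \<in> Cb" "\<And>i. i < n \<Longrightarrow> k (Some i) \<in> Cb" using assms by (auto simp: st_dirs_def)
  note [measurable] = Cb_measurable[OF k(1)] Cb_measurable[OF k(2)]
  obtain t x where z: "z = (t, x)" by (cases z)
  have 1: "(\<lambda>q. k None (t - fst q) * sp.ker n (\<lambda>i. k (Some i)) x (snd q)) \<in> borel_measurable (st_borel n)"
    unfolding st_borel_def
    by (intro borel_measurable_times sp.ker_measurable_comp k sp_coord_measurable measurable_compose[OF measurable_snd sp_coord_measurable]) (use k in auto)
  have m1: "(\<lambda>y. sp.ker n (\<lambda>i. k (Some i)) x y) \<in> borel_measurable (sp_borel n)"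
    "(\<lambda>y. sp.ker n (\<lambda>i. k (Some i)) y x) \<in> borel_measurable (sp_borel n)"
    by (rule sp.ker_measurable_comp; use k in auto)+
  have "(\<integral>\<^sup>+q. \<bar>st.ker n k z (st_coord q)\<bar> \<partial>st_borel n) =
      (\<integral>\<^sup>+q. \<bar>k None (t - fst q) * sp.ker n (\<lambda>i. k (Some i)) x (snd q)\<bar> \<partial>st_borel n)"
  proof (rule nn_integral_cong)
    fix q show "ennreal \<bar>st.ker n k z (st_coord q)\<bar> = ennreal \<bar>k None (t - fst q) * sp.ker n (\<lambda>i. k (Some i)) x (snd q)\<bar>"
      by (cases q) (simp add: z st_ker_pair)
  qed
  also have "\<dots> = (\<integral>\<^sup>+s. \<integral>\<^sup>+y. \<bar>k None (t - s) * sp.ker n (\<lambda>i. k (Some i)) x y\<bar> \<partial>sp_borel n \<partial>lborel)"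
    using 1 unfolding st_borel_def by (subst sp_sigma.nn_integral_fst[symmetric]) auto
  also have "\<dots> = (\<integral>\<^sup>+s. ennreal \<bar>k None (t - s)\<bar> * (\<Prod>i<n. \<integral>\<^sup>+s. \<bar>k (Some i) s\<bar> \<partial>lborel) \<partial>lborel)"
    using m1 k by (simp add: abs_mult ennreal_mult nn_integral_cmult nn_integral_sp_ker)
  also have "\<dots> = (\<integral>\<^sup>+s. \<bar>k None s\<bar> \<partial>lborel) * (\<Prod>i<n. \<integral>\<^sup>+s. \<bar>k (Some i) s\<bar> \<partial>lborel)"
    by (subst nn_integral_multc) (auto simp: nn_integral_reflect(2)[where f="\<lambda>s. ennreal \<bar>k None s\<bar>"])
  finally show ?A .
  have 2: "(\<lambda>q. k None (fst q - t) * sp.ker n (\<lambda>i. k (Some i)) (snd q) x) \<in> borel_measurable (st_borel n)"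
    unfolding st_borel_def
    by (intro borel_measurable_times sp.ker_measurable_comp k sp_coord_measurable measurable_compose[OF measurable_snd sp_coord_measurable]) (use k in auto)
  have "(\<integral>\<^sup>+q. \<bar>st.ker n k q (st_coord z)\<bar> \<partial>st_borel n) =
      (\<integral>\<^sup>+q. \<bar>k None (fst q - t) * sp.ker n (\<lambda>i. k (Some i)) (snd q) x\<bar> \<partial>st_borel n)"
  proof (rule nn_integral_cong)
    fix q show "ennreal \<bar>st.ker n k q (st_coord z)\<bar> = ennreal \<bar>k None (fst q - t) * sp.ker n (\<lambda>i. k (Some i)) (snd q) x\<bar>"
      by (cases q) (simp add: z st_ker_pair)
  qed
  also have "\<dots> = (\<integral>\<^sup>+s. \<integral>\<^sup>+y. \<bar>k None (s - t) * sp.ker n (\<lambda>i. k (Some i)) y x\<bar> \<partial>sp_borel n \<partial>lborel)"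
    using 2 unfolding st_borel_def by (subst sp_sigma.nn_integral_fst[symmetric]) auto
  also have "\<dots> = (\<integral>\<^sup>+s. ennreal \<bar>k None (s - t)\<bar> * (\<Prod>i<n. \<integral>\<^sup>+s. \<bar>k (Some i) s\<bar> \<partial>lborel) \<partial>lborel)"
    using m1 k by (simp add: abs_mult ennreal_mult nn_integral_cmult nn_integral_sp_ker)
  also have "\<dots> = (\<integral>\<^sup>+s. \<bar>k None s\<bar> \<partial>lborel) * (\<Prod>i<n. \<integral>\<^sup>+s. \<bar>k (Some i) s\<bar> \<partial>lborel)"
    by (subst nn_integral_multc) (auto simp: nn_integral_reflect(1)[where f="\<lambda>s. ennreal \<bar>k None s\<bar>"])
  finally show ?B .
qed

section \<open>Boxes and exhaustion by compact sets\<close>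

lemma openin_sp_box: "openin (sp_top n) {y \<in> topspace (sp_top n). \<forall>i<n. \<bar>y i - x i\<bar> < r}"
proof -
  have "openin (sp_top n) (\<Pi>\<^sub>E i\<in>{..<n}. ball (x i) r)"
    unfolding sp_top_def by (subst openin_PiE) auto
  also have "(\<Pi>\<^sub>E i\<in>{..<n}. ball (x i) r) = {y \<in> topspace (sp_top n). \<forall>i<n. \<bar>y i - x i\<bar> < r}"
  proof (rule set_eqI)
    fix y show "y \<in> (\<Pi>\<^sub>E i\<in>{..<n}. ball (x i) r) \<longleftrightarrow> y \<in> {y \<in> topspace (sp_top n). \<forall>i<n. \<bar>y i - x i\<bar> < r}"
      by (simp add: PiE_iff dist_real_def abs_minus_commute conj_commute Ball_def)
  qed
  finally show ?thesis .
qed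

lemma openin_sp_top_box:
  assumes "openin (sp_top n) U" "x \<in> U"
  obtains r where "0 < r" "\<And>y. y \<in> topspace (sp_top n) \<Longrightarrow> \<forall>i<n. \<bar>y i - x i\<bar> < r \<Longrightarrow> y \<in> U"
proof -
  obtain V where V: "\<forall>i\<in>{..<n}. openin euclideanreal (V i)" "x \<in> Pi\<^sub>E {..<n} V" "Pi\<^sub>E {..<n} V \<subseteq> U"
    using assms unfolding sp_top_def openin_product_topology_alt by metis
  have "\<forall>i\<in>{..<n}. \<exists>r>0. ball (x i) r \<subseteq> V i"
  proof
    fix i assume "i \<in> {..<n}"
    then have "open (V i)" "x i \<in> V i" using V by (auto simp: PiE_iff)
    then show "\<exists>r>0. ball (x i) r \<subseteq> V i" by (rule openE) blast
  qed
  then obtain r where "\<forall>i\<in>{..<n}. 0 < r i \<and> ball (x i) (r i) \<subseteq> V i"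
    using bchoice[of "{..<n}" "\<lambda>i r. 0 < r \<and> ball (x i) r \<subseteq> V i"] by blast
  then have r: "\<And>i. i < n \<Longrightarrow> 0 < r i \<and> ball (x i) (r i) \<subseteq> V i" by simp
  define R where "R = Min (insert 1 (r ` {..<n}))"
  have "0 < R" unfolding R_def using r by (subst Min_gr_iff) auto
  moreover have "R \<le> r i" if "i < n" for i unfolding R_def using that by (intro Min_le) auto
  ultimately show thesis
  proof (intro that[of R])
    fix y assume y: "y \<in> topspace (sp_top n)" "\<forall>i<n. \<bar>y i - x i\<bar> < R"
    then have "y i \<in> V i" if "i < n" for i
      using r[OF that] that \<open>\<And>i. i < n \<Longrightarrow> R \<le> r i\<close>[OF that]
      by (auto simp: subset_iff dist_real_def abs_minus_commute intro: less_le_trans)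
    then have "y \<in> Pi\<^sub>E {..<n} V" using y by (auto simp: PiE_iff)
    then show "y \<in> U" using V(3) by blast
  qed auto
qed

text \<open>The number s k is a margin, in the maximum distance, by which K k sits inside the next
  set; it limits the mollification widths that may be used there. Boxes are the right neighbourhoods
  because product kernels have box-shaped supports.\<close>

definition sp_exhaustion :: "nat \<Rightarrow> point set \<Rightarrow> (nat \<Rightarrow> point set) \<Rightarrow> (nat \<Rightarrow> real) \<Rightarrow> bool" where
  "sp_exhaustion n \<Omega> K s \<longleftrightarrow>
     (\<forall>k. compactin (sp_top n) (K k) \<and> K k \<subseteq> \<Omega> \<and> 0 < s k \<and> s (Suc k) \<le> s k \<and>
       (\<forall>x\<in>K k. \<forall>y\<in>topspace (sp_top n). (\<forall>i<n. \<bar>y i - x i\<bar> \<le> s k) \<longrightarrow> y \<in> K (Suc k))) \<and>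
     (\<forall>C. compactin (sp_top n) C \<and> C \<subseteq> \<Omega> \<longrightarrow> (\<exists>N. C \<subseteq> K N))"

lemma sp_exhaustion_exists:
  assumes \<Omega>: "openin (sp_top n) \<Omega>"
  shows "\<exists>K s. sp_exhaustion n \<Omega> K s"
proof -
  let ?T = "topspace (sp_top n)"
  define B where "B x r = {y \<in> ?T. \<forall>i<n. \<bar>y i - x i\<bar> < r}" for x :: point and r :: real
  \<comment> \<open>Bounded points whose open box of radius 2^(-k) lies in \<Omega>. The margin
    \<open>s k\<close> is half of that radius, so a point within the margin of K k keeps an open box
    of radius 2^(-k-1) inside \<Omega>.\<close>
  define K where "K k = {x \<in> ?T. (\<forall>i<n. \<bar>x i\<bar> \<le> real k) \<and> B x ((1/2) ^ k) \<subseteq> \<Omega>}" for k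
  define s where "s k = (1/2 :: real) ^ Suc k" for k
  have sub: "K k \<subseteq> \<Omega>" for k
    unfolding K_def B_def by auto
  have cmp: "compactin (sp_top n) (K k)" for k
  proof (rule closed_compactin)
    have "compactin (sp_top n) (\<Pi>\<^sub>E i\<in>{..<n}. {- real k..real k})"
      unfolding sp_top_def by (subst compactin_PiE) auto
    then show "compactin (sp_top n) (\<Pi>\<^sub>E i\<in>{..<n}. {- real k..real k})" .
    show "K k \<subseteq> (\<Pi>\<^sub>E i\<in>{..<n}. {- real k..real k})"
      unfolding K_def by (auto simp: PiE_iff abs_le_iff minus_le_iff) (meson extensional_arb lessThan_iff)
    \<comment> \<open>Closedness of K k: removing from the closed cube the open boxes around all
      points outside \<Omega> leaves exactly K k.\<close>
    have "openin (sp_top n) (\<Union>y\<in>?T - \<Omega>. {x \<in> ?T. \<forall>i<n. \<bar>x i - y i\<bar> < (1/2) ^ k})"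
    proof -
      have "openin (sp_top n) {x \<in> ?T. \<forall>i<n. \<bar>x i - y i\<bar> < (1/2) ^ k}" for y :: point by (rule openin_sp_box)
      then show ?thesis by (intro openin_Union) auto
    qed
    moreover have "closedin (sp_top n) (\<Pi>\<^sub>E i\<in>{..<n}. {- real k..real k})"
      unfolding sp_top_def by (subst closedin_product_topology) auto
    ultimately have "closedin (sp_top n) ((\<Pi>\<^sub>E i\<in>{..<n}. {- real k..real k}) -
        (\<Union>y\<in>?T - \<Omega>. {x \<in> ?T. \<forall>i<n. \<bar>x i - y i\<bar> < (1/2) ^ k}))"
      by (rule closedin_diff[rotated])
    also have "(\<Pi>\<^sub>E i\<in>{..<n}. {- real k..real k}) -
        (\<Union>y\<in>?T - \<Omega>. {x \<in> ?T. \<forall>i<n. \<bar>x i - y i\<bar> < (1/2) ^ k}) = K k"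
    proof (rule set_eqI)
      fix x
      have "x \<in> (\<Pi>\<^sub>E i\<in>{..<n}. {- real k..real k}) \<longleftrightarrow> x \<in> ?T \<and> (\<forall>i<n. \<bar>x i\<bar> \<le> real k)"
        by (simp add: PiE_iff abs_le_iff minus_le_iff Ball_def conj_commute)
      moreover have "(\<exists>y\<in>?T - \<Omega>. \<forall>i<n. \<bar>x i - y i\<bar> < (1/2) ^ k) \<longleftrightarrow> \<not> B x ((1/2) ^ k) \<subseteq> \<Omega>"
        unfolding B_def by (subst abs_minus_commute) blast
      ultimately show "x \<in> (\<Pi>\<^sub>E i\<in>{..<n}. {- real k..real k}) -
        (\<Union>y\<in>?T - \<Omega>. {x \<in> ?T. \<forall>i<n. \<bar>x i - y i\<bar> < (1/2) ^ k}) \<longleftrightarrow> x \<in> K k"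
        unfolding K_def by blast
    qed
    finally show "closedin (sp_top n) (K k)" .
  qed
  have step: "y \<in> K (Suc k)" if x: "x \<in> K k" and y: "y \<in> ?T" "\<forall>i<n. \<bar>y i - x i\<bar> \<le> s k" for x y k
  proof -
    have "s k \<le> 1" unfolding s_def by (intro power_le_one) auto
    have "\<bar>y i\<bar> \<le> real (Suc k)" if "i < n" for i
      using x y that \<open>s k \<le> 1\<close> unfolding K_def by force
    moreover have "z \<in> \<Omega>" if z: "z \<in> B y ((1/2) ^ Suc k)" for z
    proof -
      have "\<bar>z i - x i\<bar> < (1/2) ^ k" if "i < n" for i
      proof -
        have "\<bar>z i - y i\<bar> < s k" "\<bar>y i - x i\<bar> \<le> s k" using z y that by (auto simp: B_def s_def)
        moreover have "(1/2 :: real) ^ k = s k + s k" by (simp add: s_def)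
        ultimately show ?thesis by linarith
      qed
      then have "z \<in> B x ((1/2) ^ k)" using z by (auto simp: B_def)
      then show ?thesis using x by (auto simp: K_def)
    qed
    ultimately show ?thesis using y unfolding K_def by auto
  qed
  have s: "0 < s k" "s (Suc k) \<le> s k" for k by (auto simp: s_def)
  have mono: "K k \<subseteq> K l" if "k \<le> l" for k l
  proof (rule lift_Suc_mono_le[OF _ that])
    show "K k \<subseteq> K (Suc k)" for k
    proof
      fix x assume x: "x \<in> K k"
      then show "x \<in> K (Suc k)" by (rule step) (use x s(1)[of k] in \<open>auto simp: K_def\<close>)
    qed
  qed
  have ex: "\<exists>k. x \<in> K k" if x: "x \<in> \<Omega>" for x
  proof -
    obtain r where r: "0 < r" "\<And>y. y \<in> ?T \<Longrightarrow> \<forall>i<n. \<bar>y i - x i\<bar> < r \<Longrightarrow> y \<in> \<Omega>"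
      using openin_sp_top_box[OF \<Omega> x] by blast
    obtain a where a: "(1/2 :: real) ^ a < r" using real_arch_pow_inv[OF r(1), of "1/2"] by auto
    obtain b where b: "(\<Sum>i<n. \<bar>x i\<bar>) \<le> real b" using real_arch_simple by blast
    have "\<bar>x i\<bar> \<le> real (max a b)" if "i < n" for i
      using member_le_sum[of i "{..<n}" "\<lambda>i. \<bar>x i\<bar>"] that b by auto
    moreover have "(1/2 :: real) ^ max a b \<le> (1/2) ^ a" by (intro power_decreasing) auto
    then have ab: "(1/2 :: real) ^ max a b < r" using a by linarith
    have "B x ((1/2) ^ max a b) \<subseteq> \<Omega>"
    proof
      fix y assume y: "y \<in> B x ((1/2) ^ max a b)"
      then have "\<bar>y i - x i\<bar> < r" if "i < n" for i
        using that ab unfolding B_def by (auto intro: less_trans)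
      then show "y \<in> \<Omega>" using y by (intro r(2)) (auto simp: B_def)
    qed
    ultimately show ?thesis using x openin_subset[OF \<Omega>] unfolding K_def by blast
  qed
  have "\<exists>N. C \<subseteq> K N" if C: "compactin (sp_top n) C" "C \<subseteq> \<Omega>" for C
  proof -
    \<comment> \<open>Open neighbourhoods of the sets K k, each contained in the next set. Since the
      K k increase, a finite subcover of C lies in a single one of them.\<close>
    define O' where "O' k = (\<Union>x\<in>K k. {y \<in> ?T. \<forall>i<n. \<bar>y i - x i\<bar> < s k})" for k
    have "openin (sp_top n) (O' k)" for k
    proof -
      have "openin (sp_top n) {y \<in> ?T. \<forall>i<n. \<bar>y i - x i\<bar> < s k}" for x :: point by (rule openin_sp_box)
      then show ?thesis unfolding O'_def by (intro openin_Union) auto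
    qed
    moreover have "C \<subseteq> (\<Union>k. O' k)"
    proof
      fix x assume "x \<in> C"
      then obtain k where "x \<in> K k" using ex C by blast
      then have "x \<in> O' k" using s(1)[of k] by (auto simp: O'_def K_def)
      then show "x \<in> (\<Union>k. O' k)" by blast
    qed
    ultimately obtain F where F: "finite F" "F \<subseteq> range O'" "C \<subseteq> \<Union>F"
      using conjunct2[OF C(1)[unfolded compactin_def], rule_format, of "range O'"] by blast
    then obtain I where I: "finite I" "F = O' ` I" using finite_subset_image[OF F(1,2)] by blast
    have "O' k \<subseteq> K (Suc (Max (insert 0 I)))" if "k \<in> I" for k
    proof -
      have "O' k \<subseteq> K (Suc k)"
      proof
        fix y assume "y \<in> O' k"
        then obtain x where "x \<in> K k" "y \<in> ?T" "\<forall>i<n. \<bar>y i - x i\<bar> \<le> s k"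
          unfolding O'_def by (auto simp: less_imp_le simp del: topspace_sp_top)
        then show "y \<in> K (Suc k)" by (rule step)
      qed
      also have "\<dots> \<subseteq> K (Suc (Max (insert 0 I)))" using I that by (intro mono) auto
      finally show ?thesis .
    qed
    then have "C \<subseteq> K (Suc (Max (insert 0 I)))" using F(3) unfolding I(2) by (meson UN_least order_trans)
    then show ?thesis ..
  qed
  then have "sp_exhaustion n \<Omega> K s"
    unfolding sp_exhaustion_def using cmp sub s step by (simp del: topspace_sp_top)
  then show ?thesis by (intro exI)
qed

subsection \<open>Approximate identities\<close>

text \<open>The L1 distance between f and its average under K. With values in \<open>ennreal\<close>
  it can be estimated before the average is known to be integrable.\<close>

definition L1_defect :: "'a measure \<Rightarrow> ('a \<Rightarrow> 'a \<Rightarrow> real) \<Rightarrow> ('a \<Rightarrow> real) \<Rightarrow> ennreal" where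
  "L1_defect M K f = (\<integral>\<^sup>+x. ennreal \<bar>(LINT y|M. K x y * f y) - f x\<bar> \<partial>M)"

text \<open>The mass bound concerns the first argument, the one that makes averaging a contraction
  of L1. Boundedness of K makes the average of an integrable function well defined at every
  point.\<close>

locale markov_kernel = sigma_finite_measure M for M :: "'a measure" +
  fixes K :: "'a \<Rightarrow> 'a \<Rightarrow> real"
  assumes measurable_K: "(\<lambda>p. K (fst p) (snd p)) \<in> borel_measurable (M \<Otimes>\<^sub>M M)"
    and K_nonneg: "\<And>x y. 0 \<le> K x y" and K_bounded: "\<exists>C. \<forall>x y. K x y \<le> C"
    and K_mass: "\<And>y. y \<in> space M \<Longrightarrow> (\<integral>\<^sup>+x. K x y \<partial>M) \<le> 1"
begin

lemma measurable_K_snd: "x \<in> space M \<Longrightarrow> (\<lambda>y. K x y) \<in> borel_measurable M"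
  using measurable_compose[OF measurable_Pair1' measurable_K] by simp

lemma measurable_K_fst: "y \<in> space M \<Longrightarrow> (\<lambda>x. K x y) \<in> borel_measurable M"
  using measurable_compose[OF measurable_Pair2' measurable_K] by simp

lemma integrable_K:
  assumes "integrable M f" "x \<in> space M"
  shows "integrable M (\<lambda>y. K x y * f y)"
proof -
  obtain C where C: "\<And>x y. K x y \<le> C" using K_bounded by blast
  show ?thesis
  proof (rule Bochner_Integration.integrable_bound[where f="\<lambda>y. C * f y"])
    show "(\<lambda>y. K x y * f y) \<in> borel_measurable M"
      using assms(1) by (intro borel_measurable_times measurable_K_snd assms(2)) auto
    have "K x y * \<bar>f y\<bar> \<le> C * \<bar>f y\<bar>" for y by (intro mult_right_mono C) simp
    moreover have "C \<ge> 0" using K_nonneg[of x x] C[of x x] by linarith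
    ultimately show "AE y in M. norm (K x y * f y) \<le> norm (C * f y)"
      using K_nonneg by (simp add: abs_mult)
  qed (use assms in simp)
qed

lemma measurable_convolution [measurable]:
  assumes "f \<in> borel_measurable M"
  shows "(\<lambda>x. LINT y|M. K x y * f y) \<in> borel_measurable M"
proof (rule borel_measurable_lebesgue_integral)
  have "(\<lambda>p. K (fst p) (snd p) * f (snd p)) \<in> borel_measurable (M \<Otimes>\<^sub>M M)"
    using assms by (intro borel_measurable_times measurable_K measurable_compose[OF measurable_snd])
  then show "case_prod (\<lambda>x y. K x y * f y) \<in> borel_measurable (M \<Otimes>\<^sub>M M)"
    by (simp add: case_prod_unfold)
qed

text \<open>Tonelli: integrating over x first leaves the mass of the kernel in x, which is at most
  1.\<close>

lemma convolution_contraction: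
  assumes f: "integrable M f"
  shows "(\<integral>\<^sup>+x. ennreal \<bar>LINT y|M. K x y * f y\<bar> \<partial>M) \<le> (\<integral>\<^sup>+x. ennreal \<bar>f x\<bar> \<partial>M)"
proof -
  interpret P: pair_sigma_finite M M by unfold_locales
  have fm: "f \<in> borel_measurable M" using f by auto
  have m: "(\<lambda>p. ennreal (K (fst p) (snd p)) * ennreal \<bar>f (snd p)\<bar>) \<in> borel_measurable (M \<Otimes>\<^sub>M M)"
    using measurable_K measurable_compose[OF measurable_snd fm, of M] by auto
  have "(\<integral>\<^sup>+x. ennreal \<bar>LINT y|M. K x y * f y\<bar> \<partial>M) \<le> (\<integral>\<^sup>+x. \<integral>\<^sup>+y. ennreal (K x y) * ennreal \<bar>f y\<bar> \<partial>M \<partial>M)"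
  proof (rule nn_integral_mono)
    fix x assume "x \<in> space M"
    from integral_norm_bound_ennreal[OF integrable_K[OF f this]]
    show "ennreal \<bar>LINT y|M. K x y * f y\<bar> \<le> (\<integral>\<^sup>+y. ennreal (K x y) * ennreal \<bar>f y\<bar> \<partial>M)"
      by (simp add: abs_mult K_nonneg ennreal_mult)
  qed
  also have "\<dots> = (\<integral>\<^sup>+y. \<integral>\<^sup>+x. ennreal (K x y) * ennreal \<bar>f y\<bar> \<partial>M \<partial>M)"
    using P.Fubini[OF m] by simp
  also have "\<dots> \<le> (\<integral>\<^sup>+y. 1 * ennreal \<bar>f y\<bar> \<partial>M)"
  proof (rule nn_integral_mono)
    fix y assume y: "y \<in> space M"
    have "(\<integral>\<^sup>+x. ennreal (K x y) * ennreal \<bar>f y\<bar> \<partial>M) = (\<integral>\<^sup>+x. ennreal (K x y) \<partial>M) * ennreal \<bar>f y\<bar>"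
      using measurable_K_fst[OF y] by (intro nn_integral_multc) auto
    also have "\<dots> \<le> 1 * ennreal \<bar>f y\<bar>" by (intro mult_right_mono K_mass y) auto
    finally show "(\<integral>\<^sup>+x. ennreal (K x y) * ennreal \<bar>f y\<bar> \<partial>M) \<le> 1 * ennreal \<bar>f y\<bar>" .
  qed
  finally show ?thesis by simp
qed

lemma L1_defect_add:
  assumes f: "integrable M f" and g: "integrable M g"
  shows "L1_defect M K (\<lambda>x. f x + g x) \<le> L1_defect M K f + L1_defect M K g"
proof -
  have [measurable]: "f \<in> borel_measurable M" "g \<in> borel_measurable M" using f g by auto
  have "L1_defect M K (\<lambda>x. f x + g x) \<le> (\<integral>\<^sup>+x. ennreal \<bar>(LINT y|M. K x y * f y) - f x\<bar> + ennreal \<bar>(LINT y|M. K x y * g y) - g x\<bar> \<partial>M)"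
    unfolding L1_defect_def
  proof (rule nn_integral_mono)
    fix x assume x: "x \<in> space M"
    have "(LINT y|M. K x y * (f y + g y)) = (LINT y|M. K x y * f y) + (LINT y|M. K x y * g y)"
      using integrable_K[OF f x] integrable_K[OF g x] by (simp add: distrib_left)
    then show "ennreal \<bar>(LINT y|M. K x y * (f y + g y)) - (f x + g x)\<bar> \<le> ennreal \<bar>(LINT y|M. K x y * f y) - f x\<bar> + ennreal \<bar>(LINT y|M. K x y * g y) - g x\<bar>"
      by (simp del: ennreal_plus add: ennreal_plus[symmetric])
  qed
  also have "\<dots> = L1_defect M K f + L1_defect M K g"
    unfolding L1_defect_def by (rule nn_integral_add) measurable
  finally show ?thesis .
qed

lemma L1_defect_le:
  assumes f: "integrable M f"
  shows "L1_defect M K f \<le> 2 * (\<integral>\<^sup>+x. ennreal \<bar>f x\<bar> \<partial>M)"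
proof -
  have [measurable]: "f \<in> borel_measurable M" using f by auto
  have "L1_defect M K f \<le> (\<integral>\<^sup>+x. ennreal \<bar>LINT y|M. K x y * f y\<bar> + ennreal \<bar>f x\<bar> \<partial>M)"
    unfolding L1_defect_def by (intro nn_integral_mono) (simp del: ennreal_plus add: ennreal_plus[symmetric] ennreal_leI)
  also have "\<dots> = (\<integral>\<^sup>+x. ennreal \<bar>LINT y|M. K x y * f y\<bar> \<partial>M) + (\<integral>\<^sup>+x. ennreal \<bar>f x\<bar> \<partial>M)"
    by (rule nn_integral_add) measurable
  also have "\<dots> \<le> (\<integral>\<^sup>+x. ennreal \<bar>f x\<bar> \<partial>M) + (\<integral>\<^sup>+x. ennreal \<bar>f x\<bar> \<partial>M)"
    by (intro add_mono convolution_contraction f) auto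
  finally show ?thesis by (simp add: mult_2)
qed

lemma L1_defect_scale:
  assumes f: "integrable M f"
  shows "L1_defect M K (\<lambda>x. c * f x) = ennreal \<bar>c\<bar> * L1_defect M K f"
proof -
  have [measurable]: "f \<in> borel_measurable M" using f by auto
  have "(LINT y|M. K x y * (c * f y)) - c * f x = c * ((LINT y|M. K x y * f y) - f x)" for x
  proof -
    have "(LINT y|M. K x y * (c * f y)) = (LINT y|M. c * (K x y * f y))" by (simp add: mult_ac)
    then show ?thesis by (simp add: right_diff_distrib)
  qed
  then show ?thesis unfolding L1_defect_def
    by (simp add: abs_mult ennreal_mult nn_integral_cmult)
qed

lemma L1_defect_perturb:
  assumes f: "integrable M f" and g: "integrable M g"
  shows "L1_defect M K f \<le> L1_defect M K g + 2 * (\<integral>\<^sup>+x. ennreal \<bar>f x - g x\<bar> \<partial>M)"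
proof -
  have d: "integrable M (\<lambda>x. f x - g x)" using f g by auto
  have "L1_defect M K (\<lambda>x. g x + (f x - g x)) \<le> L1_defect M K g + L1_defect M K (\<lambda>x. f x - g x)"
    by (rule L1_defect_add[OF g d])
  also have "\<dots> \<le> L1_defect M K g + 2 * (\<integral>\<^sup>+x. ennreal \<bar>f x - g x\<bar> \<partial>M)"
    by (intro add_mono L1_defect_le d) auto
  finally show ?thesis by simp
qed

end

lemma tendsto_0_ennreal_squeeze:
  fixes f g :: "nat \<Rightarrow> ennreal"
  assumes "\<And>n. f n \<le> g n" "g \<longlonglongrightarrow> 0"
  shows "f \<longlonglongrightarrow> 0"
  by (rule tendsto_sandwich[OF _ _ tendsto_const assms(2)]) (use assms(1) in auto)

text \<open>By \<open>L1_defect_perturb\<close> a change of the function alters the defect by at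
  most twice the L1 distance, whatever the kernel. Hence the functions whose defect tends to 0 form
  a closed set in L1.\<close>

lemma L1_defect_closed:
  assumes K: "\<And>N. markov_kernel M (K N)" and f: "integrable M f"
    and s: "\<And>i. integrable M (s i)" "\<And>i. (\<lambda>N. L1_defect M (K N) (s i)) \<longlonglongrightarrow> 0"
    and lim: "(\<lambda>i. \<integral>\<^sup>+x. ennreal \<bar>f x - s i x\<bar> \<partial>M) \<longlonglongrightarrow> 0"
  shows "(\<lambda>N. L1_defect M (K N) f) \<longlonglongrightarrow> 0"
proof (rule order_tendstoI)
  fix e :: ennreal assume e: "0 < e"
  obtain r :: real where r: "0 < r" "ennreal r < e"
  proof (cases e)
    case (real a)
    then show thesis using e by (intro that[of "a / 2"]) (auto simp: ennreal_less_iff)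
  next
    case top
    then show thesis by (intro that[of 1]) auto
  qed
  have "ennreal (r / 4) > 0" using r by simp
  then obtain i where i: "(\<integral>\<^sup>+x. ennreal \<bar>f x - s i x\<bar> \<partial>M) < ennreal (r / 4)"
    using order_tendstoD(2)[OF lim, of "ennreal (r / 4)"] eventually_sequentially by auto
  have "ennreal (r / 2) > 0" using r by simp
  from order_tendstoD(2)[OF s(2)[of i] this]
  show "\<forall>\<^sub>F N in sequentially. L1_defect M (K N) f < e"
  proof eventually_elim
    fix N assume N: "L1_defect M (K N) (s i) < ennreal (r / 2)"
    interpret markov_kernel M "K N" by (rule K)
    have "L1_defect M (K N) f \<le> L1_defect M (K N) (s i) + 2 * (\<integral>\<^sup>+x. ennreal \<bar>f x - s i x\<bar> \<partial>M)"
      by (rule L1_defect_perturb[OF f s(1)])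
    also have "\<dots> \<le> ennreal (r / 2) + 2 * ennreal (r / 4)"
      using N i by (intro add_mono mult_left_mono) auto
    also have "\<dots> = ennreal r" using r
      by (simp add: ennreal_mult'[symmetric] ennreal_plus[symmetric] ennreal_numeral[symmetric] del: ennreal_plus ennreal_numeral)
    also have "\<dots> < e" by (rule r)
    finally show "L1_defect M (K N) f < e" .
  qed
qed (auto simp: not_less_zero)

text \<open>Density argument from a generating \<pi>-system. Dynkin's theorem carries the
  convergence from G to the measurable subsets of a fixed E m; letting m grow reaches all sets of
  finite measure, and linear combinations and L1 limits reach every integrable function. Mollifiers
  therefore need to be tested on boxes only.\<close>

lemma L1_defect_tendsto_0:
  assumes K: "\<And>N. markov_kernel M (K N)"
    and G: "Int_stable G" "G \<subseteq> Pow (space M)" "sets M = sigma_sets (space M) G"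
    and E: "\<And>m. E m \<in> G" "incseq E" "(\<Union>m. E m) = space M" "\<And>m. emeasure M (E m) < \<infinity>"
    and conv: "\<And>A m. A \<in> G \<Longrightarrow> A \<subseteq> E m \<Longrightarrow> (\<lambda>N. L1_defect M (K N) (indicator A)) \<longlonglongrightarrow> 0"
    and f: "integrable M f"
  shows "(\<lambda>N. L1_defect M (K N) f) \<longlonglongrightarrow> 0"
proof -
  let ?P = "\<lambda>f. (\<lambda>N. L1_defect M (K N) f) \<longlonglongrightarrow> 0"
  have Es [measurable]: "E m \<in> sets M" for m using E(1) G(3) by auto
  have ii: "integrable M (indicator (A \<inter> E m) :: 'a \<Rightarrow> real)" if "A \<in> sets M" for A m
    using that emeasure_mono[of "A \<inter> E m" "E m" M] E(4)[of m]
    by (intro integrable_real_indicator) (auto intro: le_less_trans)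
  have indlim: "(\<lambda>k. \<integral>\<^sup>+x. ennreal \<bar>indicator A x - indicator (B k) x\<bar> \<partial>M) \<longlonglongrightarrow> 0"
    if A: "A \<in> sets M" "emeasure M A < \<infinity>" and B: "\<And>k. B k \<in> sets M" "\<And>k. B k \<subseteq> A"
      and ev: "\<And>x. x \<in> A \<Longrightarrow> \<forall>\<^sub>F k in sequentially. x \<in> B k" for A :: "'a set" and B :: "nat \<Rightarrow> 'a set"
  proof -
    have "(\<lambda>k. \<integral>\<^sup>+x. ennreal (norm (indicator A x - indicator (B k) x :: real)) \<partial>M) \<longlonglongrightarrow> 0"
    proof (rule nn_integral_dominated_convergence_norm[where w="indicator A"])
      show "AE x in M. (\<lambda>k. indicator (B k) x :: real) \<longlonglongrightarrow> indicator A x"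
      proof (rule AE_I2)
        fix x
        have "\<forall>\<^sub>F k in sequentially. indicator (B k) x = (indicator A x :: real)"
        proof (cases "x \<in> A")
          case True
          from ev[OF True] show ?thesis by eventually_elim (simp add: True)
        next
          case False
          then show ?thesis using B(2) by (intro always_eventually) (auto simp: indicator_def)
        qed
        then show "(\<lambda>k. indicator (B k) x :: real) \<longlonglongrightarrow> indicator A x" by (rule tendsto_eventually)
      qed
      show "AE x in M. norm (indicator (B k) x :: real) \<le> indicator A x" for k
        using B(2) by (auto simp: indicator_def)
      show "(\<integral>\<^sup>+x. ennreal (indicator A x) \<partial>M) < \<infinity>"
        using A by (simp add: ennreal_indicator)
    qed (use A B in simp_all)
    then show ?thesis by simp
  qed
  have addP: "?P (\<lambda>x. f x + g x)" if "integrable M f" "integrable M g" "?P f" "?P g" for f g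
  proof (rule tendsto_0_ennreal_squeeze)
    show "L1_defect M (K N) (\<lambda>x. f x + g x) \<le> L1_defect M (K N) f + L1_defect M (K N) g" for N
      by (rule markov_kernel.L1_defect_add[OF K that(1,2)])
    show "(\<lambda>N. L1_defect M (K N) f + L1_defect M (K N) g) \<longlonglongrightarrow> 0"
      using tendsto_add[OF that(3,4)] by simp
  qed
  have scaleP: "?P (\<lambda>x. c * f x)" if "integrable M f" "?P f" for f c
  proof -
    have "(\<lambda>N. ennreal \<bar>c\<bar> * L1_defect M (K N) f) \<longlonglongrightarrow> ennreal \<bar>c\<bar> * 0"
      by (intro ennreal_tendsto_cmult that) auto
    moreover have "L1_defect M (K N) (\<lambda>x. c * f x) = ennreal \<bar>c\<bar> * L1_defect M (K N) f" for N
      by (rule markov_kernel.L1_defect_scale[OF K that(1)])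
    ultimately show ?thesis by simp
  qed
  \<comment> \<open>Intersecting with E m keeps all sets of finite measure; otherwise the complement
    step would leave L1.\<close>
  have boxP: "?P (indicator (A \<inter> E m))" if "A \<in> sets M" for A m
  proof -
    have "A \<in> sigma_sets (space M) G" using that G(3) by simp
    with G(1,2) show ?thesis
    proof (induction rule: sigma_sets_induct_disjoint)
      case (basic A)
      then have "A \<inter> E m \<in> G" using E(1)[of m] G(1) by (auto simp: Int_stable_def)
      then show ?case by (rule conv[of _ m]) auto
    next
      case empty
      have "L1_defect M (K N) (indicator ({} \<inter> E m)) = 0" for N by (simp add: L1_defect_def)
      then show ?case by (simp only: tendsto_const)
    next
      case (compl A)
      have A: "A \<in> sets M" using compl(1) unfolding G(3) .
      have "E m \<subseteq> space M" using Es[of m] sets.sets_into_space by blast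
      then have "indicator ((space M - A) \<inter> E m) = (\<lambda>x. indicator (space M \<inter> E m) x + -1 * indicator (A \<inter> E m) x :: real)"
        by (auto simp: indicator_def fun_eq_iff)
      moreover have "?P (indicator (space M \<inter> E m))"
        using conv[OF E(1), of m m] \<open>E m \<subseteq> space M\<close> by (simp add: Int_absorb1)
      moreover have "integrable M (\<lambda>x. -1 * indicator (A \<inter> E m) x :: real)"
        by (intro integrable_mult_right ii[OF A])
      moreover have "?P (\<lambda>x. -1 * indicator (A \<inter> E m) x)"
        by (rule scaleP[OF ii[OF A] compl.IH])
      ultimately show ?case
        using addP[OF ii[OF sets.top]] by (simp only:)
    next
      case (union A)
      have A: "A i \<in> sets M" for i using union(2) unfolding G(3) image_subset_iff by blast
      define B where "B k = (\<Union>i<k. A i)" for k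
      have B: "B k \<in> sets M" for k using A by (auto simp: B_def)
      have U: "(\<Union>i. A i) \<in> sets M" using A by auto
      have "?P (indicator (B k \<inter> E m))" for k
      proof (induction k)
        case 0
        have "L1_defect M (K N) (indicator (B 0 \<inter> E m)) = 0" for N by (simp add: L1_defect_def B_def)
        then show ?case by (simp only: tendsto_const)
      next
        case (Suc k)
        have "A i \<inter> A k = {}" if "i < k" for i
          using that by (intro disjoint_family_onD[OF union(1)]) auto
        then have "B k \<inter> A k = {}" unfolding B_def by blast
        then have "indicator (B (Suc k) \<inter> E m) = (\<lambda>x. indicator (B k \<inter> E m) x + indicator (A k \<inter> E m) x :: real)"
          by (auto simp: B_def lessThan_Suc indicator_def fun_eq_iff)
        then show ?case using addP[OF ii[OF B] ii[OF A] Suc union.IH] by (simp only:)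
      qed
      moreover have "(\<lambda>k. \<integral>\<^sup>+x. ennreal \<bar>indicator ((\<Union>i. A i) \<inter> E m) x - indicator (B k \<inter> E m) x\<bar> \<partial>M) \<longlonglongrightarrow> 0"
      proof (rule indlim)
        fix x assume "x \<in> (\<Union>i. A i) \<inter> E m"
        then obtain i where "x \<in> A i" "x \<in> E m" by blast
        then show "\<forall>\<^sub>F k in sequentially. x \<in> B k \<inter> E m"
          unfolding eventually_sequentially by (intro exI[of _ "Suc i"]) (auto simp: B_def)
      next
        have "emeasure M ((\<Union>i. A i) \<inter> E m) \<le> emeasure M (E m)" by (intro emeasure_mono) auto
        then show "emeasure M ((\<Union>i. A i) \<inter> E m) < \<infinity>" using E(4)[of m] by (rule le_less_trans)
      qed (use B U in \<open>auto simp: B_def\<close>)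
      ultimately show ?case by (intro L1_defect_closed[OF K ii[OF U] ii[OF B]])
    qed
  qed
  have setP: "?P (indicator A)" if A: "A \<in> sets M" "emeasure M A < \<infinity>" for A
  proof (rule L1_defect_closed[OF K _ ii[OF A(1)] boxP[OF A(1)]])
    show "integrable M (indicator A :: 'a \<Rightarrow> real)" using A by (intro integrable_real_indicator)
    show "(\<lambda>i. \<integral>\<^sup>+x. ennreal \<bar>indicator A x - indicator (A \<inter> E i) x\<bar> \<partial>M) \<longlonglongrightarrow> 0"
    proof (rule indlim)
      fix x assume x: "x \<in> A"
      then have "x \<in> space M" using A(1) sets.sets_into_space by blast
      then obtain i where "x \<in> E i" using E(3) by blast
      then have "x \<in> E m" if "i \<le> m" for m using E(2) that by (auto simp: incseq_def)
      then show "\<forall>\<^sub>F m in sequentially. x \<in> A \<inter> E m"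
        unfolding eventually_sequentially using x by (intro exI[of _ i]) auto
    qed (use A in auto)
  qed
  from f show ?thesis
  proof (induction rule: integrable_induct)
    case (base A c)
    then show ?case using scaleP[OF _ setP, of A c]
      by (simp add: mult.commute integrable_real_indicator)
  next
    case (add f g)
    then show ?case by (intro addP)
  next
    case (lim f s)
    have [measurable]: "f \<in> borel_measurable M" "s i \<in> borel_measurable M" for i using lim.hyps by auto
    have "(\<lambda>i. \<integral>\<^sup>+x. ennreal (norm (f x - s i x)) \<partial>M) \<longlonglongrightarrow> 0"
    proof (rule nn_integral_dominated_convergence_norm[where w="\<lambda>x. 2 * \<bar>f x\<bar>"])
      have "(\<integral>\<^sup>+x. ennreal \<bar>f x\<bar> \<partial>M) < \<infinity>" using lim.hyps(4) by (simp add: integrable_iff_bounded)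
      then show "(\<integral>\<^sup>+x. ennreal (2 * \<bar>f x\<bar>) \<partial>M) < \<infinity>"
        by (simp add: ennreal_mult nn_integral_cmult ennreal_mult_less_top)
    qed (use lim.hyps in auto)
    then show ?case using lim.hyps lim.IH by (intro L1_defect_closed[OF K, of f s]) simp_all
  qed
qed

lemma markov_kernel_mol:
  assumes "0 < \<epsilon>" shows "markov_kernel lborel (\<lambda>x y. mol \<epsilon> (x - y))"
proof -
  have [measurable]: "mol \<epsilon> \<in> borel_measurable borel" by (rule Cb_measurable[OF mol_Cb])
  show ?thesis
  proof
    show "\<exists>C. \<forall>x y. mol \<epsilon> (x - y) \<le> C"
      using Cb_bounded[OF mol_Cb[of \<epsilon>]] abs_le_D1 by meson
    show "(\<integral>\<^sup>+x. ennreal (mol \<epsilon> (x - y)) \<partial>lborel) \<le> 1" for y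
      using nn_integral_reflect(1)[where f="\<lambda>x. ennreal (mol \<epsilon> x)"] nn_integral_mol[OF assms] by simp
  qed (use assms mol_nonneg in auto)
qed

lemma
  assumes "0 < \<epsilon>"
  shows integrable_mol: "integrable lborel (\<lambda>y. mol \<epsilon> (x - y))"
    and integral_mol: "(LINT y|lborel. mol \<epsilon> (x - y)) = 1"
proof -
  have [measurable]: "mol \<epsilon> \<in> borel_measurable borel" by (rule Cb_measurable[OF mol_Cb])
  have *: "(\<integral>\<^sup>+y. ennreal (mol \<epsilon> (x - y)) \<partial>lborel) = ennreal 1"
    using nn_integral_reflect(2)[where f="\<lambda>x. ennreal (mol \<epsilon> x)"] nn_integral_mol[OF assms] by simp
  show "integrable lborel (\<lambda>y. mol \<epsilon> (x - y))"
    by (rule integrableI_nonneg) (use * assms mol_nonneg in auto)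
  show "(LINT y|lborel. mol \<epsilon> (x - y)) = 1"
    using * by (intro integral_eq_nn_integral[THEN trans]) (use assms mol_nonneg in auto)
qed

text \<open>The averaged indicator of an interval agrees with the indicator except within the
  mollification width of the two end points, where both lie between 0 and 1. The defect is at most
  the total length of these two zones, four times the width.\<close>

lemma mol_L1_defect:
  assumes "integrable lborel f"
  shows "(\<lambda>N. L1_defect lborel (\<lambda>x y. mol (1 / real (Suc N)) (x - y)) f) \<longlonglongrightarrow> 0"
proof (rule L1_defect_tendsto_0[OF _ _ _ _ _ _ _ _ _ assms])
  let ?G = "range (\<lambda>(a, b). {a..b::real})"
  show "markov_kernel lborel (\<lambda>x y. mol (1 / real (Suc N)) (x - y))" for N
    by (rule markov_kernel_mol) simp
  show "Int_stable ?G" by (auto simp: Int_stable_def)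
  show "sets lborel = sigma_sets (space lborel) ?G"
    by (simp add: borel_eq_atLeastAtMost[where ?'a=real])
  show "{- real m..real m} \<in> ?G" for m by auto
  show "incseq (\<lambda>m. {- real m..real m})" by (auto simp: incseq_def)
  show "(\<Union>m. {- real m..real m}) = space lborel"
  proof -
    have "\<exists>m. x \<in> {- real m..real m}" for x :: real
      using real_arch_simple[of "\<bar>x\<bar>"] by (auto simp: abs_le_iff minus_le_iff)
    then show ?thesis by auto
  qed
  fix A m assume A: "A \<in> ?G"
  then obtain a b where ab: "A = {a..b}" by auto
  have "L1_defect lborel (\<lambda>x y. mol (1 / real (Suc N)) (x - y)) (indicator A) \<le> ennreal (4 * (1 / real (Suc N)))" for N
  proof (cases "a \<le> b")
    case False
    then show ?thesis by (simp add: L1_defect_def ab)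
  next
    case True
    define e where "e = 1 / real (Suc N)"
    have e: "0 < e" by (simp add: e_def)
    have [measurable]: "mol e \<in> borel_measurable borel" by (rule Cb_measurable[OF mol_Cb])
    have "L1_defect lborel (\<lambda>x y. mol e (x - y)) (indicator A)
        \<le> (\<integral>\<^sup>+x. indicator {a - e..a + e} x + indicator {b - e..b + e} x \<partial>lborel)"
      unfolding L1_defect_def
    proof (rule nn_integral_mono)
      fix x :: real
      let ?h = "LINT y|lborel. mol e (x - y) * indicator A y"
      have i: "integrable lborel (\<lambda>y. mol e (x - y) * indicator A y)"
        by (intro integrable_real_mult_indicator integrable_mol e) (auto simp: ab)
      have h0: "0 \<le> ?h" by (intro integral_nonneg_AE AE_I2) (auto simp: mol_nonneg e)
      have "?h \<le> (LINT y|lborel. mol e (x - y))"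
        by (intro integral_mono i integrable_mol e) (auto simp: indicator_def mol_nonneg e)
      then have h1: "?h \<le> 1" by (simp add: integral_mol e)
      show "ennreal \<bar>?h - indicator A x\<bar> \<le> indicator {a - e..a + e} x + indicator {b - e..b + e} x"
      proof (cases "x \<in> {a - e..a + e} \<union> {b - e..b + e}")
        case True
        have "ennreal \<bar>?h - indicator A x\<bar> \<le> 1"
          using h0 h1 by (auto simp: indicator_def)
        also have "1 \<le> (indicator {a - e..a + e} x + indicator {b - e..b + e} x :: ennreal)"
          using True by (auto simp: indicator_def)
        finally show ?thesis .
      next
        case False
        then consider "a + e < x" "x < b - e" | "x < a - e" | "b + e < x" using True e by force
        then have "?h = indicator A x"
        proof cases
          case 1
          have "?h = (LINT y|lborel. mol e (x - y))"
          proof (rule Bochner_Integration.integral_cong[OF refl])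
            fix y show "mol e (x - y) * indicator A y = mol e (x - y)"
              using mol_eq_0[OF e, of "x - y"] 1 by (cases "e \<le> \<bar>x - y\<bar>") (auto simp: ab indicator_def)
          qed
          then show ?thesis using 1 e by (simp add: integral_mol ab)
        next
          case 2
          have 0: "mol e (x - y) * indicator A y = 0" for y
            using mol_eq_0[OF e, of "x - y"] 2 by (cases "e \<le> \<bar>x - y\<bar>") (auto simp: ab indicator_def)
          then show ?thesis using 2 e unfolding 0 by (simp add: ab)
        next
          case 3
          have 0: "mol e (x - y) * indicator A y = 0" for y
            using mol_eq_0[OF e, of "x - y"] 3 by (cases "e \<le> \<bar>x - y\<bar>") (auto simp: ab indicator_def)
          then show ?thesis using 3 e unfolding 0 by (simp add: ab)
        qed
        then show ?thesis by simp
      qed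
    qed
    also have "\<dots> = ennreal (4 * e)"
      using e by (simp add: nn_integral_add ennreal_plus[symmetric] del: ennreal_plus)
    finally show ?thesis by (simp add: e_def)
  qed
  then show "(\<lambda>N. L1_defect lborel (\<lambda>x y. mol (1 / real (Suc N)) (x - y)) (indicator A)) \<longlonglongrightarrow> 0"
  proof (rule tendsto_0_ennreal_squeeze)
    have "(\<lambda>N. ennreal (4 * (1 / real (Suc N)))) \<longlonglongrightarrow> ennreal (4 * 0)"
      using LIMSEQ_inverse_real_of_nat
      by (intro tendsto_ennrealI tendsto_mult tendsto_const) (simp add: inverse_eq_divide)
    then show "(\<lambda>N. ennreal (4 * (1 / real (Suc N)))) \<longlonglongrightarrow> 0" by simp
  qed
qed auto

text \<open>Replace the factors one at a time. The untouched factors are enlarged to a j + b j, so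
  that the bound is a sum of products of functions of single coordinates and can be integrated
  factor by factor.\<close>

lemma abs_prod_diff_le:
  fixes a b :: "'i \<Rightarrow> real"
  assumes "finite I" "\<And>i. i \<in> I \<Longrightarrow> 0 \<le> a i" "\<And>i. i \<in> I \<Longrightarrow> 0 \<le> b i"
  shows "\<bar>(\<Prod>i\<in>I. a i) - (\<Prod>i\<in>I. b i)\<bar> \<le> (\<Sum>i\<in>I. \<Prod>j\<in>I. if j = i then \<bar>a j - b j\<bar> else a j + b j)"
  using assms
proof (induction I rule: finite_induct)
  case (insert k I)
  define A B S where "A = (\<Prod>i\<in>I. a i)" "B = (\<Prod>i\<in>I. b i)"
    "S = (\<Sum>i\<in>I. \<Prod>j\<in>I. if j = i then \<bar>a j - b j\<bar> else a j + b j)"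
  have AB: "\<bar>A - B\<bar> \<le> S" unfolding A_B_S_def using insert by simp
  have A: "0 \<le> A" "A \<le> (\<Prod>i\<in>I. a i + b i)"
    unfolding A_B_S_def using insert.prems by (auto intro!: prod_nonneg prod_mono)
  have ab: "0 \<le> a k" "0 \<le> b k" using insert.prems by auto
  have "a k * A - b k * B = (a k - b k) * A + b k * (A - B)" by (simp add: algebra_simps)
  then have "\<bar>a k * A - b k * B\<bar> \<le> \<bar>a k - b k\<bar> * \<bar>A\<bar> + \<bar>b k\<bar> * \<bar>A - B\<bar>"
    by (metis abs_mult abs_triangle_ineq)
  also have "\<dots> \<le> \<bar>a k - b k\<bar> * (\<Prod>i\<in>I. a i + b i) + (a k + b k) * S"
    using A AB ab by (intro add_mono mult_mono) auto
  also have "\<bar>a k - b k\<bar> * (\<Prod>i\<in>I. a i + b i) = (\<Prod>j\<in>insert k I. if j = k then \<bar>a j - b j\<bar> else a j + b j)"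
    using insert.hyps by (auto intro!: prod.cong)
  also have "(a k + b k) * S = (\<Sum>i\<in>I. \<Prod>j\<in>insert k I. if j = i then \<bar>a j - b j\<bar> else a j + b j)"
    unfolding A_B_S_def sum_distrib_left using insert.hyps by (intro sum.cong) auto
  finally show ?case using insert.hyps by (simp add: A_B_S_def)
qed simp

lemma markov_kernel_ker:
  assumes "0 < \<epsilon>" shows "markov_kernel (sp_borel n) (sp.ker n (\<lambda>_. mol \<epsilon>))"
proof
  have k: "\<forall>d\<in>{..<n}. mol \<epsilon> \<in> Cb" by (simp add: mol_Cb)
  show "(\<lambda>p. sp.ker n (\<lambda>_. mol \<epsilon>) (fst p) (snd p)) \<in> borel_measurable (sp_borel n \<Otimes>\<^sub>M sp_borel n)"
    by (rule sp_ker_measurable_pair) (rule mol_Cb)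
  show nn: "0 \<le> sp.ker n (\<lambda>_. mol \<epsilon>) x y" for x y
    unfolding sp.ker_def by (intro prod_nonneg) (simp add: mol_nonneg assms)
  show "\<exists>C. \<forall>x y. sp.ker n (\<lambda>_. mol \<epsilon>) x y \<le> C"
    using sp.ker_bounded[OF k] abs_le_D1 by metis
  show "(\<integral>\<^sup>+x. ennreal (sp.ker n (\<lambda>_. mol \<epsilon>) x y) \<partial>sp_borel n) \<le> 1" for y
    using nn_integral_sp_ker(2)[of n "\<lambda>_. mol \<epsilon>" y] mol_Cb nn assms
    by (simp add: mol_nonneg nn_integral_mol)
qed

text \<open>For a box the averaged indicator is a product of one-dimensional averages. By
  \<open>abs_prod_diff_le\<close> the defect is bounded by a sum of products in which one factor is
  a one-dimensional defect and each other factor is at most twice the length of a side.\<close>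

lemma ker_L1_defect:
  assumes "integrable (sp_borel n) f"
  shows "(\<lambda>N. L1_defect (sp_borel n) (sp.ker n (\<lambda>_. mol (1 / real (Suc N)))) f) \<longlonglongrightarrow> 0"
proof (rule L1_defect_tendsto_0[OF _ _ _ _ _ _ _ _ _ assms])
  let ?I = "{..<n}"
  let ?G = "{Pi\<^sub>E ?I X | X. (\<forall>i. X i \<in> sets (lborel :: real measure)) \<and> finite {i. X i \<noteq> space (lborel :: real measure)}}"
  \<comment> \<open>The value \<open>UNIV\<close> beyond n keeps the set of nontrivial factors
    finite, as the generator demands.\<close>
  define Q where "Q m i = (if i < n then {- real m..real m} else UNIV)" for m i
  have QE: "Pi\<^sub>E ?I (Q m) = Pi\<^sub>E ?I (\<lambda>_. {- real m..real m})" for m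
    by (intro PiE_cong) (simp add: Q_def)
  show "markov_kernel (sp_borel n) (sp.ker n (\<lambda>_. mol (1 / real (Suc N))))" for N
    by (rule markov_kernel_ker) simp
  show "Int_stable ?G"
  proof (rule Int_stableI)
    fix A B assume "A \<in> ?G" "B \<in> ?G"
    then obtain X Y where XY: "A = Pi\<^sub>E ?I X" "B = Pi\<^sub>E ?I Y" "\<And>i. X i \<in> sets lborel" "\<And>i. Y i \<in> sets lborel"
      "finite {i. X i \<noteq> UNIV}" "finite {i. Y i \<noteq> UNIV}" by auto
    have "{i. X i \<inter> Y i \<noteq> UNIV} \<subseteq> {i. X i \<noteq> UNIV} \<union> {i. Y i \<noteq> UNIV}" by auto
    then have "finite {i. X i \<inter> Y i \<noteq> UNIV}" using XY(5,6) finite_subset by blast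
    then show "A \<inter> B \<in> ?G" using XY(3,4) unfolding XY(1,2) PiE_Int by (intro CollectI exI[of _ "\<lambda>i. X i \<inter> Y i"]) auto
  qed
  show "?G \<subseteq> Pow (space (sp_borel n))" by auto
  show "sets (sp_borel n) = sigma_sets (space (sp_borel n)) ?G"
    unfolding sp_borel_def sets_PiM_finite by (simp add: space_PiM)
  show "Pi\<^sub>E ?I (Q m) \<in> ?G" for m
  proof -
    have "{i. Q m i \<noteq> UNIV} \<subseteq> {..<n}" by (auto simp: Q_def)
    then have "finite {i. Q m i \<noteq> UNIV}" by (rule finite_subset) simp
    then show ?thesis by (intro CollectI exI[of _ "Q m"]) (auto simp: Q_def)
  qed
  show "incseq (\<lambda>m. Pi\<^sub>E ?I (Q m))"
    unfolding QE by (intro incseq_SucI PiE_mono) auto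
  show "(\<Union>m. Pi\<^sub>E ?I (Q m)) = space (sp_borel n)"
  proof -
    have "\<exists>m. x \<in> Pi\<^sub>E ?I (Q m)" if x: "x \<in> space (sp_borel n)" for x
    proof -
      obtain m where m: "(\<Sum>i<n. \<bar>x i\<bar>) \<le> real m" using real_arch_simple by blast
      have "\<bar>x i\<bar> \<le> real m" if "i < n" for i
        using member_le_sum[of i "{..<n}" "\<lambda>i. \<bar>x i\<bar>"] that m by auto
      then show ?thesis unfolding QE using x by (intro exI[of _ m]) (auto simp: PiE_iff abs_le_iff minus_le_iff)
    qed
    then have "space (sp_borel n) \<subseteq> (\<Union>m. Pi\<^sub>E ?I (Q m))" by (intro subsetI) (simp only: UN_iff UNIV_I bex_UNIV)
    moreover have "(\<Union>m. Pi\<^sub>E ?I (Q m)) \<subseteq> space (sp_borel n)" by (intro UN_least) auto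
    ultimately show ?thesis by (rule equalityI[rotated])
  qed
  show "emeasure (sp_borel n) (Pi\<^sub>E ?I (Q m)) < \<infinity>" for m
    unfolding QE sp_borel_def by (subst sp_prod.emeasure_PiM) (auto simp: ennreal_prod_eq_top less_top[symmetric] power_eq_top_ennreal)
  fix A m assume "A \<in> ?G" and AE: "A \<subseteq> Pi\<^sub>E ?I (Q m)"
  then obtain X where X: "A = Pi\<^sub>E ?I X" "\<And>i. X i \<in> sets lborel" by auto
  show "(\<lambda>N. L1_defect (sp_borel n) (sp.ker n (\<lambda>_. mol (1 / real (Suc N)))) (indicator A)) \<longlonglongrightarrow> 0"
  \<comment> \<open>If the box is empty its sides X i are unconstrained; only for a nonempty box
    does inclusion in a cube bound every side.\<close>
  proof (cases "A = {}")
    case True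
    then show ?thesis by (simp add: L1_defect_def)
  next
    case False
    then obtain x0 where x0: "x0 \<in> Pi\<^sub>E ?I X" unfolding X(1) by blast
    have Xi: "emeasure lborel (X i) < \<infinity>" if "i < n" for i
    proof -
      have "X i \<subseteq> {- real m..real m}"
      proof
        fix s assume "s \<in> X i"
        then have "x0(i := s) \<in> A" using x0 that unfolding X(1) by (auto simp: PiE_iff extensional_def)
        then have "x0(i := s) \<in> Pi\<^sub>E ?I (\<lambda>_. {- real m..real m})" using AE unfolding QE by blast
        from PiE_mem[OF this, of i] that show "s \<in> {- real m..real m}" by simp
      qed
      then have "emeasure lborel (X i) \<le> emeasure lborel {- real m..real m}" by (intro emeasure_mono) auto
      also have "\<dots> < \<infinity>" by simp
      finally show ?thesis .
    qed
    have iX: "integrable lborel (indicator (X i) :: real \<Rightarrow> real)" if "i < n" for i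
      using X(2) Xi[OF that] by (intro integrable_real_indicator)
    have bound: "L1_defect (sp_borel n) (sp.ker n (\<lambda>_. mol e)) (indicator A) \<le>
        (\<Sum>i<n. (\<Prod>j\<in>?I - {i}. 2 * emeasure lborel (X j)) * L1_defect lborel (\<lambda>x y. mol e (x - y)) (indicator (X i)))"
      if e: "0 < e" for e
    proof -
      interpret mk: markov_kernel lborel "\<lambda>x y. mol e (x - y)" by (rule markov_kernel_mol[OF e])
      define a where "a i s = (LINT t|lborel. mol e (s - t) * indicator (X i) t)" for i s
      define b where "b i s = (indicator (X i) s :: real)" for i s
      have am: "a i \<in> borel_measurable lborel" for i
        unfolding a_def using mk.measurable_convolution[of "indicator (X i)"] X(2)[of i] by auto
      have bm: "b i \<in> borel_measurable lborel" for i unfolding b_def using X(2)[of i] by auto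
      note [measurable] = am[simplified] bm[simplified]
      have a0: "0 \<le> a i s" for i s
        unfolding a_def by (intro integral_nonneg_AE AE_I2) (auto simp: mol_nonneg e)
      have b0: "0 \<le> b i s" for i s by (simp add: b_def)
      have conv: "(LINT y|sp_borel n. sp.ker n (\<lambda>_. mol e) x y * indicator A y) = (\<Prod>i<n. a i (x i))" for x
      proof -
        have "(LINT y|sp_borel n. sp.ker n (\<lambda>_. mol e) x y * indicator A y)
            = (LINT y|sp_borel n. (\<Prod>i<n. mol e (x i - y i) * indicator (X i) (y i)))"
        proof (rule Bochner_Integration.integral_cong[OF refl])
          fix y assume y: "y \<in> space (sp_borel n)"
          have "indicator A y = (\<Prod>i<n. indicator (X i) (y i) :: real)"
          proof (cases "y \<in> A")
            case True then show ?thesis by (auto simp: X(1) PiE_iff)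
          next
            case False
            then obtain i where "i < n" "y i \<notin> X i" using y by (auto simp: X(1) PiE_iff)
            then show ?thesis using False by (auto simp: indicator_def intro!: prod_zero[symmetric] bexI[of _ i])
          qed
          then show "sp.ker n (\<lambda>_. mol e) x y * indicator A y = (\<Prod>i<n. mol e (x i - y i) * indicator (X i) (y i))"
            by (simp add: sp.ker_def prod.distrib)
        qed
        also have "\<dots> = (\<Prod>i<n. a i (x i))"
          unfolding sp_borel_def a_def
          by (rule sp_prod.product_integral_prod[where f="\<lambda>i t. mol e (x i - t) * indicator (X i) t"])
            (auto intro!: mk.integrable_K iX)
        finally show ?thesis .
      qed
      have ind: "indicator A x = (\<Prod>i<n. b i (x i))" if x: "x \<in> space (sp_borel n)" for x
      proof (cases "x \<in> A")
        case True then show ?thesis by (auto simp: X(1) PiE_iff b_def)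
      next
        case False
        then obtain i where "i < n" "x i \<notin> X i" using x by (auto simp: X(1) PiE_iff)
        then show ?thesis using False by (auto simp: b_def indicator_def intro!: prod_zero[symmetric] bexI[of _ i])
      qed
      define H where "H i j s = (if j = i then \<bar>a j s - b j s\<bar> else a j s + b j s)" for i j s
      have Hm: "H i j \<in> borel_measurable lborel" for i j unfolding H_def using am bm by simp
      have H0: "0 \<le> H i j s" for i j s using a0 b0 by (simp add: H_def)
      have "L1_defect (sp_borel n) (sp.ker n (\<lambda>_. mol e)) (indicator A) \<le>
          (\<integral>\<^sup>+x. (\<Sum>i<n. \<Prod>j<n. ennreal (H i j (x j))) \<partial>sp_borel n)"
        unfolding L1_defect_def
      proof (rule nn_integral_mono)
        fix x assume x: "x \<in> space (sp_borel n)"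
        have "\<bar>(\<Prod>i<n. a i (x i)) - (\<Prod>i<n. b i (x i))\<bar> \<le> (\<Sum>i<n. \<Prod>j<n. H i j (x j))"
          unfolding H_def by (rule abs_prod_diff_le) (auto simp: a0 b0)
        then have "ennreal \<bar>(\<Prod>i<n. a i (x i)) - (\<Prod>i<n. b i (x i))\<bar> \<le> ennreal (\<Sum>i<n. \<Prod>j<n. H i j (x j))"
          by (rule ennreal_leI)
        also have "\<dots> = (\<Sum>i<n. \<Prod>j<n. ennreal (H i j (x j)))"
          using H0 by (simp add: sum_ennreal[symmetric] prod_ennreal[symmetric] prod_nonneg)
        finally show "ennreal \<bar>(LINT y|sp_borel n. sp.ker n (\<lambda>_. mol e) x y * indicator A y) - indicator A x\<bar> \<le> (\<Sum>i<n. \<Prod>j<n. ennreal (H i j (x j)))"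
          by (simp add: conv ind[OF x])
      qed
      also have "\<dots> = (\<Sum>i<n. \<integral>\<^sup>+x. (\<Prod>j<n. ennreal (H i j (x j))) \<partial>sp_borel n)"
      proof (rule nn_integral_sum)
        fix i
        show "(\<lambda>x. \<Prod>j<n. ennreal (H i j (x j))) \<in> borel_measurable (sp_borel n)"
        proof (rule borel_measurable_prod_ennreal)
          fix j assume "j \<in> ?I"
          then have "(\<lambda>x. H i j (x j)) \<in> borel_measurable (sp_borel n)"
            using Hm[of i j] by (intro measurable_compose[OF sp_coord_measurable]) auto
          then show "(\<lambda>x. ennreal (H i j (x j))) \<in> borel_measurable (sp_borel n)" by simp
        qed
      qed
      also have "\<dots> = (\<Sum>i<n. \<Prod>j<n. \<integral>\<^sup>+s. ennreal (H i j s) \<partial>lborel)"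
        unfolding sp_borel_def using Hm by (intro sum.cong refl sp_prod.product_nn_integral_prod) auto
      also have "\<dots> \<le> (\<Sum>i<n. (\<Prod>j\<in>?I - {i}. 2 * emeasure lborel (X j)) * L1_defect lborel (\<lambda>x y. mol e (x - y)) (indicator (X i)))"
      proof (rule sum_mono)
        fix i assume i: "i \<in> ?I"
        have "(\<integral>\<^sup>+s. ennreal (H i j s) \<partial>lborel) \<le> 2 * emeasure lborel (X j)" if "j \<in> ?I - {i}" for j
        proof -
          have "(\<integral>\<^sup>+s. ennreal (H i j s) \<partial>lborel) = (\<integral>\<^sup>+s. ennreal \<bar>a j s\<bar> + ennreal \<bar>indicator (X j) s\<bar> \<partial>lborel)"
            using that a0 b0 by (intro nn_integral_cong) (auto simp: H_def b_def)
          also have "\<dots> = (\<integral>\<^sup>+s. ennreal \<bar>a j s\<bar> \<partial>lborel) + (\<integral>\<^sup>+s. ennreal \<bar>indicator (X j) s\<bar> \<partial>lborel)"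
            using am X(2)[of j] by (intro nn_integral_add) auto
          also have "\<dots> \<le> (\<integral>\<^sup>+s. ennreal \<bar>indicator (X j) s\<bar> \<partial>lborel) + (\<integral>\<^sup>+s. ennreal \<bar>indicator (X j) s\<bar> \<partial>lborel)"
            unfolding a_def using that by (intro add_mono mk.convolution_contraction iX) auto
          also have "(\<integral>\<^sup>+s. ennreal \<bar>indicator (X j) s\<bar> \<partial>lborel) = emeasure lborel (X j)"
            using X(2)[of j] by (simp add: ennreal_indicator)
          finally show ?thesis by (simp add: mult_2)
        qed
        then have "(\<Prod>j\<in>?I - {i}. \<integral>\<^sup>+s. ennreal (H i j s) \<partial>lborel) \<le> (\<Prod>j\<in>?I - {i}. 2 * emeasure lborel (X j))"
          by (rule prod_mono_ennreal)
        moreover have "(\<integral>\<^sup>+s. ennreal (H i i s) \<partial>lborel) = L1_defect lborel (\<lambda>x y. mol e (x - y)) (indicator (X i))"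
          by (simp add: H_def L1_defect_def a_def b_def)
        ultimately show "(\<Prod>j<n. \<integral>\<^sup>+s. ennreal (H i j s) \<partial>lborel) \<le>
            (\<Prod>j\<in>?I - {i}. 2 * emeasure lborel (X j)) * L1_defect lborel (\<lambda>x y. mol e (x - y)) (indicator (X i))"
          using i by (subst prod.remove[of _ i]) (auto simp: mult.commute intro: mult_left_mono)
      qed
      finally show ?thesis .
    qed
    have "(\<lambda>N. \<Sum>i<n. (\<Prod>j\<in>?I - {i}. 2 * emeasure lborel (X j)) * L1_defect lborel (\<lambda>x y. mol (1 / real (Suc N)) (x - y)) (indicator (X i))) \<longlonglongrightarrow> (\<Sum>i<n. (\<Prod>j\<in>?I - {i}. 2 * emeasure lborel (X j)) * 0)"
    proof (intro tendsto_sum ennreal_tendsto_cmult mol_L1_defect)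
      fix i assume "i \<in> ?I"
      then show "integrable lborel (indicator (X i) :: real \<Rightarrow> real)" by (intro iX) simp
      show "(\<Prod>j\<in>?I - {i}. 2 * emeasure lborel (X j)) < top"
        using Xi by (auto simp: less_top[symmetric] ennreal_prod_eq_top ennreal_mult_eq_top_iff)
    qed
    then show ?thesis
      by (intro tendsto_0_ennreal_squeeze[OF bound]) auto
  qed
qed

text \<open>Convergence on almost every slice is integrated over the parameter. The majorant is
  twice the L1 norm of the slice, by \<open>L1_defect_le\<close>.\<close>

lemma L1_defect_param:
  assumes K: "\<And>N. markov_kernel M (K N)"
    and conv: "\<And>f. integrable M f \<Longrightarrow> (\<lambda>N. L1_defect M (K N) f) \<longlonglongrightarrow> 0"
    and Y: "sigma_finite_measure Y" and v: "integrable (M \<Otimes>\<^sub>M Y) v"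
  shows "(\<lambda>N. \<integral>\<^sup>+y. L1_defect M (K N) (\<lambda>x. v (x, y)) \<partial>Y) \<longlonglongrightarrow> 0"
proof -
  interpret M: sigma_finite_measure M using K[of 0] by (rule markov_kernel.axioms(1))
  interpret Y: sigma_finite_measure Y by (rule Y)
  interpret P: pair_sigma_finite M Y ..
  have vm: "v \<in> borel_measurable (M \<Otimes>\<^sub>M Y)" using v by auto
  have vint: "integrable (M \<Otimes>\<^sub>M Y) (case_prod (\<lambda>x y. v (x, y)))" using v by simp
  have Dm: "(\<lambda>y. L1_defect M (K N) (\<lambda>x. v (x, y))) \<in> borel_measurable Y" for N
    unfolding L1_defect_def
  proof (rule M.borel_measurable_nn_integral)
    interpret mk: markov_kernel M "K N" by (rule K)
    have "(\<lambda>p. LINT x'|M. K N (snd p) x' * v (x', fst p)) \<in> borel_measurable (Y \<Otimes>\<^sub>M M)"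
    proof (rule M.borel_measurable_lebesgue_integral)
      have 1: "(\<lambda>q. (snd (fst q), snd q)) \<in> measurable ((Y \<Otimes>\<^sub>M M) \<Otimes>\<^sub>M M) (M \<Otimes>\<^sub>M M)"
        and 2: "(\<lambda>q. (snd q, fst (fst q))) \<in> measurable ((Y \<Otimes>\<^sub>M M) \<Otimes>\<^sub>M M) (M \<Otimes>\<^sub>M Y)"
        by measurable
      show "(\<lambda>(p, x'). K N (snd p) x' * v (x', fst p)) \<in> borel_measurable ((Y \<Otimes>\<^sub>M M) \<Otimes>\<^sub>M M)"
        using measurable_compose[OF 1 mk.measurable_K] measurable_compose[OF 2 vm]
        by (simp add: case_prod_unfold)
    qed
    moreover have "(\<lambda>p. v (snd p, fst p)) \<in> borel_measurable (Y \<Otimes>\<^sub>M M)"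
      using measurable_compose[OF measurable_Pair[OF measurable_snd measurable_fst] vm] .
    ultimately have "(\<lambda>p. ennreal \<bar>(LINT x'|M. K N (snd p) x' * v (x', fst p)) - v (snd p, fst p)\<bar>) \<in> borel_measurable (Y \<Otimes>\<^sub>M M)"
      by simp
    then show "(\<lambda>(y, x). ennreal \<bar>(LINT x'|M. K N x x' * v (x', y)) - v (x, y)\<bar>) \<in> borel_measurable (Y \<Otimes>\<^sub>M M)"
      by (simp add: case_prod_unfold)
  qed
  have wm: "(\<lambda>y. 2 * (\<integral>\<^sup>+x. ennreal \<bar>v (x, y)\<bar> \<partial>M)) \<in> borel_measurable Y"
    using vm by measurable
  have "(\<lambda>N. \<integral>\<^sup>+y. L1_defect M (K N) (\<lambda>x. v (x, y)) \<partial>Y) \<longlonglongrightarrow> (\<integral>\<^sup>+y. 0 \<partial>Y)"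
  proof (rule nn_integral_dominated_convergence[OF Dm _ wm])
    show "AE y in Y. L1_defect M (K N) (\<lambda>x. v (x, y)) \<le> 2 * (\<integral>\<^sup>+x. ennreal \<bar>v (x, y)\<bar> \<partial>M)" for N
      using P.AE_integrable_snd[OF vint]
      by eventually_elim (rule markov_kernel.L1_defect_le[OF K])
    show "AE y in Y. (\<lambda>N. L1_defect M (K N) (\<lambda>x. v (x, y))) \<longlonglongrightarrow> 0"
      using P.AE_integrable_snd[OF vint] by eventually_elim (rule conv)
    have "(\<integral>\<^sup>+y. (\<integral>\<^sup>+x. ennreal \<bar>v (x, y)\<bar> \<partial>M) \<partial>Y) = (\<integral>\<^sup>+p. ennreal \<bar>v p\<bar> \<partial>(M \<Otimes>\<^sub>M Y))"
      using vm by (intro P.nn_integral_snd) simp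
    also have "\<dots> < \<infinity>" using v by (simp add: integrable_iff_bounded)
    finally show "(\<integral>\<^sup>+y. 2 * (\<integral>\<^sup>+x. ennreal \<bar>v (x, y)\<bar> \<partial>M) \<partial>Y) < \<infinity>"
      using vm by (subst nn_integral_cmult) (auto simp: ennreal_mult_less_top)
  qed simp
  then show ?thesis by simp
qed

subsection \<open>Space-time convolutions\<close>

definition st_conv :: "nat \<Rightarrow> (nat option \<Rightarrow> real \<Rightarrow> real) \<Rightarrow> (real \<times> point \<Rightarrow> real) \<Rightarrow> real \<times> point \<Rightarrow> real" where
  "st_conv n k v z = (LINT q|st_borel n. v q * st.ker n k z (st_coord q))"

text \<open>Only the spatial factors are asked to vanish beyond r, because the boundary to be
  respected is that of \<Omega>; the convolved functions are integrable over all times.\<close>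

definition kernel_family :: "nat \<Rightarrow> real \<Rightarrow> (nat option \<Rightarrow> real \<Rightarrow> real) \<Rightarrow> bool" where
  "kernel_family n r k \<longleftrightarrow> (\<forall>d\<in>st_dirs n. k d \<in> Cb) \<and> (\<forall>i<n. \<forall>x. r < \<bar>x\<bar> \<longrightarrow> k (Some i) x = 0)"

lemma st_dirs_Some [simp]: "Some i \<in> st_dirs n \<longleftrightarrow> i < n" and st_dirs_None [simp]: "None \<in> st_dirs n"
  by (auto simp: st_dirs_def)

lemma kernel_familyD:
  assumes "kernel_family n r k"
  shows "d \<in> st_dirs n \<Longrightarrow> k d \<in> Cb" "\<forall>d\<in>st_dirs n. k d \<in> Cb" "i < n \<Longrightarrow> r < \<bar>x\<bar> \<Longrightarrow> k (Some i) x = 0"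
  using assms by (auto simp: kernel_family_def)

lemma deriv_eq_0_outside:
  fixes f :: "real \<Rightarrow> real"
  assumes "\<And>x. r < \<bar>x\<bar> \<Longrightarrow> f x = 0" "r < \<bar>x\<bar>"
  shows "deriv f x = 0"
proof (rule DERIV_imp_deriv)
  have "open {y. r < \<bar>y\<bar>}" by (intro open_Collect_less continuous_intros)
  then show "(f has_real_derivative 0) (at x)"
    by (rule has_field_derivative_transform_within_open[where f="\<lambda>_. 0" and S="{y. r < \<bar>y :: real\<bar>}", rotated])
      (use assms in auto)
qed

lemma kernel_family_deriv:
  assumes "kernel_family n r k"
  shows "kernel_family n r (k(Some i := deriv (k (Some i))))"
  unfolding kernel_family_def
proof (intro conjI ballI allI impI)
  fix d assume "d \<in> st_dirs n"
  then show "(k(Some i := deriv (k (Some i)))) d \<in> Cb"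
    using kernel_familyD(1)[OF assms] by (auto intro: Cb_deriv)
next
  fix j x assume "j < n" "r < \<bar>x\<bar>"
  then show "(k(Some i := deriv (k (Some i)))) (Some j) x = 0"
    using kernel_familyD(3)[OF assms] deriv_eq_0_outside[of r "k (Some i)" x] by auto
qed

lemma st_ker_eq_0:
  assumes "kernel_family n r k" "st.ker n k z (st_coord q) \<noteq> 0" "i < n"
  shows "\<bar>snd q i - snd z i\<bar> \<le> r"
proof (rule ccontr)
  assume "\<not> \<bar>snd q i - snd z i\<bar> \<le> r"
  then have "k (Some i) (snd z i - snd q i) = 0"
    using assms(1,3) by (intro kernel_familyD(3)) (auto simp: abs_minus_commute)
  then have "st.ker n k z (st_coord q) = 0"
    using assms(3) by (cases z; cases q) (auto simp: st_ker_pair sp.ker_def intro!: prod_zero bexI[of _ i])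
  then show False using assms(2) by simp
qed

lemma st_ker_measurable:
  assumes "\<forall>d\<in>st_dirs n. k d \<in> Cb"
  shows "(\<lambda>q. st.ker n k z (st_coord q)) \<in> borel_measurable (st_borel n)"
  by (rule st.ker_measurable[OF assms]) (use st_coord_measurable in blast)

lemma integrable_st_ker:
  assumes k: "\<forall>d\<in>st_dirs n. k d \<in> Cb" and v: "integrable (st_borel n) v"
  shows "integrable (st_borel n) (\<lambda>q. v q * st.ker n k z (st_coord q))"
proof -
  obtain C where C: "0 \<le> C" "\<And>p c. \<bar>st.ker n k p c\<bar> \<le> C" using st.ker_bounded[OF k] by blast
  show ?thesis
  proof (rule Bochner_Integration.integrable_bound[where f="\<lambda>q. v q * C"])
    show "(\<lambda>q. v q * st.ker n k z (st_coord q)) \<in> borel_measurable (st_borel n)"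
      using v by (intro borel_measurable_times st_ker_measurable k) auto
    show "AE q in st_borel n. norm (v q * st.ker n k z (st_coord q)) \<le> norm (v q * C)"
      by (intro AE_I2) (simp add: abs_mult mult_left_mono C)
  qed (use v in simp)
qed

lemma st_conv_smooth_alg:
  assumes "\<forall>d\<in>st_dirs n. k d \<in> Cb" "integrable (st_borel n) v"
  shows "st_conv n k v \<in> st.smooth_alg n (st_borel n) st_coord"
  unfolding st_conv_def[abs_def] using assms by (intro st.smooth_alg.base)

lemma st_conv_DERIV:
  assumes "\<forall>d\<in>st_dirs n. k d \<in> Cb" "integrable (st_borel n) v" "i < n"
  shows "((\<lambda>s. st_conv n k v (st_move (Some i) z s)) has_real_derivative
    st_conv n (k(Some i := deriv (k (Some i)))) v z) (at 0)"
  unfolding st_conv_def by (rule st.base_DERIV) (use assms st_coord_measurable in auto)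

text \<open>Supplies the bounds on the derivatives of the cutoffs, which are convolutions
  again.\<close>

lemma st_conv_bounded:
  assumes "\<forall>d\<in>st_dirs n. k d \<in> Cb" "integrable (st_borel n) v"
  shows "\<exists>C\<ge>0. \<forall>z. \<bar>st_conv n k v z\<bar> \<le> C"
proof -
  obtain C where C: "0 \<le> C" "\<And>p c. \<bar>st.ker n k p c\<bar> \<le> C" using st.ker_bounded[OF assms(1)] by blast
  have "\<bar>st_conv n k v z\<bar> \<le> (LINT q|st_borel n. \<bar>v q\<bar> * C)" for z
  proof -
    have "\<bar>st_conv n k v z\<bar> \<le> (LINT q|st_borel n. \<bar>v q * st.ker n k z (st_coord q)\<bar>)"
      unfolding st_conv_def by (rule integral_abs_bound)
    also have "\<dots> \<le> (LINT q|st_borel n. \<bar>v q\<bar> * C)"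
    proof (intro integral_mono integrable_abs integrable_st_ker assms integrable_mult_left)
      show "\<bar>v q * st.ker n k z (st_coord q)\<bar> \<le> \<bar>v q\<bar> * C" for q
        by (simp add: abs_mult mult_left_mono C)
    qed
    finally show ?thesis .
  qed
  moreover have "0 \<le> (LINT q|st_borel n. \<bar>v q\<bar> * C)" using C by (intro integral_nonneg_AE AE_I2) auto
  ultimately show ?thesis by blast
qed

text \<open>Cutting to a spatial set turns local integrability into integrability over space-time.
  At a point whose r-box lies in A, a convolution with kernels of radius r does not notice the
  cut.\<close>

definition loc :: "point set \<Rightarrow> (real \<times> point \<Rightarrow> real) \<Rightarrow> real \<times> point \<Rightarrow> real" where
  "loc A v z = indicator A (snd z) * v z"

lemma st_ker_loc:
  assumes k: "kernel_family n r k" and A: "\<And>y. y \<in> topspace (sp_top n) \<Longrightarrow> (\<And>i. i < n \<Longrightarrow> \<bar>y i - snd z i\<bar> \<le> r) \<Longrightarrow> y \<in> A"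
    and q: "q \<in> space (st_borel n)"
  shows "loc A v q * st.ker n k z (st_coord q) = v q * st.ker n k z (st_coord q)"
proof (cases "st.ker n k z (st_coord q) = 0")
  case False
  have "snd q \<in> A" using st_ker_eq_0[OF k False] q by (intro A) auto
  then show ?thesis by (simp add: loc_def)
qed simp

lemma st_conv_loc:
  assumes k: "kernel_family n r k" and A: "\<And>y. y \<in> topspace (sp_top n) \<Longrightarrow> (\<And>i. i < n \<Longrightarrow> \<bar>y i - snd z i\<bar> \<le> r) \<Longrightarrow> y \<in> A"
  shows "st_conv n k (loc A v) z = st_conv n k v z"
  unfolding st_conv_def by (intro Bochner_Integration.integral_cong refl st_ker_loc[OF k]) (use A in auto)

lemma integrable_st_ker_loc:
  assumes k: "kernel_family n r k" and A: "\<And>y. y \<in> topspace (sp_top n) \<Longrightarrow> (\<And>i. i < n \<Longrightarrow> \<bar>y i - snd z i\<bar> \<le> r) \<Longrightarrow> y \<in> A"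
    and v: "integrable (st_borel n) (loc A v)"
  shows "integrable (st_borel n) (\<lambda>q. v q * st.ker n k z (st_coord q))"
proof -
  have "integrable (st_borel n) (\<lambda>q. loc A v q * st.ker n k z (st_coord q))"
    by (rule integrable_st_ker[OF kernel_familyD(2)[OF k] v])
  also have "?this \<longleftrightarrow> ?thesis"
    by (intro Bochner_Integration.integrable_cong refl st_ker_loc[OF k]) (use A in auto)
  finally show ?thesis .
qed

text \<open>With x fixed, the product kernel as a function of its second argument is an admissible
  test function once its box lies in \<Omega>. The sign in the derivative comes from the reflection
  y \<mapsto> x - y.\<close>

lemma sp_ker_test_function:
  assumes h: "\<And>i. i < n \<Longrightarrow> h i \<in> Cb" "\<And>i x. i < n \<Longrightarrow> r < \<bar>x\<bar> \<Longrightarrow> h i x = 0"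
    and A: "\<And>y. y \<in> topspace (sp_top n) \<Longrightarrow> (\<And>i. i < n \<Longrightarrow> \<bar>y i - x i\<bar> \<le> r) \<Longrightarrow> y \<in> \<Omega>"
  shows "test_function n \<Omega> (\<lambda>y. sp.ker n h x y)"
    and "i < n \<Longrightarrow> partial sp_move i (\<lambda>y. sp.ker n h x y) y = - sp.ker n (h(i := deriv (h i))) x y"
proof -
  define h' where "h' i s = h i (x i - s)" for i s
  have h': "h' i \<in> Cb" if "i < n" for i
    using Cb_affine[OF h(1)[OF that], of 1 "-1" "x i"] by (simp add: h'_def[abs_def] algebra_simps)
  have eq: "sp.ker n h x y = (\<Prod>i<n. h' i (y i))" for y by (simp add: sp.ker_def h'_def)
  let ?K = "\<Pi>\<^sub>E i\<in>{..<n}. cball (x i) r"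
  have "compactin (sp_top n) ?K" unfolding sp_top_def by (subst compactin_PiE) auto
  moreover have "?K \<subseteq> \<Omega>" using A by (auto simp: PiE_iff dist_real_def abs_minus_commute)
  moreover have "sp.ker n h x y = 0" if y: "y \<in> topspace (sp_top n) - ?K" for y
  proof -
    obtain i where "i < n" "r < \<bar>x i - y i\<bar>" using y by (auto simp: PiE_iff dist_real_def not_le)
    then show ?thesis using h(2)[of i "x i - y i"] by (auto simp: sp.ker_def intro!: prod_zero bexI[of _ i])
  qed
  ultimately show "test_function n \<Omega> (\<lambda>y. sp.ker n h x y)"
    unfolding test_function_def eq by (intro conjI exI[of _ ?K] sp_smooth_prod h') auto
  assume i: "i < n"
  have d: "((\<lambda>s. h i (x i - (y i + s))) has_real_derivative - deriv (h i) (x i - y i)) (at 0)"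
  proof -
    have "((\<lambda>s. x i - (y i + s)) has_real_derivative -1) (at 0)" by (auto intro!: derivative_eq_intros)
    from DERIV_chain2[where f="h i", OF Cb_DERIV[OF h(1)[OF i]] this] show ?thesis by simp
  qed
  have "sp.ker n h x (sp_move i y s) = h i (x i - (y i + s)) * (\<Prod>j\<in>{..<n} - {i}. h j (x j - y j))" for s
    unfolding sp.ker_def using i by (subst prod.remove[of _ i]) (auto simp: sp_move_def intro!: prod.cong)
  moreover have "sp.ker n (h(i := deriv (h i))) x y = deriv (h i) (x i - y i) * (\<Prod>j\<in>{..<n} - {i}. h j (x j - y j))"
    unfolding sp.ker_def using i by (subst prod.remove[of _ i]) (auto intro!: prod.cong)
  ultimately show "partial sp_move i (\<lambda>y. sp.ker n h x y) y = - sp.ker n (h(i := deriv (h i))) x y"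
    unfolding partial_def using DERIV_imp_deriv[OF DERIV_cmult_right[OF d]] by simp
qed

text \<open>At almost every time s the weak identity is applied with the spatial kernel itself as
  test function; the time factor k None (t - s) is constant on the slice and is pulled out of both
  sides.\<close>

lemma st_conv_integration_by_parts:
  assumes k: "kernel_family n r k" and i: "i < n" and x: "x \<in> topspace (sp_top n)"
    and A: "\<And>y. y \<in> topspace (sp_top n) \<Longrightarrow> (\<And>i. i < n \<Longrightarrow> \<bar>y i - x i\<bar> \<le> r) \<Longrightarrow> y \<in> A" "A \<subseteq> \<Omega>"
    and u: "integrable (st_borel n) (loc A u)" and g: "integrable (st_borel n) (loc A g)"
    and weak: "AE t in lborel. \<forall>\<psi>. test_function n \<Omega> \<psi> \<longrightarrow>
       (LINT x|sp_borel n. u (t, x) * partial sp_move i \<psi> x) = - (LINT x|sp_borel n. g (t, x) * \<psi> x)"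
  shows "st_conv n (k(Some i := deriv (k (Some i)))) u (t, x) = st_conv n k g (t, x)"
proof -
  let ?k = "k(Some i := deriv (k (Some i)))"
  let ?h = "\<lambda>i. k (Some i)"
  have k': "kernel_family n r ?k" by (rule kernel_family_deriv[OF k])
  have A': "\<And>y. y \<in> topspace (sp_top n) \<Longrightarrow> (\<And>i. i < n \<Longrightarrow> \<bar>y i - snd (t, x) i\<bar> \<le> r) \<Longrightarrow> y \<in> A" using A by simp
  have iu: "integrable (lborel \<Otimes>\<^sub>M sp_borel n) (\<lambda>q. u q * st.ker n ?k (t, x) (st_coord q))"
    using integrable_st_ker_loc[where z="(t, x)", OF k' A' u] by (simp add: st_borel_def)
  have ig: "integrable (lborel \<Otimes>\<^sub>M sp_borel n) (\<lambda>q. g q * st.ker n k (t, x) (st_coord q))"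
    using integrable_st_ker_loc[where z="(t, x)", OF k A' g] by (simp add: st_borel_def)
  have hC: "?h j \<in> Cb" if "j < n" for j using kernel_familyD(1)[OF k, of "Some j"] that by simp
  have A\<Omega>: "y \<in> \<Omega>" if "y \<in> topspace (sp_top n)" "\<And>i. i < n \<Longrightarrow> \<bar>y i - x i\<bar> \<le> r" for y
    using A(1)[OF that] A(2) by blast
  have tf: "test_function n \<Omega> (\<lambda>y. sp.ker n ?h x y)"
    by (rule sp_ker_test_function(1)[OF hC kernel_familyD(3)[OF k] A\<Omega>])
  have pt: "partial sp_move i (\<lambda>y. sp.ker n ?h x y) y = - sp.ker n (?h(i := deriv (?h i))) x y" for y
    by (rule sp_ker_test_function(2)[OF hC kernel_familyD(3)[OF k] A\<Omega> i])
  have kk: "(\<lambda>j. ?k (Some j)) = ?h(i := deriv (?h i))" by auto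
  have "st_conv n ?k u (t, x) = (LINT s|lborel. LINT y|sp_borel n. u (s, y) * st.ker n ?k (t, x) (st_coord (s, y)))"
    unfolding st_conv_def using st_pair.integral_fst'[OF iu] by (simp add: st_borel_def)
  also have "\<dots> = (LINT s|lborel. LINT y|sp_borel n. g (s, y) * st.ker n k (t, x) (st_coord (s, y)))"
  proof (rule integral_cong_AE)
    show "(\<lambda>s. LINT y|sp_borel n. u (s, y) * st.ker n ?k (t, x) (st_coord (s, y))) \<in> borel_measurable lborel"
      using st_pair.integrable_fst'[OF iu] by auto
    show "(\<lambda>s. LINT y|sp_borel n. g (s, y) * st.ker n k (t, x) (st_coord (s, y))) \<in> borel_measurable lborel"
      using st_pair.integrable_fst'[OF ig] by auto
    show "AE s in lborel. (LINT y|sp_borel n. u (s, y) * st.ker n ?k (t, x) (st_coord (s, y))) =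
        (LINT y|sp_borel n. g (s, y) * st.ker n k (t, x) (st_coord (s, y)))"
      using weak
    proof eventually_elim
      fix s assume "\<forall>\<psi>. test_function n \<Omega> \<psi> \<longrightarrow>
       (LINT x|sp_borel n. u (s, x) * partial sp_move i \<psi> x) = - (LINT x|sp_borel n. g (s, x) * \<psi> x)"
      then have "(LINT y|sp_borel n. u (s, y) * - sp.ker n (?h(i := deriv (?h i))) x y) = - (LINT y|sp_borel n. g (s, y) * sp.ker n ?h x y)"
        using tf unfolding pt[symmetric] by blast
      then have eq: "(LINT y|sp_borel n. u (s, y) * sp.ker n (?h(i := deriv (?h i))) x y) = (LINT y|sp_borel n. g (s, y) * sp.ker n ?h x y)"
        by simp
      have "(LINT y|sp_borel n. u (s, y) * st.ker n ?k (t, x) (st_coord (s, y)))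
          = k None (t - s) * (LINT y|sp_borel n. u (s, y) * sp.ker n (?h(i := deriv (?h i))) x y)"
        by (subst integral_mult_right_zero[symmetric]) (simp only: st_ker_pair kk, simp add: mult_ac)
      also have "\<dots> = (LINT y|sp_borel n. g (s, y) * st.ker n k (t, x) (st_coord (s, y)))"
        unfolding eq by (subst integral_mult_right_zero[symmetric]) (simp add: st_ker_pair mult_ac)
      finally show "(LINT y|sp_borel n. u (s, y) * st.ker n ?k (t, x) (st_coord (s, y))) =
        (LINT y|sp_borel n. g (s, y) * st.ker n k (t, x) (st_coord (s, y)))" .
    qed
  qed
  also have "\<dots> = st_conv n k g (t, x)"
    unfolding st_conv_def using st_pair.integral_fst'[OF ig] by (simp add: st_borel_def)
  finally show ?thesis .
qed

text \<open>Minkowski's inequality for integrals: pair the vector of integrals with itself, use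
  Cauchy-Schwarz under the integral and divide by the norm N. The constant 1 matters, since a larger
  one would spoil the mass bound in Jensen's inequality.\<close>

lemma L2_set_integral_le:
  assumes J: "finite J" and f: "\<And>a. a \<in> J \<Longrightarrow> integrable M (f a)"
  shows "L2_set (\<lambda>a. LINT q|M. f a q) J \<le> (LINT q|M. L2_set (\<lambda>a. f a q) J)"
proof -
  let ?I = "\<lambda>a. LINT q|M. f a q"
  define N where "N = L2_set ?I J"
  have fm: "f a \<in> borel_measurable M" if "a \<in> J" for a using f[OF that] by auto
  have int: "integrable M (\<lambda>q. L2_set (\<lambda>a. f a q) J)"
  proof (rule Bochner_Integration.integrable_bound[where f="\<lambda>q. \<Sum>a\<in>J. \<bar>f a q\<bar>"])
    show "(\<lambda>q. L2_set (\<lambda>a. f a q) J) \<in> borel_measurable M"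
      unfolding L2_set_def using fm
      by (intro measurable_compose[OF _ borel_measurable_sqrt] borel_measurable_sum borel_measurable_power) auto
    show "AE q in M. norm (L2_set (\<lambda>a. f a q) J) \<le> norm (\<Sum>a\<in>J. \<bar>f a q\<bar>)"
      using L2_set_le_sum_abs by (auto simp: L2_set_nonneg sum_nonneg)
  qed (use f in auto)
  have "N * N = (\<Sum>a\<in>J. ?I a * ?I a)"
    unfolding N_def L2_set_def by (simp add: sum_nonneg power2_eq_square)
  also have "\<dots> = (LINT q|M. (\<Sum>a\<in>J. ?I a * f a q))"
    using f by (subst Bochner_Integration.integral_sum) auto
  also have "\<dots> \<le> (LINT q|M. N * L2_set (\<lambda>a. f a q) J)"
  proof (intro integral_mono Bochner_Integration.integrable_sum integrable_mult_right f int)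
    fix q
    have "(\<Sum>a\<in>J. ?I a * f a q) \<le> (\<Sum>a\<in>J. \<bar>?I a\<bar> * \<bar>f a q\<bar>)"
      by (intro sum_mono) (metis abs_ge_self abs_mult)
    also have "\<dots> \<le> N * L2_set (\<lambda>a. f a q) J" unfolding N_def by (rule L2_set_mult_ineq)
    finally show "(\<Sum>a\<in>J. ?I a * f a q) \<le> N * L2_set (\<lambda>a. f a q) J" .
  qed
  also have "\<dots> = N * (LINT q|M. L2_set (\<lambda>a. f a q) J)" by simp
  finally have "N * N \<le> N * (LINT q|M. L2_set (\<lambda>a. f a q) J)" .
  moreover have "0 \<le> N" by (simp add: N_def L2_set_nonneg)
  moreover have "0 \<le> (LINT q|M. L2_set (\<lambda>a. f a q) J)"
    by (intro integral_nonneg_AE AE_I2) (simp add: L2_set_nonneg)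
  ultimately show ?thesis unfolding N_def[symmetric]
    by (cases "N = 0") (auto simp: mult_le_cancel_left_pos)
qed

subsection \<open>Cutoffs and partitions of unity\<close>

lemma compactin_sp_top_finite_measure:
  assumes "compactin (sp_top n) C"
  shows "emeasure (sp_borel n) C < \<infinity>"
proof -
  have "\<exists>b. \<forall>x\<in>C. \<bar>x i\<bar> \<le> b" if "i < n" for i
  proof -
    have "compactin euclideanreal ((\<lambda>x. x i) ` C)"
      by (rule image_compactin[OF assms sp_coord_continuous[OF that]])
    then have "bounded ((\<lambda>x. x i) ` C)" by (simp add: compact_imp_bounded)
    then show ?thesis unfolding bounded_iff by auto
  qed
  then obtain b where b: "\<And>i x. i < n \<Longrightarrow> x \<in> C \<Longrightarrow> \<bar>x i\<bar> \<le> b i" by metis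
  have "C \<subseteq> topspace (sp_top n)" using assms by (rule compactin_subset_topspace)
  then have "C \<subseteq> (\<Pi>\<^sub>E i\<in>{..<n}. {- b i..b i})" using b by (auto simp: PiE_iff abs_le_iff minus_le_iff)
  then have "emeasure (sp_borel n) C \<le> emeasure (sp_borel n) (\<Pi>\<^sub>E i\<in>{..<n}. {- b i..b i})"
    unfolding sp_borel_def by (intro emeasure_mono sets_PiM_I_finite) auto
  also have "\<dots> < \<infinity>"
    unfolding sp_borel_def by (subst sp_prod.emeasure_PiM) (auto simp: ennreal_prod_eq_top less_top[symmetric] emeasure_lborel_Icc_eq)
  finally show ?thesis .
qed

lemma
  assumes "0 < \<epsilon>"
  shows integrable_sp_mol: "integrable (sp_borel n) (\<lambda>y. sp.ker n (\<lambda>_. mol \<epsilon>) x y)"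
    and integral_sp_mol: "(LINT y|sp_borel n. sp.ker n (\<lambda>_. mol \<epsilon>) x y) = 1"
    and sp_mol_nonneg: "0 \<le> sp.ker n (\<lambda>_. mol \<epsilon>) x y"
proof -
  have nn: "0 \<le> sp.ker n (\<lambda>_. mol \<epsilon>) x y" for y
    unfolding sp.ker_def by (intro prod_nonneg) (simp add: mol_nonneg assms)
  then show "0 \<le> sp.ker n (\<lambda>_. mol \<epsilon>) x y" .
  have *: "(\<integral>\<^sup>+y. ennreal (sp.ker n (\<lambda>_. mol \<epsilon>) x y) \<partial>sp_borel n) = ennreal 1"
    using nn_integral_sp_ker(1)[of n "\<lambda>_. mol \<epsilon>" x] mol_Cb nn assms by (simp add: mol_nonneg nn_integral_mol)
  have m: "(\<lambda>y. sp.ker n (\<lambda>_. mol \<epsilon>) x y) \<in> borel_measurable (sp_borel n)"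
    by (rule sp.ker_measurable) (auto simp: mol_Cb)
  show "integrable (sp_borel n) (\<lambda>y. sp.ker n (\<lambda>_. mol \<epsilon>) x y)"
    using * nn by (intro integrableI_nonneg m) auto
  show "(LINT y|sp_borel n. sp.ker n (\<lambda>_. mol \<epsilon>) x y) = 1"
    using * nn m by (subst integral_eq_nn_integral) auto
qed

lemma sp_mol_eq_0:
  assumes "0 < \<epsilon>" "i < n" "\<epsilon> \<le> \<bar>y i - x i\<bar>"
  shows "sp.ker n (\<lambda>_. mol \<epsilon>) x y = 0"
  unfolding sp.ker_def using assms mol_eq_0[of \<epsilon> "x i - y i"]
  by (intro prod_zero) (auto simp: abs_minus_commute)

lemma sp_exhaustion_mono:
  assumes "sp_exhaustion n \<Omega> K s" "k \<le> l"
  shows "K k \<subseteq> K l"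
proof (rule lift_Suc_mono_le[OF _ assms(2)])
  show "K k \<subseteq> K (Suc k)" for k
  proof
    fix x assume x: "x \<in> K k"
    have "compactin (sp_top n) (K k)" "0 < s k" using assms(1) by (auto simp: sp_exhaustion_def)
    then have "x \<in> topspace (sp_top n)" "\<forall>i<n. \<bar>x i - x i\<bar> \<le> s k"
      using x compactin_subset_topspace[of "sp_top n" "K k"] by (auto simp del: topspace_sp_top)
    then show "x \<in> K (Suc k)" using assms(1) x unfolding sp_exhaustion_def by blast
  qed
qed

text \<open>Taking every second set leaves an intermediate compact set between consecutive members;
  the cutoffs are mollifications of its indicator.\<close>

lemma sp_exhaustion_even:
  assumes "sp_exhaustion n \<Omega> K s"
  shows "sp_exhaustion n \<Omega> (\<lambda>k. K (2 * k)) (\<lambda>k. s (2 * k))"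
proof -
  have "s (2 * Suc k) \<le> s (2 * k)" for k
    using assms order_trans[of "s (Suc (Suc (2 * k)))" "s (Suc (2 * k))" "s (2 * k)"] by (simp add: sp_exhaustion_def)
  moreover have "y \<in> K (2 * Suc k)"
    if "x \<in> K (2 * k)" "y \<in> topspace (sp_top n)" "\<forall>i<n. \<bar>y i - x i\<bar> \<le> s (2 * k)" for x y k
  proof -
    have "y \<in> K (Suc (2 * k))" using assms that unfolding sp_exhaustion_def by blast
    then show ?thesis using sp_exhaustion_mono[OF assms, of "Suc (2 * k)" "2 * Suc k"] by auto
  qed
  moreover have "\<exists>N. C \<subseteq> K (2 * N)" if C: "compactin (sp_top n) C" "C \<subseteq> \<Omega>" for C
  proof -
    obtain N where "C \<subseteq> K N" using assms C unfolding sp_exhaustion_def by blast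
    then show ?thesis using sp_exhaustion_mono[OF assms, of N "2 * N"] by auto
  qed
  moreover have "compactin (sp_top n) (K (2 * k))" "K (2 * k) \<subseteq> \<Omega>" "0 < s (2 * k)" for k
    using assms unfolding sp_exhaustion_def by blast+
  ultimately show ?thesis unfolding sp_exhaustion_def by (simp del: topspace_sp_top)
qed

text \<open>The cutoffs to be constructed vary in space only, but they are placed in the space-time
  algebra so that they can be multiplied there with the mollified functions. The last clause
  supplies the constants in front of the commutators.\<close>

definition sp_cutoffs :: "nat \<Rightarrow> (nat \<Rightarrow> point set) \<Rightarrow> (nat \<Rightarrow> real \<times> point \<Rightarrow> real) \<Rightarrow> bool" where
  "sp_cutoffs n A \<theta> \<longleftrightarrow> (\<forall>k. \<theta> k \<in> st.smooth_alg n (st_borel n) st_coord \<and>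
      (\<forall>z\<in>topspace (st_top n). 0 \<le> \<theta> k z \<and> \<theta> k z \<le> 1 \<and> (snd z \<in> A k \<longrightarrow> \<theta> k z = 1) \<and> (snd z \<notin> A (Suc k) \<longrightarrow> \<theta> k z = 0)) \<and>
      (\<exists>C\<ge>0. \<forall>i<n. \<forall>z. \<bar>partial st_move (Some i) (\<theta> k) z\<bar> \<le> C))"

lemma sp_cutoffs_exist:
  assumes exh: "sp_exhaustion n \<Omega> K s"
  shows "\<exists>\<theta>. sp_cutoffs n (\<lambda>k. K (2 * k)) \<theta>"
proof -
  have "\<exists>\<theta>. \<theta> \<in> st.smooth_alg n (st_borel n) st_coord \<and>
      (\<forall>z\<in>topspace (st_top n). 0 \<le> \<theta> z \<and> \<theta> z \<le> 1 \<and> (snd z \<in> K (2 * k) \<longrightarrow> \<theta> z = 1) \<and> (snd z \<notin> K (2 * Suc k) \<longrightarrow> \<theta> z = 0)) \<and>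
      (\<exists>C\<ge>0. \<forall>i<n. \<forall>z. \<bar>partial st_move (Some i) \<theta> z\<bar> \<le> C)" for k
  proof -
    define C where "C = K (Suc (2 * k))"
    \<comment> \<open>Since the margins decrease, this width respects both of them: from K (2 * k)
      into C and from C into K (2 * Suc k).\<close>
    define \<rho> where "\<rho> = s (Suc (2 * k))"
    \<comment> \<open>With density on the unit time interval and time factor 1, the space-time
      convolution is independent of t and equals the spatial mollification \<open>c\<close> of the
      indicator of C. This puts a purely spatial cutoff into the space-time algebra.\<close>
    define v :: "real \<times> point \<Rightarrow> real" where "v q = indicator {0..1} (fst q) * indicator C (snd q)" for q
    define \<kappa> :: "nat option \<Rightarrow> real \<Rightarrow> real" where "\<kappa> d = (case d of None \<Rightarrow> (\<lambda>_. 1) | Some _ \<Rightarrow> mol \<rho>)" for d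
    have \<rho>: "0 < \<rho>" "\<rho> \<le> s (2 * k)" using exh by (auto simp: \<rho>_def sp_exhaustion_def)
    have cC: "compactin (sp_top n) C" using exh by (simp add: C_def sp_exhaustion_def)
    have Cs [measurable]: "C \<in> sets (sp_borel n)" by (rule compactin_sp_top_sets[OF cC])
    have iC: "integrable (sp_borel n) (indicator C :: point \<Rightarrow> real)"
      using compactin_sp_top_finite_measure[OF cC] Cs by (intro integrable_real_indicator)
    have \<kappa>: "\<forall>d\<in>st_dirs n. \<kappa> d \<in> Cb" by (auto simp: \<kappa>_def mol_Cb Cb_const split: option.split)
    have v: "integrable (st_borel n) v"
    proof -
      have "v = indicator ({0..1} \<times> C)" by (auto simp: v_def indicator_def fun_eq_iff)
      moreover have "emeasure (st_borel n) ({0..1} \<times> C) = 1 * emeasure (sp_borel n) C"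
        unfolding st_borel_def by (subst sp_sigma.emeasure_pair_measure_Times) (auto simp: Cs)
      moreover have "{0..1} \<times> C \<in> sets (st_borel n)" unfolding st_borel_def by (rule pair_measureI) (auto simp: Cs)
      ultimately show ?thesis using compactin_sp_top_finite_measure[OF cC]
        by (simp only: mult_1 integrable_real_indicator)
    qed
    define c where "c x = (LINT y|sp_borel n. indicator C y * sp.ker n (\<lambda>_. mol \<rho>) x y)" for x
    have ic: "integrable (sp_borel n) (\<lambda>y. indicator C y * sp.ker n (\<lambda>_. mol \<rho>) x y)" for x
      by (rule Bochner_Integration.integrable_bound[OF integrable_sp_mol[OF \<rho>(1), of n x]])
        (use Cs integrable_sp_mol[OF \<rho>(1), of n x] in \<open>auto simp: indicator_def\<close>)
    have eq: "st_conv n \<kappa> v (t, x) = c x" for t x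
    proof -
      have i: "integrable (lborel \<Otimes>\<^sub>M sp_borel n) (\<lambda>q. v q * st.ker n \<kappa> (t, x) (st_coord q))"
        using integrable_st_ker[OF \<kappa> v] by (simp add: st_borel_def)
      have "st_conv n \<kappa> v (t, x) = (LINT a|lborel. LINT y|sp_borel n. v (a, y) * st.ker n \<kappa> (t, x) (st_coord (a, y)))"
        unfolding st_conv_def using st_pair.integral_fst'[OF i] by (simp add: st_borel_def)
      also have "\<dots> = (LINT a|lborel. indicator {0..1::real} a * c x)"
      proof (rule Bochner_Integration.integral_cong[OF refl])
        fix a
        have "v (a, y) * st.ker n \<kappa> (t, x) (st_coord (a, y)) = indicator {0..1} a * (indicator C y * sp.ker n (\<lambda>_. mol \<rho>) x y)" for y
          by (simp add: v_def st_ker_pair \<kappa>_def)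
        then show "(LINT y|sp_borel n. v (a, y) * st.ker n \<kappa> (t, x) (st_coord (a, y))) = indicator {0..1} a * c x"
          by (simp add: c_def)
      qed
      also have "\<dots> = c x" by simp
      finally show ?thesis .
    qed
    have c0: "0 \<le> c x" for x
      unfolding c_def by (intro integral_nonneg_AE AE_I2) (simp add: sp_mol_nonneg[OF \<rho>(1)])
    have c1: "c x = 1" if x: "x \<in> K (2 * k)" for x
    proof -
      have "c x = (LINT y|sp_borel n. sp.ker n (\<lambda>_. mol \<rho>) x y)"
        unfolding c_def
      proof (rule Bochner_Integration.integral_cong[OF refl])
        fix y assume y: "y \<in> space (sp_borel n)"
        show "indicator C y * sp.ker n (\<lambda>_. mol \<rho>) x y = sp.ker n (\<lambda>_. mol \<rho>) x y"
        proof (cases "\<exists>i<n. \<rho> \<le> \<bar>y i - x i\<bar>")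
          case True
          then show ?thesis using sp_mol_eq_0[OF \<rho>(1)] by auto
        next
          case False
          then have "\<forall>i<n. \<bar>y i - x i\<bar> \<le> s (2 * k)" using \<rho>(2) by (auto simp: not_le)
          then have "y \<in> C" using exh x y unfolding sp_exhaustion_def C_def by fastforce
          then show ?thesis by simp
        qed
      qed
      then show ?thesis by (simp add: integral_sp_mol[OF \<rho>(1)])
    qed
    have c2: "c x = 0" if x: "x \<in> topspace (sp_top n)" "x \<notin> K (2 * Suc k)" for x
    proof -
      have "indicator C y * sp.ker n (\<lambda>_. mol \<rho>) x y = 0" for y
      proof (cases "y \<in> C")
        case True
        have "\<exists>i<n. \<rho> < \<bar>x i - y i\<bar>"
        proof (rule ccontr)
          assume "\<not> ?thesis"
          then have "\<forall>i<n. \<bar>x i - y i\<bar> \<le> s (Suc (2 * k))" unfolding \<rho>_def by (meson not_less)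
          then have "x \<in> K (Suc (Suc (2 * k)))" using exh x(1) True unfolding sp_exhaustion_def C_def by blast
          then show False using x(2) by simp
        qed
        then obtain i where "i < n" "\<rho> \<le> \<bar>y i - x i\<bar>" by (auto simp: abs_minus_commute)
        then show ?thesis using sp_mol_eq_0[OF \<rho>(1)] by simp
      qed simp
      then show ?thesis unfolding c_def by (simp only: Bochner_Integration.integral_zero)
    qed
    have c3: "c x \<le> 1" for x
      unfolding c_def integral_sp_mol[OF \<rho>(1), of n x, symmetric]
      by (intro integral_mono ic integrable_sp_mol \<rho>) (auto simp: indicator_def sp_mol_nonneg[OF \<rho>(1)])
    have bd: "\<exists>D\<ge>0. \<forall>i<n. \<forall>z. \<bar>partial st_move (Some i) (st_conv n \<kappa> v) z\<bar> \<le> D"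
    proof -
      have "\<exists>D. \<forall>z. \<bar>partial st_move (Some i) (st_conv n \<kappa> v) z\<bar> \<le> D" if i: "i < n" for i
      proof -
        have "\<forall>d\<in>st_dirs n. (\<kappa>(Some i := deriv (\<kappa> (Some i)))) d \<in> Cb"
          using \<kappa> i by (auto intro!: Cb_deriv)
        from st_conv_bounded[OF this v] obtain D where
          "\<forall>z. \<bar>st_conv n (\<kappa>(Some i := deriv (\<kappa> (Some i)))) v z\<bar> \<le> D" by blast
        then show ?thesis unfolding partial_def DERIV_imp_deriv[OF st_conv_DERIV[OF \<kappa> v i]] by (rule exI)
      qed
      then obtain D where D: "\<And>i. i < n \<Longrightarrow> \<forall>z. \<bar>partial st_move (Some i) (st_conv n \<kappa> v) z\<bar> \<le> D i" by metis
      show ?thesis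
      proof (intro exI[of _ "\<Sum>i<n. \<bar>D i\<bar>"] conjI allI impI)
        fix i z assume i: "i < n"
        have "\<bar>partial st_move (Some i) (st_conv n \<kappa> v) z\<bar> \<le> \<bar>D i\<bar>" using D[OF i] abs_ge_self order_trans by blast
        also have "\<dots> \<le> (\<Sum>i<n. \<bar>D i\<bar>)" using i by (intro member_le_sum) auto
        finally show "\<bar>partial st_move (Some i) (st_conv n \<kappa> v) z\<bar> \<le> (\<Sum>i<n. \<bar>D i\<bar>)" .
      qed (simp add: sum_nonneg)
    qed
    show ?thesis
    proof (intro exI[of _ "st_conv n \<kappa> v"] conjI ballI bd st_conv_smooth_alg \<kappa> v)
      fix z assume "z \<in> topspace (st_top n)"
      then obtain t x where z: "z = (t, x)" "x \<in> topspace (sp_top n)" by auto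
      show "0 \<le> st_conv n \<kappa> v z" "st_conv n \<kappa> v z \<le> 1" "snd z \<in> K (2 * k) \<longrightarrow> st_conv n \<kappa> v z = 1"
        "snd z \<notin> K (2 * Suc k) \<longrightarrow> st_conv n \<kappa> v z = 0"
        using c0 c1 c2 c3 z(2) unfolding z(1) eq by auto
    qed (use \<kappa> in blast)
  qed
  then show ?thesis unfolding sp_cutoffs_def by metis
qed

section \<open>Space-time mollifiers and the kernels of their differences\<close>

definition ker_mol :: "real \<Rightarrow> real \<Rightarrow> nat option \<Rightarrow> real \<Rightarrow> real" where
  "ker_mol \<delta> \<epsilon> d = (case d of None \<Rightarrow> mol \<delta> | Some _ \<Rightarrow> mol \<epsilon>)"

text \<open>
  The kernels interpolating between the mollifiers of widths \<open>\<epsilon>\<close> and \<open>\<epsilon>'\<close>; consecutive ones differ by a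
  partial derivative of \<open>ker_gap\<close>.
\<close>

definition ker_mix :: "real \<Rightarrow> real \<Rightarrow> real \<Rightarrow> nat \<Rightarrow> nat option \<Rightarrow> real \<Rightarrow> real" where
  "ker_mix \<delta> \<epsilon> \<epsilon>' l d = (case d of None \<Rightarrow> mol \<delta> | Some j \<Rightarrow> if j < l then mol \<epsilon>' else mol \<epsilon>)"

definition ker_gap :: "real \<Rightarrow> real \<Rightarrow> real \<Rightarrow> nat \<Rightarrow> nat option \<Rightarrow> real \<Rightarrow> real" where
  "ker_gap \<delta> \<epsilon> \<epsilon>' l d = (case d of None \<Rightarrow> mol \<delta>
     | Some j \<Rightarrow> if j < l then mol \<epsilon>' else if j = l then mol_gap \<epsilon> \<epsilon>' else mol \<epsilon>)"

lemma kernel_family_mol: "0 < \<epsilon> \<Longrightarrow> \<epsilon> \<le> r \<Longrightarrow> kernel_family n r (ker_mol \<delta> \<epsilon>)"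
  by (auto simp: kernel_family_def ker_mol_def mol_Cb mol_eq_0 split: option.split)

lemma kernel_family_mix:
  "0 < \<epsilon> \<Longrightarrow> \<epsilon> \<le> r \<Longrightarrow> 0 < \<epsilon>' \<Longrightarrow> \<epsilon>' \<le> r \<Longrightarrow> kernel_family n r (ker_mix \<delta> \<epsilon> \<epsilon>' l)"
  by (auto simp: kernel_family_def ker_mix_def mol_Cb mol_eq_0 split: option.split)

lemma kernel_family_gap:
  "0 < \<epsilon> \<Longrightarrow> \<epsilon> \<le> r \<Longrightarrow> 0 < \<epsilon>' \<Longrightarrow> \<epsilon>' \<le> r \<Longrightarrow> kernel_family n r (ker_gap \<delta> \<epsilon> \<epsilon>' l)"
  by (auto simp: kernel_family_def ker_gap_def mol_Cb mol_gap_Cb mol_eq_0 mol_gap_eq_0 split: option.split)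

lemma st_ker_mix_0: "st.ker n (ker_mix \<delta> \<epsilon> \<epsilon>' 0) = st.ker n (ker_mol \<delta> \<epsilon>)"
  by (simp add: ker_mix_def[abs_def] ker_mol_def[abs_def])

lemma st_ker_mix_n: "st.ker n (ker_mix \<delta> \<epsilon> \<epsilon>' n) z c = st.ker n (ker_mol \<delta> \<epsilon>') z c"
  unfolding st_ker_split by (simp add: ker_mix_def ker_mol_def)

text \<open>Only the l-th factor changes, and \<open>mol_gap\<close> is the antiderivative of that
  change. The difference is thus a spatial derivative, to which integration by parts
  applies.\<close>

lemma st_ker_mix_diff:
  assumes l: "l < n"
  shows "st.ker n (ker_mix \<delta> \<epsilon> \<epsilon>' l) z c - st.ker n (ker_mix \<delta> \<epsilon> \<epsilon>' (Suc l)) z c =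
    st.ker n ((ker_gap \<delta> \<epsilon> \<epsilon>' l)(Some l := deriv (ker_gap \<delta> \<epsilon> \<epsilon>' l (Some l)))) z c"
proof -
  define a where "a i = st_coord z (Some i) - c (Some i)" for i
  define P where "P = (\<Prod>i\<in>{..<n} - {l}. (if i < l then mol \<epsilon>' else mol \<epsilon>) (a i))"
  define t where "t = st_coord z None - c None"
  have "st.ker n (ker_mix \<delta> \<epsilon> \<epsilon>' l) z c = mol \<delta> t * (mol \<epsilon> (a l) * P)"
    unfolding st_ker_split P_def t_def a_def using l
    by (subst prod.remove[of _ l]) (auto simp: ker_mix_def)
  moreover have "st.ker n (ker_mix \<delta> \<epsilon> \<epsilon>' (Suc l)) z c = mol \<delta> t * (mol \<epsilon>' (a l) * P)"
    unfolding st_ker_split P_def t_def a_def using l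
    by (subst prod.remove[of _ l]) (auto simp: ker_mix_def less_Suc_eq intro!: prod.cong)
  moreover have "st.ker n ((ker_gap \<delta> \<epsilon> \<epsilon>' l)(Some l := deriv (ker_gap \<delta> \<epsilon> \<epsilon>' l (Some l)))) z c
      = mol \<delta> t * ((mol \<epsilon> (a l) - mol \<epsilon>' (a l)) * P)"
    unfolding st_ker_split P_def t_def a_def using l
    by (subst prod.remove[of _ l]) (auto simp: ker_gap_def deriv_mol_gap intro!: prod.cong split: if_splits)
  ultimately show ?thesis by (simp add: algebra_simps)
qed

lemma st_ker_mol_nonneg: "0 < \<delta> \<Longrightarrow> 0 < \<epsilon> \<Longrightarrow> 0 \<le> st.ker n (ker_mol \<delta> \<epsilon>) z c"
  unfolding st_ker_split by (intro mult_nonneg_nonneg prod_nonneg) (auto simp: ker_mol_def mol_nonneg)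

lemma nn_integral_ker_mol:
  assumes "0 < \<delta>" "0 < \<epsilon>"
  shows "(\<integral>\<^sup>+q. ennreal (st.ker n (ker_mol \<delta> \<epsilon>) z (st_coord q)) \<partial>st_borel n) = 1"
  using nn_integral_st_ker(1)[of n "ker_mol \<delta> \<epsilon>" z] kernel_familyD(1)[OF kernel_family_mol[OF assms(2) order_refl]]
    st_ker_mol_nonneg[OF assms]
  by (simp add: ker_mol_def mol_nonneg nn_integral_mol assms)

text \<open>All factors except the l-th are mollifiers of mass 1, so the mass is that of a single
  \<open>mol_gap\<close>.\<close>

lemma
  assumes "0 < \<delta>" "0 < \<epsilon>" "0 < \<epsilon>'" "l < n"
  shows nn_integral_ker_gap_snd: "(\<integral>\<^sup>+q. ennreal \<bar>st.ker n (ker_gap \<delta> \<epsilon> \<epsilon>' l) z (st_coord q)\<bar> \<partial>st_borel n) \<le> ennreal (2 * (\<epsilon> + \<epsilon>'))" (is ?A)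
    and nn_integral_ker_gap_fst: "(\<integral>\<^sup>+q. ennreal \<bar>st.ker n (ker_gap \<delta> \<epsilon> \<epsilon>' l) q (st_coord z)\<bar> \<partial>st_borel n) \<le> ennreal (2 * (\<epsilon> + \<epsilon>'))" (is ?B)
proof -
  have k: "ker_gap \<delta> \<epsilon> \<epsilon>' l d \<in> Cb" for d by (auto simp: ker_gap_def mol_Cb mol_gap_Cb split: option.split)
  have "(\<Prod>i<n. \<integral>\<^sup>+s. ennreal \<bar>ker_gap \<delta> \<epsilon> \<epsilon>' l (Some i) s\<bar> \<partial>lborel) = (\<integral>\<^sup>+s. ennreal \<bar>mol_gap \<epsilon> \<epsilon>' s\<bar> \<partial>lborel)"
  proof -
    have "(\<integral>\<^sup>+s. ennreal \<bar>ker_gap \<delta> \<epsilon> \<epsilon>' l (Some i) s\<bar> \<partial>lborel) = 1" if "i \<noteq> l" for i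
      using assms that by (cases "i < l") (auto simp: ker_gap_def mol_nonneg nn_integral_mol)
    then show ?thesis using assms by (subst prod.remove[of _ l]) (auto simp: ker_gap_def)
  qed
  then have "(\<integral>\<^sup>+s. ennreal \<bar>ker_gap \<delta> \<epsilon> \<epsilon>' l None s\<bar> \<partial>lborel) * (\<Prod>i<n. \<integral>\<^sup>+s. ennreal \<bar>ker_gap \<delta> \<epsilon> \<epsilon>' l (Some i) s\<bar> \<partial>lborel) \<le> ennreal (2 * (\<epsilon> + \<epsilon>'))"
    using assms nn_integral_mol_gap[OF assms(2,3)] by (simp add: ker_gap_def mol_nonneg nn_integral_mol)
  then show ?A ?B using nn_integral_st_ker[of n "ker_gap \<delta> \<epsilon> \<epsilon>' l" z] k by simp_all
qed

lemma partial_eq_0_local: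
  assumes d: "d \<in> st_dirs n" and V: "openin (st_top n) V" "z \<in> V" "\<And>q. q \<in> V \<Longrightarrow> f q = c"
  shows "partial st_move d f z = 0"
proof -
  have "\<forall>\<^sub>F s in nhds 0. f (st_move d z s) = c"
    using st.eventually_move[OF d V(1,2)] by eventually_elim (rule V(3))
  then have "((\<lambda>s. f (st_move d z s)) has_real_derivative 0) (at 0) \<longleftrightarrow> ((\<lambda>s. c) has_real_derivative 0) (at 0)"
    by (intro DERIV_cong_ev) auto
  then show ?thesis unfolding partial_def by (intro DERIV_imp_deriv) simp
qed

text \<open>Used with a k the derivative of \<theta> k, it moves the difference from the cutoffs to
  the mollified functions. The index -1 stands for the value 0, and the boundary term disappears
  wherever a N does.\<close>

lemma abel_summation:
  fixes a M :: "nat \<Rightarrow> real"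
  shows "(\<Sum>k<Suc N. (a k - (if k = 0 then 0 else a (k - 1))) * M k) = (\<Sum>k<N. a k * (M k - M (Suc k))) + a N * M N"
  by (induction N) (auto simp: algebra_simps)

text \<open>u and g stand for function and gradient after the cut in time. Each operation shifts the
  index by one: \<beta> k lives on A (Suc k), and a box of radius r (Suc k) around a point of that
  set stays in A (Suc (Suc k)). Hence the form of the bound on \<epsilon> k.\<close>

locale mollification =
  fixes n m :: nat and \<Omega> :: "point set" and A :: "nat \<Rightarrow> point set" and r :: "nat \<Rightarrow> real"
    and \<theta> :: "nat \<Rightarrow> real \<times> point \<Rightarrow> real" and \<delta> :: real and \<epsilon> :: "nat \<Rightarrow> real"
    and u :: "real \<times> point \<Rightarrow> nat \<Rightarrow> real" and g :: "real \<times> point \<Rightarrow> nat \<times> nat \<Rightarrow> real"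
  assumes openin_\<Omega>: "openin (sp_top n) \<Omega>"
    and exh: "sp_exhaustion n \<Omega> A r" and cut: "sp_cutoffs n A \<theta>"
    and \<delta>: "0 < \<delta>" and \<epsilon>: "\<And>k. 0 < \<epsilon> k" "\<And>k. \<epsilon> k \<le> r (Suc k)"
    and u: "\<And>j k. j < m \<Longrightarrow> integrable (st_borel n) (loc (A k) (\<lambda>z. u z j))"
    and g: "\<And>j i k. j < m \<Longrightarrow> i < n \<Longrightarrow> integrable (st_borel n) (loc (A k) (\<lambda>z. g z (j, i)))"
    and weak: "\<And>j i. j < m \<Longrightarrow> i < n \<Longrightarrow> AE t in lborel. \<forall>\<psi>. test_function n \<Omega> \<psi> \<longrightarrow>
       (LINT x|sp_borel n. u (t, x) j * partial sp_move i \<psi> x) = - (LINT x|sp_borel n. g (t, x) (j, i) * \<psi> x)"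
begin

lemmas A_mono = sp_exhaustion_mono[OF exh]

lemma A_compact: "compactin (sp_top n) (A k)" and A_subset: "A k \<subseteq> \<Omega>" and r_pos: "0 < r k" and r_Suc: "r (Suc k) \<le> r k"
  using exh by (auto simp: sp_exhaustion_def)

lemma A_topspace: "A k \<subseteq> topspace (sp_top n)"
  by (rule compactin_subset_topspace[OF A_compact])

lemma A_Suc:
  assumes "x \<in> A k" "y \<in> topspace (sp_top n)" "\<And>i. i < n \<Longrightarrow> \<bar>y i - x i\<bar> \<le> r k"
  shows "y \<in> A (Suc k)"
  using exh assms unfolding sp_exhaustion_def by blast

lemma A_cover:
  assumes "x \<in> \<Omega>" obtains N where "x \<in> A N"
proof -
  have "x \<in> topspace (sp_top n)" using openin_subset[OF openin_\<Omega>] assms by blast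
  then have "compactin (sp_top n) {x}" by (simp only: compactin_sing)
  then obtain N where "{x} \<subseteq> A N" using exh assms unfolding sp_exhaustion_def by (meson empty_subsetI insert_subset)
  then show thesis using that by blast
qed

lemma \<theta>_alg: "\<theta> k \<in> st.smooth_alg n (st_borel n) st_coord"
  using cut by (simp add: sp_cutoffs_def)

lemma \<theta>_nonneg: "z \<in> topspace (st_top n) \<Longrightarrow> 0 \<le> \<theta> k z"
  and \<theta>_le_1: "z \<in> topspace (st_top n) \<Longrightarrow> \<theta> k z \<le> 1"
  and \<theta>_1: "z \<in> topspace (st_top n) \<Longrightarrow> snd z \<in> A k \<Longrightarrow> \<theta> k z = 1"
  and \<theta>_0: "z \<in> topspace (st_top n) \<Longrightarrow> snd z \<notin> A (Suc k) \<Longrightarrow> \<theta> k z = 0"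
  using cut unfolding sp_cutoffs_def by blast+

lemma nbhd:
  assumes "z \<in> topspace (st_top n)" "snd z \<in> A N"
  obtains V where "openin (st_top n) V" "z \<in> V" "\<And>q. q \<in> V \<Longrightarrow> q \<in> topspace (st_top n) \<and> snd q \<in> A (Suc N)"
proof -
  let ?W = "{y \<in> topspace (sp_top n). \<forall>i<n. \<bar>y i - snd z i\<bar> < r N}"
  show thesis
  proof (rule that[of "(UNIV :: real set) \<times> ?W"])
    show "openin (st_top n) (UNIV \<times> ?W)"
      unfolding st_top_def by (rule openin_prod_Times_iff[THEN iffD2]) (use openin_sp_box in auto)
    show "z \<in> UNIV \<times> ?W" using assms r_pos[of N] by (cases z) auto
    fix q assume "q \<in> (UNIV :: real set) \<times> ?W"
    then show "q \<in> topspace (st_top n) \<and> snd q \<in> A (Suc N)"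
      using A_Suc[OF assms(2), of "snd q"] by (cases q) (auto simp: less_imp_le)
  qed
qed

definition \<beta> :: "nat \<Rightarrow> real \<times> point \<Rightarrow> real" where
  "\<beta> k z = \<theta> k z - (if k = 0 then 0 else \<theta> (k - 1) z)"

text \<open>Where \<theta> (k - 1) is nonzero, the point lies in A k, and there \<theta> k is
  already 1.\<close>

lemma \<beta>_nonneg: "z \<in> topspace (st_top n) \<Longrightarrow> 0 \<le> \<beta> k z"
proof -
  assume z: "z \<in> topspace (st_top n)"
  show ?thesis
  proof (cases "k = 0 \<or> \<theta> (k - 1) z = 0")
    case True then show ?thesis using \<theta>_nonneg[OF z, of k] by (auto simp: \<beta>_def)
  next
    case False
    then have "snd z \<in> A k" using \<theta>_0[OF z, of "k - 1"] by auto
    then show ?thesis using \<theta>_1[OF z, of k] \<theta>_le_1[OF z, of "k - 1"] by (auto simp: \<beta>_def)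
  qed
qed

lemma \<beta>_support:
  assumes z: "z \<in> topspace (st_top n)" and "\<beta> k z \<noteq> 0"
  shows "snd z \<in> A (Suc k)"
proof (rule ccontr)
  assume no: "snd z \<notin> A (Suc k)"
  then have "\<theta> k z = 0" by (rule \<theta>_0[OF z])
  moreover have "\<theta> (k - 1) z = 0" if "k \<noteq> 0"
    using no A_mono[of k "Suc k"] that by (intro \<theta>_0[OF z]) auto
  ultimately show False using assms(2) by (simp add: \<beta>_def split: if_splits)
qed

lemma \<beta>_eq_0:
  assumes z: "z \<in> topspace (st_top n)" and N: "snd z \<in> A N" "N < k"
  shows "\<beta> k z = 0"
proof -
  have "\<theta> k z = 1" using A_mono[of N k] N by (intro \<theta>_1[OF z]) auto
  moreover have "N \<le> k - 1" using N by simp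
  then have "\<theta> (k - 1) z = 1" using A_mono[of N "k - 1"] N by (intro \<theta>_1[OF z]) auto
  ultimately show ?thesis using N by (simp add: \<beta>_def)
qed

lemma sum_\<beta>: "(\<Sum>k<Suc N. \<beta> k z) = \<theta> N z"
  using abel_summation[of "\<lambda>k. \<theta> k z" "\<lambda>_. 1" N] by (simp add: \<beta>_def)

lemma \<beta>_alg: "\<beta> k \<in> st.smooth_alg n (st_borel n) st_coord"
proof (cases k)
  case 0 then show ?thesis using \<theta>_alg[of 0] by (simp add: \<beta>_def[abs_def])
next
  case (Suc l)
  then have "\<beta> k = (\<lambda>z. \<theta> k z + -1 * \<theta> l z)" by (simp add: \<beta>_def fun_eq_iff)
  then show ?thesis by (simp only:) (intro st.smooth_alg.add st.smooth_alg.scale \<theta>_alg)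
qed

text \<open>The localisation makes the convolution defined and smooth everywhere. By
  \<open>Mu_eq\<close> it is invisible on A (Suc k), which contains the support of \<beta>
  k.\<close>

definition Mu :: "nat \<Rightarrow> nat \<Rightarrow> real \<times> point \<Rightarrow> real" where
  "Mu k j = st_conv n (ker_mol \<delta> (\<epsilon> k)) (loc (A (Suc (Suc k))) (\<lambda>z. u z j))"

definition S :: "nat \<Rightarrow> nat \<Rightarrow> real \<times> point \<Rightarrow> real" where
  "S N j z = (\<Sum>k<N. \<beta> k z * Mu k j z)"

text \<open>At each point of \<Omega> only finitely many terms are nonzero, with a bound that
  depends on the point. The least N provides one, and by \<open>B_eq\<close> any larger bound gives
  the same value.\<close>

definition B :: "real \<times> point \<Rightarrow> nat \<Rightarrow> real" where
  "B z j = S (Suc (LEAST N. snd z \<in> A N)) j z"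

lemma ker_mol_Cb: "\<forall>d\<in>st_dirs n. ker_mol \<delta> e d \<in> Cb"
  by (auto simp: ker_mol_def mol_Cb split: option.split)

lemma S_alg:
  assumes "j < m" shows "S N j \<in> st.smooth_alg n (st_borel n) st_coord"
proof (induction N)
  case 0
  have "S 0 j = (\<lambda>z. 0 * \<theta> 0 z)" by (simp add: S_def fun_eq_iff)
  then show ?case using st.smooth_alg.scale[OF \<theta>_alg[of 0], of 0] by (simp only:)
next
  case (Suc N)
  have "S (Suc N) j = (\<lambda>z. S N j z + \<beta> N z * Mu N j z)" by (simp add: S_def fun_eq_iff)
  then show ?case unfolding Mu_def
    by (simp only:) (intro st.smooth_alg.add Suc st.smooth_alg.mult \<beta>_alg st_conv_smooth_alg ker_mol_Cb u assms)
qed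

lemma B_eq:
  assumes z: "z \<in> topspace (st_top n)" "snd z \<in> A N" and M: "N < M"
  shows "B z j = S M j z"
proof -
  define L where "L = (LEAST N. snd z \<in> A N)"
  have L: "snd z \<in> A L" "L \<le> N" unfolding L_def using z(2) by (auto intro: LeastI Least_le)
  have "S M j z = (\<Sum>k<Suc L. \<beta> k z * Mu k j z)"
    unfolding S_def using L M \<beta>_eq_0[OF z(1) L(1)] by (intro sum.mono_neutral_right) (auto simp: not_less)
  then show ?thesis by (simp add: B_def L_def S_def)
qed

text \<open>Near a point of A N all points lie in A (Suc N), so a single finite sum of members of
  the algebra represents B on a whole neighbourhood.\<close>

lemma B_smooth:
  assumes j: "j < m"
  shows "st_smooth n (UNIV \<times> \<Omega>) (\<lambda>z. a * B z j)"
  unfolding st_smooth_def st_dirs_def[symmetric]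
proof (rule st.smooth_wrt_local)
  show "\<forall>d\<in>st_dirs n. (\<lambda>q. st_coord q d) \<in> borel_measurable (st_borel n)" using st_coord_measurable by blast
  show "openin (st_top n) (UNIV \<times> \<Omega>)"
    unfolding st_top_def using openin_\<Omega> by (intro openin_prod_Times_iff[THEN iffD2]) auto
  fix z :: "real \<times> point" assume "z \<in> UNIV \<times> \<Omega>"
  then have z: "snd z \<in> \<Omega>" by auto
  then obtain N where N: "snd z \<in> A N" using A_cover by blast
  have zt: "z \<in> topspace (st_top n)" using N A_topspace[of N] by (cases z) auto
  obtain V where V: "openin (st_top n) V" "z \<in> V" "\<And>q. q \<in> V \<Longrightarrow> q \<in> topspace (st_top n) \<and> snd q \<in> A (Suc N)"
    using nbhd[OF zt N] by blast
  show "\<exists>V g. openin (st_top n) V \<and> z \<in> V \<and> g \<in> st.smooth_alg n (st_borel n) st_coord \<and> (\<forall>q\<in>V. a * B q j = g q)"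
    using V B_eq[of _ "Suc N" "Suc (Suc N)" j]
    by (intro exI[of _ V] exI[of _ "\<lambda>q. a * S (Suc (Suc N)) j q"] conjI st.smooth_alg.scale S_alg j ballI) auto
qed

lemma box_subset:
  assumes "x \<in> A k" "e \<le> r k" "y \<in> topspace (sp_top n)" "\<And>i. i < n \<Longrightarrow> \<bar>y i - x i\<bar> \<le> e"
  shows "y \<in> A (Suc k)"
  using assms by (intro A_Suc[of x]) (auto intro: order_trans)

lemma Mu_eq:
  assumes x: "x \<in> A (Suc k)"
  shows "Mu k j (t, x) = st_conv n (ker_mol \<delta> (\<epsilon> k)) (\<lambda>z. u z j) (t, x)"
  unfolding Mu_def
  by (rule st_conv_loc[OF kernel_family_mol[OF \<epsilon>(1) order_refl]])
    (use box_subset[OF x \<epsilon>(2)] in auto)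

text \<open>The derivative falls on the kernel, and integration by parts hands it to u, where it
  becomes g.\<close>

lemma Mu_DERIV:
  assumes x: "x \<in> A (Suc k)" and i: "i < n" and j: "j < m"
  shows "((\<lambda>s. Mu k j (st_move (Some i) (t, x) s)) has_real_derivative
     st_conv n (ker_mol \<delta> (\<epsilon> k)) (\<lambda>z. g z (j, i)) (t, x)) (at 0)"
proof -
  let ?k = "ker_mol \<delta> (\<epsilon> k)"
  have kf: "kernel_family n (\<epsilon> k) ?k" by (rule kernel_family_mol[OF \<epsilon>(1) order_refl])
  have bx: "y \<in> A (Suc (Suc k))" if "y \<in> topspace (sp_top n)" "\<And>i. i < n \<Longrightarrow> \<bar>y i - x i\<bar> \<le> \<epsilon> k" for y
    by (rule box_subset[OF x \<epsilon>(2) that])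
  have "st_conv n (?k(Some i := deriv (?k (Some i)))) (loc (A (Suc (Suc k))) (\<lambda>z. u z j)) (t, x)
      = st_conv n (?k(Some i := deriv (?k (Some i)))) (\<lambda>z. u z j) (t, x)"
    by (rule st_conv_loc[OF kernel_family_deriv[OF kf]]) (use bx in auto)
  also have "\<dots> = st_conv n ?k (\<lambda>z. g z (j, i)) (t, x)"
    by (rule st_conv_integration_by_parts[OF kf i _ bx A_subset u[OF j] g[OF j i] weak[OF j i]])
      (use x A_topspace in blast)
  finally show ?thesis
    using st_conv_DERIV[OF ker_mol_Cb u[OF j] i, of "\<epsilon> k" "Suc (Suc k)" "(t, x)"] unfolding Mu_def by simp
qed

text \<open>Telescope over the interpolating kernels, one coordinate at a time; every step is a
  derivative of a gap kernel, which integration by parts transfers to g. Here u itself disappears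
  from the commutators.\<close>

lemma Mu_diff:
  assumes x: "x \<in> A (Suc k)" and j: "j < m"
  shows "Mu k j (t, x) - Mu (Suc k) j (t, x) =
    (\<Sum>l<n. st_conv n (ker_gap \<delta> (\<epsilon> k) (\<epsilon> (Suc k)) l) (\<lambda>z. g z (j, l)) (t, x))"
proof -
  define T where "T l = ker_mix \<delta> (\<epsilon> k) (\<epsilon> (Suc k)) l" for l
  define R where "R l = ker_gap \<delta> (\<epsilon> k) (\<epsilon> (Suc k)) l" for l
  have \<epsilon>': "\<epsilon> (Suc k) \<le> r (Suc k)" using \<epsilon>(2)[of "Suc k"] r_Suc[of "Suc k"] by linarith
  have bx: "y \<in> A (Suc (Suc k))" if "y \<in> topspace (sp_top n)" "\<And>i. i < n \<Longrightarrow> \<bar>y i - x i\<bar> \<le> r (Suc k)" for y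
    by (rule box_subset[OF x order_refl that])
  have bx': "y \<in> A (Suc (Suc k))" if "y \<in> topspace (sp_top n)" "\<And>i. i < n \<Longrightarrow> \<bar>y i - snd (t, x) i\<bar> \<le> r (Suc k)" for y
    using bx that by simp
  have T: "kernel_family n (r (Suc k)) (T l)" and R: "kernel_family n (r (Suc k)) (R l)" for l
    unfolding T_def R_def by (rule kernel_family_mix kernel_family_gap; fact \<epsilon> \<epsilon>')+
  have int: "integrable (st_borel n) (\<lambda>q. u q j * st.ker n (T l) (t, x) (st_coord q))" for l
    by (rule integrable_st_ker_loc[where z="(t, x)", OF T bx' u[OF j]])
  have "st_conv n (T l) (\<lambda>z. u z j) (t, x) - st_conv n (T (Suc l)) (\<lambda>z. u z j) (t, x)
      = st_conv n (R l) (\<lambda>z. g z (j, l)) (t, x)" if l: "l < n" for l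
  proof -
    have "st_conv n (T l) (\<lambda>z. u z j) (t, x) - st_conv n (T (Suc l)) (\<lambda>z. u z j) (t, x)
        = (LINT q|st_borel n. u q j * st.ker n (T l) (t, x) (st_coord q) - u q j * st.ker n (T (Suc l)) (t, x) (st_coord q))"
      unfolding st_conv_def by (rule Bochner_Integration.integral_diff[OF int int, symmetric])
    also have "\<dots> = st_conv n ((R l)(Some l := deriv (R l (Some l)))) (\<lambda>z. u z j) (t, x)"
      unfolding st_conv_def R_def T_def by (simp only: right_diff_distrib[symmetric] st_ker_mix_diff[OF l])
    also have "\<dots> = st_conv n (R l) (\<lambda>z. g z (j, l)) (t, x)"
      by (rule st_conv_integration_by_parts[OF R l _ bx A_subset u[OF j] g[OF j l] weak[OF j l]])
        (use x A_topspace in blast)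
    finally show ?thesis .
  qed
  then have "(\<Sum>l<n. st_conv n (R l) (\<lambda>z. g z (j, l)) (t, x))
      = (\<Sum>l<n. st_conv n (T l) (\<lambda>z. u z j) (t, x) - st_conv n (T (Suc l)) (\<lambda>z. u z j) (t, x))"
    by (intro sum.cong) auto
  also have "\<dots> = st_conv n (T 0) (\<lambda>z. u z j) (t, x) - st_conv n (T n) (\<lambda>z. u z j) (t, x)"
    by (rule sum_lessThan_telescope')
  also have "st_conv n (T 0) (\<lambda>z. u z j) (t, x) = Mu k j (t, x)"
    unfolding Mu_eq[OF x] unfolding T_def st_conv_def st_ker_mix_0 ..
  also have "st_conv n (T n) (\<lambda>z. u z j) (t, x) = Mu (Suc k) j (t, x)"
    using x A_mono[of "Suc k" "Suc (Suc k)"] by (subst Mu_eq) (auto simp: T_def st_conv_def st_ker_mix_n)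
  finally show ?thesis by (simp add: R_def)
qed

definition d\<theta> :: "nat \<Rightarrow> nat \<Rightarrow> real \<times> point \<Rightarrow> real" where
  "d\<theta> i k z = partial st_move (Some i) (\<theta> k) z"

lemma \<theta>_DERIV:
  assumes i: "i < n"
  shows "((\<lambda>s. \<theta> k (st_move (Some i) z s)) has_real_derivative d\<theta> i k z) (at 0)"
proof -
  have "Some i \<in> st_dirs n" using i by simp
  then obtain f' where f': "\<And>p. ((\<lambda>s. \<theta> k (st_move (Some i) p s)) has_real_derivative f' p) (at 0)"
    using st.smooth_alg_regular[OF _ \<theta>_alg] st_coord_measurable by blast
  show ?thesis unfolding d\<theta>_def partial_def DERIV_imp_deriv[OF f'[of z]] by (rule f')
qed

text \<open>A zero derivative needs constancy on a neighbourhood. Around a point of A N there is a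
  margin inside A (Suc N), which is contained in A k; and the complement of A (Suc k) is
  open.\<close>

lemma d\<theta>_eq_0:
  assumes i: "i < n" and z: "z \<in> topspace (st_top n)"
  shows "snd z \<in> A N \<Longrightarrow> N < k \<Longrightarrow> d\<theta> i k z = 0" and "snd z \<notin> A (Suc k) \<Longrightarrow> d\<theta> i k z = 0"
proof -
  show "d\<theta> i k z = 0" if N: "snd z \<in> A N" "N < k"
  proof -
    obtain V where V: "openin (st_top n) V" "z \<in> V" "\<And>q. q \<in> V \<Longrightarrow> q \<in> topspace (st_top n) \<and> snd q \<in> A (Suc N)"
      using nbhd[OF z N(1)] by blast
    have "\<theta> k q = 1" if "q \<in> V" for q using V(3)[OF that] N(2) A_mono[of "Suc N" k] by (intro \<theta>_1) auto
    then show ?thesis unfolding d\<theta>_def using i by (intro partial_eq_0_local[OF _ V(1,2)]) auto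
  qed
  show "d\<theta> i k z = 0" if N: "snd z \<notin> A (Suc k)"
  proof -
    let ?V = "(UNIV :: real set) \<times> (topspace (sp_top n) - A (Suc k))"
    have "closedin (sp_top n) (A (Suc k))" using A_compact Hausdorff_sp_top compactin_imp_closedin by blast
    then have "openin (st_top n) ?V"
      unfolding st_top_def by (intro openin_prod_Times_iff[THEN iffD2]) (auto simp: closedin_def)
    moreover have "z \<in> ?V" using z N by (cases z) auto
    moreover have "\<theta> k q = 0" if "q \<in> ?V" for q using that by (intro \<theta>_0) (auto simp: mem_Times_iff)
    ultimately show ?thesis unfolding d\<theta>_def using i by (intro partial_eq_0_local[of _ n ?V]) auto
  qed
qed

text \<open>Product rule on the finite sum that represents B near x, then summation by parts. The
  boundary term contains the derivative of the cutoff of index Suc N, which vanishes on A N, so the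
  second sum is one term shorter than the first.\<close>

theorem sp_deriv_B:
  assumes x: "x \<in> A N" and i: "i < n" and j: "j < m"
  shows "((\<lambda>s. B (st_move (Some i) (t, x) s) j) has_real_derivative
    (\<Sum>k<Suc (Suc N). \<beta> k (t, x) * st_conv n (ker_mol \<delta> (\<epsilon> k)) (\<lambda>z. g z (j, i)) (t, x)) +
    (\<Sum>k<Suc N. d\<theta> i k (t, x) * (\<Sum>l<n. st_conv n (ker_gap \<delta> (\<epsilon> k) (\<epsilon> (Suc k)) l) (\<lambda>z. g z (j, l)) (t, x)))) (at 0)"
proof -
  let ?M = "\<lambda>k. st_conv n (ker_mol \<delta> (\<epsilon> k)) (\<lambda>z. g z (j, i)) (t, x)"
  have z: "(t, x) \<in> topspace (st_top n)" using x A_topspace by auto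
  have i': "Some i \<in> st_dirs n" using i by simp
  define d\<beta> where "d\<beta> k = d\<theta> i k (t, x) - (if k = 0 then 0 else d\<theta> i (k - 1) (t, x))" for k
  obtain V where V: "openin (st_top n) V" "(t, x) \<in> V" "\<And>q. q \<in> V \<Longrightarrow> q \<in> topspace (st_top n) \<and> snd q \<in> A (Suc N)"
    using nbhd[OF z] x by auto
  have "\<forall>\<^sub>F s in nhds 0. B (st_move (Some i) (t, x) s) j = S (Suc (Suc N)) j (st_move (Some i) (t, x) s)"
    using st.eventually_move[OF i' V(1,2)] by eventually_elim (use V(3) B_eq in blast)
  moreover have "((\<lambda>s. S (Suc (Suc N)) j (st_move (Some i) (t, x) s)) has_real_derivative
      (\<Sum>k<Suc (Suc N). d\<beta> k * Mu k j (t, x) + \<beta> k (t, x) * ?M k)) (at 0)"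
    unfolding S_def
  proof (rule DERIV_sum)
    fix k
    have d\<beta>: "((\<lambda>s. \<beta> k (st_move (Some i) (t, x) s)) has_real_derivative d\<beta> k) (at 0)"
      unfolding \<beta>_def d\<beta>_def by (cases "k = 0") (auto intro!: \<theta>_DERIV[OF i] DERIV_diff simp del: st_move.simps)
    have dM: "((\<lambda>s. Mu k j (st_move (Some i) (t, x) s)) has_real_derivative
        st_conv n ((ker_mol \<delta> (\<epsilon> k))(Some i := deriv (ker_mol \<delta> (\<epsilon> k) (Some i)))) (loc (A (Suc (Suc k))) (\<lambda>z. u z j)) (t, x)) (at 0)"
      unfolding Mu_def by (rule st_conv_DERIV[OF ker_mol_Cb u[OF j] i])
    have 0: "st_move (Some i) (t, x) 0 = (t, x)" by (rule st.move_0[OF i'])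
    show "((\<lambda>s. \<beta> k (st_move (Some i) (t, x) s) * Mu k j (st_move (Some i) (t, x) s)) has_real_derivative
        d\<beta> k * Mu k j (t, x) + \<beta> k (t, x) * ?M k) (at 0)"
    proof (cases "\<beta> k (t, x) = 0")
      \<comment> \<open>Off the support of \<beta> k the derivative of \<open>Mu\<close> need not be
        the mollified g, but it is multiplied by 0.\<close>
      case True
      then show ?thesis using DERIV_mult[OF d\<beta> dM] by (simp only: 0 mult_zero_left mult_zero_right add_0_right)
    next
      case False
      then have "x \<in> A (Suc k)" using \<beta>_support[OF z] by simp
      from DERIV_mult[OF d\<beta> Mu_DERIV[OF this i j, of t]] show ?thesis by (simp only: 0 mult.commute)
    qed
  qed
  ultimately have "((\<lambda>s. B (st_move (Some i) (t, x) s) j) has_real_derivative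
      (\<Sum>k<Suc (Suc N). d\<beta> k * Mu k j (t, x) + \<beta> k (t, x) * ?M k)) (at 0)"
    by (subst DERIV_cong_ev[OF refl _ refl])
  also have "(\<Sum>k<Suc (Suc N). d\<beta> k * Mu k j (t, x) + \<beta> k (t, x) * ?M k)
      = (\<Sum>k<Suc (Suc N). \<beta> k (t, x) * ?M k) + (\<Sum>k<Suc (Suc N). d\<beta> k * Mu k j (t, x))"
    by (simp only: sum.distrib add.commute)
  also have "(\<Sum>k<Suc (Suc N). d\<beta> k * Mu k j (t, x))
      = (\<Sum>k<Suc N. d\<theta> i k (t, x) * (Mu k j (t, x) - Mu (Suc k) j (t, x)))"
    using d\<theta>_eq_0(1)[OF i z, of N "Suc N"] x unfolding d\<beta>_def abel_summation[of "\<lambda>k. d\<theta> i k (t, x)"] by simp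
  also have "\<dots> = (\<Sum>k<Suc N. d\<theta> i k (t, x) * (\<Sum>l<n. st_conv n (ker_gap \<delta> (\<epsilon> k) (\<epsilon> (Suc k)) l) (\<lambda>z. g z (j, l)) (t, x)))"
  proof (intro sum.cong refl)
    fix k
    show "d\<theta> i k (t, x) * (Mu k j (t, x) - Mu (Suc k) j (t, x)) =
       d\<theta> i k (t, x) * (\<Sum>l<n. st_conv n (ker_gap \<delta> (\<epsilon> k) (\<epsilon> (Suc k)) l) (\<lambda>z. g z (j, l)) (t, x))"
      using d\<theta>_eq_0(2)[OF i z, of k] Mu_diff[OF _ j, of x k t] by (cases "x \<in> A (Suc k)") auto
  qed
  finally show ?thesis .
qed

end

subsection \<open>The modular inequality\<close>

lemma L2_set_sum_le:
  "L2_set (\<lambda>a. \<Sum>k\<in>I. f k a) J \<le> (\<Sum>k\<in>I. L2_set (f k) J)"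
proof (induction I rule: infinite_finite_induct)
  case (insert k I)
  have "L2_set (\<lambda>a. f k a + (\<Sum>k\<in>I. f k a)) J \<le> L2_set (f k) J + L2_set (\<lambda>a. \<Sum>k\<in>I. f k a) J"
    by (rule L2_set_triangle_ineq)
  then show ?case using insert by simp
qed (simp_all add: L2_set_def)

lemma L2_set_scale: "0 \<le> (c :: real) \<Longrightarrow> L2_set (\<lambda>a. c * f a) J = c * L2_set f J"
  by (rule L2_set_right_distrib[symmetric])

lemma L2_set_le_const: 
  assumes "\<And>a. a \<in> J \<Longrightarrow> \<bar>f a\<bar> \<le> c" shows "L2_set f J \<le> real (card J) * c"
proof -
  have "L2_set f J \<le> (\<Sum>a\<in>J. \<bar>f a\<bar>)" by (rule L2_set_le_sum_abs)
  also have "\<dots> \<le> (\<Sum>a\<in>J. c)" by (rule sum_mono[OF assms])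
  finally show ?thesis by simp
qed

lemma mat_norm_nonneg: "0 \<le> mat_norm m n M"
  by (simp add: mat_norm_def L2_set_nonneg)

lemma abs_le_mat_norm:
  assumes "j < m" "i < n" shows "\<bar>M (j, i)\<bar> \<le> mat_norm m n M"
proof -
  have "\<bar>M (j, i)\<bar> \<le> L2_set (\<lambda>a. \<bar>M a\<bar>) ({..<m} \<times> {..<n})"
    using assms by (intro member_le_L2_set[where f="\<lambda>a. \<bar>M a\<bar>"]) auto
  then show ?thesis by (simp add: mat_norm_def L2_set_def)
qed

lemma borel_measurable_L2_set:
  assumes "\<And>a. a \<in> J \<Longrightarrow> f a \<in> borel_measurable N"
  shows "(\<lambda>q. L2_set (\<lambda>a. f a q) J) \<in> borel_measurable N"
proof -
  have "(\<lambda>q. \<Sum>a\<in>J. (f a q)\<^sup>2) \<in> borel_measurable N"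
    by (intro borel_measurable_sum borel_measurable_power assms)
  from measurable_compose[OF this borel_measurable_sqrt] show ?thesis by (simp add: L2_set_def)
qed

lemma abs_convex_combination_le:
  fixes b c :: "nat \<Rightarrow> real"
  assumes "\<And>k. k < N \<Longrightarrow> 0 \<le> b k" "(\<Sum>k<N. b k) = 1"
  shows "\<bar>(\<Sum>k<N. b k * c k) - v\<bar> \<le> (\<Sum>k<N. b k * \<bar>c k - v\<bar>)"
proof -
  have "(\<Sum>k<N. b k * c k) - v = (\<Sum>k<N. b k * (c k - v))"
    using assms(2) by (simp add: right_diff_distrib sum_subtractf flip: sum_distrib_right)
  also have "\<bar>\<dots>\<bar> \<le> (\<Sum>k<N. \<bar>b k * (c k - v)\<bar>)" by (rule sum_abs)
  also have "\<dots> = (\<Sum>k<N. b k * \<bar>c k - v\<bar>)" using assms(1) by (intro sum.cong) (auto simp: abs_mult)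
  finally show ?thesis .
qed

text \<open>\<open>mass\<close> says that lam times the total mass of the averaging kernel is at
  most 1. The summand 1 comes from the mollifiers; the k-th commutator contributes the derivative
  bound of its cutoff, the number m n of matrix entries and the mass of n gap kernels.\<close>

locale young_mollification = mollification +
  fixes \<phi> :: "real \<Rightarrow> real" and lam :: real and Dc :: "nat \<Rightarrow> real"
  assumes \<phi>: "young_fun \<phi>" and lam: "0 < lam" "lam < 1"
    and Dc: "\<And>i k z. i < n \<Longrightarrow> \<bar>partial st_move (Some i) (\<theta> k) z\<bar> \<le> Dc k" "\<And>k. 0 \<le> Dc k"
    and mass: "\<And>N. lam * (1 + (\<Sum>k<N. real m * real n * Dc k * (real n * (2 * (\<epsilon> k + \<epsilon> (Suc k)))))) \<le> 1"
    and \<Phi>: "\<And>k. integrable (st_borel n) (loc (A k) (\<lambda>z. \<phi> (mat_norm m n (g z))))"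
begin

definition G :: "real \<times> point \<Rightarrow> real" where "G z = mat_norm m n (g z)"

definition C :: "nat \<Rightarrow> real" where "C k = real m * real n * Dc k"

text \<open>A common majorant, for all matrix entries, of the n gap kernels in the k-th
  commutator.\<close>

definition E :: "nat \<Rightarrow> real \<times> point \<Rightarrow> real \<times> point \<Rightarrow> real" where
  "E k z q = (\<Sum>l<n. \<bar>st.ker n (ker_gap \<delta> (\<epsilon> k) (\<epsilon> (Suc k)) l) z (st_coord q)\<bar>)"

definition Err :: "nat \<Rightarrow> (real \<times> point \<Rightarrow> real) \<Rightarrow> real \<times> point \<Rightarrow> real" where
  "Err k v z = (LINT q|st_borel n. v q * E k z q)"

abbreviation cv :: "nat \<Rightarrow> (real \<times> point \<Rightarrow> real) \<Rightarrow> real \<times> point \<Rightarrow> real" where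
  "cv k \<equiv> st_conv n (ker_mol \<delta> (\<epsilon> k))"

definition loc_integrable :: "(real \<times> point \<Rightarrow> real) \<Rightarrow> bool" where
  "loc_integrable v \<longleftrightarrow> (\<forall>k. integrable (st_borel n) (loc (A k) v))"

lemma C_nonneg: "0 \<le> C k" using Dc by (simp add: C_def)

lemma E_nonneg: "0 \<le> E k z q" by (simp add: E_def sum_nonneg)

lemma Err_nonneg: "(\<And>q. 0 \<le> v q) \<Longrightarrow> 0 \<le> Err k v z"
  unfolding Err_def by (intro integral_nonneg_AE AE_I2) (simp add: E_nonneg)

lemma G_nonneg: "0 \<le> G z" by (simp add: G_def mat_norm_nonneg)

lemma loc_integrable_u: "j < m \<Longrightarrow> loc_integrable (\<lambda>z. u z j)"
  and loc_integrable_g: "j < m \<Longrightarrow> i < n \<Longrightarrow> loc_integrable (\<lambda>z. g z (j, i))"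
  and loc_integrable_\<Phi>: "loc_integrable (\<lambda>z. \<phi> (G z))"
  using u g \<Phi> by (simp_all add: loc_integrable_def G_def)

lemma loc_integrable_G: "loc_integrable G"
  unfolding loc_integrable_def
proof
  fix k
  let ?J = "{..<m} \<times> {..<n}"
  have gi: "integrable (st_borel n) (loc (A k) (\<lambda>z. g z a))" if "a \<in> ?J" for a using that g by auto
  have eq: "loc (A k) G z = L2_set (\<lambda>a. loc (A k) (\<lambda>z. g z a) z) ?J" for z
    by (simp add: loc_def L2_set_scale G_def mat_norm_def)
  show "integrable (st_borel n) (loc (A k) G)"
    unfolding eq
  proof (rule Bochner_Integration.integrable_bound[where f="\<lambda>z. \<Sum>a\<in>?J. \<bar>loc (A k) (\<lambda>z. g z a) z\<bar>"])
    show "(\<lambda>z. L2_set (\<lambda>a. loc (A k) (\<lambda>z. g z a) z) ?J) \<in> borel_measurable (st_borel n)"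
      using gi by (intro borel_measurable_L2_set borel_measurable_integrable) auto
    show "AE z in st_borel n. norm (L2_set (\<lambda>a. loc (A k) (\<lambda>z. g z a) z) ?J) \<le> norm (\<Sum>a\<in>?J. \<bar>loc (A k) (\<lambda>z. g z a) z\<bar>)"
      using L2_set_le_sum_abs by (auto simp: L2_set_nonneg sum_nonneg)
  qed (use gi in auto)
qed

lemma gap_family: "kernel_family n (r (Suc k)) (ker_gap \<delta> (\<epsilon> k) (\<epsilon> (Suc k)) l)"
  using \<epsilon>[of k] \<epsilon>[of "Suc k"] r_Suc[of "Suc k"] by (intro kernel_family_gap) auto

lemma mol_family: "kernel_family n (r (Suc k)) (ker_mol \<delta> (\<epsilon> k))"
  using \<epsilon> by (intro kernel_family_mol)

lemma box:
  assumes "snd z \<in> A (Suc k)" "y \<in> topspace (sp_top n)" "\<And>i. i < n \<Longrightarrow> \<bar>y i - snd z i\<bar> \<le> r (Suc k)"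
  shows "y \<in> A (Suc (Suc k))"
  by (rule box_subset[OF assms(1) order_refl assms(2,3)])

lemma cv_loc: "snd z \<in> A (Suc k) \<Longrightarrow> cv k (loc (A (Suc (Suc k))) v) z = cv k v z"
  by (rule st_conv_loc[OF mol_family]) (rule box)

lemma integrable_cv:
  assumes "snd z \<in> A (Suc k)" "loc_integrable v"
  shows "integrable (st_borel n) (\<lambda>q. v q * st.ker n (ker_mol \<delta> (\<epsilon> k)) z (st_coord q))"
  by (rule integrable_st_ker_loc[OF mol_family box[OF assms(1)]]) (use assms(2) in \<open>auto simp: loc_integrable_def\<close>)

lemma integrable_gap:
  assumes "snd z \<in> A (Suc k)" "loc_integrable v"
  shows "integrable (st_borel n) (\<lambda>q. v q * st.ker n (ker_gap \<delta> (\<epsilon> k) (\<epsilon> (Suc k)) l) z (st_coord q))"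
  by (rule integrable_st_ker_loc[OF gap_family box[OF assms(1)]]) (use assms(2) in \<open>auto simp: loc_integrable_def\<close>)

lemma E_measurable: "(\<lambda>q. E k z q) \<in> borel_measurable (st_borel n)"
  unfolding E_def using kernel_familyD(2)[OF gap_family]
  by (intro borel_measurable_sum borel_measurable_abs st_ker_measurable)

lemma E_measurable_pair: "(\<lambda>p. E k (fst p) (snd p)) \<in> borel_measurable (st_borel n \<Otimes>\<^sub>M st_borel n)"
  unfolding E_def using kernel_familyD(1)[OF gap_family]
  by (intro borel_measurable_sum borel_measurable_abs st_ker_measurable_pair)

lemma integrable_E:
  assumes z: "snd z \<in> A (Suc k)" and v: "loc_integrable v"
  shows "integrable (st_borel n) (\<lambda>q. v q * E k z q)"
proof -
  have "integrable (st_borel n) (\<lambda>q. v q * \<bar>st.ker n (ker_gap \<delta> (\<epsilon> k) (\<epsilon> (Suc k)) l) z (st_coord q)\<bar>)" for l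
  proof (rule Bochner_Integration.integrable_bound[OF integrable_gap[OF z v, of l]])
    have 1: "(\<lambda>q. v q * st.ker n (ker_gap \<delta> (\<epsilon> k) (\<epsilon> (Suc k)) l) z (st_coord q)) \<in> borel_measurable (st_borel n)"
      and 2: "(\<lambda>q. st.ker n (ker_gap \<delta> (\<epsilon> k) (\<epsilon> (Suc k)) l) z (st_coord q)) \<in> borel_measurable (st_borel n)"
      using integrable_gap[OF z v, of l] st_ker_measurable[OF kernel_familyD(2)[OF gap_family]] by auto
    \<comment> \<open>Only the product of v with the kernel is known to be measurable, so the
      absolute value of the kernel is produced by multiplying with its sign.\<close>
    have "(\<lambda>q. (v q * st.ker n (ker_gap \<delta> (\<epsilon> k) (\<epsilon> (Suc k)) l) z (st_coord q)) * sgn (st.ker n (ker_gap \<delta> (\<epsilon> k) (\<epsilon> (Suc k)) l) z (st_coord q)))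
        \<in> borel_measurable (st_borel n)"
      by (rule borel_measurable_times[OF 1 measurable_compose[OF 2 borel_measurable_sgn]])
    then show "(\<lambda>q. v q * \<bar>st.ker n (ker_gap \<delta> (\<epsilon> k) (\<epsilon> (Suc k)) l) z (st_coord q)\<bar>) \<in> borel_measurable (st_borel n)"
      by (simp add: abs_sgn mult.assoc)
  qed (auto simp: abs_mult)
  then show ?thesis unfolding E_def sum_distrib_left by (intro Bochner_Integration.integrable_sum)
qed

lemma integral_ker_mol:
  shows "integrable (st_borel n) (\<lambda>q. st.ker n (ker_mol \<delta> (\<epsilon> k)) z (st_coord q))"
    and "(LINT q|st_borel n. st.ker n (ker_mol \<delta> (\<epsilon> k)) z (st_coord q)) = 1"
proof -
  note nn = st_ker_mol_nonneg[OF \<delta> \<epsilon>(1)]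
  note ms = st_ker_measurable[OF kernel_familyD(2)[OF mol_family]]
  show "integrable (st_borel n) (\<lambda>q. st.ker n (ker_mol \<delta> (\<epsilon> k)) z (st_coord q))"
    using nn_integral_ker_mol[OF \<delta> \<epsilon>(1)] nn by (intro integrableI_nonneg ms) auto
  show "(LINT q|st_borel n. st.ker n (ker_mol \<delta> (\<epsilon> k)) z (st_coord q)) = 1"
    using nn_integral_ker_mol[OF \<delta> \<epsilon>(1)] nn by (subst integral_eq_nn_integral[OF ms]) auto
qed

lemma nn_integral_E:
  shows "(\<integral>\<^sup>+q. ennreal (E k z q) \<partial>st_borel n) \<le> ennreal (real n * (2 * (\<epsilon> k + \<epsilon> (Suc k))))"
    and "(\<integral>\<^sup>+q. ennreal (E k q z) \<partial>st_borel n) \<le> ennreal (real n * (2 * (\<epsilon> k + \<epsilon> (Suc k))))"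
proof -
  let ?c = "2 * (\<epsilon> k + \<epsilon> (Suc k))"
  have c0: "0 \<le> ?c" using \<epsilon>(1)[of k] \<epsilon>(1)[of "Suc k"] by simp
  have c: "(\<Sum>l<n. ennreal ?c) = ennreal (real n * ?c)" using c0 by (simp add: ennreal_mult ennreal_of_nat_eq_real_of_nat)
  have m1: "(\<lambda>q. ennreal \<bar>st.ker n (ker_gap \<delta> (\<epsilon> k) (\<epsilon> (Suc k)) l) z (st_coord q)\<bar>) \<in> borel_measurable (st_borel n)" for l
    using st_ker_measurable[OF kernel_familyD(2)[OF gap_family]] by simp
  have m2: "(\<lambda>q. ennreal \<bar>st.ker n (ker_gap \<delta> (\<epsilon> k) (\<epsilon> (Suc k)) l) q (st_coord z)\<bar>) \<in> borel_measurable (st_borel n)" for l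
  proof -
    have "(\<lambda>q. st.ker n (ker_gap \<delta> (\<epsilon> k) (\<epsilon> (Suc k)) l) q (st_coord z)) \<in> borel_measurable (st_borel n)"
      by (rule st.ker_measurable_comp[where a="\<lambda>q. q", OF kernel_familyD(1)[OF gap_family] st_coord_measurable]) simp_all
    then show ?thesis by simp
  qed
  have "(\<integral>\<^sup>+q. ennreal (E k z q) \<partial>st_borel n) = (\<Sum>l<n. \<integral>\<^sup>+q. ennreal \<bar>st.ker n (ker_gap \<delta> (\<epsilon> k) (\<epsilon> (Suc k)) l) z (st_coord q)\<bar> \<partial>st_borel n)"
    by (subst nn_integral_sum[OF m1, symmetric]) (simp add: E_def sum_ennreal)
  also have "\<dots> \<le> (\<Sum>l<n. ennreal ?c)" by (intro sum_mono nn_integral_ker_gap_snd \<delta> \<epsilon>) auto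
  finally show "(\<integral>\<^sup>+q. ennreal (E k z q) \<partial>st_borel n) \<le> ennreal (real n * ?c)" unfolding c .
  have "(\<integral>\<^sup>+q. ennreal (E k q z) \<partial>st_borel n) = (\<Sum>l<n. \<integral>\<^sup>+q. ennreal \<bar>st.ker n (ker_gap \<delta> (\<epsilon> k) (\<epsilon> (Suc k)) l) q (st_coord z)\<bar> \<partial>st_borel n)"
    by (subst nn_integral_sum[OF m2, symmetric]) (simp add: E_def sum_ennreal)
  also have "\<dots> \<le> (\<Sum>l<n. ennreal ?c)" by (intro sum_mono nn_integral_ker_gap_fst \<delta> \<epsilon>) auto
  finally show "(\<integral>\<^sup>+q. ennreal (E k q z) \<partial>st_borel n) \<le> ennreal (real n * ?c)" unfolding c .
qed

lemma integral_E:
  shows "integrable (st_borel n) (\<lambda>q. E k z q)" and "(LINT q|st_borel n. E k z q) \<le> real n * (2 * (\<epsilon> k + \<epsilon> (Suc k)))"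
proof -
  have c0: "0 \<le> real n * (2 * (\<epsilon> k + \<epsilon> (Suc k)))" using \<epsilon>(1)[of k] \<epsilon>(1)[of "Suc k"] by simp
  have f: "(\<integral>\<^sup>+q. ennreal (E k z q) \<partial>st_borel n) < \<infinity>"
    using nn_integral_E(1)[of k z] by (rule le_less_trans) simp
  show i: "integrable (st_borel n) (\<lambda>q. E k z q)"
    using f by (intro integrableI_nonneg E_measurable AE_I2 E_nonneg)
  have "ennreal (LINT q|st_borel n. E k z q) = (\<integral>\<^sup>+q. ennreal (E k z q) \<partial>st_borel n)"
    by (rule nn_integral_eq_integral[symmetric, OF i]) (simp add: E_nonneg)
  also have "\<dots> \<le> ennreal (real n * (2 * (\<epsilon> k + \<epsilon> (Suc k))))" by (rule nn_integral_E)
  finally show "(LINT q|st_borel n. E k z q) \<le> real n * (2 * (\<epsilon> k + \<epsilon> (Suc k)))"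
    using c0 by (simp add: ennreal_le_iff)
qed

text \<open>Marks the region where the k-th commutator can be nonzero; on it the convolutions see
  only A (Suc (Suc k)).\<close>

definition ind :: "nat \<Rightarrow> real \<times> point \<Rightarrow> real" where "ind k z = indicator (A (Suc k)) (snd z)"

definition dB :: "real \<times> point \<Rightarrow> nat \<times> nat \<Rightarrow> real" where
  "dB = sp_deriv (\<lambda>z j. lam * B z j)"

lemma dB_eq:
  assumes x: "x \<in> A N" and i: "i < n" and j: "j < m"
  shows "dB (t, x) (j, i) = lam * ((\<Sum>k<Suc (Suc N). \<beta> k (t, x) * cv k (\<lambda>z. g z (j, i)) (t, x)) +
    (\<Sum>k<Suc N. d\<theta> i k (t, x) * (\<Sum>l<n. st_conv n (ker_gap \<delta> (\<epsilon> k) (\<epsilon> (Suc k)) l) (\<lambda>z. g z (j, l)) (t, x))))"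
  unfolding dB_def sp_deriv_def partial_def split
  by (rule DERIV_imp_deriv) (rule DERIV_cmult[OF sp_deriv_B[OF x i j]])

lemma gap_bound:
  assumes i: "i < n" and j: "j < m" and z: "z \<in> topspace (st_top n)"
  shows "\<bar>d\<theta> i k z * (\<Sum>l<n. st_conv n (ker_gap \<delta> (\<epsilon> k) (\<epsilon> (Suc k)) l) (\<lambda>z. g z (j, l)) z)\<bar> \<le> Dc k * ind k z * Err k G z"
proof (cases "snd z \<in> A (Suc k)")
  case False
  then show ?thesis using d\<theta>_eq_0(2)[OF i z False] by (simp add: ind_def)
next
  case True
  let ?c = "\<lambda>l. st_conv n (ker_gap \<delta> (\<epsilon> k) (\<epsilon> (Suc k)) l) (\<lambda>z. g z (j, l)) z"
  let ?ker = "\<lambda>l q. st.ker n (ker_gap \<delta> (\<epsilon> k) (\<epsilon> (Suc k)) l) z (st_coord q)"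
  have gi: "integrable (st_borel n) (\<lambda>q. g q (j, l) * ?ker l q)" if "l < n" for l
    by (rule integrable_gap[OF True loc_integrable_g[OF j that]])
  have "\<bar>\<Sum>l<n. ?c l\<bar> \<le> (\<Sum>l<n. \<bar>?c l\<bar>)" by (rule sum_abs)
  also have "\<dots> \<le> (\<Sum>l<n. LINT q|st_borel n. \<bar>g q (j, l) * ?ker l q\<bar>)"
    unfolding st_conv_def by (intro sum_mono integral_abs_bound)
  also have "\<dots> = (LINT q|st_borel n. (\<Sum>l<n. \<bar>g q (j, l) * ?ker l q\<bar>))"
    using gi by (intro Bochner_Integration.integral_sum[symmetric]) auto
  also have "\<dots> \<le> Err k G z"
    unfolding Err_def
  proof (intro integral_mono integrable_E[OF True loc_integrable_G])
    show "integrable (st_borel n) (\<lambda>q. \<Sum>l<n. \<bar>g q (j, l) * ?ker l q\<bar>)" using gi by auto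
    fix q
    show "(\<Sum>l<n. \<bar>g q (j, l) * ?ker l q\<bar>) \<le> G q * E k z q"
      unfolding E_def sum_distrib_left G_def abs_mult
      by (intro sum_mono mult_right_mono abs_le_mat_norm j) auto
  qed
  finally have "\<bar>\<Sum>l<n. ?c l\<bar> \<le> Err k G z" .
  moreover have "\<bar>d\<theta> i k z\<bar> \<le> Dc k" unfolding d\<theta>_def by (rule Dc(1)[OF i])
  ultimately have "\<bar>d\<theta> i k z\<bar> * \<bar>\<Sum>l<n. ?c l\<bar> \<le> Dc k * Err k G z" using Dc(2) by (intro mult_mono) auto
  then show ?thesis using True by (simp add: abs_mult ind_def)
qed

lemma st_top_memI: "x \<in> A N \<Longrightarrow> (t, x) \<in> topspace (st_top n)"
  using A_topspace by auto

text \<open>The two parts are treated differently. For the mollified gradient the integral form of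
  Minkowski's inequality loses nothing, so its mass stays at most 1. For the commutators the crude
  count of m n entries suffices, because their mass can be made as small as desired.\<close>

lemma mat_norm_dB_le:
  assumes x: "x \<in> A N"
  shows "mat_norm m n (dB (t, x)) \<le> lam * ((\<Sum>k<Suc (Suc N). \<beta> k (t, x) * cv k G (t, x)) +
    (\<Sum>k<Suc N. C k * ind k (t, x) * Err k G (t, x)))"
proof -
  let ?J = "{..<m} \<times> {..<n}" and ?z = "(t, x)"
  have z: "?z \<in> topspace (st_top n)" by (rule st_top_memI[OF x])
  define P where "P a = (\<Sum>k<Suc (Suc N). \<beta> k ?z * cv k (\<lambda>z. g z a) ?z)" for a
  define Q where "Q a = (\<Sum>k<Suc N. d\<theta> (snd a) k ?z * (\<Sum>l<n. st_conv n (ker_gap \<delta> (\<epsilon> k) (\<epsilon> (Suc k)) l) (\<lambda>z. g z (fst a, l)) ?z))" for a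
  have "dB ?z a = lam * (P a + Q a)" if "a \<in> ?J" for a
    using that dB_eq[OF x, of "snd a" "fst a" t] by (auto simp: P_def Q_def)
  then have "mat_norm m n (dB ?z) = L2_set (\<lambda>a. lam * (P a + Q a)) ?J"
    unfolding mat_norm_def by (intro L2_set_cong) auto
  also have "\<dots> = lam * L2_set (\<lambda>a. P a + Q a) ?J" using lam by (intro L2_set_scale) auto
  also have "\<dots> \<le> lam * (L2_set P ?J + L2_set Q ?J)"
    using lam by (intro mult_left_mono L2_set_triangle_ineq) auto
  finally have 1: "mat_norm m n (dB ?z) \<le> lam * (L2_set P ?J + L2_set Q ?J)" .
  have "L2_set P ?J \<le> (\<Sum>k<Suc (Suc N). L2_set (\<lambda>a. \<beta> k ?z * cv k (\<lambda>z. g z a) ?z) ?J)"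
    unfolding P_def by (rule L2_set_sum_le)
  also have "\<dots> \<le> (\<Sum>k<Suc (Suc N). \<beta> k ?z * cv k G ?z)"
  proof (rule sum_mono)
    fix k
    show "L2_set (\<lambda>a. \<beta> k ?z * cv k (\<lambda>z. g z a) ?z) ?J \<le> \<beta> k ?z * cv k G ?z"
    proof (cases "\<beta> k ?z = 0")
      case True then show ?thesis by (simp add: L2_set_def)
    next
      case False
      then have s: "snd ?z \<in> A (Suc k)" by (rule \<beta>_support[OF z])
      have "L2_set (\<lambda>a. cv k (\<lambda>z. g z a) ?z) ?J \<le>
          (LINT q|st_borel n. L2_set (\<lambda>a. g q a * st.ker n (ker_mol \<delta> (\<epsilon> k)) ?z (st_coord q)) ?J)"
        unfolding st_conv_def
        by (intro L2_set_integral_le integrable_cv[OF s]) (auto intro: loc_integrable_g)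
      also have "\<dots> = cv k G ?z"
      proof -
        have "L2_set (\<lambda>a. g q a * st.ker n (ker_mol \<delta> (\<epsilon> k)) ?z (st_coord q)) ?J = G q * st.ker n (ker_mol \<delta> (\<epsilon> k)) ?z (st_coord q)" for q
          using L2_set_scale[OF st_ker_mol_nonneg[OF \<delta> \<epsilon>(1)], of n k ?z "st_coord q" "g q" ?J]
          by (simp add: mult.commute G_def mat_norm_def)
        then show ?thesis by (simp add: st_conv_def)
      qed
      finally show ?thesis using \<beta>_nonneg[OF z, of k] by (simp add: L2_set_scale mult_left_mono)
    qed
  qed
  finally have 2: "L2_set P ?J \<le> (\<Sum>k<Suc (Suc N). \<beta> k ?z * cv k G ?z)" .
  have "\<bar>Q a\<bar> \<le> (\<Sum>k<Suc N. Dc k * ind k ?z * Err k G ?z)" if "a \<in> ?J" for a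
    unfolding Q_def using that by (intro order_trans[OF sum_abs] sum_mono gap_bound z) auto
  then have "L2_set Q ?J \<le> real (card ?J) * (\<Sum>k<Suc N. Dc k * ind k ?z * Err k G ?z)" by (rule L2_set_le_const)
  also have "\<dots> = (\<Sum>k<Suc N. C k * ind k ?z * Err k G ?z)"
    unfolding C_def sum_distrib_left by (intro sum.cong) (auto simp: card_cartesian_product mult_ac)
  finally have 3: "L2_set Q ?J \<le> (\<Sum>k<Suc N. C k * ind k ?z * Err k G ?z)" .
  show ?thesis using lam by (intro order_trans[OF 1] mult_left_mono add_mono 2 3) auto
qed

text \<open>The gradient of the mollified function is an average of \<open>g\<close> with total mass at most 1.\<close>

lemma young_dB_le:
  assumes x: "x \<in> A N"
  shows "\<phi> (mat_norm m n (dB (t, x))) \<le> (\<Sum>k<Suc (Suc N). \<beta> k (t, x) * cv k (\<lambda>z. \<phi> (G z)) (t, x)) +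
    (\<Sum>k<Suc N. C k * ind k (t, x) * Err k (\<lambda>z. \<phi> (G z)) (t, x))"
proof -
  let ?z = "(t, x)"
  have z: "?z \<in> topspace (st_top n)" by (rule st_top_memI[OF x])
  have b0: "0 \<le> \<beta> k ?z" for k by (rule \<beta>_nonneg[OF z])
  have i0: "0 \<le> ind k ?z" for k by (simp add: ind_def)
  define K where "K k q = st.ker n (ker_mol \<delta> (\<epsilon> k)) ?z (st_coord q)" for k q
  \<comment> \<open>The kernel whose integral against G bounds the norm of the gradient. Integrated
    against \<phi> (G) it gives, up to the factor lam, the right-hand side of the claim.\<close>
  define \<kappa> where "\<kappa> q = lam * ((\<Sum>k<Suc (Suc N). \<beta> k ?z * K k q) + (\<Sum>k<Suc N. C k * ind k ?z * E k ?z q))" for q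
  have K0: "0 \<le> K k q" for k q unfolding K_def by (rule st_ker_mol_nonneg[OF \<delta> \<epsilon>(1)])
  have \<kappa>0: "0 \<le> \<kappa> q" for q unfolding \<kappa>_def using lam b0 K0 i0 C_nonneg E_nonneg
    by (intro mult_nonneg_nonneg add_nonneg_nonneg sum_nonneg) auto
  have \<kappa>v: "integrable (st_borel n) (\<lambda>q. \<kappa> q * v q)"
      "(LINT q|st_borel n. \<kappa> q * v q) = lam * ((\<Sum>k<Suc (Suc N). \<beta> k ?z * cv k v ?z) + (\<Sum>k<Suc N. C k * ind k ?z * Err k v ?z))"
    if v: "loc_integrable v" for v
  proof -
    have 1: "integrable (st_borel n) (\<lambda>q. \<beta> k ?z * (v q * K k q))" for k
      using \<beta>_support[OF z, of k] integrable_cv[OF _ v, of ?z k] unfolding K_def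
      by (cases "\<beta> k ?z = 0") auto
    have 2: "integrable (st_borel n) (\<lambda>q. C k * ind k ?z * (v q * E k ?z q))" for k
      using integrable_E[OF _ v, of ?z k] by (cases "snd ?z \<in> A (Suc k)") (auto simp: ind_def)
    have eq: "\<kappa> q * v q = lam * ((\<Sum>k<Suc (Suc N). \<beta> k ?z * (v q * K k q)) + (\<Sum>k<Suc N. C k * ind k ?z * (v q * E k ?z q)))" for q
      unfolding \<kappa>_def by (simp only: sum_distrib_right sum_distrib_left distrib_right distrib_left mult_ac)
    show "integrable (st_borel n) (\<lambda>q. \<kappa> q * v q)"
      unfolding eq by (intro integrable_mult_right Bochner_Integration.integrable_add Bochner_Integration.integrable_sum 1 2)
    have s1: "(LINT q|st_borel n. (\<Sum>k<Suc (Suc N). \<beta> k ?z * (v q * K k q))) = (\<Sum>k<Suc (Suc N). \<beta> k ?z * cv k v ?z)"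
      by (subst Bochner_Integration.integral_sum[OF 1]) (simp add: st_conv_def K_def)
    have s2: "(LINT q|st_borel n. (\<Sum>k<Suc N. C k * ind k ?z * (v q * E k ?z q))) = (\<Sum>k<Suc N. C k * ind k ?z * Err k v ?z)"
      by (subst Bochner_Integration.integral_sum[OF 2]) (simp add: Err_def)
    show "(LINT q|st_borel n. \<kappa> q * v q) = lam * ((\<Sum>k<Suc (Suc N). \<beta> k ?z * cv k v ?z) + (\<Sum>k<Suc N. C k * ind k ?z * Err k v ?z))"
      unfolding eq integral_mult_right_zero s1[symmetric] s2[symmetric]
      by (subst Bochner_Integration.integral_add) (intro Bochner_Integration.integrable_sum 1 2 refl)+
  qed
  have i\<kappa>: "integrable (st_borel n) \<kappa>"
    unfolding \<kappa>_def K_def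
    by (intro integrable_mult_right Bochner_Integration.integrable_add Bochner_Integration.integrable_sum integral_ker_mol integral_E)
  have "(LINT q|st_borel n. \<kappa> q) = lam * ((\<Sum>k<Suc (Suc N). \<beta> k ?z * 1) + (\<Sum>k<Suc N. C k * ind k ?z * (LINT q|st_borel n. E k ?z q)))"
  proof -
    have 1: "integrable (st_borel n) (\<lambda>q. \<beta> k ?z * K k q)" for k unfolding K_def by (intro integrable_mult_right integral_ker_mol)
    have 2: "integrable (st_borel n) (\<lambda>q. C k * ind k ?z * E k ?z q)" for k by (intro integrable_mult_right integral_E)
    have s1: "(LINT q|st_borel n. (\<Sum>k<Suc (Suc N). \<beta> k ?z * K k q)) = (\<Sum>k<Suc (Suc N). \<beta> k ?z * 1)"
      by (subst Bochner_Integration.integral_sum[OF 1]) (simp add: K_def integral_ker_mol)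
    have s2: "(LINT q|st_borel n. (\<Sum>k<Suc N. C k * ind k ?z * E k ?z q)) = (\<Sum>k<Suc N. C k * ind k ?z * (LINT q|st_borel n. E k ?z q))"
      by (subst Bochner_Integration.integral_sum[OF 2]) simp
    show ?thesis unfolding \<kappa>_def integral_mult_right_zero s1[symmetric] s2[symmetric]
      by (subst Bochner_Integration.integral_add) (intro Bochner_Integration.integrable_sum 1 2 refl)+
  qed
  also have "\<dots> \<le> lam * (1 + (\<Sum>k<Suc N. C k * (real n * (2 * (\<epsilon> k + \<epsilon> (Suc k))))))"
  proof (intro mult_left_mono add_mono sum_mono)
    show "(\<Sum>k<Suc (Suc N). \<beta> k ?z * 1) \<le> 1" using sum_\<beta>[where N="Suc N" and z="?z"] \<theta>_le_1[OF z, of "Suc N"] by simp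
    fix k
    have "ind k ?z * (LINT q|st_borel n. E k ?z q) \<le> 1 * (real n * (2 * (\<epsilon> k + \<epsilon> (Suc k))))"
    proof (rule mult_mono)
      show "0 \<le> (LINT q|st_borel n. E k ?z q)" by (intro integral_nonneg_AE AE_I2) (rule E_nonneg)
    qed (use integral_E(2)[of k ?z] in \<open>simp_all add: ind_def indicator_def\<close>)
    then have "C k * (ind k ?z * (LINT q|st_borel n. E k ?z q)) \<le> C k * (1 * (real n * (2 * (\<epsilon> k + \<epsilon> (Suc k)))))"
      using C_nonneg by (rule mult_left_mono)
    then show "C k * ind k ?z * (LINT q|st_borel n. E k ?z q) \<le> C k * (real n * (2 * (\<epsilon> k + \<epsilon> (Suc k))))" by (simp only: mult.assoc mult_1_left)
  qed (use lam in auto)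
  also have "\<dots> \<le> 1" using mass[of "Suc N"] unfolding C_def .
  finally have m1: "(LINT q|st_borel n. \<kappa> q) \<le> 1" .
  have "\<phi> (mat_norm m n (dB ?z)) \<le> \<phi> (LINT q|st_borel n. \<kappa> q * G q)"
    by (rule young_fun_mono[OF \<phi> mat_norm_nonneg]) (use mat_norm_dB_le[OF x] \<kappa>v(2)[OF loc_integrable_G] in \<open>simp only:\<close>)
  also have "\<dots> \<le> (LINT q|st_borel n. \<kappa> q * \<phi> (G q))"
    by (rule jensen_sub_probability[OF \<phi> i\<kappa> \<kappa>0 m1 \<kappa>v(1)[OF loc_integrable_G] G_nonneg \<kappa>v(1)[OF loc_integrable_\<Phi>]])
  also have "\<dots> = lam * ((\<Sum>k<Suc (Suc N). \<beta> k ?z * cv k (\<lambda>z. \<phi> (G z)) ?z) + (\<Sum>k<Suc N. C k * ind k ?z * Err k (\<lambda>z. \<phi> (G z)) ?z))" (is "_ = lam * ?R")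
    by (rule \<kappa>v(2)[OF loc_integrable_\<Phi>])
  also have "\<dots> \<le> 1 * ?R"
  proof (rule mult_right_mono)
    have \<phi>0: "0 \<le> \<phi> (G q)" for q by (rule young_fun_nonneg[OF \<phi> G_nonneg])
    have "0 \<le> cv k (\<lambda>z. \<phi> (G z)) ?z" for k
      unfolding st_conv_def using K0[of k] \<phi>0 by (intro integral_nonneg_AE AE_I2) (simp add: K_def)
    then show "0 \<le> ?R" using b0 i0 C_nonneg Err_nonneg \<phi>0
      by (intro add_nonneg_nonneg sum_nonneg mult_nonneg_nonneg) auto
  qed (use lam in simp)
  finally show ?thesis by (simp only: mult_1_left)
qed

end

subsection \<open>Convergence in the mean\<close>

text \<open>Averaging in time alone is the intermediate stage between v and its space-time
  convolution: for fixed \<delta> the latter tends to it as the spatial width goes to 0, and spatial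
  widths can then be chosen separately on each compact set.\<close>

definition t_conv :: "real \<Rightarrow> (real \<times> point \<Rightarrow> real) \<Rightarrow> real \<times> point \<Rightarrow> real" where
  "t_conv \<delta> v z = (LINT s|lborel. mol \<delta> (fst z - s) * v (s, snd z))"

lemma t_conv_loc: "t_conv \<delta> (loc A v) z = indicator A (snd z) * t_conv \<delta> v z"
  by (simp add: t_conv_def loc_def mult.left_commute[of "mol _ _"])

text \<open>This is how time-independence of the weight is used: the time average of w \<phi>(|Db|)
  is w times the time average of \<phi>(|Db|), so this stage asks for neither continuity nor bounds
  of w.\<close>

lemma t_conv_weight: "t_conv \<delta> (\<lambda>z. w (snd z) * v z) z = w (snd z) * t_conv \<delta> v z"
  by (simp add: t_conv_def mult.left_commute[of "mol _ _"])

lemma t_conv_measurable: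
  assumes v: "v \<in> borel_measurable (st_borel n)"
  shows "t_conv \<delta> v \<in> borel_measurable (st_borel n)"
  unfolding t_conv_def[abs_def]
proof (rule lborel.borel_measurable_lebesgue_integral)
  have m: "mol \<delta> \<in> borel_measurable borel" by (rule Cb_measurable[OF mol_Cb])
  have 1: "(\<lambda>q. fst (fst q) - snd q) \<in> borel_measurable (st_borel n \<Otimes>\<^sub>M lborel)"
    unfolding st_borel_def by measurable
  have 2: "(\<lambda>q. (snd q, snd (fst q))) \<in> measurable (st_borel n \<Otimes>\<^sub>M lborel) (st_borel n)"
    unfolding st_borel_def by measurable
  show "(\<lambda>(z, s). mol \<delta> (fst z - s) * v (s, snd z)) \<in> borel_measurable (st_borel n \<Otimes>\<^sub>M lborel)"
    using measurable_compose[OF 1 m] measurable_compose[OF 2 v] by (simp add: case_prod_unfold)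
qed

lemma t_conv_integrable:
  assumes \<delta>: "0 < \<delta>" and v: "integrable (st_borel n) v"
  shows "integrable (st_borel n) (t_conv \<delta> v)"
proof -
  interpret mk: markov_kernel lborel "\<lambda>x y. mol \<delta> (x - y)" by (rule markov_kernel_mol[OF \<delta>])
  have vm: "v \<in> borel_measurable (st_borel n)" using v by auto
  have vi: "integrable (lborel \<Otimes>\<^sub>M sp_borel n) (case_prod (\<lambda>s x. v (s, x)))" using v by (simp add: st_borel_def)
  have tm: "t_conv \<delta> v \<in> borel_measurable (st_borel n)" by (rule t_conv_measurable[OF vm])
  have "(\<integral>\<^sup>+z. ennreal (norm (t_conv \<delta> v z)) \<partial>st_borel n) = (\<integral>\<^sup>+x. \<integral>\<^sup>+t. ennreal (norm (t_conv \<delta> v (t, x))) \<partial>lborel \<partial>sp_borel n)"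
    using tm unfolding st_borel_def by (subst st_pair.nn_integral_snd) auto
  also have "\<dots> \<le> (\<integral>\<^sup>+x. \<integral>\<^sup>+t. ennreal (norm (v (t, x))) \<partial>lborel \<partial>sp_borel n)"
  proof (rule nn_integral_mono_AE)
    show "AE x in sp_borel n. (\<integral>\<^sup>+t. ennreal (norm (t_conv \<delta> v (t, x))) \<partial>lborel) \<le> (\<integral>\<^sup>+t. ennreal (norm (v (t, x))) \<partial>lborel)"
      using st_pair.AE_integrable_snd[OF vi]
    proof eventually_elim
      fix x assume "integrable lborel (\<lambda>s. v (s, x))"
      from mk.convolution_contraction[OF this]
      show "(\<integral>\<^sup>+t. ennreal (norm (t_conv \<delta> v (t, x))) \<partial>lborel) \<le> (\<integral>\<^sup>+t. ennreal (norm (v (t, x))) \<partial>lborel)"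
        by (simp add: t_conv_def)
    qed
  qed
  also have "\<dots> = (\<integral>\<^sup>+z. ennreal (norm (v z)) \<partial>st_borel n)"
    using vm unfolding st_borel_def by (subst st_pair.nn_integral_snd) auto
  also have "\<dots> < \<infinity>" using v by (simp add: integrable_iff_bounded)
  finally show ?thesis using tm by (simp add: integrable_iff_bounded)
qed

lemma t_conv_defect:
  assumes v: "integrable (st_borel n) v"
  shows "(\<lambda>N. \<integral>\<^sup>+z. ennreal \<bar>t_conv (1 / real (Suc N)) v z - v z\<bar> \<partial>st_borel n) \<longlonglongrightarrow> 0"
proof -
  have vi: "integrable (lborel \<Otimes>\<^sub>M sp_borel n) v" using v by (simp add: st_borel_def)
  have vm: "v \<in> borel_measurable (st_borel n)" using v by auto
  have "(\<lambda>N. \<integral>\<^sup>+x. L1_defect lborel (\<lambda>a b. mol (1 / real (Suc N)) (a - b)) (\<lambda>t. v (t, x)) \<partial>sp_borel n) \<longlonglongrightarrow> 0"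
    by (rule L1_defect_param[OF markov_kernel_mol mol_L1_defect sp_sigma.sigma_finite_measure_axioms vi]) auto
  moreover have "(\<integral>\<^sup>+x. L1_defect lborel (\<lambda>a b. mol (1 / real (Suc N)) (a - b)) (\<lambda>t. v (t, x)) \<partial>sp_borel n)
      = (\<integral>\<^sup>+z. ennreal \<bar>t_conv (1 / real (Suc N)) v z - v z\<bar> \<partial>st_borel n)" for N
  proof -
    have "(\<lambda>z. ennreal \<bar>t_conv (1 / real (Suc N)) v z - v z\<bar>) \<in> borel_measurable (lborel \<Otimes>\<^sub>M sp_borel n)"
      using t_conv_measurable[OF vm, of "1 / real (Suc N)"] vm unfolding st_borel_def by simp
    from st_pair.nn_integral_snd[OF this] show ?thesis
      by (simp add: L1_defect_def t_conv_def st_borel_def)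
  qed
  ultimately show ?thesis by simp
qed

text \<open>The kernel is a product, so by Fubini the time integral can be done first.\<close>

lemma st_conv_ker_mol:
  assumes \<delta>: "0 < \<delta>" and v: "integrable (st_borel n) v"
  shows "st_conv n (ker_mol \<delta> \<epsilon>) v (t, x) = (LINT y|sp_borel n. sp.ker n (\<lambda>_. mol \<epsilon>) x y * t_conv \<delta> v (t, y))"
proof -
  have k: "\<forall>d\<in>st_dirs n. ker_mol \<delta> \<epsilon> d \<in> Cb" by (auto simp: ker_mol_def mol_Cb split: option.split)
  have i: "integrable (lborel \<Otimes>\<^sub>M sp_borel n) (case_prod (\<lambda>s y. v (s, y) * st.ker n (ker_mol \<delta> \<epsilon>) (t, x) (st_coord (s, y))))"
    using integrable_st_ker[OF k v, of "(t, x)"] by (simp add: st_borel_def case_prod_unfold)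
  have "st_conv n (ker_mol \<delta> \<epsilon>) v (t, x) = (LINT y|sp_borel n. LINT s|lborel. v (s, y) * st.ker n (ker_mol \<delta> \<epsilon>) (t, x) (st_coord (s, y)))"
    unfolding st_conv_def using st_pair.integral_snd[OF i] by (simp add: st_borel_def case_prod_unfold)
  also have "\<dots> = (LINT y|sp_borel n. sp.ker n (\<lambda>_. mol \<epsilon>) x y * t_conv \<delta> v (t, y))"
  proof (rule Bochner_Integration.integral_cong[OF refl])
    fix y
    have "v (s, y) * st.ker n (ker_mol \<delta> \<epsilon>) (t, x) (st_coord (s, y)) = sp.ker n (\<lambda>_. mol \<epsilon>) x y * (mol \<delta> (t - s) * v (s, y))" for s
      by (simp add: st_ker_pair ker_mol_def)
    then have "(LINT s|lborel. v (s, y) * st.ker n (ker_mol \<delta> \<epsilon>) (t, x) (st_coord (s, y))) = (LINT s|lborel. sp.ker n (\<lambda>_. mol \<epsilon>) x y * (mol \<delta> (t - s) * v (s, y)))"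
      by (simp only:)
    then show "(LINT s|lborel. v (s, y) * st.ker n (ker_mol \<delta> \<epsilon>) (t, x) (st_coord (s, y))) = sp.ker n (\<lambda>_. mol \<epsilon>) x y * t_conv \<delta> v (t, y)"
      by (simp add: t_conv_def)
  qed
  finally show ?thesis .
qed

lemma st_conv_measurable:
  assumes k: "\<And>d. d \<in> st_dirs n \<Longrightarrow> k d \<in> Cb" and v: "v \<in> borel_measurable (st_borel n)"
  shows "st_conv n k v \<in> borel_measurable (st_borel n)"
  unfolding st_conv_def[abs_def]
proof (rule st_sigma.borel_measurable_lebesgue_integral)
  show "(\<lambda>(z, q). v q * st.ker n k z (st_coord q)) \<in> borel_measurable (st_borel n \<Otimes>\<^sub>M st_borel n)"
    using borel_measurable_times[OF measurable_compose[OF measurable_snd v] st_ker_measurable_pair[OF k]]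
    by (simp add: case_prod_unfold)
qed

text \<open>By \<open>st_conv_ker_mol\<close> the integrand at a fixed time is the spatial defect of
  a slice of \<open>t_conv \<delta> v\<close>, so \<open>L1_defect_param\<close> applies with time
  as the parameter. The width \<delta> is held fixed, in accordance with the order in which the
  widths are chosen.\<close>

lemma st_conv_defect:
  assumes \<delta>: "0 < \<delta>" and v: "integrable (st_borel n) v"
  shows "(\<lambda>N. \<integral>\<^sup>+z. ennreal \<bar>st_conv n (ker_mol \<delta> (1 / real (Suc N))) v z - t_conv \<delta> v z\<bar> \<partial>st_borel n) \<longlonglongrightarrow> 0"
proof -
  interpret Q: pair_sigma_finite "sp_borel n" "lborel :: real measure" by unfold_locales
  have vm: "v \<in> borel_measurable (st_borel n)" using v by auto
  have ti: "integrable (lborel \<Otimes>\<^sub>M sp_borel n) (t_conv \<delta> v)" using t_conv_integrable[OF \<delta> v] by (simp add: st_borel_def)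
  have ti': "integrable (sp_borel n \<Otimes>\<^sub>M lborel) (\<lambda>p. t_conv \<delta> v (snd p, fst p))"
    using st_pair.integrable_product_swap[OF ti] by (simp add: case_prod_unfold)
  have "(\<lambda>N. \<integral>\<^sup>+t. L1_defect (sp_borel n) (sp.ker n (\<lambda>_. mol (1 / real (Suc N)))) (\<lambda>x. t_conv \<delta> v (t, x)) \<partial>lborel) \<longlonglongrightarrow> 0"
    using L1_defect_param[OF markov_kernel_ker ker_L1_defect lborel.sigma_finite_measure_axioms ti'] by simp
  moreover have "(\<integral>\<^sup>+t. L1_defect (sp_borel n) (sp.ker n (\<lambda>_. mol (1 / real (Suc N)))) (\<lambda>x. t_conv \<delta> v (t, x)) \<partial>lborel)
      = (\<integral>\<^sup>+z. ennreal \<bar>st_conv n (ker_mol \<delta> (1 / real (Suc N))) v z - t_conv \<delta> v z\<bar> \<partial>st_borel n)" for N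
  proof -
    have km: "ker_mol \<delta> (1 / real (Suc N)) d \<in> Cb" for d by (auto simp: ker_mol_def mol_Cb split: option.split)
    have "(\<lambda>z. ennreal \<bar>st_conv n (ker_mol \<delta> (1 / real (Suc N))) v z - t_conv \<delta> v z\<bar>) \<in> borel_measurable (lborel \<Otimes>\<^sub>M sp_borel n)"
      using st_conv_measurable[of n "ker_mol \<delta> (1 / real (Suc N))", OF km vm] t_conv_measurable[OF vm, of \<delta>]
      unfolding st_borel_def by simp
    then show ?thesis unfolding st_borel_def L1_defect_def
      by (subst sp_sigma.nn_integral_fst[symmetric]) (auto simp: st_conv_ker_mol[OF \<delta> v])
  qed
  ultimately show ?thesis by simp
qed

context young_mollification
begin

text \<open>Localised to a set that contains everything the k-th mollifier sees from the support of
  \<beta> k. The widths \<epsilon> k are chosen later so that these numbers, even after weighting,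
  are summable.\<close>

definition defect :: "nat \<Rightarrow> (real \<times> point \<Rightarrow> real) \<Rightarrow> ennreal" where
  "defect k v = (\<integral>\<^sup>+z. ennreal \<bar>cv k (loc (A (Suc (Suc k))) v) z - t_conv \<delta> (loc (A (Suc (Suc k))) v) z\<bar> \<partial>st_borel n)"

lemma cv_diff_measurable:
  assumes v: "loc_integrable v"
  shows "(\<lambda>z. cv k (loc (A (Suc (Suc k))) v) z - t_conv \<delta> (loc (A (Suc (Suc k))) v) z) \<in> borel_measurable (st_borel n)"
proof -
  have "loc (A (Suc (Suc k))) v \<in> borel_measurable (st_borel n)" using v by (auto simp: loc_integrable_def)
  then show ?thesis
    by (intro borel_measurable_diff st_conv_measurable t_conv_measurable) (auto intro: kernel_familyD(1)[OF mol_family])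
qed

lemma loc_E:
  assumes "snd z \<in> A (Suc k)" "q \<in> space (st_borel n)"
  shows "loc (A (Suc (Suc k))) v q * E k z q = v q * E k z q"
proof -
  have "loc (A (Suc (Suc k))) v q * \<bar>st.ker n (ker_gap \<delta> (\<epsilon> k) (\<epsilon> (Suc k)) l) z (st_coord q)\<bar> = v q * \<bar>st.ker n (ker_gap \<delta> (\<epsilon> k) (\<epsilon> (Suc k)) l) z (st_coord q)\<bar>" for l
    using st_ker_loc[OF gap_family[of k l] box[OF assms(1)] assms(2), where v=v and z=z] by (cases "st.ker n (ker_gap \<delta> (\<epsilon> k) (\<epsilon> (Suc k)) l) z (st_coord q) = 0") auto
  then show ?thesis unfolding E_def sum_distrib_left by (simp only:)
qed

text \<open>Joint measurability is available for the localised function; on A (Suc k) both integrals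
  coincide by \<open>loc_E\<close>, and elsewhere \<open>ind\<close> is 0.\<close>

lemma Err_measurable:
  assumes v: "loc_integrable v"
  shows "(\<lambda>z. ind k z * Err k v z) \<in> borel_measurable (st_borel n)"
proof -
  have lm: "loc (A (Suc (Suc k))) v \<in> borel_measurable (st_borel n)" using v by (auto simp: loc_integrable_def)
  have im: "ind k \<in> borel_measurable (st_borel n)"
    unfolding ind_def[abs_def] st_borel_def
    using compactin_sp_top_sets[OF A_compact] by (intro measurable_compose[OF measurable_snd]) simp
  have "(\<lambda>z. LINT q|st_borel n. loc (A (Suc (Suc k))) v q * E k z q) \<in> borel_measurable (st_borel n)"
  proof (rule st_sigma.borel_measurable_lebesgue_integral)
    show "(\<lambda>(z, q). loc (A (Suc (Suc k))) v q * E k z q) \<in> borel_measurable (st_borel n \<Otimes>\<^sub>M st_borel n)"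
      using borel_measurable_times[OF measurable_compose[OF measurable_snd lm] E_measurable_pair]
      by (simp add: case_prod_unfold)
  qed
  with im have "(\<lambda>z. ind k z * (LINT q|st_borel n. loc (A (Suc (Suc k))) v q * E k z q)) \<in> borel_measurable (st_borel n)"
    by (rule borel_measurable_times)
  moreover have "ind k z * (LINT q|st_borel n. loc (A (Suc (Suc k))) v q * E k z q) = ind k z * Err k v z" for z
  proof (cases "snd z \<in> A (Suc k)")
    case True
    then show ?thesis unfolding Err_def by (intro arg_cong2[where f="(*)"] refl Bochner_Integration.integral_cong loc_E)
  qed (simp add: ind_def)
  ultimately show ?thesis by simp
qed

text \<open>Tonelli, then the mass of \<open>E\<close> in its first argument: the commutator
  operator has small norm on L1.\<close>

lemma nn_integral_Err:
  assumes v: "loc_integrable v" and v0: "\<And>q. 0 \<le> v q"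
  shows "(\<integral>\<^sup>+z. ennreal (ind k z * Err k v z) \<partial>st_borel n)
    \<le> ennreal (real n * (2 * (\<epsilon> k + \<epsilon> (Suc k)))) * (\<integral>\<^sup>+z. ennreal (loc (A (Suc (Suc k))) v z) \<partial>st_borel n)"
proof -
  let ?l = "loc (A (Suc (Suc k))) v"
  interpret P: pair_sigma_finite "st_borel n" "st_borel n" ..
  have lm: "?l \<in> borel_measurable (st_borel n)" using v by (auto simp: loc_integrable_def)
  have l0: "0 \<le> ?l q" for q using v0 by (simp add: loc_def)
  have m: "(\<lambda>p. ennreal (?l (snd p)) * ennreal (E k (fst p) (snd p))) \<in> borel_measurable (st_borel n \<Otimes>\<^sub>M st_borel n)"
    using measurable_compose[OF measurable_snd lm, of "st_borel n"] E_measurable_pair by simp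
  have "(\<integral>\<^sup>+z. ennreal (ind k z * Err k v z) \<partial>st_borel n) \<le> (\<integral>\<^sup>+z. \<integral>\<^sup>+q. ennreal (?l q) * ennreal (E k z q) \<partial>st_borel n \<partial>st_borel n)"
  proof (rule nn_integral_mono)
    fix z
    show "ennreal (ind k z * Err k v z) \<le> (\<integral>\<^sup>+q. ennreal (?l q) * ennreal (E k z q) \<partial>st_borel n)"
    proof (cases "snd z \<in> A (Suc k)")
      case True
      have "ennreal (Err k v z) = (\<integral>\<^sup>+q. ennreal (v q * E k z q) \<partial>st_borel n)"
        unfolding Err_def using v0 E_nonneg by (intro nn_integral_eq_integral[symmetric] integrable_E[OF True v]) auto
      also have "\<dots> = (\<integral>\<^sup>+q. ennreal (?l q) * ennreal (E k z q) \<partial>st_borel n)"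
      proof (rule nn_integral_cong)
        fix q assume "q \<in> space (st_borel n)"
        from loc_E[OF True this, of v] show "ennreal (v q * E k z q) = ennreal (?l q) * ennreal (E k z q)"
          by (simp only: ennreal_mult[OF l0 E_nonneg, symmetric])
      qed
      finally show ?thesis using True by (simp add: ind_def)
    qed (simp add: ind_def)
  qed
  also have "\<dots> = (\<integral>\<^sup>+q. \<integral>\<^sup>+z. ennreal (?l q) * ennreal (E k z q) \<partial>st_borel n \<partial>st_borel n)"
    using P.Fubini[OF m] by simp
  also have "\<dots> \<le> (\<integral>\<^sup>+q. ennreal (real n * (2 * (\<epsilon> k + \<epsilon> (Suc k)))) * ennreal (?l q) \<partial>st_borel n)"
  proof (rule nn_integral_mono)
    fix q assume q: "q \<in> space (st_borel n)"
    have "(\<lambda>z. E k z q) \<in> borel_measurable (st_borel n)"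
      using measurable_compose[OF measurable_Pair2'[OF q] E_measurable_pair] by simp
    then have "(\<integral>\<^sup>+z. ennreal (?l q) * ennreal (E k z q) \<partial>st_borel n) = ennreal (?l q) * (\<integral>\<^sup>+z. ennreal (E k z q) \<partial>st_borel n)"
      by (intro nn_integral_cmult) simp
    also have "\<dots> \<le> ennreal (?l q) * ennreal (real n * (2 * (\<epsilon> k + \<epsilon> (Suc k))))"
      by (intro mult_left_mono nn_integral_E(2)) simp
    finally show "(\<integral>\<^sup>+z. ennreal (?l q) * ennreal (E k z q) \<partial>st_borel n) \<le> ennreal (real n * (2 * (\<epsilon> k + \<epsilon> (Suc k)))) * ennreal (?l q)"
      by (simp add: mult.commute)
  qed
  also have "\<dots> = ennreal (real n * (2 * (\<epsilon> k + \<epsilon> (Suc k)))) * (\<integral>\<^sup>+z. ennreal (?l z) \<partial>st_borel n)"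
    using lm by (intro nn_integral_cmult) simp
  finally show ?thesis .
qed

lemma \<beta>_cv_diff_le:
  assumes z: "z \<in> topspace (st_top n)"
  shows "\<beta> k z * \<bar>cv k v z - t_conv \<delta> v z\<bar> \<le> ind k z * \<bar>cv k (loc (A (Suc (Suc k))) v) z - t_conv \<delta> (loc (A (Suc (Suc k))) v) z\<bar>"
proof (cases "snd z \<in> A (Suc k)")
  case True
  have "\<beta> k z \<le> 1"
    using \<theta>_le_1[OF z, of k] \<theta>_nonneg[OF z, of "k - 1"] by (auto simp: \<beta>_def)
  moreover have "snd z \<in> A (Suc (Suc k))" using True A_mono[of "Suc k" "Suc (Suc k)"] by auto
  ultimately show ?thesis using True \<beta>_nonneg[OF z, of k]
    by (simp add: cv_loc t_conv_loc ind_def mult_left_le_one_le)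
next
  case False
  then have "\<beta> k z = 0" using \<beta>_support[OF z, of k] by blast
  then show ?thesis by (simp add: ind_def)
qed

text \<open>On A N the weights \<beta> k with k \<le> Suc N sum to 1, so the error of the
  combination is at most the combination of the errors.\<close>

lemma sum_\<beta>_cv_diff_le:
  assumes z: "z \<in> topspace (st_top n)" "snd z \<in> A N"
  shows "\<bar>(\<Sum>k<Suc (Suc N). \<beta> k z * cv k v z) - t_conv \<delta> v z\<bar>
    \<le> (\<Sum>k<Suc (Suc N). ind k z * \<bar>cv k (loc (A (Suc (Suc k))) v) z - t_conv \<delta> (loc (A (Suc (Suc k))) v) z\<bar>)"
proof -
  have "snd z \<in> A (Suc N)" using z A_mono[of N "Suc N"] by auto
  then have "(\<Sum>k<Suc (Suc N). \<beta> k z) = 1" using sum_\<beta>[where N="Suc N" and z=z] \<theta>_1[OF z(1), of "Suc N"] by simp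
  then have "\<bar>(\<Sum>k<Suc (Suc N). \<beta> k z * cv k v z) - t_conv \<delta> v z\<bar> \<le> (\<Sum>k<Suc (Suc N). \<beta> k z * \<bar>cv k v z - t_conv \<delta> v z\<bar>)"
    by (intro abs_convex_combination_le \<beta>_nonneg z)
  also have "\<dots> \<le> (\<Sum>k<Suc (Suc N). ind k z * \<bar>cv k (loc (A (Suc (Suc k))) v) z - t_conv \<delta> (loc (A (Suc (Suc k))) v) z\<bar>)"
    by (intro sum_mono \<beta>_cv_diff_le z)
  finally show ?thesis .
qed

lemma ind_le_1: "0 \<le> ind k z" "ind k z \<le> 1"
  by (auto simp: ind_def indicator_def)

text \<open>Shared by the function and its gradient. With X the combination of mollified v and T its
  time average, b - v = (b - lam X) + lam (X - T) + lam (T - v) - (1 - lam) v. The bound R of the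
  first term is 0 for the function and consists of commutators for the gradient.\<close>

lemma L1_error_le:
  assumes v: "loc_integrable v"
    and b: "\<And>t x. x \<in> A N \<Longrightarrow> \<bar>b (t, x) - lam * (\<Sum>k<Suc (Suc N). \<beta> k (t, x) * cv k v (t, x))\<bar> \<le> R (t, x)"
    and R: "R \<in> borel_measurable (st_borel n)" "\<And>z. 0 \<le> R z"
  shows "(\<integral>\<^sup>+z. ennreal (indicator (A N) (snd z) * \<bar>b z - v z\<bar>) \<partial>st_borel n)
    \<le> (\<integral>\<^sup>+z. ennreal (R z) \<partial>st_borel n) + (\<Sum>k<Suc (Suc N). defect k v)
      + (\<integral>\<^sup>+z. ennreal \<bar>t_conv \<delta> (loc (A N) v) z - loc (A N) v z\<bar> \<partial>st_borel n)
      + ennreal (1 - lam) * (\<integral>\<^sup>+z. ennreal \<bar>loc (A N) v z\<bar> \<partial>st_borel n)"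
proof -
  define Df where "Df k z = \<bar>cv k (loc (A (Suc (Suc k))) v) z - t_conv \<delta> (loc (A (Suc (Suc k))) v) z\<bar>" for k z
  define Tf where "Tf z = \<bar>t_conv \<delta> (loc (A N) v) z - loc (A N) v z\<bar>" for z
  have lm: "loc (A k) v \<in> borel_measurable (st_borel n)" for k using v by (auto simp: loc_integrable_def)
  have Dm: "Df k \<in> borel_measurable (st_borel n)" for k
    unfolding Df_def[abs_def] by (intro borel_measurable_abs cv_diff_measurable v)
  have Tm: "Tf \<in> borel_measurable (st_borel n)"
    unfolding Tf_def[abs_def] by (intro borel_measurable_abs borel_measurable_diff t_conv_measurable lm)
  have "(\<integral>\<^sup>+z. ennreal (indicator (A N) (snd z) * \<bar>b z - v z\<bar>) \<partial>st_borel n)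
      \<le> (\<integral>\<^sup>+z. ennreal (R z) + (\<Sum>k<Suc (Suc N). ennreal (Df k z)) + ennreal (Tf z) + ennreal (1 - lam) * ennreal \<bar>loc (A N) v z\<bar> \<partial>st_borel n)"
  proof (rule nn_integral_mono)
    fix z assume "z \<in> space (st_borel n)"
    then obtain t x where z: "z = (t, x)" "(t, x) \<in> topspace (st_top n)" by auto
    show "ennreal (indicator (A N) (snd z) * \<bar>b z - v z\<bar>) \<le> ennreal (R z) + (\<Sum>k<Suc (Suc N). ennreal (Df k z)) + ennreal (Tf z) + ennreal (1 - lam) * ennreal \<bar>loc (A N) v z\<bar>"
    proof (cases "x \<in> A N")
      case False then show ?thesis by (simp add: z)
    next
      case True
      define X where "X = (\<Sum>k<Suc (Suc N). \<beta> k (t, x) * cv k v (t, x))"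
      define T where "T = t_conv \<delta> v (t, x)"
      have "\<bar>X - T\<bar> \<le> (\<Sum>k<Suc (Suc N). ind k (t, x) * Df k (t, x))"
        unfolding X_def T_def Df_def by (rule sum_\<beta>_cv_diff_le) (use z True in auto)
      also have "\<dots> \<le> (\<Sum>k<Suc (Suc N). Df k (t, x))"
        using ind_le_1 by (intro sum_mono mult_left_le_one_le) (auto simp: Df_def)
      finally have 1: "\<bar>X - T\<bar> \<le> (\<Sum>k<Suc (Suc N). Df k (t, x))" .
      have 2: "\<bar>b (t, x) - lam * X\<bar> \<le> R (t, x)" unfolding X_def by (rule b[OF True])
      have "lam * \<bar>X - T\<bar> \<le> 1 * \<bar>X - T\<bar>" "lam * \<bar>T - v z\<bar> \<le> 1 * \<bar>T - v z\<bar>" using lam by (intro mult_right_mono; simp)+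
      moreover have "b z - v z = (b z - lam * X) + lam * (X - T) + lam * (T - v z) - (1 - lam) * v z" by (simp add: algebra_simps)
      then have "\<bar>b z - v z\<bar> \<le> \<bar>b z - lam * X\<bar> + \<bar>lam * (X - T)\<bar> + \<bar>lam * (T - v z)\<bar> + \<bar>(1 - lam) * v z\<bar>" by linarith
      then have "\<bar>b z - v z\<bar> \<le> \<bar>b z - lam * X\<bar> + lam * \<bar>X - T\<bar> + lam * \<bar>T - v z\<bar> + (1 - lam) * \<bar>v z\<bar>" using lam by (simp add: abs_mult)
      ultimately have "\<bar>b z - v z\<bar> \<le> R z + (\<Sum>k<Suc (Suc N). Df k z) + \<bar>T - v z\<bar> + (1 - lam) * \<bar>v z\<bar>" using 1 2 unfolding z(1) by linarith
      also have "\<bar>T - v z\<bar> = Tf z" using True by (simp add: Tf_def T_def t_conv_loc z loc_def)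
      also have "(1 - lam) * \<bar>v z\<bar> = (1 - lam) * \<bar>loc (A N) v z\<bar>" using True by (simp add: z loc_def)
      finally have "ennreal \<bar>b z - v z\<bar> \<le> ennreal (R z + (\<Sum>k<Suc (Suc N). Df k z) + Tf z + (1 - lam) * \<bar>loc (A N) v z\<bar>)" by (rule ennreal_leI)
      also have "\<dots> = ennreal (R z) + (\<Sum>k<Suc (Suc N). ennreal (Df k z)) + ennreal (Tf z) + ennreal (1 - lam) * ennreal \<bar>loc (A N) v z\<bar>"
      proof -
        have "0 \<le> Df k z" for k by (simp add: Df_def)
        moreover have "0 \<le> Tf z" by (simp add: Tf_def)
        ultimately show ?thesis using R(2)[of z] lam
          by (simp only: ennreal_plus add_nonneg_nonneg sum_nonneg ennreal_mult mult_nonneg_nonneg abs_ge_zero sum_ennreal diff_ge_0_iff_ge less_imp_le)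
      qed
      finally show ?thesis using True by (simp add: z)
    qed
  qed
  also have "\<dots> = (\<integral>\<^sup>+z. ennreal (R z) \<partial>st_borel n) + (\<Sum>k<Suc (Suc N). \<integral>\<^sup>+z. ennreal (Df k z) \<partial>st_borel n)
      + (\<integral>\<^sup>+z. ennreal (Tf z) \<partial>st_borel n) + ennreal (1 - lam) * (\<integral>\<^sup>+z. ennreal \<bar>loc (A N) v z\<bar> \<partial>st_borel n)"
    using R(1) Dm Tm lm[of N]
    by (simp add: nn_integral_add nn_integral_sum nn_integral_cmult del: sum.lessThan_Suc)
  finally show ?thesis by (simp only: defect_def Df_def Tf_def)
qed

lemma u_error_le:
  assumes j: "j < m"
  shows "(\<integral>\<^sup>+z. ennreal (indicator (A N) (snd z) * \<bar>lam * B z j - u z j\<bar>) \<partial>st_borel n)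
    \<le> (\<Sum>k<Suc (Suc N). defect k (\<lambda>z. u z j))
      + (\<integral>\<^sup>+z. ennreal \<bar>t_conv \<delta> (loc (A N) (\<lambda>z. u z j)) z - loc (A N) (\<lambda>z. u z j) z\<bar> \<partial>st_borel n)
      + ennreal (1 - lam) * (\<integral>\<^sup>+z. ennreal \<bar>loc (A N) (\<lambda>z. u z j) z\<bar> \<partial>st_borel n)"
proof -
  have "\<bar>lam * B (t, x) j - lam * (\<Sum>k<Suc (Suc N). \<beta> k (t, x) * cv k (\<lambda>z. u z j) (t, x))\<bar> \<le> 0"
    if x: "x \<in> A N" for t x
  proof -
    have z: "(t, x) \<in> topspace (st_top n)" by (rule st_top_memI[OF x])
    have "B (t, x) j = S (Suc (Suc N)) j (t, x)" by (rule B_eq[OF z, of N]) (use x in auto)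
    also have "\<dots> = (\<Sum>k<Suc (Suc N). \<beta> k (t, x) * cv k (\<lambda>z. u z j) (t, x))"
      unfolding S_def
    proof (rule sum.cong[OF refl])
      fix k
      show "\<beta> k (t, x) * Mu k j (t, x) = \<beta> k (t, x) * cv k (\<lambda>z. u z j) (t, x)"
        using \<beta>_support[OF z, of k] Mu_eq[of x k j t] by (cases "\<beta> k (t, x) = 0") auto
    qed
    finally show ?thesis by simp
  qed
  from L1_error_le[OF loc_integrable_u[OF j] this] show ?thesis by simp
qed

lemma g_error_le:
  assumes j: "j < m" and i: "i < n"
  shows "(\<integral>\<^sup>+z. ennreal (indicator (A N) (snd z) * \<bar>dB z (j, i) - g z (j, i)\<bar>) \<partial>st_borel n)
    \<le> (\<Sum>k<Suc N. ennreal (C k * (real n * (2 * (\<epsilon> k + \<epsilon> (Suc k))))) * (\<integral>\<^sup>+z. ennreal (loc (A (Suc (Suc k))) G z) \<partial>st_borel n))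
      + (\<Sum>k<Suc (Suc N). defect k (\<lambda>z. g z (j, i)))
      + (\<integral>\<^sup>+z. ennreal \<bar>t_conv \<delta> (loc (A N) (\<lambda>z. g z (j, i))) z - loc (A N) (\<lambda>z. g z (j, i)) z\<bar> \<partial>st_borel n)
      + ennreal (1 - lam) * (\<integral>\<^sup>+z. ennreal \<bar>loc (A N) (\<lambda>z. g z (j, i)) z\<bar> \<partial>st_borel n)"
proof -
  define R where "R z = (\<Sum>k<Suc N. Dc k * (ind k z * Err k G z))" for z
  have e0: "0 \<le> ind k z * Err k G z" for k z
    using ind_le_1 Err_nonneg[OF G_nonneg] by (intro mult_nonneg_nonneg)
  have em: "(\<lambda>z. ind k z * Err k G z) \<in> borel_measurable (st_borel n)" for k by (rule Err_measurable[OF loc_integrable_G])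
  have Rm: "R \<in> borel_measurable (st_borel n)"
    unfolding R_def[abs_def] by (intro borel_measurable_sum borel_measurable_times em) simp
  have R0: "0 \<le> R z" for z unfolding R_def by (intro sum_nonneg mult_nonneg_nonneg[OF Dc(2) e0])
  have b: "\<bar>dB (t, x) (j, i) - lam * (\<Sum>k<Suc (Suc N). \<beta> k (t, x) * cv k (\<lambda>z. g z (j, i)) (t, x))\<bar> \<le> R (t, x)"
    if x: "x \<in> A N" for t x
  proof -
    have z: "(t, x) \<in> topspace (st_top n)" by (rule st_top_memI[OF x])
    let ?Q = "\<Sum>k<Suc N. d\<theta> i k (t, x) * (\<Sum>l<n. st_conv n (ker_gap \<delta> (\<epsilon> k) (\<epsilon> (Suc k)) l) (\<lambda>z. g z (j, l)) (t, x))"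
    have "dB (t, x) (j, i) - lam * (\<Sum>k<Suc (Suc N). \<beta> k (t, x) * cv k (\<lambda>z. g z (j, i)) (t, x)) = lam * ?Q"
      unfolding dB_eq[OF x i j] by (simp only: distrib_left add_diff_cancel_left')
    moreover have "\<bar>?Q\<bar> \<le> R (t, x)"
      unfolding R_def mult.assoc[symmetric] by (intro order_trans[OF sum_abs] sum_mono gap_bound i j z)
    moreover have "lam * \<bar>?Q\<bar> \<le> 1 * \<bar>?Q\<bar>" using lam by (intro mult_right_mono) auto
    ultimately show ?thesis using lam by (simp only: abs_mult abs_of_pos)
  qed
  \<comment> \<open>\<open>C k\<close> contains the factor m n, at least 1 here, so the smallness
    arranged for \<open>C\<close> also covers the single-entry bound with \<open>Dc\<close>.\<close>
  have mn: "1 \<le> real m * real n" using i j mult_mono[of 1 "real m" 1 "real n"] by simp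
  have "(\<integral>\<^sup>+z. ennreal (R z) \<partial>st_borel n) = (\<Sum>k<Suc N. ennreal (Dc k) * (\<integral>\<^sup>+z. ennreal (ind k z * Err k G z) \<partial>st_borel n))"
  proof -
    have "(\<integral>\<^sup>+z. ennreal (R z) \<partial>st_borel n) = (\<integral>\<^sup>+z. (\<Sum>k<Suc N. ennreal (Dc k) * ennreal (ind k z * Err k G z)) \<partial>st_borel n)"
      unfolding R_def
    proof (rule nn_integral_cong)
      fix z
      have "ennreal (\<Sum>k<Suc N. Dc k * (ind k z * Err k G z)) = (\<Sum>k<Suc N. ennreal (Dc k * (ind k z * Err k G z)))"
        by (intro sum_ennreal[symmetric] mult_nonneg_nonneg[OF Dc(2) e0])
      also have "\<dots> = (\<Sum>k<Suc N. ennreal (Dc k) * ennreal (ind k z * Err k G z))"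
        by (intro sum.cong refl ennreal_mult Dc(2) e0)
      finally show "ennreal (\<Sum>k<Suc N. Dc k * (ind k z * Err k G z)) = (\<Sum>k<Suc N. ennreal (Dc k) * ennreal (ind k z * Err k G z))" .
    qed
    also have "\<dots> = (\<Sum>k<Suc N. \<integral>\<^sup>+z. ennreal (Dc k) * ennreal (ind k z * Err k G z) \<partial>st_borel n)"
      using em by (intro nn_integral_sum) simp
    also have "\<dots> = (\<Sum>k<Suc N. ennreal (Dc k) * (\<integral>\<^sup>+z. ennreal (ind k z * Err k G z) \<partial>st_borel n))"
      using em by (intro sum.cong refl nn_integral_cmult) simp
    finally show ?thesis .
  qed
  also have "\<dots> \<le> (\<Sum>k<Suc N. ennreal (C k * (real n * (2 * (\<epsilon> k + \<epsilon> (Suc k))))) * (\<integral>\<^sup>+z. ennreal (loc (A (Suc (Suc k))) G z) \<partial>st_borel n))"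
  proof (rule sum_mono)
    fix k
    have c0: "0 \<le> real n * (2 * (\<epsilon> k + \<epsilon> (Suc k)))" using \<epsilon>(1)[of k] \<epsilon>(1)[of "Suc k"] by simp
    have "1 * Dc k \<le> C k" unfolding C_def using mn Dc(2) by (intro mult_right_mono)
    then have "ennreal (Dc k) * (\<integral>\<^sup>+z. ennreal (ind k z * Err k G z) \<partial>st_borel n)
      \<le> ennreal (C k) * (ennreal (real n * (2 * (\<epsilon> k + \<epsilon> (Suc k)))) * (\<integral>\<^sup>+z. ennreal (loc (A (Suc (Suc k))) G z) \<partial>st_borel n))"
      by (intro mult_mono nn_integral_Err loc_integrable_G G_nonneg ennreal_leI) auto
    then show "ennreal (Dc k) * (\<integral>\<^sup>+z. ennreal (ind k z * Err k G z) \<partial>st_borel n)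
      \<le> ennreal (C k * (real n * (2 * (\<epsilon> k + \<epsilon> (Suc k))))) * (\<integral>\<^sup>+z. ennreal (loc (A (Suc (Suc k))) G z) \<partial>st_borel n)"
      using c0 C_nonneg[of k] by (simp only: ennreal_mult mult.assoc)
  qed
  finally have "(\<integral>\<^sup>+z. ennreal (R z) \<partial>st_borel n) \<le> \<dots>" .
  from order_trans[OF L1_error_le[OF loc_integrable_g[OF j i] b Rm R0] add_right_mono[OF add_right_mono[OF add_right_mono[OF this]]]]
  show ?thesis .
qed

text \<open>Truncated subtraction in \<open>ennreal\<close> measures the excess over F only, which
  is what Jensen's inequality controls. After multiplication by w the time average becomes exactly
  that of F; the remaining terms of index k live on A (Suc k), where w is at most W (Suc k).\<close>

lemma modular_excess_le:
  assumes w: "w \<in> borel_measurable (sp_borel n)" "\<And>x. 0 \<le> w x" "\<And>x. x \<notin> \<Omega> \<Longrightarrow> w x = 0"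
    and W: "\<And>k x. x \<in> A k \<Longrightarrow> w x \<le> W k" "\<And>k. 0 \<le> W k"
  defines "F \<equiv> (\<lambda>z. w (snd z) * \<phi> (G z))"
  assumes F: "integrable (st_borel n) F"
  shows "(\<integral>\<^sup>+z. ennreal (w (snd z) * \<phi> (mat_norm m n (dB z))) - ennreal (F z) \<partial>st_borel n)
    \<le> (\<integral>\<^sup>+z. ennreal \<bar>t_conv \<delta> F z - F z\<bar> \<partial>st_borel n)
      + (\<Sum>k. ennreal (W (Suc k)) * (defect k (\<lambda>z. \<phi> (G z)) +
          ennreal (C k * (real n * (2 * (\<epsilon> k + \<epsilon> (Suc k))))) * (\<integral>\<^sup>+z. ennreal (loc (A (Suc (Suc k))) (\<lambda>z. \<phi> (G z)) z) \<partial>st_borel n)))"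
proof -
  let ?\<Phi> = "\<lambda>z. \<phi> (G z)"
  have \<phi>0: "0 \<le> ?\<Phi> q" for q by (rule young_fun_nonneg[OF \<phi> G_nonneg])
  have F0: "0 \<le> F z" for z unfolding F_def using w(2) \<phi>0 by simp
  define Df where "Df k z = \<bar>cv k (loc (A (Suc (Suc k))) ?\<Phi>) z - t_conv \<delta> (loc (A (Suc (Suc k))) ?\<Phi>) z\<bar>" for k z
  define Er where "Er k z = ind k z * Err k ?\<Phi> z" for k z
  define a where "a k z = W (Suc k) * (Df k z + C k * Er k z)" for k z
  have Dm: "Df k \<in> borel_measurable (st_borel n)" for k
    unfolding Df_def[abs_def] by (intro borel_measurable_abs cv_diff_measurable loc_integrable_\<Phi>)
  have Em: "Er k \<in> borel_measurable (st_borel n)" for k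
    unfolding Er_def[abs_def] by (rule Err_measurable[OF loc_integrable_\<Phi>])
  have D0: "0 \<le> Df k z" for k z by (simp add: Df_def)
  have E0: "0 \<le> Er k z" for k z unfolding Er_def using ind_le_1 Err_nonneg[of ?\<Phi>, OF \<phi>0] by (intro mult_nonneg_nonneg)
  have a0: "0 \<le> a k z" for k z unfolding a_def using W(2) D0 E0 C_nonneg by simp
  have am: "a k \<in> borel_measurable (st_borel n)" for k unfolding a_def[abs_def] using Dm Em by simp
  have Fm: "F \<in> borel_measurable (st_borel n)" using F by auto
  have tm: "t_conv \<delta> F \<in> borel_measurable (st_borel n)" by (rule t_conv_measurable[OF Fm])
  have "(\<integral>\<^sup>+z. ennreal (w (snd z) * \<phi> (mat_norm m n (dB z))) - ennreal (F z) \<partial>st_borel n)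
      \<le> (\<integral>\<^sup>+z. ennreal \<bar>t_conv \<delta> F z - F z\<bar> + (\<Sum>k. ennreal (a k z)) \<partial>st_borel n)"
  proof (rule nn_integral_mono)
    fix z assume "z \<in> space (st_borel n)"
    then obtain t x where z: "z = (t, x)" "(t, x) \<in> topspace (st_top n)" by auto
    show "ennreal (w (snd z) * \<phi> (mat_norm m n (dB z))) - ennreal (F z) \<le> ennreal \<bar>t_conv \<delta> F z - F z\<bar> + (\<Sum>k. ennreal (a k z))"
    proof (cases "x \<in> \<Omega>")
      case False
      then show ?thesis using w(3) by (simp add: z)
    next
      case True
      then obtain N where N: "x \<in> A N" using A_cover by blast
      define X where "X = (\<Sum>k<Suc (Suc N). \<beta> k (t, x) * cv k ?\<Phi> (t, x))"
      define T where "T = t_conv \<delta> ?\<Phi> (t, x)"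
      have "\<bar>X - T\<bar> \<le> (\<Sum>k<Suc (Suc N). ind k (t, x) * Df k (t, x))"
        unfolding X_def T_def Df_def by (rule sum_\<beta>_cv_diff_le) (use z N in auto)
      moreover have "(\<Sum>k<Suc N. C k * ind k (t, x) * Err k ?\<Phi> (t, x)) \<le> (\<Sum>k<Suc (Suc N). ind k (t, x) * (C k * Er k (t, x)))"
      proof -
        have "C k * ind k (t, x) * Err k ?\<Phi> (t, x) = ind k (t, x) * (C k * Er k (t, x))" for k
          by (simp add: Er_def ind_def indicator_def)
        then have "(\<Sum>k<Suc N. C k * ind k (t, x) * Err k ?\<Phi> (t, x)) = (\<Sum>k<Suc N. ind k (t, x) * (C k * Er k (t, x)))" by (simp only:)
        also have "\<dots> \<le> (\<Sum>k<Suc (Suc N). ind k (t, x) * (C k * Er k (t, x)))"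
          using ind_le_1 C_nonneg E0 by (intro sum_mono2) auto
        finally show ?thesis .
      qed
      moreover have "\<phi> (mat_norm m n (dB (t, x))) \<le> X + (\<Sum>k<Suc N. C k * ind k (t, x) * Err k ?\<Phi> (t, x))"
        unfolding X_def by (rule young_dB_le[OF N])
      ultimately have "\<phi> (mat_norm m n (dB (t, x))) \<le> T + (\<Sum>k<Suc (Suc N). ind k (t, x) * Df k (t, x)) + (\<Sum>k<Suc (Suc N). ind k (t, x) * (C k * Er k (t, x)))"
        by linarith
      then have "\<phi> (mat_norm m n (dB (t, x))) \<le> T + (\<Sum>k<Suc (Suc N). ind k (t, x) * (Df k (t, x) + C k * Er k (t, x)))"
        by (simp only: distrib_left sum.distrib add.assoc)
      then have "w x * \<phi> (mat_norm m n (dB (t, x))) \<le> w x * (T + (\<Sum>k<Suc (Suc N). ind k (t, x) * (Df k (t, x) + C k * Er k (t, x))))"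
        by (rule mult_left_mono[OF _ w(2)])
      also have "\<dots> = w x * T + (\<Sum>k<Suc (Suc N). w x * (ind k (t, x) * (Df k (t, x) + C k * Er k (t, x))))"
        by (simp only: distrib_left sum_distrib_left)
      also have "\<dots> \<le> w x * T + (\<Sum>k<Suc (Suc N). a k (t, x))"
      proof (intro add_left_mono sum_mono)
        fix k
        have "w x * ind k (t, x) \<le> W (Suc k)" using W(1)[of x "Suc k"] W(2) by (simp add: ind_def indicator_def)
        then have "(w x * ind k (t, x)) * (Df k (t, x) + C k * Er k (t, x)) \<le> a k (t, x)"
          unfolding a_def using D0 E0 C_nonneg by (intro mult_right_mono) auto
        then show "w x * (ind k (t, x) * (Df k (t, x) + C k * Er k (t, x))) \<le> a k (t, x)" by (simp only: mult.assoc)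
      qed
      also have "w x * T = t_conv \<delta> F z" unfolding F_def T_def using t_conv_weight[of \<delta> w ?\<Phi> z] by (simp add: z)
      finally have "w x * \<phi> (mat_norm m n (dB (t, x))) - F z \<le> \<bar>t_conv \<delta> F z - F z\<bar> + (\<Sum>k<Suc (Suc N). a k z)" unfolding z(1) by linarith
      then have "ennreal (w (snd z) * \<phi> (mat_norm m n (dB z)) - F z) \<le> ennreal (\<bar>t_conv \<delta> F z - F z\<bar> + (\<Sum>k<Suc (Suc N). a k z))"
        unfolding z(1) by (intro ennreal_leI) simp
      also have "\<dots> = ennreal \<bar>t_conv \<delta> F z - F z\<bar> + (\<Sum>k<Suc (Suc N). ennreal (a k z))"
        using a0 by (simp only: ennreal_plus abs_ge_zero sum_nonneg sum_ennreal)
      also have "\<dots> \<le> ennreal \<bar>t_conv \<delta> F z - F z\<bar> + (\<Sum>k. ennreal (a k z))"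
        by (intro add_left_mono sum_le_suminf) auto
      finally show ?thesis using F0[of z] by (simp only: ennreal_minus)
    qed
  qed
  also have "\<dots> = (\<integral>\<^sup>+z. ennreal \<bar>t_conv \<delta> F z - F z\<bar> \<partial>st_borel n) + (\<Sum>k. \<integral>\<^sup>+z. ennreal (a k z) \<partial>st_borel n)"
    using am Fm tm by (simp add: nn_integral_add nn_integral_suminf)
  also have "\<dots> \<le> (\<integral>\<^sup>+z. ennreal \<bar>t_conv \<delta> F z - F z\<bar> \<partial>st_borel n)
      + (\<Sum>k. ennreal (W (Suc k)) * (defect k ?\<Phi> +
          ennreal (C k * (real n * (2 * (\<epsilon> k + \<epsilon> (Suc k))))) * (\<integral>\<^sup>+z. ennreal (loc (A (Suc (Suc k))) ?\<Phi> z) \<partial>st_borel n)))"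
  proof (intro add_left_mono suminf_le allI)
    fix k
    have c0: "0 \<le> real n * (2 * (\<epsilon> k + \<epsilon> (Suc k)))" using \<epsilon>(1)[of k] \<epsilon>(1)[of "Suc k"] by simp
    have ak: "ennreal (a k z) = ennreal (W (Suc k)) * (ennreal (Df k z) + ennreal (C k) * ennreal (Er k z))" for z
      unfolding a_def using W(2) D0 E0 C_nonneg by (simp add: ennreal_mult)
    then have "(\<integral>\<^sup>+z. ennreal (a k z) \<partial>st_borel n) = ennreal (W (Suc k)) * (defect k ?\<Phi> + ennreal (C k) * (\<integral>\<^sup>+z. ennreal (Er k z) \<partial>st_borel n))"
    proof -
      have d: "defect k ?\<Phi> = (\<integral>\<^sup>+z. ennreal (Df k z) \<partial>st_borel n)" by (simp only: defect_def Df_def)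
      show ?thesis unfolding ak d using Dm[of k] Em[of k]
        by (simp add: nn_integral_cmult nn_integral_add)
    qed
    also have "\<dots> \<le> ennreal (W (Suc k)) * (defect k ?\<Phi> + ennreal (C k) * (ennreal (real n * (2 * (\<epsilon> k + \<epsilon> (Suc k)))) * (\<integral>\<^sup>+z. ennreal (loc (A (Suc (Suc k))) ?\<Phi> z) \<partial>st_borel n)))"
      unfolding Er_def by (intro mult_left_mono add_left_mono nn_integral_Err loc_integrable_\<Phi> \<phi>0) auto
    finally show "(\<integral>\<^sup>+z. ennreal (a k z) \<partial>st_borel n) \<le> ennreal (W (Suc k)) * (defect k ?\<Phi> +
          ennreal (C k * (real n * (2 * (\<epsilon> k + \<epsilon> (Suc k))))) * (\<integral>\<^sup>+z. ennreal (loc (A (Suc (Suc k))) ?\<Phi> z) \<partial>st_borel n))"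
      using c0 C_nonneg[of k] by (simp only: ennreal_mult mult.assoc)
  qed auto
  finally show ?thesis .
qed

end

subsection \<open>Approximation up to a prescribed error\<close>

lemma nn_integral_abs_eq_ennreal:
  fixes f :: "'a \<Rightarrow> real"
  assumes "integrable M f"
  shows "(\<integral>\<^sup>+z. ennreal \<bar>f z\<bar> \<partial>M) = ennreal (LINT z|M. \<bar>f z\<bar>)"
  by (rule nn_integral_eq_integral) (use assms in auto)

lemma suminf_geometric_ennreal:
  assumes "0 \<le> c" shows "(\<Sum>k. ennreal (c * (1/2) ^ Suc k)) = ennreal c"
proof -
  have "(\<lambda>k. c * (1/2) ^ Suc k) sums (c * 1)" by (rule sums_mult[OF power_half_series])
  then show ?thesis using assms by (subst suminf_ennreal2) (auto simp: sums_iff)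
qed

lemma sum_geometric_le:
  assumes "0 \<le> c" shows "(\<Sum>k<N. c * (1/2) ^ Suc k) \<le> (c :: real)"
proof -
  have s: "(\<lambda>k. c * (1/2) ^ Suc k) sums (c * 1)" by (rule sums_mult[OF power_half_series])
  have "(\<Sum>k<N. c * (1/2) ^ Suc k) \<le> (\<Sum>k. c * (1/2) ^ Suc k)"
    using s assms by (intro sum_le_suminf) (auto simp: sums_iff)
  then show ?thesis using s by (simp add: sums_iff)
qed

lemma eventually_defect_le:
  assumes "f \<longlonglongrightarrow> (0::ennreal)" "0 < (c::real)"
  shows "\<forall>\<^sub>F N in sequentially. f N \<le> ennreal c"
proof -
  have "0 < ennreal c" using assms(2) by simp
  from order_tendstoD(2)[OF assms(1) this] show ?thesis by eventually_elim simp
qed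

text \<open>The convergence statements run along the widths 1 / (N + 1); this extracts one width
  that also meets an upper bound.\<close>

lemma exists_scale:
  assumes "\<forall>\<^sub>F N in sequentially. P (1 / real (Suc N))" "0 < (d::real)"
  obtains \<epsilon> where "0 < \<epsilon>" "\<epsilon> \<le> d" "P \<epsilon>"
proof -
  have "(\<lambda>N. 1 / real (Suc N)) \<longlonglongrightarrow> 0"
    using LIMSEQ_inverse_real_of_nat by (simp add: inverse_eq_divide)
  from order_tendstoD(2)[OF this assms(2)] assms(1)
  have "\<forall>\<^sub>F N in sequentially. 1 / real (Suc N) \<le> d \<and> P (1 / real (Suc N))"
    by eventually_elim simp
  then obtain N where "1 / real (Suc N) \<le> d" "P (1 / real (Suc N))"
    unfolding eventually_sequentially by auto
  then show thesis by (intro that[of "1 / real (Suc N)"]) auto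
qed

text \<open>The parameters are fixed in an order in which each may depend on the earlier ones:
  \<eta> from L1 norms on A N, then the time width \<delta>, then the spatial widths \<epsilon> k
  from constants belonging to nearby sets of the exhaustion. The four sources of error, namely
  commutators, spatial defect, time defect and the factor 1 - \<eta>, receive e / 4 each. The set A
  N concerns the L1 estimates only; the excess is estimated on all of space-time.\<close>

lemma core_approximation:
  fixes u :: "real \<times> point \<Rightarrow> nat \<Rightarrow> real" and g :: "real \<times> point \<Rightarrow> nat \<times> nat \<Rightarrow> real"
  assumes \<Omega>: "openin (sp_top n) \<Omega>"
    and exh: "sp_exhaustion n \<Omega> A r" and cut: "sp_cutoffs n A \<theta>" and \<phi>: "young_fun \<phi>"
    and u: "\<And>j k. j < m \<Longrightarrow> integrable (st_borel n) (loc (A k) (\<lambda>z. u z j))"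
    and g: "\<And>j i k. j < m \<Longrightarrow> i < n \<Longrightarrow> integrable (st_borel n) (loc (A k) (\<lambda>z. g z (j, i)))"
    and gm: "\<And>j i. j < m \<Longrightarrow> i < n \<Longrightarrow> (\<lambda>z. g z (j, i)) \<in> borel_measurable (st_borel n)"
    and weak: "\<And>j i. j < m \<Longrightarrow> i < n \<Longrightarrow> AE t in lborel. \<forall>\<psi>. test_function n \<Omega> \<psi> \<longrightarrow>
       (LINT x|sp_borel n. u (t, x) j * partial sp_move i \<psi> x) = - (LINT x|sp_borel n. g (t, x) (j, i) * \<psi> x)"
    and w: "w \<in> borel_measurable (sp_borel n)" "\<And>x. 0 \<le> w x" "\<And>x. x \<notin> \<Omega> \<Longrightarrow> w x = 0"
    and wb: "\<And>k. \<exists>c C. 0 < c \<and> (\<forall>x\<in>A k. c \<le> w x \<and> w x \<le> C)"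
    and fin: "(\<integral>\<^sup>+z. ennreal (w (snd z) * \<phi> (mat_norm m n (g z))) \<partial>st_borel n) < \<infinity>"
    and e: "0 < (e::real)"
  shows "\<exists>b. (\<forall>j<m. st_smooth n (UNIV \<times> \<Omega>) (\<lambda>z. b z j)) \<and>
    (\<forall>j<m. (\<integral>\<^sup>+z. ennreal (indicator (A N) (snd z) * \<bar>b z j - u z j\<bar>) \<partial>st_borel n) \<le> ennreal e) \<and>
    (\<forall>j<m. \<forall>i<n. (\<integral>\<^sup>+z. ennreal (indicator (A N) (snd z) * \<bar>sp_deriv b z (j, i) - g z (j, i)\<bar>) \<partial>st_borel n) \<le> ennreal e) \<and>
    (\<integral>\<^sup>+z. ennreal (w (snd z) * \<phi> (mat_norm m n (sp_deriv b z))) - ennreal (w (snd z) * \<phi> (mat_norm m n (g z))) \<partial>st_borel n) \<le> ennreal e"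
proof -
  define G where "G z = mat_norm m n (g z)" for z
  define \<Phi> where "\<Phi> z = \<phi> (G z)" for z
  define F where "F z = w (snd z) * \<Phi> z" for z
  \<comment> \<open>All components of u and g; since there are finitely many, common widths serve
    them all.\<close>
  define V where "V = (\<lambda>j z. u z j) ` {..<m} \<union> (\<lambda>a z. g z a) ` ({..<m} \<times> {..<n})"
  have finV: "finite V" by (simp add: V_def)
  have G0: "0 \<le> G z" for z by (simp add: G_def mat_norm_nonneg)
  have \<Phi>0: "0 \<le> \<Phi> z" for z unfolding \<Phi>_def by (rule young_fun_nonneg[OF \<phi> G0])
  have Gm: "G \<in> borel_measurable (st_borel n)"
    unfolding G_def[abs_def] mat_norm_def by (rule borel_measurable_L2_set) (auto intro: gm)
  have \<Phi>m: "\<Phi> \<in> borel_measurable (st_borel n)"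
    unfolding \<Phi>_def[abs_def] by (rule young_fun_measurable[OF \<phi> Gm G0])
  have wm: "(\<lambda>z. w (snd z)) \<in> borel_measurable (st_borel n)"
    unfolding st_borel_def by (rule measurable_compose[OF measurable_snd w(1)])
  have F0: "0 \<le> F z" for z using w(2) \<Phi>0 by (simp add: F_def)
  have Fi: "integrable (st_borel n) F"
  proof (rule integrableI_nonneg)
    show "F \<in> borel_measurable (st_borel n)" unfolding F_def[abs_def] using wm \<Phi>m by (rule borel_measurable_times)
    show "(\<integral>\<^sup>+z. ennreal (F z) \<partial>st_borel n) < \<infinity>" using fin by (simp add: F_def \<Phi>_def G_def)
  qed (use F0 in auto)
  have As: "A k \<in> sets (sp_borel n)" for k
    using exh compactin_sp_top_sets unfolding sp_exhaustion_def by blast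
  have Am: "(\<lambda>z. indicator (A k) (snd z) :: real) \<in> borel_measurable (st_borel n)" for k
    unfolding st_borel_def using As[of k] by (intro measurable_compose[OF measurable_snd]) simp
  \<comment> \<open>The lower bound of w on A k turns integrability of F into local integrability of
    \<Phi>.\<close>
  have \<Phi>i: "integrable (st_borel n) (loc (A k) \<Phi>)" for k
  proof -
    obtain c C where c: "0 < c" "\<And>x. x \<in> A k \<Longrightarrow> c \<le> w x" using wb[of k] by blast
    show ?thesis
    proof (rule Bochner_Integration.integrable_bound[where f="\<lambda>z. 1 / c * F z"])
      show "loc (A k) \<Phi> \<in> borel_measurable (st_borel n)"
        unfolding loc_def[abs_def] by (rule borel_measurable_times[OF Am \<Phi>m])
      have "loc (A k) \<Phi> z \<le> 1 / c * F z" for z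
      proof (cases "snd z \<in> A k")
        case True
        have "c * \<Phi> z \<le> F z" unfolding F_def using c(2)[OF True] \<Phi>0 by (rule mult_right_mono)
        then show ?thesis using True c(1) by (simp add: loc_def field_simps)
      qed (use c(1) F0 in \<open>simp add: loc_def\<close>)
      then show "AE z in st_borel n. norm (loc (A k) \<Phi> z) \<le> norm (1 / c * F z)"
        using c(1) F0 \<Phi>0 by (auto simp: loc_def)
    qed (use Fi in simp)
  qed
  have Vi: "integrable (st_borel n) (loc (A k) v)" if "v \<in> V" for k v
    using that u g by (auto simp: V_def)
  have Gi: "integrable (st_borel n) (loc (A k) G)" for k
  proof (rule Bochner_Integration.integrable_bound[where f="\<lambda>z. \<Sum>a\<in>{..<m}\<times>{..<n}. \<bar>loc (A k) (\<lambda>z. g z a) z\<bar>"])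
    show "loc (A k) G \<in> borel_measurable (st_borel n)"
      unfolding loc_def[abs_def] by (rule borel_measurable_times[OF Am Gm])
    have "loc (A k) G z \<le> (\<Sum>a\<in>{..<m}\<times>{..<n}. \<bar>loc (A k) (\<lambda>z. g z a) z\<bar>)" for z
      unfolding G_def mat_norm_def loc_def using L2_set_le_sum_abs[of "g z" "{..<m}\<times>{..<n}"]
      by (auto simp: indicator_def sum_nonneg)
    then show "AE z in st_borel n. norm (loc (A k) G z) \<le> norm (\<Sum>a\<in>{..<m}\<times>{..<n}. \<bar>loc (A k) (\<lambda>z. g z a) z\<bar>)"
      using G0 by (auto simp: loc_def sum_nonneg)
  qed (use g in auto)
  define M where "M = (\<Sum>v\<in>V. LINT z|st_borel n. \<bar>loc (A N) v z\<bar>)"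
  have M0: "0 \<le> M" unfolding M_def by (intro sum_nonneg integral_nonneg_AE AE_I2) auto
  \<comment> \<open>1 + M in place of M avoids a division by 0, and the bound 1/2 keeps 1 - \<eta>
    strictly positive.\<close>
  define \<eta> where "\<eta> = min (1/2) (e / 4 / (1 + M))"
  have \<eta>12: "0 < \<eta>" "\<eta> \<le> 1/2"
    using e M0 unfolding \<eta>_def by (simp, intro min.cobounded1)
  have "\<eta> * (1 + M) \<le> e / 4 / (1 + M) * (1 + M)"
    using M0 by (intro mult_right_mono) (auto simp: \<eta>_def)
  also have "\<dots> = e / 4"
    using nonzero_eq_divide_eq[of "1 + M" "e / 4 / (1 + M)" "e / 4"] M0 by fastforce
  finally have \<eta>: "0 < \<eta>" "\<eta> \<le> 1/2" "\<eta> * (1 + M) \<le> e / 4"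
    using \<eta>12 by auto
  have \<eta>V: "ennreal \<eta> * (\<integral>\<^sup>+z. ennreal \<bar>loc (A N) v z\<bar> \<partial>st_borel n) \<le> ennreal (e / 4)" if v: "v \<in> V" for v
  proof -
    have "(LINT z|st_borel n. \<bar>loc (A N) v z\<bar>) \<le> M"
      unfolding M_def using finV v by (intro member_le_sum integral_nonneg_AE AE_I2) auto
    then have "\<eta> * (LINT z|st_borel n. \<bar>loc (A N) v z\<bar>) \<le> \<eta> * (1 + M)" using \<eta>(1) by (intro mult_left_mono) auto
    also note \<eta>(3)
    finally have "ennreal (\<eta> * (LINT z|st_borel n. \<bar>loc (A N) v z\<bar>)) \<le> ennreal (e / 4)" by (rule ennreal_leI)
    then show ?thesis using \<eta>(1) by (simp only: nn_integral_abs_eq_ennreal[OF Vi[OF v]] ennreal_mult'[symmetric] less_imp_le)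
  qed
  have ev: "\<forall>\<^sub>F k in sequentially. (\<integral>\<^sup>+z. ennreal \<bar>t_conv (1 / real (Suc k)) F z - F z\<bar> \<partial>st_borel n) \<le> ennreal (e / 4) \<and>
      (\<forall>v\<in>V. (\<integral>\<^sup>+z. ennreal \<bar>t_conv (1 / real (Suc k)) (loc (A N) v) z - loc (A N) v z\<bar> \<partial>st_borel n) \<le> ennreal (e / 4))"
    using e by (intro eventually_conj eventually_ball_finite finV ballI eventually_defect_le t_conv_defect Fi Vi) auto
  obtain \<delta> where \<delta>': "0 < \<delta>" "\<delta> \<le> 1" "(\<integral>\<^sup>+z. ennreal \<bar>t_conv \<delta> F z - F z\<bar> \<partial>st_borel n) \<le> ennreal (e / 4) \<and>
      (\<forall>v\<in>V. (\<integral>\<^sup>+z. ennreal \<bar>t_conv \<delta> (loc (A N) v) z - loc (A N) v z\<bar> \<partial>st_borel n) \<le> ennreal (e / 4))"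
    by (rule exists_scale[OF ev zero_less_one])
  note \<delta> = \<delta>'(1) conjunct1[OF \<delta>'(3)] bspec[OF conjunct2[OF \<delta>'(3)]]
  have "\<forall>k. \<exists>W. 0 \<le> W \<and> (\<forall>x\<in>A k. w x \<le> W)"
  proof
    fix k
    obtain c C where "\<forall>x\<in>A k. c \<le> w x \<and> w x \<le> C" using wb[of k] by blast
    then show "\<exists>W. 0 \<le> W \<and> (\<forall>x\<in>A k. w x \<le> W)" by (intro exI[of _ "max 0 C"]) (auto simp: le_max_iff_disj)
  qed
  then obtain W where W: "\<And>k. 0 \<le> W k" "\<And>k x. x \<in> A k \<Longrightarrow> w x \<le> W k" by metis
  have "\<forall>k. \<exists>D. 0 \<le> D \<and> (\<forall>i<n. \<forall>z. \<bar>partial st_move (Some i) (\<theta> k) z\<bar> \<le> D)"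
    using cut unfolding sp_cutoffs_def by blast
  then obtain Dc where Dc: "\<And>k. 0 \<le> Dc k" "\<And>i k z. i < n \<Longrightarrow> \<bar>partial st_move (Some i) (\<theta> k) z\<bar> \<le> Dc k" by metis
  define C where "C k = real m * real n * Dc k" for k
  define J where "J k = (LINT z|st_borel n. \<bar>loc (A (Suc (Suc k))) \<Phi> z\<bar>) + (LINT z|st_borel n. \<bar>loc (A (Suc (Suc k))) G z\<bar>)" for k
  \<comment> \<open>Gathers every constant that multiplies \<epsilon> k + \<epsilon> (Suc k) in the
    mass condition, the gradient error and the modular excess. The summands 1 allow j and v in
    \<open>CJ\<close> below to be either 1 or a norm respectively a bound of the weight.\<close>
  define P where "P k = C k * (real n * 2) * (1 + J k) * (1 + W (Suc k))" for k
  define \<rho> where "\<rho> = min \<eta> (e / 4)"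
  have \<rho>: "0 < \<rho>" "\<rho> \<le> \<eta>" "\<rho> \<le> e / 4" using \<eta> e by (auto simp: \<rho>_def)
  have C0: "0 \<le> C k" for k using Dc by (simp add: C_def)
  have J0: "0 \<le> J k" for k unfolding J_def by (intro add_nonneg_nonneg integral_nonneg_AE AE_I2) auto
  have P0: "0 \<le> P k" for k unfolding P_def using C0[of k] J0[of k] W(1)[of "Suc k"] by simp
  have rp: "0 < r k" for k using exh by (simp add: sp_exhaustion_def)
  define Df where "Df k \<epsilon> v = (\<integral>\<^sup>+z. ennreal \<bar>st_conv n (ker_mol \<delta> \<epsilon>) (loc (A (Suc (Suc k))) v) z - t_conv \<delta> (loc (A (Suc (Suc k))) v) z\<bar> \<partial>st_borel n)" for k \<epsilon> v
  \<comment> \<open>Both P k and P (k - 1) appear because \<epsilon> k enters the commutators of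
    index k and k - 1. The exponent k + 2 leaves half of \<rho> 2^(-k-1) to each of \<epsilon> k and
    \<epsilon> (Suc k). Division by 1 + W (Suc k) compensates the weight in the excess
    estimate.\<close>
  have "\<exists>\<epsilon>. 0 < \<epsilon> \<and> \<epsilon> \<le> r (Suc k) \<and> \<epsilon> \<le> \<rho> * (1/2) ^ (k + 2) / (1 + P k + P (k - 1)) \<and>
      (\<forall>v\<in>insert \<Phi> V. Df k \<epsilon> v \<le> ennreal (e / 4 * (1/2) ^ Suc k / (1 + W (Suc k))))" for k
  proof -
    have "0 < 1 + W (Suc k)" using W(1)[of "Suc k"] by simp
    then have "\<forall>\<^sub>F l in sequentially. \<forall>v\<in>insert \<Phi> V. Df k (1 / real (Suc l)) v \<le> ennreal (e / 4 * (1/2) ^ Suc k / (1 + W (Suc k)))"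
      unfolding Df_def using e finV
      by (intro eventually_ball_finite ballI eventually_defect_le st_conv_defect \<delta>(1)) (auto intro: \<Phi>i Vi)
    moreover have "0 < min (r (Suc k)) (\<rho> * (1/2) ^ (k + 2) / (1 + P k + P (k - 1)))"
      using rp \<rho>(1) P0[of k] P0[of "k - 1"] by (simp add: add_pos_nonneg)
    ultimately obtain \<epsilon> where "0 < \<epsilon>" "\<epsilon> \<le> min (r (Suc k)) (\<rho> * (1/2) ^ (k + 2) / (1 + P k + P (k - 1)))"
        "\<forall>v\<in>insert \<Phi> V. Df k \<epsilon> v \<le> ennreal (e / 4 * (1/2) ^ Suc k / (1 + W (Suc k)))"
      by (rule exists_scale)
    then show ?thesis by auto
  qed
  then obtain \<epsilon> where \<epsilon>: "\<And>k. 0 < \<epsilon> k" "\<And>k. \<epsilon> k \<le> r (Suc k)" "\<And>k. \<epsilon> k \<le> \<rho> * (1/2) ^ (k + 2) / (1 + P k + P (k - 1))"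
    and D\<epsilon>: "\<And>k v. v \<in> insert \<Phi> V \<Longrightarrow> Df k (\<epsilon> k) v \<le> ennreal (e / 4 * (1/2) ^ Suc k / (1 + W (Suc k)))"
    by metis
  have P\<epsilon>: "P k * (\<epsilon> k + \<epsilon> (Suc k)) \<le> \<rho> * (1/2) ^ Suc k" for k
  proof -
    have p: "0 < 1 + P k" using P0[of k] by simp
    have "\<epsilon> k \<le> \<rho> * (1/2) ^ (k + 2) / (1 + P k)"
      using \<epsilon>(3)[of k] P0[of "k - 1"] p \<rho>(1) by (elim order_trans) (intro divide_left_mono, auto)
    moreover have "\<epsilon> (Suc k) \<le> \<rho> * (1/2) ^ (k + 2) / (1 + P k)"
    proof -
      have "\<epsilon> (Suc k) \<le> \<rho> * (1/2) ^ (Suc k + 2) / (1 + P (Suc k) + P k)" using \<epsilon>(3)[of "Suc k"] by simp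
      also have "\<dots> \<le> \<rho> * (1/2) ^ (k + 2) / (1 + P k)"
        using \<rho>(1) P0[of "Suc k"] P0[of k] p by (intro frac_le mult_left_mono power_decreasing) auto
      finally show ?thesis .
    qed
    ultimately have "\<epsilon> k + \<epsilon> (Suc k) \<le> 2 * (\<rho> * (1/2) ^ (k + 2) / (1 + P k))" by linarith
    also have "\<dots> = 2 * (\<rho> * (1/2) ^ (k + 2)) / (1 + P k)" by (rule times_divide_eq_right)
    also have "2 * (\<rho> * (1/2) ^ (k + 2)) = \<rho> * (1/2) ^ Suc k" by simp
    finally have "P k * (\<epsilon> k + \<epsilon> (Suc k)) \<le> P k * (\<rho> * (1/2) ^ Suc k / (1 + P k))" using P0 by (rule mult_left_mono)
    also have "\<dots> = (P k / (1 + P k)) * (\<rho> * (1/2) ^ Suc k)"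
      by (simp only: times_divide_eq_right times_divide_eq_left)
    also have "\<dots> \<le> 1 * (\<rho> * (1/2) ^ Suc k)" using p \<rho>(1) by (intro mult_right_mono) auto
    finally show ?thesis by simp
  qed
  have CJ: "C k * (real n * (2 * (\<epsilon> k + \<epsilon> (Suc k)))) * j * v \<le> \<rho> * (1/2) ^ Suc k"
    if "0 \<le> j" "j \<le> 1 + J k" "0 \<le> v" "v \<le> 1 + W (Suc k)" for k j v
  proof -
    have "C k * (real n * 2) * j * v \<le> P k"
      unfolding P_def using that C0[of k] J0[of k] by (intro mult_mono mult_nonneg_nonneg) auto
    then have "C k * (real n * 2) * j * v * (\<epsilon> k + \<epsilon> (Suc k)) \<le> P k * (\<epsilon> k + \<epsilon> (Suc k))"
      using \<epsilon>(1)[of k] \<epsilon>(1)[of "Suc k"] by (intro mult_right_mono) auto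
    also note P\<epsilon>[of k]
    finally show ?thesis by (simp add: mult_ac)
  qed
  have e0: "0 \<le> real n * (2 * (\<epsilon> k + \<epsilon> (Suc k)))" for k using \<epsilon>(1)[of k] \<epsilon>(1)[of "Suc k"] by simp
  interpret ym: young_mollification n m \<Omega> A r \<theta> \<delta> \<epsilon> u g \<phi> "1 - \<eta>" Dc
  proof
    \<comment> \<open>The commutators have total mass at most \<rho> \<le> \<eta>, and (1 - \<eta>)
      (1 + \<eta>) \<le> 1.\<close>
    show "(1 - \<eta>) * (1 + (\<Sum>k<L. real m * real n * Dc k * (real n * (2 * (\<epsilon> k + \<epsilon> (Suc k)))))) \<le> 1" for L
    proof -
      have "(\<Sum>k<L. C k * (real n * (2 * (\<epsilon> k + \<epsilon> (Suc k))))) \<le> (\<Sum>k<L. \<rho> * (1/2) ^ Suc k)"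
        using CJ[of 1 _ 1] J0 W(1) by (intro sum_mono) simp
      also have "\<dots> \<le> \<rho>" by (rule sum_geometric_le) (use \<rho> in simp)
      also have "\<dots> \<le> \<eta>" by (rule \<rho>)
      finally have "(1 - \<eta>) * (1 + (\<Sum>k<L. C k * (real n * (2 * (\<epsilon> k + \<epsilon> (Suc k)))))) \<le> (1 - \<eta>) * (1 + \<eta>)"
        using \<eta> by (intro mult_left_mono) auto
      also have "\<dots> \<le> 1" by (simp add: algebra_simps)
      finally show ?thesis by (simp add: C_def)
    qed
    show "integrable (st_borel n) (loc (A k) (\<lambda>z. \<phi> (mat_norm m n (g z))))" for k
      using \<Phi>i[of k] by (simp add: \<Phi>_def[abs_def] G_def)
  qed (use \<Omega> exh cut \<delta>(1) \<epsilon> u g weak \<phi> \<eta> Dc in auto)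
  have eqs: "ym.G = G" "ym.C = C" "ym.defect k v = Df k (\<epsilon> k) v" for k v
    by (simp_all add: fun_eq_iff ym.G_def G_def ym.C_def C_def ym.defect_def Df_def)
  have defect: "Df k (\<epsilon> k) v \<le> ennreal (e / 4 * (1/2) ^ Suc k)" if "v \<in> insert \<Phi> V" for k v
  proof -
    have "e / 4 * (1/2) ^ Suc k / (1 + W (Suc k)) \<le> e / 4 * (1/2) ^ Suc k / 1"
      using W(1)[of "Suc k"] e by (intro divide_left_mono) auto
    then show ?thesis using D\<epsilon>[OF that, of k] by (elim order_trans) (intro ennreal_leI, simp)
  qed
  have defect_sum: "(\<Sum>k<L. Df k (\<epsilon> k) v) \<le> ennreal (e / 4)" if "v \<in> V" for v L
  proof -
    have "(\<Sum>k<L. Df k (\<epsilon> k) v) \<le> (\<Sum>k<L. ennreal (e / 4 * (1/2) ^ Suc k))"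
      using that by (intro sum_mono defect) auto
    also have "\<dots> = ennreal (\<Sum>k<L. e / 4 * (1/2) ^ Suc k)" using e by (intro sum_ennreal) auto
    also have "\<dots> \<le> ennreal (e / 4)" using e by (intro ennreal_leI sum_geometric_le) auto
    finally show ?thesis .
  qed
  have locG: "(\<integral>\<^sup>+z. ennreal (loc (A (Suc (Suc k))) G z) \<partial>st_borel n) = ennreal (LINT z|st_borel n. \<bar>loc (A (Suc (Suc k))) G z\<bar>)" for k
    using nn_integral_abs_eq_ennreal[OF Gi[of "Suc (Suc k)"]] G0 by (simp add: loc_def)
  have loc\<Phi>: "(\<integral>\<^sup>+z. ennreal (loc (A (Suc (Suc k))) \<Phi> z) \<partial>st_borel n) = ennreal (LINT z|st_borel n. \<bar>loc (A (Suc (Suc k))) \<Phi> z\<bar>)" for k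
    using nn_integral_abs_eq_ennreal[OF \<Phi>i[of "Suc (Suc k)"]] \<Phi>0 by (simp add: loc_def)
  have jG: "0 \<le> (LINT z|st_borel n. \<bar>loc (A (Suc (Suc k))) G z\<bar>)" "(LINT z|st_borel n. \<bar>loc (A (Suc (Suc k))) G z\<bar>) \<le> 1 + J k"
    and j\<Phi>: "0 \<le> (LINT z|st_borel n. \<bar>loc (A (Suc (Suc k))) \<Phi> z\<bar>)" "(LINT z|st_borel n. \<bar>loc (A (Suc (Suc k))) \<Phi> z\<bar>) \<le> 1 + J k" for k
  proof -
    show *: "0 \<le> (LINT z|st_borel n. \<bar>loc (A (Suc (Suc k))) G z\<bar>)" "0 \<le> (LINT z|st_borel n. \<bar>loc (A (Suc (Suc k))) \<Phi> z\<bar>)"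
      by (intro integral_nonneg_AE AE_I2, simp)+
    show "(LINT z|st_borel n. \<bar>loc (A (Suc (Suc k))) G z\<bar>) \<le> 1 + J k" "(LINT z|st_borel n. \<bar>loc (A (Suc (Suc k))) \<Phi> z\<bar>) \<le> 1 + J k"
      using * unfolding J_def by linarith+
  qed
  have gsum: "(\<Sum>k<L. ennreal (C k * (real n * (2 * (\<epsilon> k + \<epsilon> (Suc k))))) * (\<integral>\<^sup>+z. ennreal (loc (A (Suc (Suc k))) G z) \<partial>st_borel n)) \<le> ennreal (e / 4)" for L
  proof -
    have "(\<Sum>k<L. ennreal (C k * (real n * (2 * (\<epsilon> k + \<epsilon> (Suc k))))) * (\<integral>\<^sup>+z. ennreal (loc (A (Suc (Suc k))) G z) \<partial>st_borel n))
        \<le> (\<Sum>k<L. ennreal (\<rho> * (1/2) ^ Suc k))"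
    proof (rule sum_mono)
      fix k
      show "ennreal (C k * (real n * (2 * (\<epsilon> k + \<epsilon> (Suc k))))) * (\<integral>\<^sup>+z. ennreal (loc (A (Suc (Suc k))) G z) \<partial>st_borel n) \<le> ennreal (\<rho> * (1/2) ^ Suc k)"
        using CJ[OF jG, of 1 k] W(1)[of "Suc k"] C0[of k] e0[of k] jG[of k]
        by (simp add: locG ennreal_mult[symmetric] ennreal_leI del: power_Suc)
    qed
    also have "\<dots> = ennreal (\<Sum>k<L. \<rho> * (1/2) ^ Suc k)" using \<rho> by (intro sum_ennreal) auto
    also have "\<dots> \<le> ennreal \<rho>" using \<rho> by (intro ennreal_leI sum_geometric_le) auto
    also have "\<dots> \<le> ennreal (e / 4)" using \<rho> by (intro ennreal_leI)
    finally show ?thesis .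
  qed
  have add4: "a + b + c + d \<le> ennreal e" if "a \<le> ennreal (e / 4)" "b \<le> ennreal (e / 4)" "c \<le> ennreal (e / 4)" "d \<le> ennreal (e / 4)" for a b c d
  proof -
    have "a + b + c + d \<le> ennreal (e / 4) + ennreal (e / 4) + ennreal (e / 4) + ennreal (e / 4)" by (intro add_mono that)
    also have "\<dots> = ennreal e" using e by (simp add: ennreal_plus[symmetric] del: ennreal_plus)
    finally show ?thesis .
  qed
  define b where "b z j = (1 - \<eta>) * ym.B z j" for z j
  have db: "sp_deriv b = ym.dB" by (simp add: ym.dB_def b_def[abs_def])
  have "st_smooth n (UNIV \<times> \<Omega>) (\<lambda>z. b z j)" if "j < m" for j
    unfolding b_def by (rule ym.B_smooth[OF that])
  moreover have "(\<integral>\<^sup>+z. ennreal (indicator (A N) (snd z) * \<bar>b z j - u z j\<bar>) \<partial>st_borel n) \<le> ennreal e" if j: "j < m" for j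
  proof -
    have v: "(\<lambda>z. u z j) \<in> V" using j by (auto simp: V_def)
    have 1: "1 - (1 - \<eta>) = \<eta>" by simp
    show ?thesis using ym.u_error_le[OF j, of N] add4[OF _ defect_sum[OF v, of "Suc (Suc N)"] \<delta>(3)[OF v] \<eta>V[OF v], of 0]
      unfolding b_def eqs 1 by (elim order_trans) (simp only: zero_le add_0_left)
  qed
  moreover have "(\<integral>\<^sup>+z. ennreal (indicator (A N) (snd z) * \<bar>sp_deriv b z (j, i) - g z (j, i)\<bar>) \<partial>st_borel n) \<le> ennreal e" if j: "j < m" and i: "i < n" for j i
  proof -
    have v: "(\<lambda>z. g z (j, i)) \<in> V" using j i by (auto simp: V_def)
    have 1: "1 - (1 - \<eta>) = \<eta>" by simp
    show ?thesis using ym.g_error_le[OF j i, of N] add4[OF gsum[of "Suc N"] defect_sum[OF v, of "Suc (Suc N)"] \<delta>(3)[OF v] \<eta>V[OF v]]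
      unfolding db eqs 1 by (rule order_trans)
  qed
  moreover have "(\<integral>\<^sup>+z. ennreal (w (snd z) * \<phi> (mat_norm m n (sp_deriv b z))) - ennreal (w (snd z) * \<phi> (mat_norm m n (g z))) \<partial>st_borel n) \<le> ennreal e"
  proof -
    have "(\<Sum>k. ennreal (W (Suc k)) * (Df k (\<epsilon> k) \<Phi> + ennreal (C k * (real n * (2 * (\<epsilon> k + \<epsilon> (Suc k))))) * (\<integral>\<^sup>+z. ennreal (loc (A (Suc (Suc k))) \<Phi> z) \<partial>st_borel n)))
        \<le> (\<Sum>k. ennreal (e / 2 * (1/2) ^ Suc k))"
    proof (intro suminf_le allI)
      fix k
      let ?h = "(1/2 :: real) ^ Suc k"
      have Wk: "0 \<le> W (Suc k)" "0 < 1 + W (Suc k)" using W(1)[of "Suc k"] by auto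
      have "ennreal (W (Suc k)) * Df k (\<epsilon> k) \<Phi> \<le> ennreal (1 + W (Suc k)) * ennreal (e / 4 * ?h / (1 + W (Suc k)))"
        by (intro mult_mono D\<epsilon> ennreal_leI) auto
      also have "\<dots> = ennreal ((1 + W (Suc k)) * (e / 4 * ?h / (1 + W (Suc k))))"
        using Wk e by (intro ennreal_mult[symmetric]) auto
      also have "(1 + W (Suc k)) * (e / 4 * ?h / (1 + W (Suc k))) = e / 4 * ?h"
        using Wk by (simp only: times_divide_eq_right) (intro nonzero_mult_div_cancel_left, simp)
      finally have 1: "ennreal (W (Suc k)) * Df k (\<epsilon> k) \<Phi> \<le> ennreal (e / 4 * ?h)" .
      have "ennreal (W (Suc k)) * (ennreal (C k * (real n * (2 * (\<epsilon> k + \<epsilon> (Suc k))))) * (\<integral>\<^sup>+z. ennreal (loc (A (Suc (Suc k))) \<Phi> z) \<partial>st_borel n))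
          = ennreal (C k * (real n * (2 * (\<epsilon> k + \<epsilon> (Suc k)))) * (LINT z|st_borel n. \<bar>loc (A (Suc (Suc k))) \<Phi> z\<bar>) * W (Suc k))"
        using Wk C0[of k] e0[of k] j\<Phi>[of k] unfolding loc\<Phi>
        by (subst ennreal_mult[symmetric] , simp, simp, subst ennreal_mult[symmetric], simp, simp, simp add: mult.commute)
      also have "\<dots> \<le> ennreal (\<rho> * ?h)" using Wk by (intro ennreal_leI CJ j\<Phi>) auto
      also have "\<dots> \<le> ennreal (e / 4 * ?h)" using \<rho> by (intro ennreal_leI mult_right_mono) auto
      finally have 2: "ennreal (W (Suc k)) * (ennreal (C k * (real n * (2 * (\<epsilon> k + \<epsilon> (Suc k))))) * (\<integral>\<^sup>+z. ennreal (loc (A (Suc (Suc k))) \<Phi> z) \<partial>st_borel n)) \<le> ennreal (e / 4 * ?h)" .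
      have "ennreal (W (Suc k)) * (Df k (\<epsilon> k) \<Phi> + ennreal (C k * (real n * (2 * (\<epsilon> k + \<epsilon> (Suc k))))) * (\<integral>\<^sup>+z. ennreal (loc (A (Suc (Suc k))) \<Phi> z) \<partial>st_borel n))
          \<le> ennreal (e / 4 * ?h) + ennreal (e / 4 * ?h)"
        by (subst distrib_left) (intro add_mono 1 2)
      also have "\<dots> = ennreal (e / 2 * ?h)" using e by (simp add: ennreal_plus[symmetric] del: ennreal_plus power_Suc)
      finally show "ennreal (W (Suc k)) * (Df k (\<epsilon> k) \<Phi> + ennreal (C k * (real n * (2 * (\<epsilon> k + \<epsilon> (Suc k))))) * (\<integral>\<^sup>+z. ennreal (loc (A (Suc (Suc k))) \<Phi> z) \<partial>st_borel n)) \<le> ennreal (e / 2 * ?h)" .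
    qed auto
    also have "\<dots> = ennreal (e / 2)" using e by (intro suminf_geometric_ennreal) simp
    also have "\<dots> = ennreal (e / 4) + ennreal (e / 4)" using e by (simp add: ennreal_plus[symmetric] del: ennreal_plus)
    finally have s: "(\<Sum>k. ennreal (W (Suc k)) * (Df k (\<epsilon> k) \<Phi> + ennreal (C k * (real n * (2 * (\<epsilon> k + \<epsilon> (Suc k))))) * (\<integral>\<^sup>+z. ennreal (loc (A (Suc (Suc k))) \<Phi> z) \<partial>st_borel n)))
        \<le> ennreal (e / 4) + ennreal (e / 4)" .
    have Fe: "F = (\<lambda>z. w (snd z) * \<phi> (ym.G z))" by (simp add: F_def \<Phi>_def eqs fun_eq_iff)
    have "(\<integral>\<^sup>+z. ennreal (w (snd z) * \<phi> (mat_norm m n (ym.dB z))) - ennreal (w (snd z) * \<phi> (ym.G z)) \<partial>st_borel n)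
        \<le> (\<integral>\<^sup>+z. ennreal \<bar>t_conv \<delta> F z - F z\<bar> \<partial>st_borel n) + (\<Sum>k. ennreal (W (Suc k)) * (Df k (\<epsilon> k) \<Phi> + ennreal (C k * (real n * (2 * (\<epsilon> k + \<epsilon> (Suc k))))) * (\<integral>\<^sup>+z. ennreal (loc (A (Suc (Suc k))) \<Phi> z) \<partial>st_borel n)))"
      using ym.modular_excess_le[OF w W(2) W(1) Fi[unfolded Fe]] unfolding Fe eqs \<Phi>_def[abs_def] by simp
    also have "\<dots> \<le> ennreal (e / 4) + (ennreal (e / 4) + ennreal (e / 4))" by (intro add_mono \<delta>(2) s)
    also have "\<dots> = ennreal (e / 4) + ennreal (e / 4) + ennreal (e / 4) + 0" by (simp only: add.assoc add_0_right)
    also have "\<dots> \<le> ennreal e" by (rule add4) auto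
    finally show ?thesis unfolding db eqs(1) by (simp add: G_def)
  qed
  ultimately show ?thesis by blast
qed

subsection \<open>Completed measures and local convergence\<close>

text \<open>f differs from a Borel function only inside a null set, all of whose subsets are
  measurable for the completion.\<close>

lemma borel_measurable_completion_AE:
  fixes f g :: "'a \<Rightarrow> real"
  assumes g: "g \<in> borel_measurable M" and eq: "AE x in M. f x = g x"
  shows "f \<in> borel_measurable (completion M)"
proof (rule borel_measurableI)
  fix S :: "real set" assume S: "open S"
  obtain N where N: "N \<in> null_sets M" "{x \<in> space M. f x \<noteq> g x} \<subseteq> N"
    using eq unfolding eventually_ae_filter by auto
  have "g -` S \<inter> space M - N \<in> sets M"
    using measurable_sets[OF g borel_open[OF S]] N(1) by auto
  moreover have "f -` S \<inter> space M \<inter> N \<in> sets (completion M)"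
    by (rule null_sets_completion[OF N(1)]) auto
  moreover have "f -` S \<inter> space M = (g -` S \<inter> space M - N) \<union> (f -` S \<inter> space M \<inter> N)"
    using N(2) by auto
  ultimately show "f -` S \<inter> space (completion M) \<in> sets (completion M)"
    by (metis sets.Un sets_completionI_sets space_completion)
qed

text \<open>Bridge between the Lebesgue measures of the statement and the Borel product measures in
  which all estimates are made.\<close>

lemma completion_integral_AE:
  fixes f g :: "'a \<Rightarrow> real"
  assumes g: "g \<in> borel_measurable M" and eq: "AE x in M. f x = g x"
  shows "integrable (completion M) f \<longleftrightarrow> integrable M g"
    and "integral\<^sup>L (completion M) f = integral\<^sup>L M g"
proof -
  note f = borel_measurable_completion_AE[OF assms]
  have g': "g \<in> borel_measurable (completion M)" by (rule measurable_completion[OF g])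
  have eq': "AE x in completion M. f x = g x" using eq by (simp only: AE_completion_iff)
  show "integrable (completion M) f \<longleftrightarrow> integrable M g"
    using integrable_cong_AE[OF f g' eq'] integrable_completion[OF g] by blast
  show "integral\<^sup>L (completion M) f = integral\<^sup>L M g"
    using integral_cong_AE[OF f g' eq'] integral_completion[OF g] by simp
qed

lemma set_borel_representative:
  fixes f :: "'a \<Rightarrow> real"
  assumes "set_borel_measurable (completion M) S f" "S \<in> sets M"
  shows "\<exists>g\<in>borel_measurable M. (\<forall>z. z \<notin> S \<longrightarrow> g z = 0) \<and> (AE z in M. z \<in> S \<longrightarrow> g z = f z)"
proof -
  obtain g where g: "g \<in> borel_measurable M" "AE z in M. indicator S z * f z = g z"
    using completion_ex_borel_measurable_real[of "\<lambda>z. indicator S z * f z" M] assms(1)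
    unfolding set_borel_measurable_def real_scaleR_def by blast
  have "(\<lambda>z. indicator S z * g z) \<in> borel_measurable M" using assms(2) g(1) by measurable
  moreover have "AE z in M. z \<in> S \<longrightarrow> indicator S z * g z = f z"
    using g(2) by eventually_elim (auto simp: indicator_def)
  ultimately show ?thesis by (intro bexI[of _ "\<lambda>z. indicator S z * g z"]) auto
qed

lemma smooth_wrt_subset:
  assumes "smooth_wrt T move D U f" "V \<subseteq> U"
  shows "smooth_wrt T move D V f"
proof -
  have "continuous_map (subtopology T V) euclideanreal g" if "continuous_map (subtopology T U) euclideanreal g" for g
    using that assms(2) by (rule continuous_map_from_subtopology_mono)
  with assms show ?thesis unfolding smooth_wrt_def Let_def subset_iff by metis
qed

lemma st_smooth_continuous:
  assumes "st_smooth n U f"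
  shows "continuous_map (subtopology (st_top n) U) euclideanreal f"
    and "i < n \<Longrightarrow> continuous_map (subtopology (st_top n) U) euclideanreal (partial st_move (Some i) f)"
proof -
  have c: "continuous_map (subtopology (st_top n) U) euclideanreal (foldr (partial st_move) ds f)"
    if "ds \<in> lists (insert None (Some ` {..<n}))" for ds
    using assms that unfolding st_smooth_def smooth_wrt_def Let_def by blast
  show "continuous_map (subtopology (st_top n) U) euclideanreal f" using c[of "[]"] by simp
  show "i < n \<Longrightarrow> continuous_map (subtopology (st_top n) U) euclideanreal (partial st_move (Some i) f)"
    using c[of "[Some i]"] by simp
qed

lemma continuous_map_sp_measurable:
  assumes "continuous_map (sp_top n) euclideanreal f"
  shows "f \<in> borel_measurable (sp_borel n)"
proof (rule borel_measurableI)
  fix S :: "real set" assume "open S"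
  then have "openin (sp_top n) {x \<in> topspace (sp_top n). f x \<in> S}"
    using assms by (simp add: continuous_map)
  moreover have "{x \<in> topspace (sp_top n). f x \<in> S} = f -` S \<inter> space (sp_borel n)" by auto
  ultimately show "f -` S \<inter> space (sp_borel n) \<in> sets (sp_borel n)" using openin_sp_top_sets by metis
qed

lemma test_function_measurable:
  assumes "test_function n \<Omega> \<psi>"
  shows "\<psi> \<in> borel_measurable (sp_borel n)"
    and "i < n \<Longrightarrow> partial sp_move i \<psi> \<in> borel_measurable (sp_borel n)"
proof -
  have c: "continuous_map (sp_top n) euclideanreal (foldr (partial sp_move) ds \<psi>)" if "ds \<in> lists {..<n}" for ds
    using assms that unfolding test_function_def sp_smooth_def smooth_wrt_def Let_def subtopology_topspace by blast
  show "\<psi> \<in> borel_measurable (sp_borel n)" using c[of "[]"] by (simp add: continuous_map_sp_measurable)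
  show "i < n \<Longrightarrow> partial sp_move i \<psi> \<in> borel_measurable (sp_borel n)"
    using c[of "[i]"] by (simp add: continuous_map_sp_measurable)
qed

lemma compactin_st_top_projections:
  assumes "compactin (st_top n) K"
  shows "compact (fst ` K)" "compactin (sp_top n) (snd ` K)"
proof -
  have "continuous_map (st_top n) euclideanreal fst" "continuous_map (st_top n) (sp_top n) snd"
    unfolding st_top_def by (rule continuous_map_fst continuous_map_snd)+
  from this[THEN image_compactin[OF assms]] show "compact (fst ` K)" "compactin (sp_top n) (snd ` K)"
    by (simp_all only: compactin_euclidean_iff)
qed

lemma compactin_st_top_finite_measure:
  assumes K: "compactin (st_top n) K"
  shows "emeasure (st_borel n) K < \<infinity>"
proof -
  note p = compactin_st_top_projections[OF K]
  have s: "fst ` K \<in> sets lborel" "snd ` K \<in> sets (sp_borel n)"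
    using p compactin_sp_top_sets by (auto intro: borel_compact)
  have "emeasure (st_borel n) K \<le> emeasure (st_borel n) (fst ` K \<times> snd ` K)"
    unfolding st_borel_def using s
    by (intro emeasure_mono pair_measureI) (auto intro: image_eqI[where x="(a, b)" for a b])
  also have "\<dots> = emeasure lborel (fst ` K) * emeasure (sp_borel n) (snd ` K)"
    unfolding st_borel_def using s by (rule sp_sigma.emeasure_pair_measure_Times)
  also have "\<dots> < \<infinity>"
    using emeasure_compact_finite[OF p(1)] compactin_sp_top_finite_measure[OF p(2)]
    by (simp add: ennreal_mult_less_top)
  finally show ?thesis .
qed

lemma continuous_map_integrable_compact:
  assumes U: "openin (st_top n) U" and f: "continuous_map (subtopology (st_top n) U) euclideanreal f"
    and K: "compactin (st_top n) K" "K \<subseteq> U"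
  shows "integrable (st_borel n) (\<lambda>z. indicator K z * f z)"
proof -
  have "compactin (subtopology (st_top n) U) K" using K by (simp add: compactin_subtopology)
  from image_compactin[OF this f] have "compact (f ` K)" by simp
  then obtain B where B: "\<And>z. z \<in> K \<Longrightarrow> \<bar>f z\<bar> \<le> B" using compact_imp_bounded[of "f ` K"] by (auto simp: bounded_iff)
  have Ks: "K \<in> sets (st_borel n)" by (rule compactin_st_top_sets[OF K(1)])
  show ?thesis
  proof (rule integrableI_bounded_set[where A=K and B=B])
    have "(\<lambda>z. indicator K z * (indicator U z * f z)) \<in> borel_measurable (st_borel n)"
      using Ks by (intro borel_measurable_times continuous_map_st_measurable[OF U f]) simp
    moreover have "indicator K z * (indicator U z * f z) = indicator K z * f z" for z
      using K(2) by (cases "z \<in> K") auto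
    ultimately show "(\<lambda>z. indicator K z * f z) \<in> borel_measurable (st_borel n)" by (simp only:)
    show "emeasure (st_borel n) K < \<infinity>" by (rule compactin_st_top_finite_measure[OF K(1)])
    show "AE z in st_borel n. z \<in> K \<longrightarrow> norm (indicator K z * f z) \<le> B" using B by auto
  qed (use Ks in auto)
qed

text \<open>Reduces local convergence to componentwise bounds 2^(-h) against a Borel representative
  f of the limit. They are asked for eventually only, since a given compact set is reached by the
  h-th cut-off region for large h alone.\<close>

lemma L1loc_tendstoI:
  fixes F :: "nat \<Rightarrow> real \<times> point \<Rightarrow> 'j \<Rightarrow> real"
  assumes U: "openin (st_top n) U" and J: "finite J"
    and F: "\<And>h j. j \<in> J \<Longrightarrow> continuous_map (subtopology (st_top n) U) euclideanreal (\<lambda>z. F h z j)"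
    and f: "\<And>j. j \<in> J \<Longrightarrow> (\<lambda>z. f z j) \<in> borel_measurable (st_borel n)"
    and fi: "\<And>K j. compactin (st_top n) K \<Longrightarrow> K \<subseteq> U \<Longrightarrow> j \<in> J \<Longrightarrow> integrable (st_borel n) (\<lambda>z. indicator K z * f z j)"
    and eq: "AE z in st_borel n. z \<in> U \<longrightarrow> (\<forall>j\<in>J. f z j = f0 z j)"
    and lim: "\<And>K. compactin (st_top n) K \<Longrightarrow> K \<subseteq> U \<Longrightarrow> \<forall>\<^sub>F h in sequentially. \<forall>j\<in>J.
      (\<integral>\<^sup>+z. ennreal (indicator K z * \<bar>F h z j - f z j\<bar>) \<partial>st_borel n) \<le> ennreal ((1/2) ^ h)"
  shows "L1loc_tendsto n J U F f0"
  unfolding L1loc_tendsto_def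
proof (intro allI impI conjI ballI)
  fix K assume K: "compactin (st_top n) K \<and> K \<subseteq> U"
  have Ki: "integrable (st_borel n) (\<lambda>z. indicator K z * F h z j)" if "j \<in> J" for h j
    using continuous_map_integrable_compact[OF U F[OF that]] K by blast
  have fK: "integrable (st_borel n) (\<lambda>z. indicator K z * f z j)" if "j \<in> J" for j
    using fi K that by blast
  have di: "integrable (st_borel n) (\<lambda>z. indicator K z * \<bar>F h z j - f z j\<bar>)" if "j \<in> J" for h j
  proof -
    have "integrable (st_borel n) (\<lambda>z. \<bar>indicator K z * F h z j - indicator K z * f z j\<bar>)"
      using Ki[OF that] fK[OF that] by (intro integrable_abs Bochner_Integration.integrable_diff)
    then show ?thesis by (simp add: right_diff_distrib[symmetric] abs_mult)
  qed
  show "set_integrable (st_leb n) K (\<lambda>z. F h z j)" if "j \<in> J" for h j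
    unfolding set_integrable_def st_leb_def st_borel_def[symmetric]
    using completion_integral_AE(1)[of "\<lambda>z. indicator K z * F h z j" "st_borel n" "\<lambda>z. indicator K z * F h z j"] Ki[OF that]
    by auto
  show "set_integrable (st_leb n) K (\<lambda>z. f0 z j)" if "j \<in> J" for j
  proof -
    have "AE z in st_borel n. indicator K z * f0 z j = indicator K z * f z j"
      using eq by eventually_elim (use K that in \<open>auto simp: indicator_def\<close>)
    from completion_integral_AE(1)[OF _ this] fK[OF that] show ?thesis
      unfolding set_integrable_def st_leb_def st_borel_def[symmetric] by auto
  qed
  define H where "H h z = L2_set (\<lambda>j. indicator K z * F h z j - indicator K z * f z j) J" for h z
  have Hm: "H h \<in> borel_measurable (st_borel n)" for h
    unfolding H_def[abs_def] using Ki fK by (intro borel_measurable_L2_set borel_measurable_diff) auto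
  have Heq: "(LINT z:K|st_leb n. L2_set (\<lambda>j. F h z j - f0 z j) J) = (LINT z|st_borel n. H h z)" for h
  proof -
    have "AE z in st_borel n. indicator K z * L2_set (\<lambda>j. F h z j - f0 z j) J = H h z"
      using eq
    proof eventually_elim
      case (elim z)
      show ?case
      proof (cases "z \<in> K")
        case True
        then have "L2_set (\<lambda>j. F h z j - f0 z j) J = L2_set (\<lambda>j. F h z j - f z j) J"
          using elim K by (intro L2_set_cong) auto
        then show ?thesis using True by (simp add: H_def)
      qed (simp add: H_def L2_set_def)
    qed
    from completion_integral_AE(2)[OF Hm this] show ?thesis
      unfolding set_lebesgue_integral_def st_leb_def st_borel_def[symmetric] by simp
  qed
  have H0: "0 \<le> H h z" for h z by (simp add: H_def L2_set_nonneg)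
  have Hle: "H h z \<le> (\<Sum>j\<in>J. indicator K z * \<bar>F h z j - f z j\<bar>)" for h z
    unfolding H_def by (rule order_trans[OF L2_set_le_sum_abs]) (simp add: right_diff_distrib[symmetric] abs_mult)
  have "\<forall>\<^sub>F h in sequentially. (LINT z|st_borel n. H h z) \<le> real (card J) * (1/2) ^ h"
    using lim[OF conjunct1[OF K] conjunct2[OF K]]
  proof eventually_elim
    case (elim h)
    have 1: "(LINT z|st_borel n. indicator K z * \<bar>F h z j - f z j\<bar>) \<le> (1/2) ^ h" if "j \<in> J" for j
    proof -
      have "ennreal (LINT z|st_borel n. indicator K z * \<bar>F h z j - f z j\<bar>) \<le> ennreal ((1/2) ^ h)"
        using elim that nn_integral_eq_integral[OF di[OF that, of h]] by auto
      then show ?thesis by (subst (asm) ennreal_le_iff) auto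
    qed
    have "(LINT z|st_borel n. H h z) \<le> (LINT z|st_borel n. (\<Sum>j\<in>J. indicator K z * \<bar>F h z j - f z j\<bar>))"
      using di Hle by (intro integral_mono_AE' AE_I2 Bochner_Integration.integrable_sum sum_nonneg) auto
    also have "\<dots> = (\<Sum>j\<in>J. (LINT z|st_borel n. indicator K z * \<bar>F h z j - f z j\<bar>))"
      using di by (intro Bochner_Integration.integral_sum)
    also have "\<dots> \<le> (\<Sum>j\<in>J. (1/2) ^ h)" by (intro sum_mono 1)
    finally show ?case by simp
  qed
  moreover have "(\<lambda>h. real (card J) * (1/2) ^ h) \<longlonglongrightarrow> 0"
    by (intro tendsto_mult_right_zero LIMSEQ_realpow_zero) auto
  ultimately have "(\<lambda>h. LINT z|st_borel n. H h z) \<longlonglongrightarrow> 0"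
    using H0 by (intro tendsto_sandwich[of "\<lambda>_. 0" "\<lambda>h. LINT z|st_borel n. H h z" sequentially "\<lambda>h. real (card J) * (1/2) ^ h"])
      (auto intro!: always_eventually integral_nonneg_AE AE_I2)
  then show "(\<lambda>h. LINT z:K|st_leb n. L2_set (\<lambda>j. F h z j - f0 z j) J) \<longlonglongrightarrow> 0"
    unfolding Heq .
qed

text \<open>Split |F - f| into the excess of F over f and the deficit. The excess tends to 0 in mean
  by assumption; the deficit is at most f and tends to 0 almost everywhere, so dominated convergence
  applies to it. No majorant of the F h is involved.\<close>

lemma nn_integral_abs_diff_tendsto_0:
  fixes f :: "'a \<Rightarrow> real"
  assumes f: "f \<in> borel_measurable M" "\<And>x. 0 \<le> f x" "(\<integral>\<^sup>+x. ennreal (f x) \<partial>M) < \<infinity>"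
    and F: "\<And>h. F h \<in> borel_measurable M" "\<And>h x. 0 \<le> F h x"
    and ae: "AE x in M. (\<lambda>h. F h x) \<longlonglongrightarrow> f x"
    and exc: "(\<lambda>h. \<integral>\<^sup>+x. ennreal (F h x) - ennreal (f x) \<partial>M) \<longlonglongrightarrow> 0"
  shows "(\<lambda>h. \<integral>\<^sup>+x. ennreal \<bar>F h x - f x\<bar> \<partial>M) \<longlonglongrightarrow> 0"
proof -
  have "(\<lambda>h. \<integral>\<^sup>+x. ennreal (f x) - ennreal (F h x) \<partial>M) \<longlonglongrightarrow> (\<integral>\<^sup>+x. 0 \<partial>M)"
  proof (rule nn_integral_dominated_convergence[where w="\<lambda>x. ennreal (f x)"])
    show "AE x in M. (\<lambda>h. ennreal (f x) - ennreal (F h x)) \<longlonglongrightarrow> 0"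
      using ae
    proof eventually_elim
      case (elim x)
      have "(\<lambda>h. ennreal (f x - F h x)) \<longlonglongrightarrow> ennreal (f x - f x)"
        by (intro tendsto_intros elim)
      then show ?case using F(2) by (simp add: ennreal_minus)
    qed
  qed (use f F in auto)
  then have "(\<lambda>h. (\<integral>\<^sup>+x. ennreal (F h x) - ennreal (f x) \<partial>M) + (\<integral>\<^sup>+x. ennreal (f x) - ennreal (F h x) \<partial>M)) \<longlonglongrightarrow> 0 + 0"
    by (intro tendsto_add exc) simp
  moreover have "(\<integral>\<^sup>+x. ennreal (F h x) - ennreal (f x) \<partial>M) + (\<integral>\<^sup>+x. ennreal (f x) - ennreal (F h x) \<partial>M)
      = (\<integral>\<^sup>+x. ennreal \<bar>F h x - f x\<bar> \<partial>M)" for h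
  proof -
    have "ennreal (F h x) - ennreal (f x) + (ennreal (f x) - ennreal (F h x)) = ennreal \<bar>F h x - f x\<bar>" for x
    proof (cases "f x \<le> F h x")
      case True
      then show ?thesis using f(2)[of x] F(2)[of h x] by (simp add: ennreal_minus ennreal_neg)
    next
      case False
      then show ?thesis using f(2)[of x] F(2)[of h x] by (simp add: ennreal_minus ennreal_neg)
    qed
    then show ?thesis using f(1) F(1)[of h] by (subst nn_integral_add[symmetric]) auto
  qed
  ultimately show ?thesis by simp
qed

text \<open>The sum of all F h has finite integral, hence is finite almost everywhere and its terms
  tend to 0. The geometric rate replaces the passage to a subsequence.\<close>

lemma AE_tendsto_0_of_summable:
  fixes F :: "nat \<Rightarrow> 'a \<Rightarrow> real"
  assumes F: "\<And>h. F h \<in> borel_measurable M" "\<And>h x. 0 \<le> F h x"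
    and le: "\<And>h. (\<integral>\<^sup>+x. ennreal (F h x) \<partial>M) \<le> ennreal ((1/2) ^ h)"
  shows "AE x in M. (\<lambda>h. F h x) \<longlonglongrightarrow> 0"
proof -
  have "(\<integral>\<^sup>+x. (\<Sum>h. ennreal (F h x)) \<partial>M) = (\<Sum>h. \<integral>\<^sup>+x. ennreal (F h x) \<partial>M)"
    using F(1) by (intro nn_integral_suminf) auto
  also have "\<dots> \<le> (\<Sum>h. ennreal ((1/2) ^ h))" by (intro suminf_le le) auto
  also have "\<dots> = ennreal (\<Sum>h. (1/2) ^ h)" by (rule suminf_ennreal2) (auto intro: summable_geometric)
  also have "\<dots> < \<infinity>" by simp
  finally have "AE x in M. (\<Sum>h. ennreal (F h x)) \<noteq> \<infinity>"
    using F(1) by (intro nn_integral_PInf_AE) auto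
  then show ?thesis
  proof eventually_elim
    case (elim x)
    then have "summable (\<lambda>h. F h x)" using F(2) by (intro summable_suminf_not_top) auto
    then show ?case by (rule summable_LIMSEQ_zero)
  qed
qed

text \<open>Extension by 0 off I \<times> \<Omega> makes the representatives available on all of
  space-time, where the convolutions integrate.\<close>

lemma borel_representatives:
  assumes I: "open I" and \<Omega>: "openin (sp_top n) \<Omega>" and b: "L1loc_W11loc n m I \<Omega> b Db"
  obtains u :: "real \<times> point \<Rightarrow> nat \<Rightarrow> real" and g :: "real \<times> point \<Rightarrow> nat \<times> nat \<Rightarrow> real"
  where "\<And>j. j < m \<Longrightarrow> (\<lambda>z. u z j) \<in> borel_measurable (st_borel n)"
    and "\<And>j i. j < m \<Longrightarrow> i < n \<Longrightarrow> (\<lambda>z. g z (j, i)) \<in> borel_measurable (st_borel n)"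
    and "\<And>z j. j < m \<Longrightarrow> z \<notin> I \<times> \<Omega> \<Longrightarrow> u z j = 0"
    and "\<And>z j i. j < m \<Longrightarrow> i < n \<Longrightarrow> z \<notin> I \<times> \<Omega> \<Longrightarrow> g z (j, i) = 0"
    and "AE z in st_borel n. z \<in> I \<times> \<Omega> \<longrightarrow> (\<forall>j<m. u z j = b z j) \<and> (\<forall>j<m. \<forall>i<n. g z (j, i) = Db z (j, i))"
proof -
  have S: "I \<times> \<Omega> \<in> sets (st_borel n)"
    unfolding st_borel_def using I openin_sp_top_sets[OF \<Omega>] by (intro pair_measureI) auto
  define R where "R f v \<longleftrightarrow> v \<in> borel_measurable (st_borel n) \<and> (\<forall>z. z \<notin> I \<times> \<Omega> \<longrightarrow> v z = 0) \<and>
      (AE z in st_borel n. z \<in> I \<times> \<Omega> \<longrightarrow> v z = f z)" for f v :: "real \<times> point \<Rightarrow> real"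
  have R: "\<exists>v. R f v" if "set_borel_measurable (st_leb n) (I \<times> \<Omega>) f" for f
    using set_borel_representative[OF _ S, of f] that unfolding R_def st_leb_def st_borel_def[symmetric] by blast
  have "\<forall>j\<in>{..<m}. \<exists>v. R (\<lambda>z. b z j) v"
    using b unfolding L1loc_W11loc_def by (intro ballI R) simp
  from bchoice[OF this] obtain v where v: "\<And>j. j < m \<Longrightarrow> R (\<lambda>z. b z j) (v j)" by auto
  have "\<forall>a\<in>{..<m} \<times> {..<n}. \<exists>v. R (\<lambda>z. Db z a) v"
    using b unfolding L1loc_W11loc_def by (intro ballI R) auto
  from bchoice[OF this] obtain q where q: "\<And>j i. j < m \<Longrightarrow> i < n \<Longrightarrow> R (\<lambda>z. Db z (j, i)) (q (j, i))" by auto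
  have "AE z in st_borel n. \<forall>j\<in>{..<m}. z \<in> I \<times> \<Omega> \<longrightarrow> v j z = b z j"
    using v unfolding R_def by (intro AE_finite_allI) auto
  moreover have "AE z in st_borel n. \<forall>j\<in>{..<m}. \<forall>i\<in>{..<n}. z \<in> I \<times> \<Omega> \<longrightarrow> q (j, i) z = Db z (j, i)"
    using q unfolding R_def by (intro AE_finite_allI) auto
  ultimately have "AE z in st_borel n. z \<in> I \<times> \<Omega> \<longrightarrow> (\<forall>j<m. v j z = b z j) \<and> (\<forall>j<m. \<forall>i<n. q (j, i) z = Db z (j, i))"
    by eventually_elim blast
  then show thesis
    using v q unfolding R_def by (intro that[of "\<lambda>z j. v j z" "\<lambda>z a. q a z"]) blast+
qed

lemma nn_integral_st_borel:
  assumes "h \<in> borel_measurable (st_borel n)"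
  shows "(\<integral>\<^sup>+z. h z \<partial>st_borel n) = (\<integral>\<^sup>+t. \<integral>\<^sup>+x. h (t, x) \<partial>sp_borel n \<partial>lborel)"
  using assms unfolding st_borel_def by (rule sp_sigma.nn_integral_fst[symmetric])

lemma AE_st_borel: "AE z in st_borel n. P z \<Longrightarrow> AE t in lborel. AE x in sp_borel n. P (t, x)"
  unfolding st_borel_def by (rule st_pair.AE_pair)

text \<open>Tonelli is applied to the Borel function h only. The integrand of the modular agrees
  with it on almost every time slice, almost everywhere in \<Omega>, which is enough for the
  iterated integral.\<close>

lemma modular_eq_nn_integral:
  assumes h: "h \<in> borel_measurable (st_borel n)" and "\<And>z. z \<notin> I \<times> \<Omega> \<Longrightarrow> h z = (0 :: real)"
    and eq: "AE z in st_borel n. z \<in> I \<times> \<Omega> \<longrightarrow> h z = w (snd z) * \<phi> (f z)"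
  shows "modular n I \<Omega> \<phi> w f = (\<integral>\<^sup>+z. ennreal (h z) \<partial>st_borel n)"
proof -
  have "AE t in lborel. (\<integral>\<^sup>+x\<in>\<Omega>. ennreal (w x * \<phi> (f (t, x))) \<partial>sp_borel n) * indicator I t
      = (\<integral>\<^sup>+x. ennreal (h (t, x)) \<partial>sp_borel n)"
    using AE_st_borel[OF eq]
  proof eventually_elim
    case (elim t)
    show ?case
    proof (cases "t \<in> I")
      case True
      have "AE x in sp_borel n. ennreal (w x * \<phi> (f (t, x))) * indicator \<Omega> x = ennreal (h (t, x))"
        using elim
      proof eventually_elim
        case (elim x)
        then show ?case using True assms(2)[of "(t, x)"] by (cases "x \<in> \<Omega>") auto
      qed
      then show ?thesis using True by (simp add: nn_integral_cong_AE)
    next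
      case False
      then show ?thesis using assms(2) by simp
    qed
  qed
  then show ?thesis
    unfolding modular_def sp_leb_def nn_integral_completion
    using nn_integral_st_borel[of "\<lambda>z. ennreal (h z)" n] h by (simp add: nn_integral_cong_AE)
qed

text \<open>Turns the iterated-integral clause of \<open>L1loc_W11loc\<close> into integrability for
  the product measure, for a Borel function dominated by the integrand.\<close>

lemma integrable_on_product:
  assumes b: "L1loc_W11loc n m I \<Omega> b Db"
    and J: "compact J" "J \<subseteq> I" and K: "compactin (sp_top n) K" "K \<subseteq> \<Omega>"
    and v: "v \<in> borel_measurable (st_borel n)"
    and le: "AE z in st_borel n. z \<in> J \<times> K \<longrightarrow> \<bar>v z\<bar> \<le> vec_norm m (b z) + mat_norm m n (Db z)"
  shows "integrable (st_borel n) (\<lambda>z. indicator (J \<times> K) z * v z)"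
proof -
  have S: "J \<times> K \<in> sets (st_borel n)"
    unfolding st_borel_def using J(1) compactin_sp_top_sets[OF K(1)] by (intro pair_measureI) (auto intro: borel_compact)
  have m: "(\<lambda>z. indicator (J \<times> K) z * v z) \<in> borel_measurable (st_borel n)"
    using S v by measurable
  have "(\<integral>\<^sup>+z. ennreal (norm (indicator (J \<times> K) z * v z)) \<partial>st_borel n)
      = (\<integral>\<^sup>+t. \<integral>\<^sup>+x. ennreal (norm (indicator (J \<times> K) (t, x) * v (t, x))) \<partial>sp_borel n \<partial>lborel)"
    by (intro nn_integral_st_borel measurable_compose[OF measurable_compose[OF m borel_measurable_norm] measurable_ennreal])
  also have "\<dots> \<le> (\<integral>\<^sup>+t\<in>J. (\<integral>\<^sup>+x\<in>K. ennreal (vec_norm m (b (t, x)) + mat_norm m n (Db (t, x))) \<partial>sp_borel n) \<partial>lborel)"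
  proof (rule nn_integral_mono_AE)
    show "AE t in lborel. (\<integral>\<^sup>+x. ennreal (norm (indicator (J \<times> K) (t, x) * v (t, x))) \<partial>sp_borel n)
        \<le> (\<integral>\<^sup>+x\<in>K. ennreal (vec_norm m (b (t, x)) + mat_norm m n (Db (t, x))) \<partial>sp_borel n) * indicator J t"
      using AE_st_borel[OF le]
    proof eventually_elim
      case (elim t)
      show ?case
      proof (cases "t \<in> J")
        case True
        have "AE x in sp_borel n. ennreal (norm (indicator (J \<times> K) (t, x) * v (t, x)))
            \<le> ennreal (vec_norm m (b (t, x)) + mat_norm m n (Db (t, x))) * indicator K x"
          using elim
        proof eventually_elim
          case (elim x)
          then show ?case using True by (cases "x \<in> K") (auto intro: ennreal_leI)
        qed
        then show ?thesis using True by (simp add: nn_integral_mono_AE)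
      qed simp
    qed
  qed
  also have "\<dots> < \<infinity>"
    using b J K unfolding L1loc_W11loc_def sp_leb_def nn_integral_completion by blast
  finally show ?thesis using m by (intro integrableI_bounded)
qed

text \<open>At almost every time in I the sections agree with those of b and Db almost everywhere in
  \<Omega>; at times outside I both sides are 0. One exceptional set of times serves all test
  functions, since at each remaining time the whole section is weakly differentiable.\<close>

lemma weak_identity:
  assumes \<Omega>: "openin (sp_top n) \<Omega>" and b: "L1loc_W11loc n m I \<Omega> b Db" and j: "j < m" and i: "i < n"
    and u: "u \<in> borel_measurable (st_borel n)" "\<And>z. z \<notin> I \<times> \<Omega> \<Longrightarrow> u z = 0"
      "AE z in st_borel n. z \<in> I \<times> \<Omega> \<longrightarrow> u z = b z j"
    and g: "g \<in> borel_measurable (st_borel n)" "\<And>z. z \<notin> I \<times> \<Omega> \<Longrightarrow> g z = 0"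
      "AE z in st_borel n. z \<in> I \<times> \<Omega> \<longrightarrow> g z = Db z (j, i)"
  shows "AE t in lborel. \<forall>\<psi>. test_function n \<Omega> \<psi> \<longrightarrow>
    (LINT x|sp_borel n. u (t, x) * partial sp_move i \<psi> x) = - (LINT x|sp_borel n. g (t, x) * \<psi> x)"
proof -
  have "AE t in lborel. t \<in> I \<longrightarrow> W11loc n m \<Omega> (\<lambda>x. b (t, x)) (\<lambda>x. Db (t, x))"
    using b unfolding L1loc_W11loc_def AE_completion_iff by blast
  then show ?thesis using AE_st_borel[OF u(3)] AE_st_borel[OF g(3)]
  proof eventually_elim
    case (elim t)
    show ?case
    proof (cases "t \<in> I")
      case False
      then show ?thesis using u(2) g(2) by simp
    next
      case True
      have sec: "(\<lambda>x. f (t, x)) \<in> borel_measurable (sp_borel n)" if "f \<in> borel_measurable (st_borel n)" for f :: "real \<times> point \<Rightarrow> real"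
        using that unfolding st_borel_def by (intro measurable_compose[OF measurable_Pair1']) simp_all
      have ui: "(LINT x:\<Omega>|sp_leb n. b (t, x) j * q x) = (LINT x|sp_borel n. u (t, x) * q x)"
        and gi: "(LINT x:\<Omega>|sp_leb n. Db (t, x) (j, i) * q x) = (LINT x|sp_borel n. g (t, x) * q x)"
        if q: "q \<in> borel_measurable (sp_borel n)" for q
      proof -
        have "AE x in sp_borel n. indicator \<Omega> x * (b (t, x) j * q x) = u (t, x) * q x"
          using elim(2)
        proof eventually_elim
          case (elim x)
          then show ?case using True u(2)[of "(t, x)"] by (cases "x \<in> \<Omega>") auto
        qed
        from completion_integral_AE(2)[OF borel_measurable_times[OF sec[OF u(1)] q] this]
        show "(LINT x:\<Omega>|sp_leb n. b (t, x) j * q x) = (LINT x|sp_borel n. u (t, x) * q x)"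
          unfolding set_lebesgue_integral_def sp_leb_def by simp
        have "AE x in sp_borel n. indicator \<Omega> x * (Db (t, x) (j, i) * q x) = g (t, x) * q x"
          using elim(3)
        proof eventually_elim
          case (elim x)
          then show ?case using True g(2)[of "(t, x)"] by (cases "x \<in> \<Omega>") auto
        qed
        from completion_integral_AE(2)[OF borel_measurable_times[OF sec[OF g(1)] q] this]
        show "(LINT x:\<Omega>|sp_leb n. Db (t, x) (j, i) * q x) = (LINT x|sp_borel n. g (t, x) * q x)"
          unfolding set_lebesgue_integral_def sp_leb_def by simp
      qed
      show ?thesis
      proof (intro allI impI)
        fix \<psi> assume \<psi>: "test_function n \<Omega> \<psi>"
        have "weak_derivative n \<Omega> (\<lambda>x. b (t, x) j) (\<lambda>i x. Db (t, x) (j, i))"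
          using elim(1) True j unfolding W11loc_def by blast
        then have "(LINT x:\<Omega>|sp_leb n. b (t, x) j * partial sp_move i \<psi> x) = - (LINT x:\<Omega>|sp_leb n. Db (t, x) (j, i) * \<psi> x)"
          using \<psi> i unfolding weak_derivative_def by blast
        then show "(LINT x|sp_borel n. u (t, x) * partial sp_move i \<psi> x) = - (LINT x|sp_borel n. g (t, x) * \<psi> x)"
          unfolding ui[OF test_function_measurable(2)[OF \<psi> i]] gi[OF test_function_measurable(1)[OF \<psi>]] .
      qed
    qed
  qed
qed

text \<open>F and f are Borel versions, set to 0 outside A, of functions that are prescribed up to
  null sets. Convergence of the integrals follows from convergence in mean.\<close>

lemma L1_tendsto_completionI:
  fixes f :: "'a \<Rightarrow> real"
  assumes f: "integrable M f" "\<And>x. 0 \<le> f x" and F: "\<And>h. integrable M (F h)" "\<And>h x. 0 \<le> F h x"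
    and lim: "(\<lambda>h. \<integral>\<^sup>+x. ennreal \<bar>F h x - f x\<bar> \<partial>M) \<longlonglongrightarrow> 0"
    and F0: "\<And>h. AE x in M. indicator A x * F0 h x = F h x" and f0: "AE x in M. indicator A x * f0 x = f x"
  shows "L1_tendsto (completion M) A F0 f0"
    and "(\<lambda>h. \<integral>\<^sup>+x. ennreal (F h x) \<partial>M) \<longlonglongrightarrow> (\<integral>\<^sup>+x. ennreal (f x) \<partial>M)"
proof -
  note fm = borel_measurable_integrable[OF f(1)] and Fm = borel_measurable_integrable[OF F(1)]
  have di: "integrable M (\<lambda>x. \<bar>F h x - f x\<bar>)" for h
    using F(1)[of h] f(1) by (intro integrable_abs Bochner_Integration.integrable_diff)
  have eq: "AE x in M. indicator A x * \<bar>F0 h x - f0 x\<bar> = \<bar>F h x - f x\<bar>" for h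
    using F0[of h] f0
  proof eventually_elim
    case (elim x)
    then have "\<bar>F h x - f x\<bar> = \<bar>indicator A x * (F0 h x - f0 x)\<bar>" by (simp add: right_diff_distrib)
    then show ?case by (simp add: abs_mult)
  qed
  have "(\<lambda>h. ennreal (LINT x|M. \<bar>F h x - f x\<bar>)) \<longlonglongrightarrow> ennreal 0"
    using lim by (simp add: nn_integral_eq_integral[OF di])
  then have l: "(\<lambda>h. LINT x|M. \<bar>F h x - f x\<bar>) \<longlonglongrightarrow> 0"
    by (rule tendsto_ennrealD) (auto intro!: always_eventually integral_nonneg_AE AE_I2)
  show "L1_tendsto (completion M) A F0 f0"
    unfolding L1_tendsto_def set_integrable_def set_lebesgue_integral_def real_scaleR_def
    using completion_integral_AE(1)[OF Fm F0] completion_integral_AE(1)[OF fm f0]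
      completion_integral_AE(2)[OF borel_measurable_integrable[OF di] eq] F(1) f(1) l by simp
  have "(\<lambda>h. (LINT x|M. F h x) - (LINT x|M. f x)) \<longlonglongrightarrow> 0"
  proof (rule Lim_null_comparison[OF always_eventually l], intro allI)
    fix h
    have "(LINT x|M. F h x) - (LINT x|M. f x) = (LINT x|M. F h x - f x)"
      using F(1)[of h] f(1) by (rule Bochner_Integration.integral_diff[symmetric])
    then show "norm ((LINT x|M. F h x) - (LINT x|M. f x)) \<le> (LINT x|M. \<bar>F h x - f x\<bar>)"
      using integral_norm_bound[of M "\<lambda>x. F h x - f x"] by simp
  qed
  then have "(\<lambda>h. LINT x|M. F h x) \<longlonglongrightarrow> (LINT x|M. f x)" by (rule LIM_zero_cancel)
  moreover have "(\<integral>\<^sup>+x. ennreal (F h x) \<partial>M) = ennreal (LINT x|M. F h x)" for h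
    using F by (intro nn_integral_eq_integral) auto
  moreover have "(\<integral>\<^sup>+x. ennreal (f x) \<partial>M) = ennreal (LINT x|M. f x)"
    using f by (intro nn_integral_eq_integral) auto
  ultimately show "(\<lambda>h. \<integral>\<^sup>+x. ennreal (F h x) \<partial>M) \<longlonglongrightarrow> (\<integral>\<^sup>+x. ennreal (f x) \<partial>M)"
    by (simp add: tendsto_ennrealI)
qed

lemma mat_norm_cong: "(\<And>j i. j < m \<Longrightarrow> i < n \<Longrightarrow> X (j, i) = Y (j, i)) \<Longrightarrow> mat_norm m n X = mat_norm m n Y"
  unfolding mat_norm_def by (intro L2_set_cong) auto

lemma mat_norm_zero [simp]: "mat_norm m n (\<lambda>_. 0) = 0"
  by (simp add: mat_norm_def L2_set_def)

lemma tendsto_mat_norm: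
  assumes "\<And>j i. j < m \<Longrightarrow> i < n \<Longrightarrow> (\<lambda>h. X h (j, i)) \<longlonglongrightarrow> Y (j, i)"
  shows "(\<lambda>h. mat_norm m n (X h)) \<longlonglongrightarrow> mat_norm m n Y"
  unfolding mat_norm_def L2_set_def
  using assms by (intro tendsto_real_sqrt tendsto_sum tendsto_power) auto

text \<open>Assembles approximations of b cut off to growing compact sets of times, with errors
  2^(-h). Summable errors give convergence of the gradients almost everywhere; with the bound on the
  excess this yields convergence in mean of the weighted \<phi> of the gradients.\<close>

theorem young_approximation:
  assumes \<phi>: "young_fun \<phi>" and I: "open I" and \<Omega>: "openin (sp_top n) \<Omega>"
    and wm: "set_borel_measurable (sp_borel n) \<Omega> w" and wpos: "\<And>x. x \<in> \<Omega> \<Longrightarrow> 0 < w x"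
    and wb: "\<And>K. compactin (sp_top n) K \<Longrightarrow> K \<subseteq> \<Omega> \<Longrightarrow> \<exists>c C. 0 < c \<and> (\<forall>x\<in>K. c \<le> w x \<and> w x \<le> C)"
    and b: "L1loc_W11loc n m I \<Omega> b Db"
    and fin: "modular n I \<Omega> \<phi> w (\<lambda>z. mat_norm m n (Db z)) < \<infinity>"
  shows "\<exists>bs. (\<forall>h. \<forall>j<m. st_smooth n (I \<times> \<Omega>) (\<lambda>z. bs h z j)) \<and>
         L1loc_tendsto n {..<m} (I \<times> \<Omega>) bs b \<and>
         L1loc_tendsto n ({..<m} \<times> {..<n}) (I \<times> \<Omega>) (\<lambda>h. sp_deriv (bs h)) Db \<and>
         L1_tendsto (st_leb n) (I \<times> \<Omega>)
           (\<lambda>h (t, x). w x * \<phi> (mat_norm m n (sp_deriv (bs h) (t, x))))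
           (\<lambda>(t, x). w x * \<phi> (mat_norm m n (Db (t, x)))) \<and>
         (\<lambda>h. modular n I \<Omega> \<phi> w (\<lambda>z. mat_norm m n (sp_deriv (bs h) z)))
           \<longlonglongrightarrow> modular n I \<Omega> \<phi> w (\<lambda>z. mat_norm m n (Db z))"
proof (rule borel_representatives[OF I \<Omega> b])
  fix u :: "real \<times> point \<Rightarrow> nat \<Rightarrow> real" and g :: "real \<times> point \<Rightarrow> nat \<times> nat \<Rightarrow> real"
    assume um: "\<And>j. j < m \<Longrightarrow> (\<lambda>z. u z j) \<in> borel_measurable (st_borel n)"
      and gm: "\<And>j i. j < m \<Longrightarrow> i < n \<Longrightarrow> (\<lambda>z. g z (j, i)) \<in> borel_measurable (st_borel n)"
      and u0: "\<And>z j. j < m \<Longrightarrow> z \<notin> I \<times> \<Omega> \<Longrightarrow> u z j = 0"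
      and g0: "\<And>z j i. j < m \<Longrightarrow> i < n \<Longrightarrow> z \<notin> I \<times> \<Omega> \<Longrightarrow> g z (j, i) = 0"
      and eq: "AE z in st_borel n. z \<in> I \<times> \<Omega> \<longrightarrow> (\<forall>j<m. u z j = b z j) \<and> (\<forall>j<m. \<forall>i<n. g z (j, i) = Db z (j, i))"
  obtain K s where exh0: "sp_exhaustion n \<Omega> K s" using sp_exhaustion_exists[OF \<Omega>] by blast
  define A r where "A k = K (2 * k)" and "r k = s (2 * k)" for k
  have exh: "sp_exhaustion n \<Omega> A r" using sp_exhaustion_even[OF exh0] by (simp only: A_def[abs_def] r_def[abs_def])
  obtain \<theta> where cut: "sp_cutoffs n A \<theta>" using sp_cutoffs_exist[OF exh0] by (auto simp only: A_def[abs_def])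
  have A: "compactin (sp_top n) (A k)" "A k \<subseteq> \<Omega>" for k using exh by (auto simp: sp_exhaustion_def)
  \<comment> \<open>Compact sets of times, eventually containing each compact subset of I.
    Restriction to J h makes the representatives integrable in time.\<close>
  obtain J where J: "\<And>h::nat. compact (J h)" "\<And>h. J h \<subseteq> I" "\<And>C. compact C \<Longrightarrow> C \<subseteq> I \<Longrightarrow> \<exists>N. \<forall>h\<ge>N. C \<subseteq> J h"
    using open_Union_compact_subsets[OF I] by metis
  have Js: "J h \<in> sets borel" for h using J(1) by (rule borel_compact)
  have JA: "\<forall>\<^sub>F h in sequentially. C \<subseteq> J h \<times> A h" if C: "compactin (st_top n) C" "C \<subseteq> I \<times> \<Omega>" for C
  proof -
    note p = compactin_st_top_projections[OF C(1)]
    have s: "fst ` C \<subseteq> I" "snd ` C \<subseteq> \<Omega>" using C(2) by auto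
    obtain N where N: "\<And>h. h \<ge> N \<Longrightarrow> fst ` C \<subseteq> J h" using J(3)[OF p(1) s(1)] by blast
    obtain N' where N': "snd ` C \<subseteq> A N'" using exh p(2) s(2) unfolding sp_exhaustion_def by blast
    have "C \<subseteq> J h \<times> A h" if "max N N' \<le> h" for h
    proof -
      have "snd ` C \<subseteq> A h" using N' sp_exhaustion_mono[OF exh, of N' h] that by auto
      moreover have "fst ` C \<subseteq> J h" using N that by simp
      ultimately show ?thesis by (intro subsetI) (simp add: mem_Times_iff image_subset_iff)
    qed
    then show ?thesis by (rule eventually_sequentiallyI)
  qed
  have \<Omega>s: "\<Omega> \<in> sets (sp_borel n)" by (rule openin_sp_top_sets[OF \<Omega>])
  have U: "openin (st_top n) (I \<times> \<Omega>)" using I \<Omega> by (simp add: st_top_def openin_prod_Times_iff)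
  have U': "openin (st_top n) ((UNIV :: real set) \<times> \<Omega>)" using \<Omega> by (simp add: st_top_def openin_prod_Times_iff)
  note Us = openin_st_top_sets[OF U]
  \<comment> \<open>The weight extended by 0, Borel on all of space.\<close>
  define v where "v x = indicator \<Omega> x * w x" for x
  have vm: "v \<in> borel_measurable (sp_borel n)"
    using wm by (simp add: set_borel_measurable_def v_def[abs_def])
  have v0: "0 \<le> v x" for x using wpos by (simp add: v_def indicator_def less_imp_le)
  have v\<Omega>: "x \<notin> \<Omega> \<Longrightarrow> v x = 0" for x by (simp add: v_def)
  have vb: "\<exists>c C. 0 < c \<and> (\<forall>x\<in>A k. c \<le> v x \<and> v x \<le> C)" for k
    using wb[OF A[of k]] A(2)[of k] by (auto simp: v_def subset_iff)
  have vst: "(\<lambda>z. v (snd z)) \<in> borel_measurable (st_borel n)"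
    unfolding st_borel_def by (rule measurable_compose[OF measurable_snd vm])
  have \<phi>00: "\<phi> 0 = 0" and \<phi>c: "continuous_on {0..} \<phi>" using \<phi> by (auto simp: young_fun_def)
  have \<phi>0: "0 \<le> \<phi> (mat_norm m n X)" for X by (rule young_fun_nonneg[OF \<phi> mat_norm_nonneg])
  define f where "f z = v (snd z) * \<phi> (mat_norm m n (g z))" for z
  have f0: "0 \<le> f z" for z using v0 \<phi>0 by (simp add: f_def)
  have fm: "f \<in> borel_measurable (st_borel n)"
    unfolding f_def[abs_def] mat_norm_def using gm
    by (intro borel_measurable_times vst young_fun_measurable[OF \<phi>] borel_measurable_L2_set L2_set_nonneg) auto
  have foff: "f z = 0" if "z \<notin> I \<times> \<Omega>" for z
  proof -
    have "mat_norm m n (g z) = mat_norm m n (\<lambda>_. 0)" using g0 that by (intro mat_norm_cong) auto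
    then show ?thesis by (simp add: f_def \<phi>00)
  qed
  have feq: "AE z in st_borel n. z \<in> I \<times> \<Omega> \<longrightarrow> f z = w (snd z) * \<phi> (mat_norm m n (Db z))"
    using eq
  proof eventually_elim
    case (elim z)
    show ?case
    proof
      assume z: "z \<in> I \<times> \<Omega>"
      then have "mat_norm m n (g z) = mat_norm m n (Db z)" using elim by (intro mat_norm_cong) blast
      then show "f z = w (snd z) * \<phi> (mat_norm m n (Db z))" using z by (auto simp: f_def v_def)
    qed
  qed
  have modf: "modular n I \<Omega> \<phi> w (\<lambda>z. mat_norm m n (Db z)) = (\<integral>\<^sup>+z. ennreal (f z) \<partial>st_borel n)"
    by (rule modular_eq_nn_integral[where h=f, OF fm]) (simp add: foff, rule feq)
  have ffin: "(\<integral>\<^sup>+z. ennreal (f z) \<partial>st_borel n) < \<infinity>" using fin modf by simp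
  have fi: "integrable (st_borel n) f"
    using fm ffin f0 by (intro integrableI_bounded) simp_all
  have eu: "AE z in st_borel n. z \<in> I \<times> \<Omega> \<longrightarrow> u z j = b z j" if "j < m" for j
    using eq by eventually_elim (use that in blast)
  have eg: "AE z in st_borel n. z \<in> I \<times> \<Omega> \<longrightarrow> g z (j, i) = Db z (j, i)" if "j < m" "i < n" for j i
    using eq by eventually_elim (use that in blast)
  have ui: "integrable (st_borel n) (\<lambda>z. indicator (L \<times> C) z * u z j)"
    if "j < m" "compact L" "L \<subseteq> I" "compactin (sp_top n) C" "C \<subseteq> \<Omega>" for j L C
  proof (rule integrable_on_product[OF b that(2-5) um[OF that(1)]])
    show "AE z in st_borel n. z \<in> L \<times> C \<longrightarrow> \<bar>u z j\<bar> \<le> vec_norm m (b z) + mat_norm m n (Db z)"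
      using eu[OF that(1)]
    proof eventually_elim
      case (elim z)
      have "\<bar>b z j\<bar> \<le> vec_norm m (b z)"
        using member_le_L2_set[of "{..<m}" j "\<lambda>j. \<bar>b z j\<bar>"] that(1) by (simp add: vec_norm_def L2_set_def)
      then show ?case using elim that mat_norm_nonneg[of m n "Db z"] by (auto simp: subset_iff)
    qed
  qed
  have gi: "integrable (st_borel n) (\<lambda>z. indicator (L \<times> C) z * g z (j, i))"
    if "j < m" "compact L" "L \<subseteq> I" "compactin (sp_top n) C" "C \<subseteq> \<Omega>" "i < n" for j i L C
  proof (rule integrable_on_product[OF b that(2-5) gm[OF that(1,6)]])
    show "AE z in st_borel n. z \<in> L \<times> C \<longrightarrow> \<bar>g z (j, i)\<bar> \<le> vec_norm m (b z) + mat_norm m n (Db z)"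
      using eg[OF that(1,6)]
    proof eventually_elim
      case (elim z)
      have "0 \<le> vec_norm m (b z)" by (simp add: vec_norm_def L2_set_nonneg)
      then show ?case using elim that abs_le_mat_norm[OF that(1,6), of "Db z"] by (auto simp: subset_iff)
    qed
  qed
  have indK: "indicator C z * x = indicator C z * (indicator (fst ` C \<times> snd ` C) z * x)" for C :: "(real \<times> point) set" and z and x :: real
    by (cases "z \<in> C") (simp_all add: mem_Times_iff)
  have uK: "integrable (st_borel n) (\<lambda>z. indicator C z * u z j)"
    if C: "compactin (st_top n) C" "C \<subseteq> I \<times> \<Omega>" and j: "j < m" for C j
  proof -
    note p = compactin_st_top_projections[OF C(1)]
    have "fst ` C \<subseteq> I" "snd ` C \<subseteq> \<Omega>" using C(2) by auto
    from ui[OF j p(1) this(1) p(2) this(2)] show ?thesis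
      by (subst indK) (erule integrable_mult_indicator[where 'b=real, OF compactin_st_top_sets[OF C(1)], unfolded real_scaleR_def])
  qed
  have gK: "integrable (st_borel n) (\<lambda>z. indicator C z * g z (j, i))"
    if C: "compactin (st_top n) C" "C \<subseteq> I \<times> \<Omega>" and j: "j < m" and i: "i < n" for C j i
  proof -
    note p = compactin_st_top_projections[OF C(1)]
    have "fst ` C \<subseteq> I" "snd ` C \<subseteq> \<Omega>" using C(2) by auto
    from gi[OF j p(1) this(1) p(2) this(2) i] show ?thesis
      by (subst indK) (erule integrable_mult_indicator[where 'b=real, OF compactin_st_top_sets[OF C(1)], unfolded real_scaleR_def])
  qed
  \<comment> \<open>The cut in time may be a sharp indicator: only spatial derivatives are tracked,
    and smoothness in time comes from the mollification.\<close>
  define uh gh where "uh h z j = indicator (J h) (fst z) * u z j" and "gh h z a = indicator (J h) (fst z) * g z a" for h z j a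
  have Jst: "(\<lambda>z. indicator (J h) (fst z) :: real) \<in> borel_measurable (st_borel n)" for h
    unfolding st_borel_def using Js[of h] by (intro measurable_compose[OF measurable_fst]) simp
  have ghm: "(\<lambda>z. gh h z (j, i)) \<in> borel_measurable (st_borel n)" if "j < m" "i < n" for h j i
    unfolding gh_def using gm[OF that] by (intro borel_measurable_times Jst)
  \<comment> \<open>The cut replaces the gradient by 0 at some times, and \<phi> 0 = 0. Hence the
    excess over f is bounded by the excess over the cut function.\<close>
  have ghle: "v (snd z) * \<phi> (mat_norm m n (gh h z)) \<le> f z" for h z
    using f0[of z] by (cases "fst z \<in> J h") (simp_all add: f_def gh_def[abs_def] \<phi>00)
  \<comment> \<open>The error 2^(-h) and the region A h improve together: every compact set is
    eventually covered, and the errors are summable.\<close>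
  define P where "P h bb \<longleftrightarrow> (\<forall>j<m. st_smooth n (UNIV \<times> \<Omega>) (\<lambda>z. bb z j)) \<and>
    (\<forall>j<m. (\<integral>\<^sup>+z. ennreal (indicator (A h) (snd z) * \<bar>bb z j - uh h z j\<bar>) \<partial>st_borel n) \<le> ennreal ((1/2) ^ h)) \<and>
    (\<forall>j<m. \<forall>i<n. (\<integral>\<^sup>+z. ennreal (indicator (A h) (snd z) * \<bar>sp_deriv bb z (j, i) - gh h z (j, i)\<bar>) \<partial>st_borel n) \<le> ennreal ((1/2) ^ h)) \<and>
    (\<integral>\<^sup>+z. ennreal (v (snd z) * \<phi> (mat_norm m n (sp_deriv bb z))) - ennreal (v (snd z) * \<phi> (mat_norm m n (gh h z))) \<partial>st_borel n) \<le> ennreal ((1/2) ^ h)" for h bb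
  have "\<exists>bb. P h bb" for h
    unfolding P_def
  proof (rule core_approximation[OF \<Omega> exh cut \<phi>, where u="uh h" and g="gh h" and w=v and e="(1/2) ^ h" and N=h])
    show "integrable (st_borel n) (loc (A k) (\<lambda>z. uh h z j))" if "j < m" for j k
    proof -
      have "loc (A k) (\<lambda>z. uh h z j) = (\<lambda>z. indicator (J h \<times> A k) z * u z j)"
        by (simp add: fun_eq_iff loc_def uh_def indicator_times)
      then show ?thesis using ui[OF that J(1,2) A] by simp
    qed
    show "integrable (st_borel n) (loc (A k) (\<lambda>z. gh h z (j, i)))" if "j < m" "i < n" for j i k
    proof -
      have "loc (A k) (\<lambda>z. gh h z (j, i)) = (\<lambda>z. indicator (J h \<times> A k) z * g z (j, i))"
        by (simp add: fun_eq_iff loc_def gh_def indicator_times)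
      then show ?thesis using gi[OF that(1) J(1,2) A that(2)] by simp
    qed
    show "AE t in lborel. \<forall>\<psi>. test_function n \<Omega> \<psi> \<longrightarrow>
       (LINT x|sp_borel n. uh h (t, x) j * partial sp_move i \<psi> x) = - (LINT x|sp_borel n. gh h (t, x) (j, i) * \<psi> x)"
      if j: "j < m" and i: "i < n" for j i
    proof -
      have "AE t in lborel. \<forall>\<psi>. test_function n \<Omega> \<psi> \<longrightarrow>
          (LINT x|sp_borel n. u (t, x) j * partial sp_move i \<psi> x) = - (LINT x|sp_borel n. g (t, x) (j, i) * \<psi> x)"
        by (rule weak_identity[OF \<Omega> b j i, where u="\<lambda>z. u z j" and g="\<lambda>z. g z (j, i)"])
          (use um gm u0 g0 eu eg j i in simp_all)
      then show ?thesis
      proof eventually_elim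
        case (elim t)
        then show ?case by (cases "t \<in> J h") (simp_all add: uh_def gh_def)
      qed
    qed
    show "(\<integral>\<^sup>+z. ennreal (v (snd z) * \<phi> (mat_norm m n (gh h z))) \<partial>st_borel n) < \<infinity>"
      by (rule le_less_trans[OF nn_integral_mono ffin]) (rule ennreal_leI[OF ghle])
  qed (use ghm vm v0 v\<Omega> vb in auto)
  then have "\<forall>h. \<exists>bb. P h bb" by blast
  from choice[OF this] obtain bs where bs: "\<And>h. P h (bs h)" by blast
  have sm': "st_smooth n (UNIV \<times> \<Omega>) (\<lambda>z. bs h z j)" if "j < m" for h j
    using bs[of h] that by (simp add: P_def)
  have sm: "st_smooth n (I \<times> \<Omega>) (\<lambda>z. bs h z j)" if "j < m" for h j
    using sm'[OF that, of h] unfolding st_smooth_def by (rule smooth_wrt_subset) auto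
  have e1: "(\<integral>\<^sup>+z. ennreal (indicator (A h) (snd z) * \<bar>bs h z j - uh h z j\<bar>) \<partial>st_borel n) \<le> ennreal ((1/2) ^ h)" if "j < m" for h j
    using bs[of h] that unfolding P_def by blast
  have e2: "(\<integral>\<^sup>+z. ennreal (indicator (A h) (snd z) * \<bar>sp_deriv (bs h) z (j, i) - gh h z (j, i)\<bar>) \<partial>st_borel n) \<le> ennreal ((1/2) ^ h)" if "j < m" "i < n" for h j i
    using bs[of h] that unfolding P_def by blast
  have e3: "(\<integral>\<^sup>+z. ennreal (v (snd z) * \<phi> (mat_norm m n (sp_deriv (bs h) z))) - ennreal (v (snd z) * \<phi> (mat_norm m n (gh h z))) \<partial>st_borel n) \<le> ennreal ((1/2) ^ h)" for h
    using bs[of h] unfolding P_def by blast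
  have half: "(\<lambda>h. ennreal ((1/2) ^ h)) \<longlonglongrightarrow> 0"
    using tendsto_ennrealI[OF LIMSEQ_realpow_zero[of "1/2 :: real"]] by simp
  have C1: "L1loc_tendsto n {..<m} (I \<times> \<Omega>) bs b"
  proof (rule L1loc_tendstoI[OF U, where f=u])
    show "AE z in st_borel n. z \<in> I \<times> \<Omega> \<longrightarrow> (\<forall>j\<in>{..<m}. u z j = b z j)"
      using eq by eventually_elim auto
    fix C assume C: "compactin (st_top n) C" "C \<subseteq> I \<times> \<Omega>"
    show "\<forall>\<^sub>F h in sequentially. \<forall>j\<in>{..<m}. (\<integral>\<^sup>+z. ennreal (indicator C z * \<bar>bs h z j - u z j\<bar>) \<partial>st_borel n) \<le> ennreal ((1/2) ^ h)"
      using JA[OF C]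
    proof eventually_elim
      case (elim h)
      show ?case
      proof
        fix j assume "j \<in> {..<m}"
        have "indicator C z * \<bar>bs h z j - u z j\<bar> \<le> indicator (A h) (snd z) * \<bar>bs h z j - uh h z j\<bar>" for z
          using elim by (cases "z \<in> C") (auto simp: uh_def mem_Times_iff)
        then have "(\<integral>\<^sup>+z. ennreal (indicator C z * \<bar>bs h z j - u z j\<bar>) \<partial>st_borel n)
            \<le> (\<integral>\<^sup>+z. ennreal (indicator (A h) (snd z) * \<bar>bs h z j - uh h z j\<bar>) \<partial>st_borel n)"
          by (intro nn_integral_mono ennreal_leI)
        also have "\<dots> \<le> ennreal ((1/2) ^ h)" using e1 \<open>j \<in> {..<m}\<close> by simp
        finally show "(\<integral>\<^sup>+z. ennreal (indicator C z * \<bar>bs h z j - u z j\<bar>) \<partial>st_borel n) \<le> ennreal ((1/2) ^ h)" .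
      qed
    qed
  qed (use st_smooth_continuous(1)[OF sm] um uK in auto)
  have C2: "L1loc_tendsto n ({..<m} \<times> {..<n}) (I \<times> \<Omega>) (\<lambda>h. sp_deriv (bs h)) Db"
  proof (rule L1loc_tendstoI[OF U, where f=g])
    show "continuous_map (subtopology (st_top n) (I \<times> \<Omega>)) euclideanreal (\<lambda>z. sp_deriv (bs h) z a)"
      if "a \<in> {..<m} \<times> {..<n}" for h a
      using st_smooth_continuous(2)[OF sm] that by (auto simp: sp_deriv_def)
    show "AE z in st_borel n. z \<in> I \<times> \<Omega> \<longrightarrow> (\<forall>a\<in>{..<m} \<times> {..<n}. g z a = Db z a)"
      using eq by eventually_elim auto
    fix C assume C: "compactin (st_top n) C" "C \<subseteq> I \<times> \<Omega>"
    show "integrable (st_borel n) (\<lambda>z. indicator C z * g z a)" if "a \<in> {..<m} \<times> {..<n}" for a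
      using gK[OF C] that by auto
    show "\<forall>\<^sub>F h in sequentially. \<forall>a\<in>{..<m} \<times> {..<n}. (\<integral>\<^sup>+z. ennreal (indicator C z * \<bar>sp_deriv (bs h) z a - g z a\<bar>) \<partial>st_borel n) \<le> ennreal ((1/2) ^ h)"
      using JA[OF C]
    proof eventually_elim
      case (elim h)
      show ?case
      proof
        fix a assume a: "a \<in> {..<m} \<times> {..<n}"
        have "indicator C z * \<bar>sp_deriv (bs h) z a - g z a\<bar> \<le> indicator (A h) (snd z) * \<bar>sp_deriv (bs h) z a - gh h z a\<bar>" for z
          using elim by (cases "z \<in> C") (auto simp: gh_def mem_Times_iff)
        then have "(\<integral>\<^sup>+z. ennreal (indicator C z * \<bar>sp_deriv (bs h) z a - g z a\<bar>) \<partial>st_borel n)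
            \<le> (\<integral>\<^sup>+z. ennreal (indicator (A h) (snd z) * \<bar>sp_deriv (bs h) z a - gh h z a\<bar>) \<partial>st_borel n)"
          by (intro nn_integral_mono ennreal_leI)
        also have "\<dots> \<le> ennreal ((1/2) ^ h)" using e2 a by auto
        finally show "(\<integral>\<^sup>+z. ennreal (indicator C z * \<bar>sp_deriv (bs h) z a - g z a\<bar>) \<partial>st_borel n) \<le> ennreal ((1/2) ^ h)" .
      qed
    qed
  qed (use gm in auto)
  \<comment> \<open>The approximation is smooth on all times but only over \<Omega>; outside
    \<Omega> its formal derivative is replaced by 0 to have a Borel function.\<close>
  define d where "d h z a = indicator (UNIV \<times> \<Omega>) z * sp_deriv (bs h) z a" for h z a
  have dm: "(\<lambda>z. d h z (j, i)) \<in> borel_measurable (st_borel n)" if "j < m" "i < n" for h j i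
    unfolding d_def using continuous_map_st_measurable[OF U' st_smooth_continuous(2)[OF sm'[OF that(1)] that(2)]]
    by (simp add: sp_deriv_def)
  have dD: "d h z = sp_deriv (bs h) z" if "snd z \<in> \<Omega>" for h z
    using that by (simp add: d_def[abs_def] mem_Times_iff)
  define F where "F h z = indicator (I \<times> \<Omega>) z * (v (snd z) * \<phi> (mat_norm m n (d h z)))" for h z
  have F0: "0 \<le> F h z" for h z using v0 \<phi>0 by (simp add: F_def)
  have Fm: "F h \<in> borel_measurable (st_borel n)" for h
    unfolding F_def[abs_def] mat_norm_def using dm Us
    by (intro borel_measurable_times vst young_fun_measurable[OF \<phi>] borel_measurable_L2_set L2_set_nonneg borel_measurable_indicator) auto
  have Fw: "F h z = indicator (I \<times> \<Omega>) z * (w (snd z) * \<phi> (mat_norm m n (sp_deriv (bs h) z)))" for h z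
    by (cases "z \<in> I \<times> \<Omega>") (auto simp: F_def v_def dD)
  have exc: "(\<integral>\<^sup>+z. ennreal (F h z) - ennreal (f z) \<partial>st_borel n) \<le> ennreal ((1/2) ^ h)" for h
  proof -
    have "F h z \<le> v (snd z) * \<phi> (mat_norm m n (sp_deriv (bs h) z))" for z
      using v0[of "snd z"] \<phi>0[of "sp_deriv (bs h) z"] by (cases "z \<in> I \<times> \<Omega>") (auto simp: F_def dD)
    then have "(\<integral>\<^sup>+z. ennreal (F h z) - ennreal (f z) \<partial>st_borel n)
        \<le> (\<integral>\<^sup>+z. ennreal (v (snd z) * \<phi> (mat_norm m n (sp_deriv (bs h) z))) - ennreal (v (snd z) * \<phi> (mat_norm m n (gh h z))) \<partial>st_borel n)"
      using ghle by (intro nn_integral_mono ennreal_minus_mono ennreal_leI)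
    then show ?thesis using e3 by (rule order_trans)
  qed
  have Fi: "integrable (st_borel n) (F h)" for h
  proof (rule integrableI_bounded[OF Fm])
    have "(\<integral>\<^sup>+z. ennreal (norm (F h z)) \<partial>st_borel n) \<le> (\<integral>\<^sup>+z. (ennreal (F h z) - ennreal (f z)) + ennreal (f z) \<partial>st_borel n)"
    proof (rule nn_integral_mono)
      fix z
      show "ennreal (norm (F h z)) \<le> (ennreal (F h z) - ennreal (f z)) + ennreal (f z)"
      proof (cases "f z \<le> F h z")
        case True
        then show ?thesis using F0[of h z] f0[of z]
          by (simp add: ennreal_minus ennreal_plus[symmetric] del: ennreal_plus)
      next
        case False
        then have "ennreal (norm (F h z)) \<le> ennreal (f z)" using F0[of h z] by (intro ennreal_leI) simp
        then show ?thesis by (rule add_increasing[OF zero_le])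
      qed
    qed
    also have "\<dots> = (\<integral>\<^sup>+z. ennreal (F h z) - ennreal (f z) \<partial>st_borel n) + (\<integral>\<^sup>+z. ennreal (f z) \<partial>st_borel n)"
      using Fm fm by (intro nn_integral_add) auto
    also have "\<dots> < \<infinity>" using ffin le_less_trans[OF exc[of h]] by simp
    finally show "(\<integral>\<^sup>+z. ennreal (norm (F h z)) \<partial>st_borel n) < \<infinity>" .
  qed
  have Ast: "(\<lambda>z. indicator (A h) (snd z) :: real) \<in> borel_measurable (st_borel n)" for h
    unfolding st_borel_def using compactin_sp_top_sets[OF A(1)] by (intro measurable_compose[OF measurable_snd]) simp
  \<comment> \<open>Summability of the errors gives convergence along the whole sequence almost
    everywhere, as \<open>nn_integral_abs_diff_tendsto_0\<close> requires.\<close>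
  have conv1: "AE z in st_borel n. (\<lambda>h. indicator (A h) (snd z) * \<bar>d h z (j, i) - gh h z (j, i)\<bar>) \<longlonglongrightarrow> 0" if ji: "j < m" "i < n" for j i
  proof (rule AE_tendsto_0_of_summable)
    show "(\<lambda>z. indicator (A h) (snd z) * \<bar>d h z (j, i) - gh h z (j, i)\<bar>) \<in> borel_measurable (st_borel n)" for h
      using dm[OF ji] ghm[OF ji] by (intro borel_measurable_times Ast borel_measurable_abs borel_measurable_diff)
    have "indicator (A h) (snd z) * \<bar>d h z (j, i) - gh h z (j, i)\<bar> = indicator (A h) (snd z) * \<bar>sp_deriv (bs h) z (j, i) - gh h z (j, i)\<bar>" for h z
      using A(2)[of h] dD[of z h] by (cases "snd z \<in> A h") auto
    then show "(\<integral>\<^sup>+z. ennreal (indicator (A h) (snd z) * \<bar>d h z (j, i) - gh h z (j, i)\<bar>) \<partial>st_borel n) \<le> ennreal ((1/2) ^ h)" for h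
      using e2[OF ji] by (simp only:)
  qed simp
  have "AE z in st_borel n. \<forall>j\<in>{..<m}. \<forall>i\<in>{..<n}. (\<lambda>h. indicator (A h) (snd z) * \<bar>d h z (j, i) - gh h z (j, i)\<bar>) \<longlonglongrightarrow> 0"
    using conv1 by (intro AE_finite_allI) auto
  then have conv: "AE z in st_borel n. (\<lambda>h. F h z) \<longlonglongrightarrow> f z"
  proof eventually_elim
    case (elim z)
    show ?case
    proof (cases "z \<in> I \<times> \<Omega>")
      case False
      then show ?thesis by (simp add: F_def foff)
    next
      case True
      have "z \<in> topspace (st_top n)" using openin_subset[OF U] True by blast
      then have "compactin (st_top n) {z}" by (simp only: compactin_sing)
      from JA[OF this] True have ev: "\<forall>\<^sub>F h in sequentially. {z} \<subseteq> J h \<times> A h" by simp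
      have "(\<lambda>h. d h z (j, i)) \<longlonglongrightarrow> g z (j, i)" if "j < m" "i < n" for j i
      proof -
        have l: "(\<lambda>h. indicator (A h) (snd z) * \<bar>d h z (j, i) - gh h z (j, i)\<bar>) \<longlonglongrightarrow> 0" using elim that by blast
        have "\<forall>\<^sub>F h in sequentially. indicator (A h) (snd z) * \<bar>d h z (j, i) - gh h z (j, i)\<bar> = \<bar>d h z (j, i) - g z (j, i)\<bar>"
          using ev by eventually_elim (simp add: gh_def mem_Times_iff)
        from Lim_transform_eventually[OF l this] have "(\<lambda>h. d h z (j, i) - g z (j, i)) \<longlonglongrightarrow> 0"
          by (rule tendsto_rabs_zero_cancel)
        then show ?thesis by (rule LIM_zero_cancel)
      qed
      then have "(\<lambda>h. mat_norm m n (d h z)) \<longlonglongrightarrow> mat_norm m n (g z)" by (rule tendsto_mat_norm)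
      then have "(\<lambda>h. \<phi> (mat_norm m n (d h z))) \<longlonglongrightarrow> \<phi> (mat_norm m n (g z))"
        by (rule continuous_on_tendsto_compose[OF \<phi>c]) (auto simp: mat_norm_nonneg)
      then show ?thesis using True unfolding F_def f_def by (auto intro!: tendsto_intros)
    qed
  qed
  have lim: "(\<lambda>h. \<integral>\<^sup>+z. ennreal \<bar>F h z - f z\<bar> \<partial>st_borel n) \<longlonglongrightarrow> 0"
  proof (rule nn_integral_abs_diff_tendsto_0[OF fm f0 ffin Fm F0 conv])
    show "(\<lambda>h. \<integral>\<^sup>+z. ennreal (F h z) - ennreal (f z) \<partial>st_borel n) \<longlonglongrightarrow> 0"
      by (rule tendsto_sandwich[OF _ _ tendsto_const half]) (auto intro!: always_eventually exc)
  qed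
  have "AE z in st_borel n. indicator (I \<times> \<Omega>) z * (case z of (t, x) \<Rightarrow> w x * \<phi> (mat_norm m n (sp_deriv (bs h) (t, x)))) = F h z" for h
    by (rule AE_I2) (simp add: Fw split_beta)
  moreover have "AE z in st_borel n. indicator (I \<times> \<Omega>) z * (case z of (t, x) \<Rightarrow> w x * \<phi> (mat_norm m n (Db (t, x)))) = f z"
    using feq
  proof eventually_elim
    case (elim z)
    then show ?case using foff[of z] by (cases "z \<in> I \<times> \<Omega>") (simp_all add: split_beta)
  qed
  ultimately have C3: "L1_tendsto (st_leb n) (I \<times> \<Omega>)
           (\<lambda>h (t, x). w x * \<phi> (mat_norm m n (sp_deriv (bs h) (t, x))))
           (\<lambda>(t, x). w x * \<phi> (mat_norm m n (Db (t, x))))"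
      and C4: "(\<lambda>h. \<integral>\<^sup>+z. ennreal (F h z) \<partial>st_borel n) \<longlonglongrightarrow> (\<integral>\<^sup>+z. ennreal (f z) \<partial>st_borel n)"
    unfolding st_leb_def st_borel_def[symmetric]
    by (rule L1_tendsto_completionI[OF fi f0 Fi F0 lim])+
  have modF: "modular n I \<Omega> \<phi> w (\<lambda>z. mat_norm m n (sp_deriv (bs h) z)) = (\<integral>\<^sup>+z. ennreal (F h z) \<partial>st_borel n)" for h
    by (rule modular_eq_nn_integral[where h="F h", OF Fm]) (simp_all add: Fw)
  show ?thesis
    using sm C1 C2 C3 C4[folded modF modf] by (intro exI[of _ bs]) simp
qed

theorem theorem3:
  shows "\<exists>\<tau>\<^sub>0>0. \<forall>\<gamma>\<in>{0..1::real}. \<forall>\<tau>::real. 1 < \<tau> \<and> \<tau>\<^sub>0 \<le> \<tau> \<longrightarrow>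
    (\<forall>(n::nat) (m::nat) (I::real set) (\<Omega>::point set) (w::point \<Rightarrow> real)
        (b::real \<times> point \<Rightarrow> nat \<Rightarrow> real) (Db::real \<times> point \<Rightarrow> nat \<times> nat \<Rightarrow> real) (\<phi>::real \<Rightarrow> real).
      1 \<le> n \<and> 1 \<le> m \<and>
      open I \<and> is_interval I \<and>
      openin (sp_top n) \<Omega> \<and>
      set_borel_measurable (sp_borel n) \<Omega> w \<and>
      (\<forall>x\<in>\<Omega>. 0 < w x) \<and>
      (\<forall>K. compactin (sp_top n) K \<and> K \<subseteq> \<Omega> \<longrightarrow> (\<exists>c C. 0 < c \<and> (\<forall>x\<in>K. c \<le> w x \<and> w x \<le> C))) \<and>
      L1loc_W11loc n m I \<Omega> b Db \<and>
      (\<phi> = exp_star \<gamma> \<tau> \<or>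
       \<phi> = exp_tilde \<gamma> \<tau> \<and>
         (set_integrable (st_leb n) (I \<times> \<Omega>) (\<lambda>(t, x). w x * mat_norm m n (Db (t, x))) \<or>
          set_integrable (st_leb n) (I \<times> \<Omega>) (\<lambda>(t, x). w x))) \<and>
      modular n I \<Omega> \<phi> w (\<lambda>z. mat_norm m n (Db z)) < \<infinity>
      \<longrightarrow>
      (\<exists>bs::nat \<Rightarrow> real \<times> point \<Rightarrow> nat \<Rightarrow> real.
         (\<forall>h. \<forall>j<m. st_smooth n (I \<times> \<Omega>) (\<lambda>z. bs h z j)) \<and>
         L1loc_tendsto n {..<m} (I \<times> \<Omega>) bs b \<and>
         L1loc_tendsto n ({..<m} \<times> {..<n}) (I \<times> \<Omega>) (\<lambda>h. sp_deriv (bs h)) Db \<and>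
         L1_tendsto (st_leb n) (I \<times> \<Omega>)
           (\<lambda>h (t, x). w x * \<phi> (mat_norm m n (sp_deriv (bs h) (t, x))))
           (\<lambda>(t, x). w x * \<phi> (mat_norm m n (Db (t, x)))) \<and>
         (\<lambda>h. modular n I \<Omega> \<phi> w (\<lambda>z. mat_norm m n (sp_deriv (bs h) z)))
           \<longlonglongrightarrow> modular n I \<Omega> \<phi> w (\<lambda>z. mat_norm m n (Db z))))"
\<comment> \<open>16 is the threshold of \<open>exp_gt_convexity\<close>; it makes \<phi> a
  \<open>young_fun\<close> in both cases, uniformly in \<gamma> and independently of the
  dimensions.\<close>
proof (rule exI[of _ 16], intro conjI ballI allI impI)
  fix \<gamma> \<tau> :: real and n m I \<Omega> w b Db \<phi>
  assume \<gamma>: "\<gamma> \<in> {0..1}" and \<tau>: "1 < \<tau> \<and> 16 \<le> \<tau>"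
    and H: "1 \<le> n \<and> 1 \<le> m \<and>
      open I \<and> is_interval I \<and>
      openin (sp_top n) \<Omega> \<and>
      set_borel_measurable (sp_borel n) \<Omega> w \<and>
      (\<forall>x\<in>\<Omega>. 0 < w x) \<and>
      (\<forall>K. compactin (sp_top n) K \<and> K \<subseteq> \<Omega> \<longrightarrow> (\<exists>c C. 0 < c \<and> (\<forall>x\<in>K. c \<le> w x \<and> w x \<le> C))) \<and>
      L1loc_W11loc n m I \<Omega> b Db \<and>
      (\<phi> = exp_star \<gamma> \<tau> \<or>
       \<phi> = exp_tilde \<gamma> \<tau> \<and>
         (set_integrable (st_leb n) (I \<times> \<Omega>) (\<lambda>(t, x). w x * mat_norm m n (Db (t, x))) \<or>
          set_integrable (st_leb n) (I \<times> \<Omega>) (\<lambda>(t, x). w x))) \<and>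
      modular n I \<Omega> \<phi> w (\<lambda>z. mat_norm m n (Db z)) < \<infinity>"
  have "young_fun \<phi>"
    using H \<gamma> \<tau> young_fun_exp_star[of \<gamma> \<tau>] young_fun_exp_tilde[of \<gamma> \<tau>] by auto
  then show "\<exists>bs::nat \<Rightarrow> real \<times> point \<Rightarrow> nat \<Rightarrow> real.
         (\<forall>h. \<forall>j<m. st_smooth n (I \<times> \<Omega>) (\<lambda>z. bs h z j)) \<and>
         L1loc_tendsto n {..<m} (I \<times> \<Omega>) bs b \<and>
         L1loc_tendsto n ({..<m} \<times> {..<n}) (I \<times> \<Omega>) (\<lambda>h. sp_deriv (bs h)) Db \<and>
         L1_tendsto (st_leb n) (I \<times> \<Omega>)
           (\<lambda>h (t, x). w x * \<phi> (mat_norm m n (sp_deriv (bs h) (t, x))))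
           (\<lambda>(t, x). w x * \<phi> (mat_norm m n (Db (t, x)))) \<and>
         (\<lambda>h. modular n I \<Omega> \<phi> w (\<lambda>z. mat_norm m n (sp_deriv (bs h) z)))
           \<longlonglongrightarrow> modular n I \<Omega> \<phi> w (\<lambda>z. mat_norm m n (Db z))"
    using H by (intro young_approximation) blast+
qed simp

end
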